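(* There is an algorithm that, given a UCA model $\mathcal{M}$ with $n$ arcs and two values $d\in\mathbb{Q}_{>0}$ and $d_s\in\mathbb{Q}_{\ge0}$, computes a $(d,d_s)$-minimal $u$-CA model equivalent to $\mathcal{M}$ (for some UCA descriptor $u=(c,\ell,d,d_s)$) in $O(n^3)$ time and $O(n^2)$ space.
   Context: A PCA model is a pair $(C,\mathcal{A})$ where $C$ is a circle with a distinguished point $0$ and $\mathcal{A}$ is a finite family of open arcs of $C$, none contained in another, no two of which cover $C$. Each arc $A$ is the open arc going clockwise from $s(A)$ to $t(A)$; these are its extremes. For points $p,q$ of $C$, $|p,q|$ is the length of the clockwise open arc from $p$ to $q$. An ordered pair $e_1e_2$ of extremes is consecutive if no extreme lies strictly between them clockwise. A UCA model is a PCA model all of whose arcs have the same length. Two PCA models are equivalent if there is a bijection $f$ between their arc families such that for all arcs $A,B$ and $e,e'\in\{s,t\}$, $e(f(A))$ precedes $e'(f(B))$ in the clockwise traversal from $0$ iff $e(A)$ precedes $e'(B)$. A UCA descriptor is $u=(c,\ell,d,d_s)$ with $c,\ell,d>0$, $d_s\ge0$; a $u$-CA model is a PCA model with $|C|=c$, all arcs of length $\ell$, $|e,e'|\ge d$ for consecutive extremes $e,e'$, and $|s(A),s(A')|\ge d+d_s$ for distinct arcs $A,A'$. A $u$-CA model $\mathcal{U}$ is $(d,d_s)$-minimal if $\ell\le\ell'$ and $c\le c'$ for every $(c',\ell',d,d_s)$-CA model equivalent to $\mathcal{U}$.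
   Formalization: The model is assumed to have at least one arc and pairwise distinct extremes; with no arcs no minimum exists, and with two coinciding extremes no equivalent u-CA model exists, since consecutive extremes must be at distance at least d > 0. *)

theory Defs
  imports Complex_Main "HOL-Library.Landau_Symbols"
begin

section \<open>Circular-arc models\<close>

text \<open>
  The circle of circumference \<open>c\<close> is \<open>{0..<c}\<close>, traversed clockwise by increasing
  coordinate, with distinguished point \<open>0\<close>. An arc is the pair \<open>(s, t)\<close> of its extremes, so
  \<open>fst\<close> and \<open>snd\<close> are the two extreme functions.
\<close>

type_synonym arc = "real \<times> real"

record model =
  circumference :: real
  arcs :: "arc set"

definition cw_dist :: "real \<Rightarrow> real \<Rightarrow> real \<Rightarrow> real" where
  "cw_dist c p q = (if p \<le> q then q - p else c - p + q)"

definition open_arc :: "real \<Rightarrow> real \<Rightarrow> real \<Rightarrow> real set" where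
  "open_arc c p q = {x \<in> {0..<c}. 0 < cw_dist c p x \<and> cw_dist c p x < cw_dist c p q}"

definition arc_points :: "model \<Rightarrow> arc \<Rightarrow> real set" where
  "arc_points M A = open_arc (circumference M) (fst A) (snd A)"

definition extremes :: "model \<Rightarrow> real set" where
  "extremes M = fst ` arcs M \<union> snd ` arcs M"

text \<open>
  The \<open>2 n\<close> extremes of a model with \<open>n\<close> arcs are required to be pairwise distinct points; this is
  the usual convention for these models, and it makes the clockwise order of the extremes strict.
\<close>

definition PCA_model :: "model \<Rightarrow> bool" where
  "PCA_model M \<longleftrightarrow>
     0 < circumference M \<and>
     finite (arcs M) \<and>
     extremes M \<subseteq> {0..<circumference M} \<and>
     inj_on fst (arcs M) \<and> inj_on snd (arcs M) \<and> fst ` arcs M \<inter> snd ` arcs M = {} \<and>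
     (\<forall>A\<in>arcs M. \<forall>B\<in>arcs M. A \<noteq> B \<longrightarrow>
        \<not> arc_points M A \<subseteq> arc_points M B \<and>
        arc_points M A \<union> arc_points M B \<noteq> {0..<circumference M})"

definition arc_length :: "model \<Rightarrow> arc \<Rightarrow> real" where
  "arc_length M A = cw_dist (circumference M) (fst A) (snd A)"

definition UCA_model :: "model \<Rightarrow> bool" where
  "UCA_model M \<longleftrightarrow> PCA_model M \<and> (\<exists>l. \<forall>A\<in>arcs M. arc_length M A = l)"

definition equivalent :: "model \<Rightarrow> model \<Rightarrow> bool" where
  "equivalent M N \<longleftrightarrow>
     (\<exists>f. bij_betw f (arcs M) (arcs N) \<and>
        (\<forall>A\<in>arcs M. \<forall>B\<in>arcs M. \<forall>e\<in>{fst, snd}. \<forall>e'\<in>{fst, snd}.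
           e (f A) < e' (f B) \<longleftrightarrow> e A < e' B))"

definition consecutive :: "model \<Rightarrow> real \<Rightarrow> real \<Rightarrow> bool" where
  "consecutive M p q \<longleftrightarrow>
     p \<in> extremes M \<and> q \<in> extremes M \<and> p \<noteq> q \<and>
     open_arc (circumference M) p q \<inter> extremes M = {}"

text \<open>A descriptor is a tuple \<open>(c, l, d, ds)\<close>.\<close>

type_synonym descriptor = "real \<times> real \<times> real \<times> real"

fun UCA_descriptor :: "descriptor \<Rightarrow> bool" where
  "UCA_descriptor (c, l, d, ds) \<longleftrightarrow> 0 < c \<and> 0 < l \<and> 0 < d \<and> 0 \<le> ds"

fun u_CA_model :: "descriptor \<Rightarrow> model \<Rightarrow> bool" where
  "u_CA_model (c, l, d, ds) M \<longleftrightarrow>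
     UCA_descriptor (c, l, d, ds) \<and>
     PCA_model M \<and>
     circumference M = c \<and>
     (\<forall>A\<in>arcs M. arc_length M A = l) \<and>
     (\<forall>p q. consecutive M p q \<longrightarrow> d \<le> cw_dist c p q) \<and>
     (\<forall>A\<in>arcs M. \<forall>B\<in>arcs M. A \<noteq> B \<longrightarrow> d + ds \<le> cw_dist c (fst A) (fst B))"

fun minimal_u_CA_model :: "descriptor \<Rightarrow> model \<Rightarrow> bool" where
  "minimal_u_CA_model (c, l, d, ds) M \<longleftrightarrow>
     u_CA_model (c, l, d, ds) M \<and>
     (\<forall>c' l' N. u_CA_model (c', l', d, ds) N \<and> equivalent N M \<longrightarrow> l \<le> l' \<and> c \<le> c')"

section \<open>The machine\<close>

text \<open>
  A random access machine with two kinds of named, zero-initialised arrays: index arrays hold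
  natural numbers and are the only source of addresses, and rational arrays hold rationals. A
  scalar variable is cell \<open>0\<close> of an array. Rationals support exact field operations and
  comparison at unit cost, but no rounding or other conversion back to indices. (Unit cost is
  forced by a time bound in the number of arcs alone, since \<open>d\<close> and \<open>ds\<close> are arbitrary.)
\<close>

type_synonym name = string

record state =
  idx :: "name \<Rightarrow> nat \<Rightarrow> nat"
  rats :: "name \<Rightarrow> nat \<Rightarrow> rat"

datatype iexp =
    IConst nat
  | ILoad name iexp
  | IAdd iexp iexp
  | ISub iexp iexp
  | IMul iexp iexp
  | IDiv iexp iexp
  | IMod iexp iexp

datatype rexp =
    RConst rat
  | RLoad name iexp
  | ROfIdx iexp
  | RAdd rexp rexp
  | RSub rexp rexp
  | RMul rexp rexp
  | RDiv rexp rexp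

datatype bexp =
    ILess iexp iexp
  | RLess rexp rexp
  | Not bexp
  | And bexp bexp

datatype com =
    Skip
  | IStore name iexp iexp
  | RStore name iexp rexp
  | Seq com com
  | If bexp com com
  | While bexp com

fun ival :: "state \<Rightarrow> iexp \<Rightarrow> nat" where
  "ival \<sigma> (IConst n) = n"
| "ival \<sigma> (ILoad x a) = idx \<sigma> x (ival \<sigma> a)"
| "ival \<sigma> (IAdd a b) = ival \<sigma> a + ival \<sigma> b"
| "ival \<sigma> (ISub a b) = ival \<sigma> a - ival \<sigma> b"
| "ival \<sigma> (IMul a b) = ival \<sigma> a * ival \<sigma> b"
| "ival \<sigma> (IDiv a b) = ival \<sigma> a div ival \<sigma> b"
| "ival \<sigma> (IMod a b) = ival \<sigma> a mod ival \<sigma> b"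

fun rval :: "state \<Rightarrow> rexp \<Rightarrow> rat" where
  "rval \<sigma> (RConst q) = q"
| "rval \<sigma> (RLoad x a) = rats \<sigma> x (ival \<sigma> a)"
| "rval \<sigma> (ROfIdx a) = of_nat (ival \<sigma> a)"
| "rval \<sigma> (RAdd a b) = rval \<sigma> a + rval \<sigma> b"
| "rval \<sigma> (RSub a b) = rval \<sigma> a - rval \<sigma> b"
| "rval \<sigma> (RMul a b) = rval \<sigma> a * rval \<sigma> b"
| "rval \<sigma> (RDiv a b) = rval \<sigma> a / rval \<sigma> b"

fun bval :: "state \<Rightarrow> bexp \<Rightarrow> bool" where
  "bval \<sigma> (ILess a b) \<longleftrightarrow> ival \<sigma> a < ival \<sigma> b"
| "bval \<sigma> (RLess a b) \<longleftrightarrow> rval \<sigma> a < rval \<sigma> b"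
| "bval \<sigma> (Not b) \<longleftrightarrow> \<not> bval \<sigma> b"
| "bval \<sigma> (And a b) \<longleftrightarrow> bval \<sigma> a \<and> bval \<sigma> b"

text \<open>
  In these predicates \<open>S\<close> is the number of cells of each array: evaluation may only access
  addresses below \<open>S\<close>.
\<close>

fun isafe :: "nat \<Rightarrow> state \<Rightarrow> iexp \<Rightarrow> bool" where
  "isafe S \<sigma> (IConst n) \<longleftrightarrow> True"
| "isafe S \<sigma> (ILoad x a) \<longleftrightarrow> isafe S \<sigma> a \<and> ival \<sigma> a < S"
| "isafe S \<sigma> (IAdd a b) \<longleftrightarrow> isafe S \<sigma> a \<and> isafe S \<sigma> b"
| "isafe S \<sigma> (ISub a b) \<longleftrightarrow> isafe S \<sigma> a \<and> isafe S \<sigma> b"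
| "isafe S \<sigma> (IMul a b) \<longleftrightarrow> isafe S \<sigma> a \<and> isafe S \<sigma> b"
| "isafe S \<sigma> (IDiv a b) \<longleftrightarrow> isafe S \<sigma> a \<and> isafe S \<sigma> b"
| "isafe S \<sigma> (IMod a b) \<longleftrightarrow> isafe S \<sigma> a \<and> isafe S \<sigma> b"

fun rsafe :: "nat \<Rightarrow> state \<Rightarrow> rexp \<Rightarrow> bool" where
  "rsafe S \<sigma> (RConst q) \<longleftrightarrow> True"
| "rsafe S \<sigma> (RLoad x a) \<longleftrightarrow> isafe S \<sigma> a \<and> ival \<sigma> a < S"
| "rsafe S \<sigma> (ROfIdx a) \<longleftrightarrow> isafe S \<sigma> a"
| "rsafe S \<sigma> (RAdd a b) \<longleftrightarrow> rsafe S \<sigma> a \<and> rsafe S \<sigma> b"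
| "rsafe S \<sigma> (RSub a b) \<longleftrightarrow> rsafe S \<sigma> a \<and> rsafe S \<sigma> b"
| "rsafe S \<sigma> (RMul a b) \<longleftrightarrow> rsafe S \<sigma> a \<and> rsafe S \<sigma> b"
| "rsafe S \<sigma> (RDiv a b) \<longleftrightarrow> rsafe S \<sigma> a \<and> rsafe S \<sigma> b"

fun bsafe :: "nat \<Rightarrow> state \<Rightarrow> bexp \<Rightarrow> bool" where
  "bsafe S \<sigma> (ILess a b) \<longleftrightarrow> isafe S \<sigma> a \<and> isafe S \<sigma> b"
| "bsafe S \<sigma> (RLess a b) \<longleftrightarrow> rsafe S \<sigma> a \<and> rsafe S \<sigma> b"
| "bsafe S \<sigma> (Not b) \<longleftrightarrow> bsafe S \<sigma> b"
| "bsafe S \<sigma> (And a b) \<longleftrightarrow> bsafe S \<sigma> a \<and> bsafe S \<sigma> b"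

text \<open>
  \<open>exec W S p \<sigma> k \<sigma>'\<close>: program \<open>p\<close>, started in \<open>\<sigma>\<close>, terminates in \<open>\<sigma>'\<close> after \<open>k\<close> steps on a machine
  whose arrays have \<open>S\<close> cells and whose index cells hold numbers below \<open>W\<close>. Any access
  outside the arrays and any index overflow leaves the machine stuck. A program is a fixed finite
  object: it mentions finitely many arrays, so the total memory is a constant multiple of \<open>S\<close>, and
  its expressions have bounded size, so one step per store or test is the operation count up to a
  constant factor.
\<close>

inductive exec :: "nat \<Rightarrow> nat \<Rightarrow> com \<Rightarrow> state \<Rightarrow> nat \<Rightarrow> state \<Rightarrow> bool" for W S :: nat where
  Skip: "exec W S Skip \<sigma> 1 \<sigma>"
| IStore: "\<lbrakk>isafe S \<sigma> a; ival \<sigma> a < S; isafe S \<sigma> e; ival \<sigma> e < W\<rbrakk> \<Longrightarrow>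
    exec W S (IStore x a e) \<sigma> 1
      (\<sigma>\<lparr>idx := (idx \<sigma>)(x := (idx \<sigma> x)(ival \<sigma> a := ival \<sigma> e))\<rparr>)"
| RStore: "\<lbrakk>isafe S \<sigma> a; ival \<sigma> a < S; rsafe S \<sigma> e\<rbrakk> \<Longrightarrow>
    exec W S (RStore x a e) \<sigma> 1
      (\<sigma>\<lparr>rats := (rats \<sigma>)(x := (rats \<sigma> x)(ival \<sigma> a := rval \<sigma> e))\<rparr>)"
| Seq: "\<lbrakk>exec W S p \<sigma> i \<sigma>'; exec W S q \<sigma>' j \<sigma>''\<rbrakk> \<Longrightarrow> exec W S (Seq p q) \<sigma> (i + j) \<sigma>''"
| IfTrue: "\<lbrakk>bsafe S \<sigma> b; bval \<sigma> b; exec W S p \<sigma> i \<sigma>'\<rbrakk> \<Longrightarrow> exec W S (If b p q) \<sigma> (i + 1) \<sigma>'"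
| IfFalse: "\<lbrakk>bsafe S \<sigma> b; \<not> bval \<sigma> b; exec W S q \<sigma> i \<sigma>'\<rbrakk> \<Longrightarrow> exec W S (If b p q) \<sigma> (i + 1) \<sigma>'"
| WhileFalse: "\<lbrakk>bsafe S \<sigma> b; \<not> bval \<sigma> b\<rbrakk> \<Longrightarrow> exec W S (While b p) \<sigma> 1 \<sigma>"
| WhileTrue: "\<lbrakk>bsafe S \<sigma> b; bval \<sigma> b; exec W S p \<sigma> i \<sigma>'; exec W S (While b p) \<sigma>' j \<sigma>''\<rbrakk> \<Longrightarrow>
    exec W S (While b p) \<sigma> (i + j + 1) \<sigma>''"

inductive_cases Skip_elim: "exec W S Skip \<sigma> k \<sigma>'"
inductive_cases IStore_elim: "exec W S (IStore x a e) \<sigma> k \<sigma>'"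
inductive_cases RStore_elim: "exec W S (RStore x a e) \<sigma> k \<sigma>'"
inductive_cases Seq_elim: "exec W S (Seq p q) \<sigma> k \<sigma>'"
inductive_cases If_elim: "exec W S (If b p q) \<sigma> k \<sigma>'"
inductive_cases While_elim: "exec W S (While b p) \<sigma> k \<sigma>'"

text \<open>By determinism, the existence of a run with some property says that the run has it.\<close>

lemma exec_deterministic:
  "exec W S p \<sigma> i \<sigma>' \<Longrightarrow> exec W S p \<sigma> j \<sigma>'' \<Longrightarrow> j = i \<and> \<sigma>'' = \<sigma>'"
proof (induction arbitrary: j \<sigma>'' rule: exec.induct)
  case Skip
  from Skip.prems show ?case by (rule Skip_elim) simp
next
  case IStore
  from IStore.prems show ?case by (rule IStore_elim) simp
next
  case RStore
  from RStore.prems show ?case by (rule RStore_elim) simp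
next
  case Seq
  from Seq.prems show ?case by (rule Seq_elim) (metis Seq.IH)
next
  case IfTrue
  from IfTrue.prems show ?case by (rule If_elim) (use IfTrue.IH IfTrue.hyps(2) in fastforce)+
next
  case IfFalse
  from IfFalse.prems show ?case by (rule If_elim) (use IfFalse.IH IfFalse.hyps(2) in fastforce)+
next
  case WhileFalse
  from WhileFalse.prems show ?case by (rule While_elim) (use WhileFalse.hyps(2) in simp_all)
next
  case WhileTrue
  from WhileTrue.prems show ?case by (rule While_elim) (use WhileTrue.IH WhileTrue.hyps(2) in fastforce)+
qed

section \<open>Input and output\<close>

text \<open>
  The model is given to the machine by its clockwise order of extremes, for an arbitrary
  numbering \<open>As\<close> of its arcs: code \<open>2 i\<close> stands for the beginning and \<open>2 i + 1\<close> for the end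
  of arc \<open>As ! i\<close>, and the codes are listed in the order in which the extremes are met
  from \<open>0\<close>. No coordinates are passed, so the (possibly irrational) input model is unrestricted.
\<close>

definition extreme_pos :: "arc list \<Rightarrow> nat \<Rightarrow> real" where
  "extreme_pos As j = (if even j then fst (As ! (j div 2)) else snd (As ! (j div 2)))"

definition extreme_order :: "arc list \<Rightarrow> nat list" where
  "extreme_order As = sort_key (extreme_pos As) [0..<2 * length As]"

definition input_state :: "arc list \<Rightarrow> rat \<Rightarrow> rat \<Rightarrow> state" where
  "input_state As d ds =
     \<lparr>idx = (\<lambda>x k.
        if x = ''n'' \<and> k = 0 then length As
        else if x = ''order'' \<and> k < 2 * length As then extreme_order As ! k
        else 0),
      rats = (\<lambda>x k.
        if x = ''d'' \<and> k = 0 then d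
        else if x = ''ds'' \<and> k = 0 then ds
        else 0)\<rparr>"

definition output_model :: "nat \<Rightarrow> state \<Rightarrow> model" where
  "output_model n \<sigma> =
     \<lparr>circumference = of_rat (rats \<sigma> ''c'' 0),
      arcs = {(of_rat (rats \<sigma> ''s'' i), of_rat (rats \<sigma> ''t'' i)) | i. i < n}\<rparr>"

definition output_descriptor :: "rat \<Rightarrow> rat \<Rightarrow> state \<Rightarrow> descriptor" where
  "output_descriptor d ds \<sigma> =
     (of_rat (rats \<sigma> ''c'' 0), of_rat (rats \<sigma> ''l'' 0), of_rat d, of_rat ds)"

end

(*
  Fix the clockwise order of the extremes and let x i be the position of the beginning of arc i.
  The required gaps become difference constraints
    x u + d + b * ds + lm * l - kp * c <= x v,   b in {0,1}, lm in {-1,0,1}, kp in {-2,...,2},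
  one for each pair of consecutive extremes and one for each pair of consecutive beginnings, on a
  graph with n vertices and 3 n edges. Hence (c, l) is realizable iff a * d + b * ds + lm * l - kp * c <= 0
  for the totals (a, b, lm, kp) of every closed walk, and the Bellman-Ford algorithm either finds
  positions or a violated inequality in O(n^2) operations.

  The graph of a model is drawn in the plane by unrolling the circle, without crossings; therefore
  no simple cycle has kp > 0 and lm < 0, and the realizable pairs are closed under componentwise
  minima. The minimal pair is the crossing of one tight inequality with kp > 0 and one with
  kp <= 0. Two nested bisections over l and c isolate these two inequalities with O(log^2 n)
  Bellman-Ford calls, since they have coefficients O(n), provided that d and ds are integers
  of polynomial size. This is arranged by replacing ds / d by the mediant of its two neighbours in
  the Stern-Brocot tree at level of order n^3, which no comparison made on the way can tell apart
  from ds / d.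
*)

theory Submission
  imports Defs
begin

text \<open>The search has to return not two numbers but two constraints, that is, small integers.
  That two constraints with \<open>0 < k1\<close> and \<open>k2 \<le> 0\<close> cross at a point
  satisfying all other valid constraints is a condition on signs of 3 by 3 determinants, each a
  linear form in \<open>d\<close> and \<open>ds\<close> with coefficients bounded by
  \<open>12 * n ^ 3\<close>. This dictates the level \<open>24 * n ^ 3\<close> of the Stern-Brocot
  descent, and it is why a pair found for the surrogates remains correct for the original values, at
  which a single further feasibility query is made. At integer surrogates the determinants are
  integers, so estimates with error below 1 decide their signs; hence the resolution of the
  bisections and the number \<open>9 * L + 14\<close> of halvings, where
  \<open>n \<le> 2 ^ L\<close>. The obstacle is that an inner search may report failure at a
  feasible \<open>l\<close>, if the feasible \<open>c\<close> form an interval below its resolution.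
  The argument therefore relies only on the constraints violated at the ends of the brackets, never
  on infeasibility of \<open>l\<close>. As log^2 n is O(n), queries of O(n^2) steps fit into the
  cubic bound. The drawing used for planarity is the input model itself.\<close>

section \<open>Paths in an unrolled model\<close>

text \<open>\<open>S\<close> is the set of beginnings of the unrolled arcs and \<open>w\<close> their common length. A step leads
  from an extreme of arc \<open>v\<close> to the next extreme, which belongs to arc \<open>v'\<close>. The row \<open>h\<close> counts the
  arcs traversed from beginning to end minus those traversed from end to beginning, so that the
  beginning \<open>v\<close> in row \<open>h\<close> is drawn at \<open>v - h * w\<close> and steps go to the right.\<close>

locale strip =
  fixes S :: "real set" and w :: real
  assumes w_pos: "w > 0" and starts_ends_disjoint: "x \<in> S \<Longrightarrow> y \<in> S \<Longrightarrow> x \<noteq> y + w"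
begin

text \<open>The same-row clause excludes only beginnings in between: it has to cover consecutive
  ends, by translation with \<open>w\<close>, and also consecutive beginnings that have ends between
  them.\<close>

definition step :: "real \<Rightarrow> int \<Rightarrow> real \<Rightarrow> int \<Rightarrow> bool" where
  "step v h v' h' \<longleftrightarrow> v \<in> S \<and> v' \<in> S \<and>
     (h' = h \<and> v < v' \<and> (\<forall>r\<in>S. \<not> (v < r \<and> r < v')) \<or>
      h' = h + 1 \<and> v + w < v' \<and>
        (\<forall>r\<in>S. \<not> (v + w < r \<and> r < v') \<and> \<not> (v + w < r + w \<and> r + w < v')) \<or>
      h' = h - 1 \<and> v < v' + w \<and>
        (\<forall>r\<in>S. \<not> (v < r \<and> r < v' + w) \<and> \<not> (v < r + w \<and> r + w < v' + w)))"

definition path :: "(nat \<Rightarrow> real) \<Rightarrow> (nat \<Rightarrow> int) \<Rightarrow> nat \<Rightarrow> nat \<Rightarrow> bool" where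
  "path f h a b \<longleftrightarrow> (\<forall>k. a \<le> k \<and> k < b \<longrightarrow> step (f k) (h k) (f (Suc k)) (h (Suc k)))"

lemma path_sub: "path f h a b \<Longrightarrow> a \<le> a' \<Longrightarrow> b' \<le> b \<Longrightarrow> path f h a' b'"
  by (auto simp: path_def)

lemma step_increases:
  assumes "step v h v' h'" shows "v - of_int h * w < v' - of_int h' * w"
  using assms by (auto simp: step_def algebra_simps)

text \<open>Rows are interchangeable, so that a path can be compared with its own translate.\<close>

lemma step_shift: "step v (h - 1) v' (h' - 1) \<longleftrightarrow> step v h v' h'"
proof -
  have "h' - 1 = h - 1 \<longleftrightarrow> h' = h" "h' - 1 = h - 1 + 1 \<longleftrightarrow> h' = h + 1" "h' - 1 = h - 1 - 1 \<longleftrightarrow> h' = h - 1"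
    by auto
  then show ?thesis unfolding step_def by presburger
qed

lemma path_increases:
  assumes "path f h a b" "a \<le> i" "i < j" "j \<le> b"
  shows "f i - of_int (h i) * w < f j - of_int (h j) * w"
  using assms(3,4)
proof (induction j)
  case (Suc j)
  have "f j - of_int (h j) * w < f (Suc j) - of_int (h (Suc j)) * w"
    using assms(1,2) Suc.prems by (intro step_increases) (auto simp: path_def)
  then show ?case using Suc by (cases "i = j") auto
qed simp

lemma path_row_increases:
  assumes "path f h a b" "a \<le> i" "i < j" "j \<le> b" "h i = h j"
  shows "f i < f j"
  using path_increases[OF assms(1-4)] assms(5) by simp

lemma path_mem:
  assumes "path f h a b" "a < b" "a \<le> i" "i \<le> b" shows "f i \<in> S"
proof (cases "i < b")
  case True
  then show ?thesis using assms by (auto simp: path_def step_def)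
next
  case False
  then obtain k where "i = Suc k" "a \<le> k" "k < b" using assms by (cases i) auto
  then show ?thesis using assms by (auto simp: path_def step_def)
qed

text \<open>A path staying weakly below row \<open>g\<close> that passes \<open>r\<close> without visiting it has to dive under it.\<close>

lemma dip:
  assumes p: "path f h a b" and "h a = g" "h b = g" and le: "\<And>k. a \<le> k \<Longrightarrow> k \<le> b \<Longrightarrow> h k \<le> g"
    and r: "r \<in> S" "f a < r" "r < f b" and av: "\<And>k. a \<le> k \<Longrightarrow> k \<le> b \<Longrightarrow> h k = g \<Longrightarrow> f k \<noteq> r"
    and ab: "a \<le> b"
  shows "\<exists>i j. a \<le> i \<and> Suc i \<le> j \<and> Suc j \<le> b \<and> h i = g \<and> h (Suc j) = g \<and> f i < r \<and> r < f (Suc j) \<and>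
    h (Suc i) = g - 1 \<and> h j = g - 1 \<and> (\<forall>k. Suc i \<le> k \<and> k \<le> j \<longrightarrow> h k \<le> g - 1)"
proof -
  \<comment> \<open>\<open>i\<close> will be the last visit to row \<open>g\<close> left of
    \<open>r\<close>, and \<open>j\<close> the next return to row \<open>g\<close>. By maximality of
    \<open>i\<close> this return lies beyond \<open>r\<close>, and one step within the row cannot
    jump over the beginning \<open>r\<close>; so the path is below row \<open>g\<close> in the
    meantime.\<close>
  define I where "I = {k. a \<le> k \<and> k \<le> b \<and> h k = g \<and> f k < r}"
  have fI: "finite I" by (rule finite_subset[of _ "{..b}"]) (auto simp: I_def)
  have aI: "a \<in> I" using assms by (auto simp: I_def)
  define i where "i = Max I"
  have iI: "i \<in> I" using fI aI unfolding i_def by (intro Max_in) auto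
  have imax: "k \<le> i" if "k \<in> I" for k using that fI unfolding i_def by simp
  have i: "a \<le> i" "i \<le> b" "h i = g" "f i < r" using iI by (auto simp: I_def)
  have ib: "i < b" using i r by (cases "i = b") auto
  define j where "j = (LEAST k. i < k \<and> h k = g)"
  have jp: "i < j \<and> h j = g" unfolding j_def by (rule LeastI[of _ b]) (use ib assms in auto)
  have jb: "j \<le> b" unfolding j_def by (rule Least_le) (use ib assms in auto)
  have between: "h k \<le> g - 1" if "i < k" "k < j" for k
  proof -
    have "h k \<noteq> g" using not_less_Least[of k "\<lambda>k. i < k \<and> h k = g"] that unfolding j_def by auto
    then show ?thesis using le[of k] that i jb by fastforce
  qed
  have fj: "r < f j"
  proof (rule ccontr)
    assume "\<not> r < f j"
    moreover have "f j \<noteq> r" using av[of j] jp jb i by auto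
    ultimately have "j \<in> I" using jp jb i by (auto simp: I_def)
    then show False using imax jp by fastforce
  qed
  have ji: "j \<noteq> Suc i"
  proof
    assume "j = Suc i"
    then have "step (f i) g (f j) g" using p i ib jp by (auto simp: path_def)
    then show False using i fj r by (auto simp: step_def)
  qed
  obtain j' where j': "j = Suc j'" using jp by (cases j) auto
  have ij': "Suc i \<le> j'" using jp ji j' by linarith
  have s1: "step (f i) g (f (Suc i)) (h (Suc i))" using p i ib by (auto simp: path_def)
  have s2: "step (f j') (h j') (f j) g" using p[unfolded path_def, rule_format, of j'] i(1) ij' jb j' jp by auto
  have "h (Suc i) = g - 1" using s1 between[of "Suc i"] j' ij' by (auto simp: step_def)
  moreover have "h j' = g - 1" using s2 between[of "j'"] j' ij' by (auto simp: step_def)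
  moreover have "h k \<le> g - 1" if "Suc i \<le> k" "k \<le> j'" for k
    using between[of k] that j' by simp
  ultimately show ?thesis using i(1,3,4) j' ij' jp jb fj by blast
qed

text \<open>The end of \<open>v'\<close> is the extreme following \<open>v\<close>, hence precedes
  \<open>u\<close>, whereas the end of \<open>u'\<close> follows \<open>u\<close>. The next two
  facts are read off in the same way: a step that changes the row admits no extreme strictly inside
  its gap.\<close>

lemma down_mono:
  assumes "step v g v' (g - 1)" "step u g u' (g - 1)" "v < u" shows "v' < u'"
  using assms starts_ends_disjoint[of u v'] by (auto simp: step_def)

lemma down_up_mono:
  assumes "step u g u' (g - 1)" "step v (g - 1) v' g" "u < v'" shows "u' \<le> v"
proof -
  have "v' \<in> S" "u' \<in> S" "\<not> (u < v' \<and> v' < u' + w)" and *: "\<not> (v + w < u' + w \<and> u' + w < v')"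
    using assms by (auto simp: step_def)
  then show ?thesis using assms(3) starts_ends_disjoint[of v' u'] by argo
qed

lemma up_mono:
  assumes "step v (g - 1) v' g" "step u (g - 1) u' g" "v' < u'" shows "v < u"
  using assms starts_ends_disjoint[of v' u] by (auto simp: step_def)

text \<open>A discrete Jordan curve argument. The first path must dive under the left endpoint of
  the second, and the second must dive under the point where the first resurfaces. By the
  monotonicity of single steps the two dives interleave again one row below, with a shorter first
  path.\<close>

lemma interleaved_arches:
  assumes "path f h a1 a2" "path f' h' b1 b2" "a1 \<le> a2" "b1 \<le> b2"
    "h a1 = g" "h a2 = g" "h' b1 = g" "h' b2 = g"
    "\<And>k. a1 \<le> k \<Longrightarrow> k \<le> a2 \<Longrightarrow> h k \<le> g" "\<And>k. b1 \<le> k \<Longrightarrow> k \<le> b2 \<Longrightarrow> h' k \<le> g"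
    "f a1 < f' b1" "f' b1 < f a2" "f a2 < f' b2"
    "\<And>i j. a1 \<le> i \<Longrightarrow> i \<le> a2 \<Longrightarrow> b1 \<le> j \<Longrightarrow> j \<le> b2 \<Longrightarrow> f i = f' j \<Longrightarrow> h i = h' j \<Longrightarrow> False"
  shows False
  using assms
proof (induction "a2 - a1" arbitrary: a1 a2 b1 b2 g rule: less_induct)
  case less
  note pA = less.prems(1) and pB = less.prems(2) and ab = less.prems(3,4) and e = less.prems(5-8)
    and leA = less.prems(9) and leB = less.prems(10) and lt = less.prems(11-13) and dj = less.prems(14)
  have "b1 \<noteq> b2" using lt by auto
  then have "f' b1 \<in> S" using path_mem[OF pB, of b1] ab by auto
  moreover have "f k \<noteq> f' b1" if "a1 \<le> k" "k \<le> a2" "h k = g" for k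
    using dj[of k b1] that e ab by auto
  ultimately obtain i j where ij: "a1 \<le> i" "Suc i \<le> j" "Suc j \<le> a2" "h i = g" "h (Suc j) = g" "f i < f' b1" "f' b1 < f (Suc j)"
    "h (Suc i) = g - 1" "h j = g - 1" "\<forall>k. Suc i \<le> k \<and> k \<le> j \<longrightarrow> h k \<le> g - 1"
    using dip[OF pA e(1,2) leA _ lt(1,2) _ ab(1)] by blast
  have fj: "f (Suc j) \<le> f a2"
    using path_row_increases[OF pA, of "Suc j" a2] ij e by (cases "Suc j = a2") auto
  have "f (Suc j) \<in> S" using path_mem[OF pA, of "Suc j"] ij by auto
  moreover have "f' k \<noteq> f (Suc j)" if "b1 \<le> k" "k \<le> b2" "h' k = g" for k
    using dj[of "Suc j" k] that ij by auto
  moreover have "f (Suc j) < f' b2" using fj lt by simp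
  ultimately obtain k l where kl: "b1 \<le> k" "Suc k \<le> l" "Suc l \<le> b2" "h' k = g" "h' (Suc l) = g" "f' k < f (Suc j)" "f (Suc j) < f' (Suc l)"
    "h' (Suc k) = g - 1" "h' l = g - 1" "\<forall>i. Suc k \<le> i \<and> i \<le> l \<longrightarrow> h' i \<le> g - 1"
    using dip[OF pB e(3,4) leB _ ij(7) _ _ ab(2)] by blast
  have fk: "f' b1 \<le> f' k"
    using path_row_increases[OF pB, of b1 k] kl e by (cases "k = b1") auto
  have sA1: "step (f i) g (f (Suc i)) (g - 1)" using pA ij unfolding path_def by (metis Suc_leD Suc_le_lessD le_trans)
  have sA2: "step (f j) (g - 1) (f (Suc j)) g" using pA ij unfolding path_def by (metis Suc_leD Suc_le_lessD le_trans)
  have sB1: "step (f' k) g (f' (Suc k)) (g - 1)" using pB kl unfolding path_def by (metis Suc_leD Suc_le_lessD le_trans)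
  have sB2: "step (f' l) (g - 1) (f' (Suc l)) g" using pB kl unfolding path_def by (metis Suc_leD Suc_le_lessD le_trans)
  have c1: "f (Suc i) < f' (Suc k)" using down_mono[OF sA1 sB1] ij fk by simp
  have "f' (Suc k) \<le> f j" using down_up_mono[OF sB1 sA2] kl by simp
  moreover have "f j \<noteq> f' (Suc k)" using dj[of j "Suc k"] ij kl by auto
  ultimately have c2: "f' (Suc k) < f j" by simp
  have c3: "f j < f' l" using up_mono[OF sA2 sB2] kl by simp
  show False
  proof (rule less.hyps[of j "Suc i" "Suc k" l "g - 1"])
    show "path f h (Suc i) j" "path f' h' (Suc k) l"
      using path_sub[OF pA, of "Suc i" j] path_sub[OF pB, of "Suc k" l] ij kl by auto
    show False if "Suc i \<le> x" "x \<le> j" "Suc k \<le> y" "y \<le> l" "f x = f' y" "h x = h' y" for x y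
      using dj[of x y] that ij kl by auto
    show "h k \<le> g - 1" if "Suc i \<le> k" "k \<le> j" for k using ij(10) that by blast
    show "h' i \<le> g - 1" if "Suc k \<le> i" "i \<le> l" for i using kl(10) that by blast
    show "j - Suc i < a2 - a1" using ij(1-3) by linarith
  qed (fact ij kl c1 c2 c3)+
qed

text \<open>An arch cannot be left downwards. At its last visit to row \<open>g\<close> the second
  path is still under the arch, by \<open>interleaved_arches\<close>. The part of the arch that
  dives under this visit encloses the remaining path one row lower, which yields an infinite descent
  of ever shorter arches.\<close>

lemma trapped:
  assumes "path f h a1 a2" "path f' h' b1 b2" "a1 \<le> a2" "b1 \<le> b2"
    "h a1 = g" "h a2 = g" "h' b1 = g" "\<And>k. a1 \<le> k \<Longrightarrow> k \<le> a2 \<Longrightarrow> h' b2 < h k"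
    "\<And>k. a1 \<le> k \<Longrightarrow> k \<le> a2 \<Longrightarrow> h k \<le> g" "\<And>k. b1 \<le> k \<Longrightarrow> k \<le> b2 \<Longrightarrow> h' k \<le> g"
    "f a1 < f' b1" "f' b1 < f a2"
    "\<And>i j. a1 \<le> i \<Longrightarrow> i \<le> a2 \<Longrightarrow> b1 \<le> j \<Longrightarrow> j \<le> b2 \<Longrightarrow> f i = f' j \<Longrightarrow> h i = h' j \<Longrightarrow> False"
  shows False
  using assms
proof (induction "a2 - a1" arbitrary: a1 a2 b1 g rule: less_induct)
  case less
  note pA = less.prems(1) and pB = less.prems(2) and ab = less.prems(3,4) and e = less.prems(5-7)
    and low = less.prems(8)
    and leA = less.prems(9) and leB = less.prems(10) and lt = less.prems(11-12) and dj = less.prems(13)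
  have h2: "h' b2 < g" using low[of a1] ab e(1) by simp
  then have b12: "b1 < b2" using e(3) ab(2) by (cases "b1 = b2") auto
  define K where "K = {k. b1 \<le> k \<and> k \<le> b2 \<and> h' k = g}"
  have fK: "finite K" by (rule finite_subset[of _ "{..b2}"]) (auto simp: K_def)
  have b1K: "b1 \<in> K" using b12 e by (auto simp: K_def)
  define k where "k = Max K"
  have "k \<in> K" using fK b1K unfolding k_def by (intro Max_in) auto
  then have k: "b1 \<le> k" "k \<le> b2" "h' k = g" by (auto simp: K_def)
  have kb: "k < b2" using k(2,3) h2 by (cases "k = b2") auto
  have kmax: "h' x \<le> g - 1" if "k < x" "x \<le> b2" for x
  proof -
    have "x \<notin> K" using Max_ge[OF fK, of x] that unfolding k_def by auto
    then show ?thesis using leB[of x] that k by (auto simp: K_def)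
  qed
  have fk1: "f' b1 \<le> f' k"
    using path_row_increases[OF pB, of b1 k] k e by (cases "k = b1") auto
  have fk2: "f' k < f a2"
  proof (rule ccontr)
    assume "\<not> f' k < f a2"
    moreover have "f a2 \<noteq> f' k" using dj[of a2 k] k e ab by auto
    ultimately have "f a2 < f' k" by simp
    then show False
      using interleaved_arches[OF pA path_sub[OF pB, of b1 k] ab(1) k(1) e k(3) leA leB lt] dj k by fastforce
  qed
  have kS: "f' k \<in> S" using path_mem[OF pB, of k] b12 k by auto
  have "f a1 < f' k" using fk1 lt by simp
  moreover have "f x \<noteq> f' k" if "a1 \<le> x" "x \<le> a2" "h x = g" for x
    using dj[of x k] that k by auto
  ultimately obtain i j where ij: "a1 \<le> i" "Suc i \<le> j" "Suc j \<le> a2" "h i = g" "h (Suc j) = g" "f i < f' k" "f' k < f (Suc j)"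
    "h (Suc i) = g - 1" "h j = g - 1" "\<forall>k. Suc i \<le> k \<and> k \<le> j \<longrightarrow> h k \<le> g - 1"
    using dip[OF pA e(1,2) leA kS _ fk2 _ ab(1)] by blast
  have sA1: "step (f i) g (f (Suc i)) (g - 1)" using pA ij unfolding path_def by (metis Suc_leD Suc_le_lessD le_trans)
  have sA2: "step (f j) (g - 1) (f (Suc j)) g" using pA ij unfolding path_def by (metis Suc_leD Suc_le_lessD le_trans)
  have "step (f' k) g (f' (Suc k)) (h' (Suc k))" using pB k kb by (auto simp: path_def)
  moreover from this have hk: "h' (Suc k) = g - 1" using kmax[of "Suc k"] kb by (auto simp: step_def)
  ultimately have sB1: "step (f' k) g (f' (Suc k)) (g - 1)" by simp
  have c1: "f (Suc i) < f' (Suc k)" using down_mono[OF sA1 sB1] ij by simp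
  have "f' (Suc k) \<le> f j" using down_up_mono[OF sB1 sA2] ij by simp
  moreover have "f j \<noteq> f' (Suc k)" using dj[of j "Suc k"] ij k kb hk by auto
  ultimately have c2: "f' (Suc k) < f j" by simp
  show False
  proof (rule less.hyps[of j "Suc i" "Suc k" "g - 1"])
    show "path f h (Suc i) j" "path f' h' (Suc k) b2"
      using path_sub[OF pA, of "Suc i" j] path_sub[OF pB, of "Suc k" b2] ij k by auto
    show False if "Suc i \<le> x" "x \<le> j" "Suc k \<le> y" "y \<le> b2" "f x = f' y" "h x = h' y" for x y
      using dj[of x y] that ij k by auto
    show "h' b2 < h x" if "Suc i \<le> x" "x \<le> j" for x using low[of x] that ij by auto
    show "h k \<le> g - 1" if "Suc i \<le> k" "k \<le> j" for k using ij(10) that by blast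
    show "h' x \<le> g - 1" if "Suc k \<le> x" "x \<le> b2" for x using kmax[of x] that by simp
    show "j - Suc i < a2 - a1" using ij(1-3) by linarith
    show "Suc k \<le> b2" using kb by simp
  qed (fact ij hk c1 c2)+
qed

text \<open>The key planarity fact. The path and its translate by one row down never meet, so the last
  exits from successive rows move to the left, whereas periodicity moves them to the right.\<close>

theorem no_descending_periodic_path:
  fixes v :: "nat \<Rightarrow> real" and h :: "nat \<Rightarrow> int" and p m :: nat
  assumes st: "\<And>k. step (v k) (h k) (v (Suc k)) (h (Suc k))"
    and inj: "inj v" and per: "\<And>k. v (k + p) = v k + C" "\<And>k. h (k + p) = h k - int m"
    and C: "C > 0" and m: "m > 0"
  shows False
proof -
  have pv: "path v h a b" for a b using st by (simp add: path_def)
  have p0: "p > 0" using per(2)[of 0] m by (cases p) auto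
  have perj: "h (k + j * p) = h k - int (j * m)" for k j
  proof (induction j)
    case (Suc j)
    then show ?case using per(2)[of "k + j * p"] by (simp add: algebra_simps)
  qed simp
  have low: "\<exists>K. \<forall>k\<ge>K. h k < H" for H
  proof -
    define B where "B = Max (h ` {..<p})"
    have B: "h k \<le> B" if "k < p" for k using that unfolding B_def by (intro Max_ge) auto
    show ?thesis
    proof (intro exI allI impI)
      fix k assume k: "nat (B - H + 1) * p \<le> k"
      have "h k = h (k mod p) - int (k div p * m)" using perj[of "k mod p" "k div p"] by simp
      moreover have "h (k mod p) \<le> B" using B p0 by simp
      moreover have "nat (B - H + 1) \<le> k div p" using k p0 by (simp add: less_eq_div_iff_mult_less_eq)
      then have "nat (B - H + 1) \<le> k div p * m" using m by (simp add: Suc_leI le_trans)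
      ultimately show "h k < H" by linarith
    qed
  qed
  define A where "A i = {k. h k \<ge> h 0 - int i}" for i
  have finA: "finite (A i)" for i
  proof -
    obtain K where "\<forall>k\<ge>K. h k < h 0 - int i" using low by blast
    then show ?thesis by (intro finite_subset[of "A i" "{..<K}"]) (auto simp: A_def not_le[symmetric])
  qed
  have A0: "0 \<in> A i" for i by (simp add: A_def)
  define T where "T i = Max (A i)" for i
  have TA: "T i \<in> A i" for i unfolding T_def using finA A0 by (intro Max_in) auto
  have Tmax: "k \<le> T i" if "k \<in> A i" for i k unfolding T_def using finA that by simp
  have after: "h k \<le> h 0 - int i - 1" if "T i < k" for i k
    using Tmax[of k i] that by (force simp: A_def)
  have dstep: "h k - 1 \<le> h (Suc k)" for k using st[of k] by (auto simp: step_def)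
  have hT: "h (T i) = h 0 - int i" and hST: "h (Suc (T i)) = h 0 - int i - 1" for i
    using TA[of i] after[of i "Suc (T i)"] dstep[of "T i"] by (auto simp: A_def)
  have Tp: "T (i + m) = T i + p" for i
  proof (rule antisym)
    show "T i + p \<le> T (i + m)" by (rule Tmax) (simp add: A_def per hT)
    show "T (i + m) \<le> T i + p"
    proof (cases "p \<le> T (i + m)")
      case True
      then have "h (T (i + m)) = h (T (i + m) - p) - int m" using per(2)[of "T (i + m) - p"] by simp
      then have "T (i + m) - p \<in> A i" using hT[of "i + m"] by (simp add: A_def)
      then show ?thesis using Tmax by fastforce
    qed auto
  qed
  have desc: "v (T (Suc i)) < v (T i)" for i
  proof (rule ccontr)
    assume "\<not> v (T (Suc i)) < v (T i)"
    moreover have "T i \<le> T (Suc i)" by (rule Tmax) (simp add: A_def hT)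
    moreover have "T i \<noteq> T (Suc i)" using hT[of i] hT[of "Suc i"] by auto
    moreover from this have "v (T (Suc i)) \<noteq> v (T i)" using injD[OF inj] by metis
    ultimately have gt: "v (T i) < v (T (Suc i))" and TT: "T i < T (Suc i)" by linarith+
    have sd: "step (v (T i)) (h 0 - int i) (v (Suc (T i))) (h 0 - int i - 1)"
      using st[of "T i"] hT hST by simp
    then have "v (Suc (T i)) \<le> v (T i)" using w_pos by (auto simp: step_def not_less)
    moreover have "v (Suc (T i)) \<noteq> v (T i)" using injD[OF inj, of "Suc (T i)" "T i"] by auto
    ultimately have lt: "v (Suc (T i)) < v (T i)" by simp
    \<comment> \<open>From \<open>Suc (T i)\<close> to \<open>T (Suc i)\<close> the path is an arch
      in row \<open>h 0 - i - 1\<close> stretching over \<open>v (T i)\<close>. The path translated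
      one row down starts at that place and finally drops below \<open>B\<close>, a lower bound for
      the rows of the arch. The two never meet, since equal beginnings force equal indices and thus
      different rows.\<close>
    define B where "B = Min (h ` {..T (Suc i)})"
    have B: "B \<le> h k" if "k \<le> T (Suc i)" for k using that unfolding B_def by (intro Min_le) auto
    obtain K where K: "\<forall>k\<ge>K. h k < B" using low by blast
    show False
    proof (rule trapped[OF pv[of "Suc (T i)" "T (Suc i)"], of v "\<lambda>k. h k - 1" "T i" "K + T i" "h 0 - int i - 1"])
      show "path v (\<lambda>k. h k - 1) (T i) (K + T i)" using st unfolding path_def step_shift by blast
      show "h (K + T i) - 1 < h k" if "Suc (T i) \<le> k" "k \<le> T (Suc i)" for k
        using K[rule_format, of "K + T i"] B[of k] that by auto
      show "h k \<le> h 0 - int i - 1" if "Suc (T i) \<le> k" for k using after[of i k] that by simp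
      show "h k - 1 \<le> h 0 - int i - 1" if "T i \<le> k" for k
        using after[of i k] hT[of i] that by (cases "k = T i") auto
      show False if "v x = v y" "h x = h y - 1" for x y using injD[OF inj, of x y] that by auto
      show "h (Suc (T i)) = h 0 - int i - 1" "h (T (Suc i)) = h 0 - int i - 1" "h (T i) - 1 = h 0 - int i - 1"
        using hT[of i] hST[of i] hT[of "Suc i"] by simp_all
    qed (use TT lt gt in simp_all)
  qed
  have "v (T (i + j)) \<le> v (T i)" for i j
  proof (induction j)
    case (Suc j)
    then show ?case using desc[of "i + j"] by simp
  qed simp
  \<comment> \<open>\<open>T m\<close> is \<open>T 0\<close> one period later, where the beginning
    has moved right by \<open>C\<close>.\<close>
  from this[of 0 m] Tp[of 0] per(1)[of "T 0"] C show False by simp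
qed

end

section \<open>Feasible descriptors and closed walks\<close>

locale wgraph =
  fixes n m :: nat and src dst :: "nat \<Rightarrow> nat" and kp lm bt :: "nat \<Rightarrow> int"
  assumes n_pos: "0 < n" and src_less: "e < m \<Longrightarrow> src e < n" and dst_less: "e < m \<Longrightarrow> dst e < n"
begin

text \<open>Polymorphic because the same graph is evaluated over the rationals by the machine and
  over the reals in the comparison with models.\<close>

definition wt :: "'a::linordered_field \<Rightarrow> 'a \<Rightarrow> 'a \<Rightarrow> 'a \<Rightarrow> nat \<Rightarrow> 'a" where
  "wt d ds l c e = d + of_int (bt e) * ds + of_int (lm e) * l - of_int (kp e) * c"

definition feas :: "'a::linordered_field \<Rightarrow> 'a \<Rightarrow> 'a \<Rightarrow> 'a \<Rightarrow> (nat \<Rightarrow> 'a) \<Rightarrow> bool" where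
  "feas d ds l c x \<longleftrightarrow> (\<forall>e<m. x (src e) + wt d ds l c e \<le> x (dst e))"

fun walk :: "nat \<Rightarrow> nat list \<Rightarrow> nat \<Rightarrow> bool" where
  "walk u [] v \<longleftrightarrow> u = v"
| "walk u (e # es) v \<longleftrightarrow> e < m \<and> src e = u \<and> walk (dst e) es v"

text \<open>Written with the totals instead of a sum of \<open>wt\<close>, as the totals are the
  coefficients of the constraint that a closed walk imposes on descriptors.\<close>

definition tw :: "'a::linordered_field \<Rightarrow> 'a \<Rightarrow> 'a \<Rightarrow> 'a \<Rightarrow> nat list \<Rightarrow> 'a" where
  "tw d ds l c es = of_nat (length es) * d + of_int (\<Sum>e\<leftarrow>es. bt e) * ds
     + of_int (\<Sum>e\<leftarrow>es. lm e) * l - of_int (\<Sum>e\<leftarrow>es. kp e) * c"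

lemma tw_simps [simp]: "tw d ds l c [] = 0" "tw d ds l c (e # es) = wt d ds l c e + tw d ds l c es"
  "tw d ds l c (es @ fs) = tw d ds l c es + tw d ds l c fs"
  by (simp_all add: tw_def wt_def algebra_simps)

lemma walk_append [simp]: "walk u (es @ fs) v \<longleftrightarrow> (\<exists>w. walk u es w \<and> walk w fs v)"
  by (induction u es v rule: walk.induct) auto

lemma feas_walk: "feas d ds l c x \<Longrightarrow> walk u es v \<Longrightarrow> x u + tw d ds l c es \<le> x v"
proof (induction u es v rule: walk.induct)
  case (2 u e es v)
  then have "x (src e) + wt d ds l c e \<le> x (dst e)" by (auto simp: feas_def)
  then show ?case using 2 by auto
qed simp

lemma feas_closed: "feas d ds l c x \<Longrightarrow> walk u es u \<Longrightarrow> tw d ds l c es \<le> 0"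
  using feas_walk[of d ds l c x u es u] by simp

lemma walk_edges: "walk u es v \<Longrightarrow> e \<in> set es \<Longrightarrow> e < m"
  by (induction u es v rule: walk.induct) auto

lemma walk_nth: "walk u es v \<Longrightarrow> i < length es \<Longrightarrow>
  src (es ! i) = (if i = 0 then u else dst (es ! (i - 1))) \<and>
  dst (es ! i) = (if Suc i = length es then v else src (es ! Suc i))"
proof (induction u es v arbitrary: i rule: walk.induct)
  case (2 u e es v)
  then show ?case
  proof (cases i)
    case 0
    then show ?thesis using 2 by (cases es) auto
  next
    case (Suc k)
    then show ?thesis using "2.IH"[of k] "2.prems" by (cases k) auto
  qed
qed simp

section \<open>Bellman-Ford tables\<close>

text \<open>Potentials are maximised, starting from an arbitrary row 0. Only successive rows are
  related, which is enough to extract either a potential or a positive cycle.\<close>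

definition bf_table :: "'a::linordered_field \<Rightarrow> 'a \<Rightarrow> 'a \<Rightarrow> 'a \<Rightarrow> (nat \<Rightarrow> nat \<Rightarrow> 'a) \<Rightarrow> (nat \<Rightarrow> nat \<Rightarrow> nat) \<Rightarrow> bool" where
  "bf_table d ds l c F P \<longleftrightarrow> (\<forall>r<n.
     (\<forall>v<n. F r v \<le> F (Suc r) v \<and>
        (F (Suc r) v = F r v \<or>
         P (Suc r) v < m \<and> dst (P (Suc r) v) = v \<and>
         F (Suc r) v = F r (src (P (Suc r) v)) + wt d ds l c (P (Suc r) v))) \<and>
     (\<forall>e<m. F r (src e) + wt d ds l c e \<le> F (Suc r) (dst e)))"

lemma bf_tableD:
  assumes "bf_table d ds l c F P" "r < n"
  shows "v < n \<Longrightarrow> F r v \<le> F (Suc r) v"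
    "v < n \<Longrightarrow> F (Suc r) v = F r v \<or> P (Suc r) v < m \<and> dst (P (Suc r) v) = v \<and>
         F (Suc r) v = F r (src (P (Suc r) v)) + wt d ds l c (P (Suc r) v)"
    "e < m \<Longrightarrow> F r (src e) + wt d ds l c e \<le> F (Suc r) (dst e)"
proof -
  note * = mp[OF spec[OF assms(1)[unfolded bf_table_def], of r] assms(2)]
  show "v < n \<Longrightarrow> F r v \<le> F (Suc r) v"
    "v < n \<Longrightarrow> F (Suc r) v = F r v \<or> P (Suc r) v < m \<and> dst (P (Suc r) v) = v \<and>
         F (Suc r) v = F r (src (P (Suc r) v)) + wt d ds l c (P (Suc r) v)"
    using conjunct1[OF *] by simp_all
  show "e < m \<Longrightarrow> F r (src e) + wt d ds l c e \<le> F (Suc r) (dst e)"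
    using conjunct2[OF *] by simp
qed

lemma bf_mono: "bf_table d ds l c F P \<Longrightarrow> r \<le> r' \<Longrightarrow> r' \<le> n \<Longrightarrow> v < n \<Longrightarrow> F r v \<le> F r' v"
proof (induction r')
  case (Suc r')
  then show ?case using bf_tableD(1)[of d ds l c F P r' v] by (cases "r = Suc r'") auto
qed simp

text \<open>A last row without improvement is a fixed point of the relaxation.\<close>

lemma bf_feas:
  assumes "bf_table d ds l c F P" "\<And>v. v < n \<Longrightarrow> F n v \<le> F (n - 1) v"
  shows "feas d ds l c (F n)"
  unfolding feas_def
proof (intro allI impI)
  fix e assume e: "e < m"
  have "F (n - 1) (src e) + wt d ds l c e \<le> F (Suc (n - 1)) (dst e)"
    by (rule bf_tableD(3)[OF assms(1)]) (use e n_pos in auto)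
  then show "F n (src e) + wt d ds l c e \<le> F n (dst e)"
    using assms(2)[OF src_less[OF e]] n_pos by simp
qed

text \<open>An improvement in row \<open>Suc r\<close> must be caused by one in row \<open>r\<close>
  at the source of the edge, because the older value of the source was already taken into account
  one row earlier. This makes chains of predecessors run back through all rows.\<close>

lemma bf_step:
  assumes t: "bf_table d ds l c F P" and r: "r < n" "v < n" and lt: "F r v < F (Suc r) v"
  defines "e \<equiv> P (Suc r) v"
  shows "e < m" "dst e = v" "F (Suc r) v = F r (src e) + wt d ds l c e"
    "0 < r \<Longrightarrow> F (r - 1) (src e) < F r (src e)"
proof -
  show *: "e < m" "dst e = v" "F (Suc r) v = F r (src e) + wt d ds l c e"
    using bf_tableD(2)[OF t r] lt unfolding e_def by auto
  assume r0: "0 < r"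
  show "F (r - 1) (src e) < F r (src e)"
  proof (rule ccontr)
    assume "\<not> F (r - 1) (src e) < F r (src e)"
    moreover have "F (r - 1) (src e) + wt d ds l c e \<le> F (Suc (r - 1)) (dst e)"
      by (rule bf_tableD(3)[OF t]) (use r0 r *(1) in auto)
    ultimately show False using * r0 lt by simp
  qed
qed

text \<open>Serves the mathematical use over the reals, where no program produces the table.\<close>

lemma bf_table_exists: "\<exists>F P. bf_table d ds l c F P"
proof -
  define A where "A f v = insert (f v) {f (src e) + wt d ds l c e | e. e < m \<and> dst e = v}" for f :: "nat \<Rightarrow> 'a" and v
  have finA: "finite (A f v)" for f v by (auto simp: A_def)
  define F where "F = rec_nat (\<lambda>_. 0) (\<lambda>_ f v. Max (A f v))"
  have FS: "F (Suc r) v = Max (A (F r) v)" for r v by (simp add: F_def)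
  define P where "P r v = (SOME e. e < m \<and> dst e = v \<and> F r v = F (r - 1) (src e) + wt d ds l c e)" for r v
  have "bf_table d ds l c F P"
    unfolding bf_table_def
  proof (intro allI impI conjI)
    fix r v assume "r < n" "v < n"
    show "F r v \<le> F (Suc r) v" unfolding FS using finA by (intro Max_ge) (auto simp: A_def)
    have "Max (A (F r) v) \<in> A (F r) v" using finA by (intro Max_in) (auto simp: A_def)
    then consider "F (Suc r) v = F r v" | e where "e < m" "dst e = v" "F (Suc r) v = F r (src e) + wt d ds l c e"
      unfolding FS by (auto simp: A_def)
    then show "F (Suc r) v = F r v \<or> P (Suc r) v < m \<and> dst (P (Suc r) v) = v \<and>
         F (Suc r) v = F r (src (P (Suc r) v)) + wt d ds l c (P (Suc r) v)"
    proof cases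
      case 2
      then show ?thesis
        using someI[of "\<lambda>e. e < m \<and> dst e = v \<and> F (Suc r) v = F r (src e) + wt d ds l c e" e]
        unfolding P_def by simp
    qed simp
  next
    fix r e assume "r < n" "e < m"
    then show "F r (src e) + wt d ds l c e \<le> F (Suc r) (dst e)"
      unfolding FS using finA by (intro Max_ge) (auto simp: A_def)
  qed
  then show ?thesis by blast
qed

lemma positive_cycle_if_infeasible:
  assumes "\<not> (\<exists>x. feas d ds l c x)"
  obtains u es where "walk u es u" "es \<noteq> []" "0 < tw d ds l c es"
proof -
  obtain F P where t: "bf_table d ds l c F P" using bf_table_exists by blast
  obtain v0 where v0: "v0 < n" "F (n - 1) v0 < F n v0"
    using bf_feas[OF t] assms by (meson not_le)
  \<comment> \<open>Predecessors are followed from a vertex that still improves in row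
    \<open>n\<close>: for \<open>j < n\<close>, \<open>vs j\<close> improves in row
    \<open>n - j\<close>. Among the \<open>n + 1\<close> vertices \<open>vs 0\<close>, ...,
    \<open>vs n\<close> one is repeated.\<close>
  define vs where "vs = rec_nat v0 (\<lambda>j v. src (P (n - j) v))"
  have vsS: "vs (Suc j) = src (P (n - j) (vs j))" for j by (simp add: vs_def)
  have inv: "vs j < n \<and> (j < n \<longrightarrow> F (n - j - 1) (vs j) < F (n - j) (vs j))" if "j \<le> n" for j
    using that
  proof (induction j)
    case 0
    then show ?case using v0 by (simp add: vs_def)
  next
    case (Suc j)
    then have j: "vs j < n" "Suc (n - j - 1) = n - j" and lt: "F (n - j - 1) (vs j) < F (n - j) (vs j)"
      by auto
    have a: "n - j - 1 < n" and b: "F (n - j - 1) (vs j) < F (Suc (n - j - 1)) (vs j)"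
      using Suc.prems lt unfolding j(2) by auto
    show ?case using bf_step(1,4)[OF t a j(1) b] Suc.prems unfolding j(2) by (auto simp: vsS intro: src_less)
  qed
  have walks: "\<exists>es. walk (vs (i + j)) es (vs i) \<and> length es = j \<and> F (n - i) (vs i) = F (n - (i + j)) (vs (i + j)) + tw d ds l c es"
    if "i + j \<le> n" for i j
    using that
  proof (induction j)
    case (Suc j)
    then obtain es where es: "walk (vs (i + j)) es (vs i)" "length es = j"
      "F (n - i) (vs i) = F (n - (i + j)) (vs (i + j)) + tw d ds l c es" by auto
    define e where "e = P (n - (i + j)) (vs (i + j))"
    have b: "Suc (n - (i + j) - 1) = n - (i + j)" "vs (i + j) < n"
      using inv[of "i + j"] Suc.prems by auto
    have a: "n - (i + j) - 1 < n" "F (n - (i + j) - 1) (vs (i + j)) < F (Suc (n - (i + j) - 1)) (vs (i + j))"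
      using inv[of "i + j"] Suc.prems unfolding b by auto
    have "e < m" "dst e = vs (i + j)" "F (n - (i + j)) (vs (i + j)) = F (n - (i + j) - 1) (src e) + wt d ds l c e"
      using bf_step[OF t a(1) b(2) a(2)] unfolding b e_def by auto
    then show ?case using es by (intro exI[of _ "e # es"]) (auto simp: vsS e_def)
  qed auto
  have "\<not> inj_on vs {..n}"
  proof
    assume "inj_on vs {..n}"
    then have "card {..n} \<le> card {..<n}" using inv by (intro card_inj_on_le[of vs]) auto
    then show False by simp
  qed
  then obtain i j where ij: "i < j" "j \<le> n" "vs i = vs j"
    unfolding inj_on_def by (metis atMost_iff nat_neq_iff)
  obtain es where es: "walk (vs j) es (vs i)" "length es = j - i" "F (n - i) (vs i) = F (n - j) (vs j) + tw d ds l c es"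
    using walks[of i "j - i"] ij by auto
  \<comment> \<open>The repeated vertex improves strictly between rows \<open>n - i - 1\<close> and
    \<open>n - i\<close>, and its value in row \<open>n - j\<close> is no larger than in row
    \<open>n - i - 1\<close>. The difference is the weight of the closed walk.\<close>
  have "F (n - j) (vs i) \<le> F (n - i - 1) (vs i)" using ij inv[of i] by (intro bf_mono[OF t]) auto
  then have "0 < tw d ds l c es" using es inv[of i] ij by auto
  moreover have "es \<noteq> []" using es(2) ij by auto
  ultimately show ?thesis using that[of "vs j" es] es(1) ij(3) by simp
qed

text \<open>Planarity speaks about curves without self-intersections, hence the interest in simple
  cycles. A shortest positive closed walk is simple: when it is cut at a repeated vertex, one of the
  two parts is still positive.\<close>

lemma simple_positive_cycle_if_infeasible:
  assumes "\<not> (\<exists>x. feas d ds l c x)"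
  obtains u es where "walk u es u" "es \<noteq> []" "0 < tw d ds l c es" "distinct (map src es)"
proof -
  let ?C = "\<lambda>k. \<exists>u es. walk u es u \<and> es \<noteq> [] \<and> 0 < tw d ds l c es \<and> length es = k"
  define k where "k = (LEAST k. ?C k)"
  have "\<exists>k. ?C k" using positive_cycle_if_infeasible[OF assms] by metis
  then have "?C k" unfolding k_def by (rule LeastI_ex)
  then obtain u es where es: "walk u es u" "es \<noteq> []" "0 < tw d ds l c es" "length es = k" by blast
  have minimal: "k \<le> length es'" if "walk u' es' u'" "es' \<noteq> []" "0 < tw d ds l c es'" for u' es'
    unfolding k_def by (rule Least_le) (use that in blast)
  have "distinct (map src es)"
  proof (rule ccontr)
    assume "\<not> distinct (map src es)"
    then obtain i j where ij: "i < j" "j < length es" "src (es ! i) = src (es ! j)"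
      by (auto simp: distinct_conv_nth) (metis nat_neq_iff)
    define A B C where "A = take i es" and "B = take (j - i) (drop i es)" and "C = drop j es"
    have split: "es = A @ B @ C" unfolding A_def B_def C_def using ij
      append_take_drop_id[of i es] append_take_drop_id[of "j - i" "drop i es"] by (simp add: add.commute)
    have BC: "B \<noteq> []" "C \<noteq> []" using ij by (auto simp: B_def C_def)
    have "drop i es = es ! i # drop (Suc i) es" "drop j es = es ! j # drop (Suc j) es"
      using ij by (simp_all add: Cons_nth_drop_Suc)
    then obtain B' C' where B': "B = es ! i # B'" "C = es ! j # C'"
      using ij by (simp add: B_def C_def take_Cons')
    obtain x y where xy: "walk u A x" "walk x B y" "walk y C u" using es(1) split by auto
    have x: "x = src (es ! i)" and y: "y = src (es ! j)" using xy B' by auto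
    have "walk x B x" "walk u (A @ C) u" using xy x y ij by auto
    moreover have "0 < tw d ds l c B \<or> 0 < tw d ds l c (A @ C)" using es(3) unfolding split by auto
    ultimately have "k \<le> length B \<or> k \<le> length (A @ C)" using minimal BC by blast
    moreover have "length B + length (A @ C) = k" using es(4) split by simp
    ultimately show False using BC by (auto simp: neq_Nil_conv)
  qed
  then show ?thesis using that es by blast
qed

end

section \<open>Lattice structure of the feasible descriptors\<close>

text \<open>A reference drawing of the graph: vertex \<open>v\<close>, \<open>q\<close> turns around the circle, sits at \<open>x0 v + q * c0\<close>.\<close>

locale drawn_graph = wgraph + strip +
  fixes x0 :: "nat \<Rightarrow> real" and c0 :: real
  assumes x0_range: "v < n \<Longrightarrow> 0 \<le> x0 v \<and> x0 v < c0" and x0_inj: "inj_on x0 {..<n}"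
    and drawn: "e < m \<Longrightarrow> step (x0 (src e) + of_int q * c0) h (x0 (dst e) + of_int (q + kp e) * c0) (h + lm e)"
begin

lemma lift_inj:
  assumes "u < n" "v < n" "x0 u + of_int q * c0 = x0 v + of_int r * c0"
  shows "u = v \<and> q = r"
proof -
  have c0: "c0 > 0" using x0_range[OF assms(1)] by linarith
  have "\<bar>x0 u - x0 v\<bar> < c0" using x0_range[OF assms(1)] x0_range[OF assms(2)] by linarith
  moreover have "x0 u - x0 v = of_int (r - q) * c0" using assms(3) by (simp add: algebra_simps)
  ultimately have "\<bar>of_int (r - q)\<bar> * c0 < 1 * c0" using c0 by (simp add: abs_mult)
  then have "\<bar>of_int (r - q) :: real\<bar> < 1" using c0 by (simp only: mult_less_cancel_right)
  then have "q = r" by linarith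
  then show ?thesis using assms x0_inj by (auto dest: inj_onD)
qed

text \<open>Running around the cycle forever lifts it to an injective periodic path in the unrolled
  drawing, each round of which moves right by a positive number of turns and loses rows.\<close>

lemma no_mixed_cycle:
  assumes es: "walk u es u" "es \<noteq> []" "distinct (map src es)"
    and K: "0 < (\<Sum>e\<leftarrow>es. kp e)" and L: "(\<Sum>e\<leftarrow>es. lm e) < 0"
  shows False
proof -
  define M where "M = length es"
  have M0: "0 < M" using es by (simp add: M_def)
  define ed where "ed k = es ! (k mod M)" for k
  define Q where "Q k = (\<Sum>j<k. kp (ed j))" for k
  define H where "H k = (\<Sum>j<k. lm (ed j))" for k
  define v where "v k = x0 (src (ed k)) + of_int (Q k) * c0" for k
  have edm: "ed k < m" for k using walk_edges[OF es(1)] M0 by (auto simp: ed_def M_def)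
  have link: "dst (ed k) = src (ed (Suc k))" for k
  proof -
    have l: "k mod M < length es" using M0 by (simp add: M_def)
    show ?thesis
    proof (cases "Suc (k mod M) = M")
      case True
      then have "ed (Suc k) = es ! 0" by (simp add: ed_def mod_Suc)
      then show ?thesis using walk_nth[OF es(1) l] walk_nth[OF es(1), of 0] True M0 by (simp add: ed_def M_def)
    next
      case False
      then show ?thesis using walk_nth[OF es(1) l] by (auto simp: ed_def M_def mod_Suc)
    qed
  qed
  have edp: "ed (k + M) = ed k" for k by (simp add: ed_def)
  have QM: "Q M = (\<Sum>e\<leftarrow>es. kp e)" and HM: "H M = (\<Sum>e\<leftarrow>es. lm e)"
    by (simp_all add: Q_def H_def ed_def M_def sum_list_sum_nth atLeast0LessThan)
  have Qp: "Q (k + M) = Q k + Q M" for k by (induction k) (auto simp: Q_def edp add.commute)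
  have Hp: "H (k + M) = H k + H M" for k by (induction k) (auto simp: H_def edp add.commute)
  have Qj: "Q (k + j * M) = Q k + int j * Q M" for k j
  proof (induction j)
    case (Suc j)
    then show ?case using Qp[of "k + j * M"] by (simp add: algebra_simps)
  qed simp
  have inj1: "k = k'" if "v k = v k'" and le: "k \<le> k'" for k k'
  proof -
    have "src (ed k) = src (ed k')" and Qk: "Q k = Q k'"
      using lift_inj[of "src (ed k)" "src (ed k')" "Q k" "Q k'"] that edm src_less by (auto simp: v_def)
    moreover have "k mod M < length es" "k' mod M < length es" using M0 by (auto simp: M_def)
    ultimately have "k' mod M = k mod M"
      using nth_eq_iff_index_eq[OF es(3), of "k mod M" "k' mod M"] by (auto simp: ed_def)
    then have "M dvd k' - k" using le by (simp add: mod_eq_dvd_iff_nat)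
    then obtain j where "k' - k = M * j" by (rule dvdE)
    then have "k' = k + j * M" using le by (simp add: mult.commute)
    then show ?thesis using Qj[of k j] Qk K QM by auto
  qed
  have "inj v" by (rule injI) (metis inj1 nat_le_linear)
  moreover have "step (v k) (H k) (v (Suc k)) (H (Suc k))" for k
    using drawn[OF edm, of k "Q k" "H k"] by (simp add: v_def H_def Q_def link)
  moreover have "v (k + M) = v k + of_int (Q M) * c0" for k by (simp add: v_def edp Qp distrib_right)
  moreover have "H (k + M) = H k - int (nat (- H M))" for k using Hp[of k] L HM by simp
  moreover have "of_int (Q M) * c0 > 0" using K QM x0_range[OF n_pos] by simp
  moreover have "0 < nat (- H M)" using L HM by simp
  ultimately show False using no_descending_periodic_path by blast
qed

text \<open>A simple cycle that is positive at \<open>(l2, c1)\<close> but not at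
  \<open>(l1, c1)\<close> has negative total \<open>lm\<close>; as it is not positive at
  \<open>(l2, c2)\<close> either, its total \<open>kp\<close> is positive. Planarity excludes this
  combination.\<close>

theorem feas_lattice:
  assumes f1: "feas d ds l1 c1 x1" and f2: "feas d ds l2 c2 x2" and le: "l2 \<le> l1" "c1 \<le> c2"
  shows "\<exists>x. feas d ds l2 c1 (x :: nat \<Rightarrow> real)"
proof (rule ccontr)
  assume "\<not> ?thesis"
  then obtain u es where es: "walk u es u" "es \<noteq> []" "0 < tw d ds l2 c1 es" "distinct (map src es)"
    using simple_positive_cycle_if_infeasible by blast
  let ?k = "\<Sum>e\<leftarrow>es. kp e" and ?l = "\<Sum>e\<leftarrow>es. lm e"
  have "tw d ds l1 c1 es \<le> 0" "tw d ds l2 c2 es \<le> 0" using feas_closed f1 f2 es by blast+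
  then have "of_int ?l * l1 < of_int ?l * l2" "of_int ?k * c1 < of_int ?k * c2"
    using es(3) by (auto simp: tw_def)
  then have "of_int ?l * (l1 - l2) < 0" "0 < of_int ?k * (c2 - c1)" by (simp_all add: algebra_simps)
  then have "?l < 0" "0 < ?k" using le by (auto simp: mult_less_0_iff zero_less_mult_iff)
  then show False using no_mixed_cycle es by blast
qed

end

section \<open>Integer surrogates for the two gap parameters\<close>

lemma le_mult_of_one_le: "1 \<le> a \<Longrightarrow> 0 \<le> x \<Longrightarrow> x \<le> a * x" for a x :: "'a::linordered_idom"
  using mult_right_mono[of 1 a x] by simp

lemma abs_of_int_le: "\<bar>x\<bar> \<le> y \<Longrightarrow> \<bar>of_int x\<bar> \<le> (of_int y :: 'a::linordered_idom)"
  by (simp flip: of_int_abs)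

text \<open>\<open>pa / qa\<close> and \<open>pb / qb\<close> are Stern-Brocot neighbours around \<open>ds / d\<close>. No linear form with small
  integer coefficients changes sign strictly between them, so its sign at \<open>(d, ds)\<close> can be read off
  at the integer point \<open>(qa + qb, pa + pb)\<close>.\<close>

lemma small_form_sign:
  fixes X Y pa qa pb qb :: int and d ds :: "'a::linordered_field"
  assumes det: "pb * qa - pa * qb = 1"
    and nn: "0 \<le> pa" "0 \<le> qa" "0 \<le> pb" "0 \<le> qb"
    and le: "of_int pa * d \<le> of_int qa * ds" "of_int qb * ds \<le> of_int pb * d"
    and small: "\<bar>X\<bar> + \<bar>Y\<bar> < pa + qa + pb + qb"
    and sgn: "X * (qa + qb) + Y * (pa + pb) \<le> 0"
  shows "of_int X * d + of_int Y * ds \<le> 0"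
proof -
  \<comment> \<open>\<open>(qa, pa)\<close> and \<open>(qb, pb)\<close> form a basis of the integer
    lattice, so \<open>X\<close> and \<open>Y\<close> are recovered from the values \<open>A\<close>
    and \<open>B\<close> of the form at these points. If these had opposite signs,
    \<open>\<bar>X\<bar> + \<bar>Y\<bar>\<close> would reach the sum of the four entries.\<close>
  define A B where "A = X * qa + Y * pa" and "B = X * qb + Y * pb"
  have AB: "A + B \<le> 0" using sgn by (simp add: A_def B_def algebra_simps)
  have "A * pb - B * pa = X * (pb * qa - pa * qb)" "B * qa - A * qb = Y * (pb * qa - pa * qb)"
    by (simp_all add: A_def B_def algebra_simps)
  then have XY: "X = A * pb - B * pa" "Y = B * qa - A * qb" by (simp_all add: det)
  have A: "A \<le> 0"
  proof (rule ccontr)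
    assume "\<not> A \<le> 0"
    then have "1 \<le> A" "1 \<le> - B" using AB by auto
    then have "pb \<le> A * pb" "pa \<le> - B * pa" "qb \<le> A * qb" "qa \<le> - B * qa"
      using nn le_mult_of_one_le by blast+
    then show False using XY small by simp
  qed
  have B: "B \<le> 0"
  proof (rule ccontr)
    assume "\<not> B \<le> 0"
    then have "1 \<le> B" "1 \<le> - A" using AB by auto
    then have "pb \<le> - A * pb" "pa \<le> B * pa" "qb \<le> - A * qb" "qa \<le> B * qa"
      using nn le_mult_of_one_le by blast+
    then show False using XY small by simp
  qed
  \<comment> \<open>The coordinates of \<open>(d, ds)\<close> in this basis, nonnegative because
    \<open>ds / d\<close> lies between the neighbours.\<close>
  define u w where "u = of_int pb * d - of_int qb * ds" and "w = of_int qa * ds - of_int pa * d"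
  have "(of_int X * d + of_int Y * ds) * of_int (pb * qa - pa * qb) = u * of_int A + w * of_int B"
    by (simp add: u_def w_def A_def B_def algebra_simps)
  then have "of_int X * d + of_int Y * ds = u * of_int A + w * of_int B" by (simp add: det)
  moreover have "u * of_int A \<le> 0" "w * of_int B \<le> 0"
    using A B le by (auto simp: u_def w_def mult_nonneg_nonpos)
  ultimately show ?thesis by simp
qed

lemma abs_mult_le: "\<bar>x\<bar> \<le> X \<Longrightarrow> \<bar>y\<bar> \<le> Y \<Longrightarrow> \<bar>x * y\<bar> \<le> X * Y" for x y :: "'a::linordered_idom"
  unfolding abs_mult by (rule mult_mono) auto

lemma abs_det_le:
  fixes x y u v :: "'a::linordered_idom"
  assumes "\<bar>x\<bar> \<le> X" "\<bar>y\<bar> \<le> Y" "\<bar>u\<bar> \<le> X" "\<bar>v\<bar> \<le> Y"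
  shows "\<bar>x * y - u * v\<bar> \<le> 2 * (X * Y)"
  using abs_mult_le[OF assms(1,2)] abs_mult_le[OF assms(3,4)] by linarith

text \<open>The point \<open>(lb, cb)\<close> satisfies all constraints and nearly violates the first two, whose crossing
  therefore lies so close to \<open>(lb, cb)\<close> that, by integrality, it satisfies the third constraint.
  Constraint \<open>0\<close> only serves to bound the slack of constraint \<open>2\<close>.\<close>

lemma crossing_satisfies:
  fixes N D0 D1 D2 D3 k0 k1 k2 k3 l0 l1 l2 l3 :: int and la lb lo hi cl cb eta eps :: "'a::linordered_field"
  assumes N: "1 \<le> N"
    and k: "\<bar>k0\<bar> \<le> 2 * N" "\<bar>k1\<bar> \<le> 2 * N" "\<bar>k2\<bar> \<le> 2 * N" "\<bar>k3\<bar> \<le> 2 * N"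
    and l: "\<bar>l0\<bar> \<le> N" "\<bar>l1\<bar> \<le> N" "\<bar>l2\<bar> \<le> N" "\<bar>l3\<bar> \<le> N"
    and pos: "0 < k0" "0 < k1" "k2 \<le> 0"
    and eta: "0 \<le> eta" "64 * of_int N ^ 3 * eta \<le> 1" and eps: "0 \<le> eps" "64 * of_int N ^ 4 * eps \<le> 1"
    and a0: "0 < of_int D0 + of_int l0 * la - of_int k0 * lo"
    and a2: "0 < of_int D2 + of_int l2 * la - of_int k2 * hi"
    and hilo: "hi - lo \<le> eta" and ab: "la \<le> lb" "lb - la \<le> eps"
    and b: "of_int D0 + of_int l0 * lb - of_int k0 * cb \<le> 0" "of_int D1 + of_int l1 * lb - of_int k1 * cb \<le> 0"
      "of_int D2 + of_int l2 * lb - of_int k2 * cb \<le> 0" "of_int D3 + of_int l3 * lb - of_int k3 * cb \<le> 0"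
    and b1: "0 < of_int D1 + of_int l1 * lb - of_int k1 * cl" and clb: "cb - cl \<le> eta"
    and m: "0 \<le> l1 * k2 - l2 * k1"
  shows "(l1 * k2 - l2 * k1) * D3 + l3 * (k1 * D2 - k2 * D1) - k3 * (l1 * D2 - l2 * D1) \<le> 0"
proof -
  define n :: 'a where "n = of_int N"
  have n: "1 \<le> n" using N by (simp add: n_def)
  define w0 w1 w2 w3 where "w0 = of_int D0 + of_int l0 * lb - of_int k0 * cb"
    and "w1 = of_int D1 + of_int l1 * lb - of_int k1 * cb" and "w2 = of_int D2 + of_int l2 * lb - of_int k2 * cb"
    and "w3 = of_int D3 + of_int l3 * lb - of_int k3 * cb"
  note wd = w0_def w1_def w2_def w3_def
  have w: "w0 \<le> 0" "w1 \<le> 0" "w2 \<le> 0" "w3 \<le> 0" using b by (simp_all add: wd)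
  have kk: "\<bar>of_int k0\<bar> \<le> 2 * n" "\<bar>of_int k1\<bar> \<le> 2 * n" "\<bar>of_int k2\<bar> \<le> 2 * n" "\<bar>of_int k3\<bar> \<le> 2 * n"
    using k[THEN abs_of_int_le, where 'a = 'a] by (simp_all add: n_def)
  have ll: "\<bar>of_int l0\<bar> \<le> n" "\<bar>of_int l1\<bar> \<le> n" "\<bar>of_int l2\<bar> \<le> n" "\<bar>of_int l3\<bar> \<le> n"
    using l[THEN abs_of_int_le, where 'a = 'a] by (simp_all add: n_def)
  have e1: "- (2 * n * eta) \<le> w1"
  proof -
    have "of_int k1 * (cb - cl) \<le> 2 * n * eta"
    proof -
      have "of_int k1 * (cb - cl) \<le> of_int k1 * eta" using clb pos by (intro mult_left_mono) auto
      also have "\<dots> \<le> 2 * n * eta" using kk eta by (intro mult_right_mono) auto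
      finally show ?thesis .
    qed
    then show ?thesis using b1 unfolding w1_def by (simp add: algebra_simps)
  qed
  have e2: "- (2 * n * eta + 4 * n\<^sup>2 * eps) \<le> w2"
  proof -
    \<comment> \<open>Constraint 0 is used to eliminate \<open>c\<close>: its violation at
      \<open>(la, lo)\<close> and its validity at \<open>(lb, cb)\<close> carry the bound for
      constraint 2 from \<open>(la, lo)\<close> over to \<open>(lb, cb)\<close>. The determinant
      \<open>M\<close> measures the loss from moving \<open>la\<close> to \<open>lb\<close>.\<close>
    define M where "M = of_int k0 * of_int l2 - of_int k2 * (of_int l0 :: 'a)"
    have M: "\<bar>M\<bar> \<le> 4 * n\<^sup>2"
      unfolding M_def using abs_det_le[OF kk(1) ll(3) kk(3) ll(1)] by (simp add: power2_eq_square)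
    have "\<bar>M * (lb - la)\<bar> \<le> 4 * n\<^sup>2 * eps" using ab by (intro abs_mult_le M) auto
    then have M': "- (4 * n\<^sup>2 * eps) \<le> M * (lb - la)" by linarith
    have h1: "- of_int k2 * (hi - lo) \<le> 2 * n * eta"
    proof -
      have "- of_int k2 * (hi - lo) \<le> - of_int k2 * eta" by (rule mult_left_mono[OF hilo]) (use pos in simp)
      also have "\<dots> \<le> 2 * n * eta" using kk eta by (intro mult_right_mono) auto
      finally show ?thesis .
    qed
    have g2: "- (2 * n * eta) \<le> of_int D2 + of_int l2 * la - of_int k2 * lo"
      using h1 a2 by (simp add: algebra_simps)
    have "- (of_int k0 * (2 * n * eta)) \<le> of_int k0 * (of_int D2 + of_int l2 * la - of_int k2 * lo)"
      using mult_left_mono[OF g2, of "of_int k0"] pos by simp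
    moreover have "0 \<le> - of_int k2 * (of_int D0 + of_int l0 * la - of_int k0 * lo)"
      using pos a0 by (intro mult_nonneg_nonneg) auto
    moreover have "0 \<le> of_int k2 * w0" using pos w by (intro mult_nonpos_nonpos) auto
    moreover have "of_int k0 * w2 = of_int k0 * (of_int D2 + of_int l2 * la - of_int k2 * lo)
        + - of_int k2 * (of_int D0 + of_int l0 * la - of_int k0 * lo) + M * (lb - la) + of_int k2 * w0"
      by (simp add: M_def wd algebra_simps)
    ultimately have "- (of_int k0 * (2 * n * eta)) - 4 * n\<^sup>2 * eps \<le> of_int k0 * w2" using M' by linarith
    moreover have "4 * n\<^sup>2 * eps \<le> of_int k0 * (4 * n\<^sup>2 * eps)"
      using mult_right_mono[of 1 "of_int k0" "4 * n\<^sup>2 * eps"] pos eps by simp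
    ultimately have "of_int k0 * - (2 * n * eta + 4 * n\<^sup>2 * eps) \<le> of_int k0 * w2" by (simp add: algebra_simps)
    then show ?thesis using pos by (simp only: mult_le_cancel_left_pos of_int_0_less_iff)
  qed
  \<comment> \<open>\<open>E\<close> is \<open>l1 * k2 - l2 * k1\<close> times the value of
    constraint 3 at the crossing of constraints 1 and 2. Being an integer, it is nonpositive once it
    is below 1; the factors 64 in the hypotheses keep the total error at 1 / 2.\<close>
  define E where "E = (l1 * k2 - l2 * k1) * D3 + l3 * (k1 * D2 - k2 * D1) - k3 * (l1 * D2 - l2 * D1)"
  have Eq: "of_int E = of_int (l1 * k2 - l2 * k1) * w3 + (of_int k3 * of_int l2 - of_int k2 * of_int l3) * w1
      + (of_int k1 * of_int l3 - of_int k3 * of_int l1) * w2"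
    by (simp add: E_def wd algebra_simps)
  have c1: "(of_int k3 * of_int l2 - of_int k2 * of_int l3) * w1 \<le> 4 * n\<^sup>2 * (2 * n * eta)"
    using abs_mult_le[OF abs_det_le[OF kk(4) ll(3) kk(3) ll(4)], of w1 "2 * n * eta"] e1 w
    by (simp add: power2_eq_square)
  have c2: "(of_int k1 * of_int l3 - of_int k3 * of_int l1) * w2 \<le> 4 * n\<^sup>2 * (2 * n * eta + 4 * n\<^sup>2 * eps)"
    using abs_mult_le[OF abs_det_le[OF kk(2) ll(4) kk(4) ll(2)], of w2 "2 * n * eta + 4 * n\<^sup>2 * eps"] e2 w
    by (simp add: power2_eq_square)
  have c3: "of_int (l1 * k2 - l2 * k1) * w3 \<le> 0" by (rule mult_nonneg_nonpos[OF of_int_nonneg[OF m] w(4)])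
  have "4 * n\<^sup>2 * (2 * n * eta) + 4 * n\<^sup>2 * (2 * n * eta + 4 * n\<^sup>2 * eps) = (64 * n ^ 3 * eta) / 4 + (64 * n ^ 4 * eps) / 4"
    by (simp add: power2_eq_square power3_eq_cube power4_eq_xxxx field_simps)
  also have "\<dots> \<le> 1 / 4 + 1 / 4" using eta eps by (intro add_mono divide_right_mono) (auto simp: n_def)
  finally have "of_int E < (1 :: 'a)" using c1 c2 c3 unfolding Eq by linarith
  then have "E < 1" by simp
  then show ?thesis unfolding E_def by simp
qed

text \<open>Adding \<open>k1\<close> times the second and \<open>- k2\<close> times the first
  constraint eliminates \<open>c\<close> up to the width of the bracket and leaves
  \<open>(l1 * k2 - l2 * k1) * L < 4 * (N\<^sup>2 * S) + 1\<close>. Hence a large enough length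
  cannot be rejected by the inner search.\<close>

lemma wide_bracket_impossible:
  fixes N S D1 D2 k1 k2 l1 l2 :: int and L lo hi eta :: "'a::linordered_field"
  assumes N: "1 \<le> N" and k: "\<bar>k1\<bar> \<le> 2 * N" "\<bar>k2\<bar> \<le> 2 * N"
    and D: "0 \<le> D1" "D1 \<le> N * S" "0 \<le> D2" "D2 \<le> N * S" and pos: "0 < k1" "k2 \<le> 0"
    and eta: "0 \<le> eta" "64 * of_int N ^ 3 * eta \<le> 1"
    and v1: "0 < of_int D1 + of_int l1 * L - of_int k1 * lo" and v2: "0 < of_int D2 + of_int l2 * L - of_int k2 * hi"
    and hilo: "hi - lo \<le> eta" and m: "0 < l1 * k2 - l2 * k1" and L: "4 * of_int (N\<^sup>2 * S) + 1 \<le> L"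
  shows False
proof -
  have "0 \<le> N * S" using D by linarith
  have h1: "- of_int k2 * (hi - lo) \<le> - of_int k2 * eta" by (rule mult_left_mono[OF hilo]) (use pos in simp)
  have "of_int k1 * (- of_int k2 * (hi - lo)) \<le> of_int k1 * (- of_int k2 * eta)"
    by (rule mult_left_mono[OF h1]) (use pos in simp)
  also have "\<dots> = of_int (k1 * - k2) * eta" by simp
  also have "\<dots> \<le> of_int (4 * N\<^sup>2) * eta"
  proof (intro mult_right_mono)
    have "k1 * - k2 \<le> (2 * N) * (2 * N)" by (rule mult_mono) (use k pos in auto)
    then show "of_int (k1 * - k2) \<le> (of_int (4 * N\<^sup>2) :: 'a)" unfolding of_int_le_iff by (simp add: power2_eq_square)
  qed (use eta in simp)
  also have "\<dots> \<le> (64 * of_int N ^ 3 * eta)"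
  proof -
    have "4 * N\<^sup>2 \<le> 64 * N ^ 3" using N power_increasing[of 2 3 N] zero_le_power2[of N] by linarith
    then have *: "of_int (4 * N\<^sup>2) \<le> (of_int (64 * N ^ 3) :: 'a)" unfolding of_int_le_iff .
    have "of_int (64 * N ^ 3) = (64 * of_int N ^ 3 :: 'a)" by simp
    then show ?thesis using mult_right_mono[OF * eta(1)] by metis
  qed
  finally have a: "of_int k1 * (- of_int k2 * (hi - lo)) \<le> 1" using eta by linarith
  have "0 < of_int k1 * (of_int D2 + of_int l2 * L - of_int k2 * hi)" using v2 pos by simp
  moreover have "0 \<le> - of_int k2 * (of_int D1 + of_int l1 * L - of_int k1 * lo)"
    using v1 pos by (intro mult_nonneg_nonneg) auto
  moreover have "of_int k1 * (of_int D2 + of_int l2 * L - of_int k2 * hi) + - of_int k2 * (of_int D1 + of_int l1 * L - of_int k1 * lo)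
     = of_int (k1 * D2 + - k2 * D1) - of_int (l1 * k2 - l2 * k1) * L + of_int k1 * (- of_int k2 * (hi - lo))"
    by (simp add: algebra_simps)
  moreover have "k1 * D2 + - k2 * D1 \<le> 4 * (N\<^sup>2 * S)"
  proof -
    have "k1 * D2 \<le> (2 * N) * (N * S)" by (rule mult_mono) (use k D N in auto)
    moreover have "- k2 * D1 \<le> (2 * N) * (N * S)" by (rule mult_mono) (use k D N in auto)
    ultimately show ?thesis by (simp add: power2_eq_square)
  qed
  then have "of_int (k1 * D2 + - k2 * D1) \<le> (of_int (4 * (N\<^sup>2 * S)) :: 'a)" unfolding of_int_le_iff .
  moreover have "1 * L \<le> of_int (l1 * k2 - l2 * k1) * L"
  proof (intro mult_right_mono)
    show "1 \<le> (of_int (l1 * k2 - l2 * k1) :: 'a)" using m unfolding of_int_1_le_iff by linarith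
    have "0 \<le> (of_int (N * (N * S)) :: 'a)" using \<open>0 \<le> N * S\<close> N by (simp only: of_int_0_le_iff) simp
    then show "0 \<le> L" using L by (simp add: power2_eq_square mult.assoc)
  qed
  ultimately show False using a L by simp
qed

section \<open>Valid constraints on descriptors\<close>

locale bgraph = wgraph +
  assumes kp_bound: "e < m \<Longrightarrow> \<bar>kp e\<bar> \<le> 2" and lm_bound: "e < m \<Longrightarrow> \<bar>lm e\<bar> \<le> 1"
    and bt_bound: "e < m \<Longrightarrow> 0 \<le> bt e \<and> bt e \<le> 1"
begin

text \<open>A constraint reads \<open>cval k l a b d ds L c \<le> 0\<close>; with
  \<open>0 < k\<close> it bounds \<open>c\<close> from below, with \<open>k < 0\<close> from
  above.\<close>

definition cval :: "int \<Rightarrow> int \<Rightarrow> int \<Rightarrow> int \<Rightarrow> 'a::linordered_field \<Rightarrow> 'a \<Rightarrow> 'a \<Rightarrow> 'a \<Rightarrow> 'a" where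
  "cval k l a b d ds L c = of_int a * d + of_int b * ds + of_int l * L - of_int k * c"

text \<open>A semantic notion without reference to a closed walk: the search keeps only four
  integers per constraint, and its initial constraints come without a walk. The bounds on the
  integers keep all later determinants small.\<close>

definition valid :: "int \<Rightarrow> int \<Rightarrow> int \<Rightarrow> int \<Rightarrow> bool" where
  "valid k l a b \<longleftrightarrow> \<bar>k\<bar> \<le> 2 * int n \<and> \<bar>l\<bar> \<le> int n \<and> 1 \<le> a \<and> a \<le> int n \<and> 0 \<le> b \<and> b \<le> int n \<and>
     (\<forall>d ds L c (x :: nat \<Rightarrow> real). 0 \<le> d \<longrightarrow> 0 \<le> ds \<longrightarrow> feas d ds L c x \<longrightarrow> cval k l a b d ds L c \<le> 0)"

lemma validD:
  assumes "valid k l a b"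
  shows "\<bar>k\<bar> \<le> 2 * int n" "\<bar>l\<bar> \<le> int n" "1 \<le> a" "a \<le> int n" "0 \<le> b" "b \<le> int n"
    "0 \<le> d \<Longrightarrow> 0 \<le> ds \<Longrightarrow> feas d ds L c (x :: nat \<Rightarrow> real) \<Longrightarrow> cval k l a b d ds L c \<le> 0"
  using assms unfolding valid_def by blast+

lemma feas_of_rat:
  assumes "feas d ds l c x"
  shows "feas (of_rat d :: real) (of_rat ds) (of_rat l) (of_rat c) (\<lambda>v. of_rat (x v))"
proof -
  have *: "of_rat (wt d ds l c e) = wt (of_rat d :: real) (of_rat ds) (of_rat l) (of_rat c) e" for e
    by (simp add: wt_def of_rat_add of_rat_mult of_rat_diff)
  show ?thesis using assms by (simp add: feas_def of_rat_less_eq flip: * of_rat_add)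
qed

lemma cval_of_rat: "of_rat (cval k l a b d ds L c) = cval k l a b (of_rat d :: real) (of_rat ds) (of_rat L) (of_rat c)"
  by (simp add: cval_def of_rat_add of_rat_mult of_rat_diff)

lemma valid_rat:
  assumes "valid k l a b" "0 \<le> d" "0 \<le> ds" "feas d ds L c (x :: nat \<Rightarrow> rat)"
  shows "cval k l a b d ds L c \<le> 0"
  using validD(7)[OF assms(1) _ _ feas_of_rat[OF assms(4)]] assms(2,3) by (simp flip: cval_of_rat)

lemma closed_walk_valid:
  assumes "walk u es u" "es \<noteq> []" "length es \<le> n"
  shows "valid (\<Sum>e\<leftarrow>es. kp e) (\<Sum>e\<leftarrow>es. lm e) (int (length es)) (\<Sum>e\<leftarrow>es. bt e)"
proof -
  have "\<bar>\<Sum>e\<leftarrow>es. kp e\<bar> \<le> 2 * int (length es)" "\<bar>\<Sum>e\<leftarrow>es. lm e\<bar> \<le> int (length es)"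
    "0 \<le> (\<Sum>e\<leftarrow>es. bt e)" "(\<Sum>e\<leftarrow>es. bt e) \<le> int (length es)"
    if "\<forall>e\<in>set es. e < m" for es
    using that
  proof (induction es)
    case (Cons e es)
    case 1 then show ?case using Cons kp_bound[of e] by simp
    case 2 then show ?case using Cons lm_bound[of e] by simp
    case 3 then show ?case using Cons bt_bound[of e] by simp
    case 4 then show ?case using Cons bt_bound[of e] by simp
  qed auto
  then have "\<bar>\<Sum>e\<leftarrow>es. kp e\<bar> \<le> 2 * int (length es)" "\<bar>\<Sum>e\<leftarrow>es. lm e\<bar> \<le> int (length es)"
    "0 \<le> (\<Sum>e\<leftarrow>es. bt e)" "(\<Sum>e\<leftarrow>es. bt e) \<le> int (length es)"
    using walk_edges[OF assms(1)] by blast+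
  moreover have "1 \<le> int (length es)" using assms(2) by (cases es) auto
  moreover have "cval (\<Sum>e\<leftarrow>es. kp e) (\<Sum>e\<leftarrow>es. lm e) (int (length es)) (\<Sum>e\<leftarrow>es. bt e) d ds L c \<le> 0"
    if "feas d ds L c x" for d ds L c :: real and x
    using feas_closed[OF that assms(1)] by (simp add: tw_def cval_def)
  ultimately show ?thesis using assms(3) unfolding valid_def by auto
qed

text \<open>Eliminating \<open>c\<close> at a feasible point with \<open>ds = 0\<close> gives
  \<open>k1 * a2 * d0 - k2 * a1 * d0 \<le> (l1 * k2 - l2 * k1) * l0\<close>, with a positive
  left-hand side. Consequently each such pair of constraints bounds \<open>l\<close> from below, and
  its two lines cross.\<close>

lemma valid_det_pos:
  assumes f: "feas d0 0 l0 c0 (x :: nat \<Rightarrow> real)" "0 < d0" "0 < l0" "0 \<le> c0"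
    and v: "valid k1 l1 a1 b1" "valid k2 l2 a2 b2" "0 < k1" "k2 \<le> 0"
  shows "0 < l1 * k2 - l2 * k1"
proof -
  have w: "cval k1 l1 a1 b1 d0 0 l0 c0 \<le> 0" "cval k2 l2 a2 b2 d0 0 l0 c0 \<le> 0"
    using validD(7)[OF v(1) _ _ f(1)] validD(7)[OF v(2) _ _ f(1)] f(2) by auto
  have "of_int k1 * cval k2 l2 a2 b2 d0 0 l0 c0 \<le> 0" "0 \<le> of_int k2 * cval k1 l1 a1 b1 d0 0 l0 c0"
    using w v by (auto simp: mult_le_0_iff zero_le_mult_iff)
  moreover have "0 < of_int k1 * (of_int a2 * d0)" "0 \<le> - of_int k2 * (of_int a1 * d0)"
    using v(3,4) validD(3)[OF v(1)] validD(3)[OF v(2)] f(2) by (auto intro!: mult_nonneg_nonneg mult_nonpos_nonneg)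
  moreover have "of_int (l1 * k2 - l2 * k1) * l0 = of_int k2 * cval k1 l1 a1 b1 d0 0 l0 c0 - of_int k1 * cval k2 l2 a2 b2 d0 0 l0 c0
     + of_int k1 * (of_int a2 * d0) + - of_int k2 * (of_int a1 * d0)"
    by (simp add: cval_def algebra_simps)
  ultimately have "0 < of_int (l1 * k2 - l2 * k1) * l0" by linarith
  then show ?thesis using f(3) by (simp add: zero_less_mult_iff del: of_int_diff of_int_mult)
qed

end

section \<open>Reasoning about programs\<close>

definition ok :: "nat \<Rightarrow> nat \<Rightarrow> com \<Rightarrow> state \<Rightarrow> nat \<Rightarrow> (state \<Rightarrow> bool) \<Rightarrow> bool" where
  "ok W S p \<sigma> t Q \<longleftrightarrow> (\<exists>k \<sigma>'. exec W S p \<sigma> k \<sigma>' \<and> k \<le> t \<and> Q \<sigma>')"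

lemma ok_mono: "ok W S p \<sigma> t Q \<Longrightarrow> t \<le> t' \<Longrightarrow> (\<And>\<sigma>'. Q \<sigma>' \<Longrightarrow> Q' \<sigma>') \<Longrightarrow> ok W S p \<sigma> t' Q'"
  unfolding ok_def by (meson order_trans)

lemma ok_seq:
  assumes "ok W S p \<sigma> t1 Q1" "\<And>\<sigma>'. Q1 \<sigma>' \<Longrightarrow> ok W S q \<sigma>' t2 Q"
  shows "ok W S (Seq p q) \<sigma> (t1 + t2) Q"
proof -
  obtain k \<sigma>' where 1: "exec W S p \<sigma> k \<sigma>'" "k \<le> t1" "Q1 \<sigma>'" using assms(1) by (auto simp: ok_def)
  obtain j \<sigma>'' where 2: "exec W S q \<sigma>' j \<sigma>''" "j \<le> t2" "Q \<sigma>''" using assms(2)[OF 1(3)] by (auto simp: ok_def)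
  show ?thesis unfolding ok_def using exec.Seq[OF 1(1) 2(1)] 1 2 by (meson add_mono)
qed

lemma ok_if:
  assumes "bsafe S \<sigma> b" "bval \<sigma> b \<Longrightarrow> ok W S p \<sigma> t Q" "\<not> bval \<sigma> b \<Longrightarrow> ok W S q \<sigma> t Q"
  shows "ok W S (If b p q) \<sigma> (t + 1) Q"
proof (cases "bval \<sigma> b")
  case True
  then show ?thesis using assms exec.IfTrue[OF assms(1) True, of W p] unfolding ok_def by (meson add_le_mono1)
next
  case False
  then show ?thesis using assms exec.IfFalse[OF assms(1) False, of W q] unfolding ok_def by (meson add_le_mono1)
qed

text \<open>The index of \<open>I\<close> bounds the number of remaining iterations; the loop may
  stop earlier.\<close>

lemma ok_while:
  assumes I: "I N \<sigma>"
    and safe: "\<And>i \<sigma>. I i \<sigma> \<Longrightarrow> bsafe S \<sigma> b"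
    and body: "\<And>i \<sigma>. I i \<sigma> \<Longrightarrow> bval \<sigma> b \<Longrightarrow> \<exists>j. i = Suc j \<and> ok W S p \<sigma> t (I j)"
    and exit: "\<And>i \<sigma>. I i \<sigma> \<Longrightarrow> \<not> bval \<sigma> b \<Longrightarrow> Q \<sigma>"
  shows "ok W S (While b p) \<sigma> (N * (t + 1) + 1) Q"
  using I
proof (induction N arbitrary: \<sigma>)
  case 0
  then have "\<not> bval \<sigma> b" using body by blast
  then show ?case using exec.WhileFalse[OF safe[OF 0]] exit[OF 0] unfolding ok_def by fastforce
next
  case (Suc N)
  show ?case
  proof (cases "bval \<sigma> b")
    case True
    obtain k \<sigma>' where 1: "exec W S p \<sigma> k \<sigma>'" "k \<le> t" "I N \<sigma>'" using body[OF Suc.prems True] by (auto simp: ok_def)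
    obtain j \<sigma>'' where 2: "exec W S (While b p) \<sigma>' j \<sigma>''" "j \<le> N * (t + 1) + 1" "Q \<sigma>''"
      using Suc.IH[OF 1(3)] by (auto simp: ok_def)
    have "exec W S (While b p) \<sigma> (k + j + 1) \<sigma>''" by (rule exec.WhileTrue[OF safe[OF Suc.prems] True 1(1) 2(1)])
    moreover have "k + j + 1 \<le> Suc N * (t + 1) + 1" using 1 2 by simp
    ultimately show ?thesis using 2 unfolding ok_def by blast
  next
    case False
    then show ?thesis using exec.WhileFalse[OF safe[OF Suc.prems]] exit[OF Suc.prems] unfolding ok_def by fastforce
  qed
qed

text \<open>For loop-free programs, which the simplifier executes symbolically. Loops go through
  \<open>ok_while\<close> and \<open>ok_FOR\<close>, so \<open>While\<close> is rejected
  here.\<close>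

fun wp :: "nat \<Rightarrow> nat \<Rightarrow> com \<Rightarrow> (state \<Rightarrow> bool) \<Rightarrow> state \<Rightarrow> bool" where
  "wp W S Skip Q \<sigma> \<longleftrightarrow> Q \<sigma>"
| "wp W S (IStore x a e) Q \<sigma> \<longleftrightarrow> isafe S \<sigma> a \<and> ival \<sigma> a < S \<and> isafe S \<sigma> e \<and> ival \<sigma> e < W \<and>
     Q (\<sigma>\<lparr>idx := (idx \<sigma>)(x := (idx \<sigma> x)(ival \<sigma> a := ival \<sigma> e))\<rparr>)"
| "wp W S (RStore x a e) Q \<sigma> \<longleftrightarrow> isafe S \<sigma> a \<and> ival \<sigma> a < S \<and> rsafe S \<sigma> e \<and>
     Q (\<sigma>\<lparr>rats := (rats \<sigma>)(x := (rats \<sigma> x)(ival \<sigma> a := rval \<sigma> e))\<rparr>)"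
| "wp W S (Seq p q) Q \<sigma> \<longleftrightarrow> wp W S p (wp W S q Q) \<sigma>"
| "wp W S (If b p q) Q \<sigma> \<longleftrightarrow> bsafe S \<sigma> b \<and> (bval \<sigma> b \<longrightarrow> wp W S p Q \<sigma>) \<and> (\<not> bval \<sigma> b \<longrightarrow> wp W S q Q \<sigma>)"
| "wp W S (While b p) Q \<sigma> \<longleftrightarrow> False"

fun cost :: "com \<Rightarrow> nat" where
  "cost Skip = 1" | "cost (IStore x a e) = 1" | "cost (RStore x a e) = 1"
| "cost (Seq p q) = cost p + cost q" | "cost (If b p q) = max (cost p) (cost q) + 1" | "cost (While b p) = 0"

lemma ok_wp: "wp W S p Q \<sigma> \<Longrightarrow> ok W S p \<sigma> (cost p) Q"
proof (induction p arbitrary: Q \<sigma>)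
  case Skip
  then show ?case unfolding ok_def using exec.Skip by fastforce
next
  case (IStore x a e)
  then show ?case unfolding ok_def by (auto intro!: exI[of _ 1] exec.IStore)
next
  case (RStore x a e)
  then show ?case unfolding ok_def by (auto intro!: exI[of _ 1] exec.RStore)
next
  case (Seq p q)
  then show ?case by (auto intro!: ok_seq)
next
  case (If b p q)
  show ?case unfolding cost.simps
  proof (rule ok_if)
    show "ok W S p \<sigma> (max (cost p) (cost q)) Q" if "bval \<sigma> b"
      by (rule ok_mono[OF If.IH(1)[of Q]]) (use If.prems that in auto)
    show "ok W S q \<sigma> (max (cost p) (cost q)) Q" if "\<not> bval \<sigma> b"
      by (rule ok_mono[OF If.IH(2)[of Q]]) (use If.prems that in auto)
  qed (use If.prems in simp)
qed simp

definition FOR :: "name \<Rightarrow> iexp \<Rightarrow> com \<Rightarrow> com" where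
  "FOR x b p = Seq (IStore x (IConst 0) (IConst 0))
     (While (ILess (ILoad x (IConst 0)) b) (Seq p (IStore x (IConst 0) (IAdd (ILoad x (IConst 0)) (IConst 1)))))"

text \<open>The assumption \<open>stable\<close> keeps the counter out of the invariant. An
  iteration costs a test and an increment on top of the body; initialisation and the last test
  account for the other two steps.\<close>

lemma ok_FOR:
  assumes init: "I 0 \<sigma>" and N: "N < W" "0 < S"
    and stable: "\<And>i \<sigma> f. I i \<sigma> \<Longrightarrow> I i (\<sigma>\<lparr>idx := (idx \<sigma>)(x := f)\<rparr>)"
    and bnd: "\<And>i \<sigma>. I i \<sigma> \<Longrightarrow> i \<le> N \<Longrightarrow> idx \<sigma> x 0 = i \<Longrightarrow> isafe S \<sigma> b \<and> ival \<sigma> b = N"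
    and body: "\<And>i \<sigma>. I i \<sigma> \<Longrightarrow> i < N \<Longrightarrow> idx \<sigma> x 0 = i \<Longrightarrow>
      ok W S p \<sigma> t (\<lambda>\<sigma>'. idx \<sigma>' x 0 = i \<and> I (Suc i) \<sigma>')"
    and exit: "\<And>\<sigma>. I N \<sigma> \<Longrightarrow> idx \<sigma> x 0 = N \<Longrightarrow> Q \<sigma>"
  shows "ok W S (FOR x b p) \<sigma> (N * (t + 2) + 2) Q"
proof -
  let ?J = "\<lambda>j \<sigma>. j \<le> N \<and> idx \<sigma> x 0 = N - j \<and> I (N - j) \<sigma>"
  have "ok W S (FOR x b p) \<sigma> (1 + (N * (t + 1 + 1) + 1)) Q"
    unfolding FOR_def
  proof (rule ok_seq[where ?Q1.0 = "?J N"])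
    show "ok W S (IStore x (IConst 0) (IConst 0)) \<sigma> 1 (?J N)"
      using ok_wp[of W S "IStore x (IConst 0) (IConst 0)"] stable[OF init] N by simp
    fix \<sigma>' assume J: "?J N \<sigma>'"
    show "ok W S (While (ILess (ILoad x (IConst 0)) b) (Seq p (IStore x (IConst 0) (IAdd (ILoad x (IConst 0)) (IConst 1)))))
       \<sigma>' (N * (t + 1 + 1) + 1) Q"
    proof (rule ok_while[where I = ?J])
      show "?J N \<sigma>'" by (rule J)
      show "bsafe S \<sigma> (ILess (ILoad x (IConst 0)) b)" if "?J j \<sigma>" for j \<sigma>
        using bnd[of "N - j" \<sigma>] that N by simp
      show "Q \<sigma>" if "?J j \<sigma>" "\<not> bval \<sigma> (ILess (ILoad x (IConst 0)) b)" for j \<sigma>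
        using exit[of \<sigma>] bnd[of "N - j" \<sigma>] that by (cases j) auto
      show "\<exists>i. j = Suc i \<and> ok W S (Seq p (IStore x (IConst 0) (IAdd (ILoad x (IConst 0)) (IConst 1)))) \<sigma> (t + 1) (?J i)"
        if J: "?J j \<sigma>" and b: "bval \<sigma> (ILess (ILoad x (IConst 0)) b)" for j \<sigma>
      proof -
        have lt: "N - j < N" using bnd[of "N - j" \<sigma>] J b by simp
        then obtain i where i: "j = Suc i" by (cases j) auto
        have s: "Suc (N - j) = N - i" using J i by linarith
        have "ok W S (Seq p (IStore x (IConst 0) (IAdd (ILoad x (IConst 0)) (IConst 1)))) \<sigma> (t + 1) (?J i)"
        proof (rule ok_seq[OF body[of "N - j" \<sigma>]])
          fix \<sigma>' assume *: "idx \<sigma>' x 0 = N - j \<and> I (Suc (N - j)) \<sigma>'"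
          show "ok W S (IStore x (IConst 0) (IAdd (ILoad x (IConst 0)) (IConst 1))) \<sigma>' 1 (?J i)"
            using ok_wp[of W S "IStore x (IConst 0) (IAdd (ILoad x (IConst 0)) (IConst 1))" "?J i" \<sigma>'] * s N i J lt
              stable[of "Suc (N - j)" \<sigma>'] by simp
        qed (use J lt in auto)
        then show ?thesis using i by blast
      qed
    qed
  qed
  then show ?thesis by (rule ok_mono) (auto simp: algebra_simps)
qed

fun imods :: "com \<Rightarrow> name set" where
  "imods (IStore x a e) = {x}" | "imods (Seq p q) = imods p \<union> imods q" | "imods (If b p q) = imods p \<union> imods q"
| "imods (While b p) = imods p" | "imods _ = {}"

fun rmods :: "com \<Rightarrow> name set" where
  "rmods (RStore x a e) = {x}" | "rmods (Seq p q) = rmods p \<union> rmods q" | "rmods (If b p q) = rmods p \<union> rmods q"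
| "rmods (While b p) = rmods p" | "rmods _ = {}"

lemma mods_FOR [simp]: "imods (FOR x b p) = insert x (imods p)" "rmods (FOR x b p) = rmods p"
  by (auto simp: FOR_def)

text \<open>Allows the specification of a subprogram to mention only what it computes; all other
  arrays are recovered from the syntax.\<close>

lemma exec_frame:
  "exec W S p \<sigma> k \<sigma>' \<Longrightarrow> (x \<notin> imods p \<longrightarrow> idx \<sigma>' x = idx \<sigma> x) \<and> (x \<notin> rmods p \<longrightarrow> rats \<sigma>' x = rats \<sigma> x)"
  by (induction rule: exec.induct) auto

lemma ok_frame:
  "ok W S p \<sigma> t Q \<Longrightarrow> ok W S p \<sigma> t (\<lambda>\<sigma>'. Q \<sigma>' \<and> (\<forall>x. x \<notin> imods p \<longrightarrow> idx \<sigma>' x = idx \<sigma> x) \<and>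
     (\<forall>x. x \<notin> rmods p \<longrightarrow> rats \<sigma>' x = rats \<sigma> x))"
  unfolding ok_def using exec_frame by meson

abbreviation "V x \<equiv> ILoad x (IConst 0)"
abbreviation "R x \<equiv> RLoad x (IConst 0)"
abbreviation "iset x e \<equiv> IStore x (IConst 0) e"
abbreviation "rset x e \<equiv> RStore x (IConst 0) e"

section \<open>The feasibility query\<close>

definition adr :: "iexp \<Rightarrow> iexp \<Rightarrow> iexp" where "adr a b = IAdd (IMul a (V ''n'')) b"

definition q_zero :: com where "q_zero = FOR ''i'' (V ''n'') (RStore ''F'' (V ''i'') (RConst 0))"

definition q_copy :: com where
  "q_copy = FOR ''i'' (V ''n'')
     (RStore ''F'' (adr (IAdd (V ''r'') (IConst 1)) (V ''i'')) (RLoad ''F'' (adr (V ''r'') (V ''i''))))"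

text \<open>The candidate is read from row \<open>r\<close> and stored in row \<open>r + 1\<close>,
  so that every predecessor edge belongs to a definite row, as the trace back requires.\<close>

definition q_edge :: com where
  "q_edge = Seq (rset ''cd'' (RAdd (RLoad ''F'' (adr (V ''r'') (ILoad ''eu'' (V ''e''))))
      (RSub (RAdd (RAdd (R ''dd'') (RMul (RLoad ''eb'' (V ''e'')) (R ''dq'')))
         (RMul (RLoad ''el'' (V ''e'')) (R ''lq''))) (RMul (RLoad ''ek'' (V ''e'')) (R ''cq'')))))
    (If (RLess (RLoad ''F'' (adr (IAdd (V ''r'') (IConst 1)) (ILoad ''ev'' (V ''e'')))) (R ''cd''))
      (Seq (RStore ''F'' (adr (IAdd (V ''r'') (IConst 1)) (ILoad ''ev'' (V ''e''))) (R ''cd''))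
        (IStore ''P'' (adr (IAdd (V ''r'') (IConst 1)) (ILoad ''ev'' (V ''e''))) (V ''e''))) Skip)"

definition q_level :: com where
  "q_level = Seq q_copy (FOR ''e'' (IMul (IConst 3) (V ''n'')) q_edge)"

definition q_table :: com where "q_table = Seq q_zero (FOR ''r'' (V ''n'') q_level)"

definition q_find :: com where
  "q_find = Seq (iset ''fe'' (IConst 1)) (FOR ''i'' (V ''n'')
     (If (RLess (RLoad ''F'' (adr (ISub (V ''n'') (IConst 1)) (V ''i''))) (RLoad ''F'' (adr (V ''n'') (V ''i''))))
       (Seq (iset ''fe'' (IConst 0)) (iset ''v'' (V ''i''))) Skip))"

definition q_clear :: com where "q_clear = FOR ''i'' (V ''n'') (IStore ''sr'' (V ''i'') (IConst 0))"

text \<open>At the first visit of a vertex the running totals are saved, so the totals of the closed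
  walk are obtained as a difference at the second visit and the walk itself is never stored. Visited
  vertices carry a row number of at least 1, which leaves 0 in \<open>sr\<close> as the mark of an
  unvisited one.\<close>

definition q_back :: com where
  "q_back =
    Seq (IStore ''sr'' (V ''v'') (V ''r''))
    (Seq (RStore ''sk'' (V ''v'') (R ''tk''))
    (Seq (RStore ''sl'' (V ''v'') (R ''tl''))
    (Seq (RStore ''sb'' (V ''v'') (R ''tb''))
    (Seq (iset ''e'' (ILoad ''P'' (adr (V ''r'') (V ''v''))))
    (Seq (rset ''tk'' (RAdd (R ''tk'') (RLoad ''ek'' (V ''e''))))
    (Seq (rset ''tl'' (RAdd (R ''tl'') (RLoad ''el'' (V ''e''))))
    (Seq (rset ''tb'' (RAdd (R ''tb'') (RLoad ''eb'' (V ''e''))))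
    (Seq (iset ''v'' (ILoad ''eu'' (V ''e'')))
     (iset ''r'' (ISub (V ''r'') (IConst 1)))))))))))"

definition q_result :: com where
  "q_result =
    Seq (RStore ''Q'' (IConst 0) (RSub (R ''tk'') (RLoad ''sk'' (V ''v''))))
    (Seq (RStore ''Q'' (IConst 1) (RSub (R ''tl'') (RLoad ''sl'' (V ''v''))))
    (Seq (RStore ''Q'' (IConst 2) (ROfIdx (ISub (ILoad ''sr'' (V ''v'')) (V ''r''))))
     (RStore ''Q'' (IConst 3) (RSub (R ''tb'') (RLoad ''sb'' (V ''v''))))))"

definition q_start :: com where
  "q_start = Seq (iset ''r'' (V ''n'')) (Seq (rset ''tk'' (RConst 0)) (Seq (rset ''tl'' (RConst 0)) (rset ''tb'' (RConst 0))))"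

definition q_trace :: com where
  "q_trace = Seq q_clear (Seq q_start (Seq (While (ILess (ILoad ''sr'' (V ''v'')) (IConst 1)) q_back) q_result))"

definition query :: com where
  "query = Seq q_table (Seq q_find (If (ILess (V ''fe'') (IConst 1)) q_trace Skip))"

lemmas query_defs = q_zero_def q_copy_def q_edge_def q_level_def q_table_def q_find_def q_clear_def
  q_back_def q_result_def q_start_def q_trace_def query_def

lemma mods_query: "imods query = {''i'', ''r'', ''e'', ''P'', ''fe'', ''v'', ''sr''}"
  "rmods query = {''F'', ''cd'', ''tk'', ''tl'', ''tb'', ''sk'', ''sl'', ''sb'', ''Q''}"
  unfolding query_defs by auto

text \<open>The leading factor 21 is 3 for copying a table entry plus 6 for each of the three edges
  per vertex.\<close>

definition query_time :: "nat \<Rightarrow> nat" where "query_time n = 21 * (n * n) + 40 * n + 50"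

section \<open>Computing the Bellman-Ford table\<close>

locale qgraph = bgraph +
  fixes W S :: nat
  assumes m_eq: "m = 3 * n" and S_large: "n * n + 5 * n + 10 \<le> S" and W_large: "3 * n + 10 \<le> W"
begin

definition env :: "state \<Rightarrow> bool" where
  "env \<sigma> \<longleftrightarrow> idx \<sigma> ''n'' 0 = n \<and> (\<forall>e<m. idx \<sigma> ''eu'' e = src e \<and> idx \<sigma> ''ev'' e = dst e \<and>
     rats \<sigma> ''ek'' e = of_int (kp e) \<and> rats \<sigma> ''el'' e = of_int (lm e) \<and> rats \<sigma> ''eb'' e = of_int (bt e))"

definition par :: "rat \<Rightarrow> rat \<Rightarrow> rat \<Rightarrow> rat \<Rightarrow> state \<Rightarrow> bool" where
  "par d ds l c \<sigma> \<longleftrightarrow> rats \<sigma> ''dd'' 0 = d \<and> rats \<sigma> ''dq'' 0 = ds \<and> rats \<sigma> ''lq'' 0 = l \<and> rats \<sigma> ''cq'' 0 = c"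

lemma env_cong:
  "env \<sigma> \<Longrightarrow> idx \<sigma>' ''n'' 0 = idx \<sigma> ''n'' 0 \<Longrightarrow> idx \<sigma>' ''eu'' = idx \<sigma> ''eu'' \<Longrightarrow> idx \<sigma>' ''ev'' = idx \<sigma> ''ev'' \<Longrightarrow>
   rats \<sigma>' ''ek'' = rats \<sigma> ''ek'' \<Longrightarrow> rats \<sigma>' ''el'' = rats \<sigma> ''el'' \<Longrightarrow> rats \<sigma>' ''eb'' = rats \<sigma> ''eb'' \<Longrightarrow> env \<sigma>'"
  by (simp add: env_def)

lemma env_n [simp]: "env \<sigma> \<Longrightarrow> idx \<sigma> ''n'' 0 = n" by (simp add: env_def)
lemma env_edge: "env \<sigma> \<Longrightarrow> e < m \<Longrightarrow> idx \<sigma> ''eu'' e = src e \<and> idx \<sigma> ''ev'' e = dst e \<and>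
     rats \<sigma> ''ek'' e = of_int (kp e) \<and> rats \<sigma> ''el'' e = of_int (lm e) \<and> rats \<sigma> ''eb'' e = of_int (bt e)"
  by (simp add: env_def)

lemma adr_eq [simp]:
  assumes "u < n" "v < n" shows "r * n + u = r' * n + v \<longleftrightarrow> r = r' \<and> u = v"
proof
  assume eq: "r * n + u = r' * n + v"
  have "(r * n + u) div n = r" "(r' * n + v) div n = r'" using assms by auto
  then show "r = r' \<and> u = v" using eq by auto
qed auto

lemma adr_less: "r \<le> n \<Longrightarrow> v < n \<Longrightarrow> r * n + v < S"
  using mult_le_mono1[of r n n] S_large by linarith

definition FT :: "state \<Rightarrow> nat \<Rightarrow> nat \<Rightarrow> rat" where "FT \<sigma> r v = rats \<sigma> ''F'' (r * n + v)"
definition PT :: "state \<Rightarrow> nat \<Rightarrow> nat \<Rightarrow> nat" where "PT \<sigma> r v = idx \<sigma> ''P'' (r * n + v)"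

definition bf_part :: "rat \<Rightarrow> rat \<Rightarrow> rat \<Rightarrow> rat \<Rightarrow> nat \<Rightarrow> nat \<Rightarrow> (nat \<Rightarrow> nat \<Rightarrow> rat) \<Rightarrow> (nat \<Rightarrow> nat \<Rightarrow> nat) \<Rightarrow> bool" where
  "bf_part d ds l c r e F P \<longleftrightarrow>
     (\<forall>v<n. F r v \<le> F (Suc r) v \<and>
        (F (Suc r) v = F r v \<or>
         P (Suc r) v < m \<and> dst (P (Suc r) v) = v \<and>
         F (Suc r) v = F r (src (P (Suc r) v)) + wt d ds l c (P (Suc r) v))) \<and>
     (\<forall>e'<e. F r (src e') + wt d ds l c e' \<le> F (Suc r) (dst e'))"

lemma bf_table_part: "bf_table d ds l c F P \<longleftrightarrow> (\<forall>r<n. bf_part d ds l c r m F P)"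
  by (simp add: bf_table_def bf_part_def)

lemma bf_part_cong:
  assumes "\<And>v. v < n \<Longrightarrow> F' r v = F r v" "\<And>v. v < n \<Longrightarrow> F' (Suc r) v = F (Suc r) v"
    "\<And>v. v < n \<Longrightarrow> P' (Suc r) v = P (Suc r) v" "e \<le> m"
  shows "bf_part d ds l c r e F' P' \<longleftrightarrow> bf_part d ds l c r e F P"
proof -
  have "src (P (Suc r) v) < n" if "P (Suc r) v < m" for v using src_less that by blast
  moreover have "src e' < n" "dst e' < n" if "e' < e" for e' using src_less dst_less that assms(4) by auto
  ultimately show ?thesis unfolding bf_part_def using assms by (smt (verit))
qed

definition rows :: "rat \<Rightarrow> rat \<Rightarrow> rat \<Rightarrow> rat \<Rightarrow> nat \<Rightarrow> state \<Rightarrow> bool" where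
  "rows d ds l c q \<sigma> \<longleftrightarrow> env \<sigma> \<and> par d ds l c \<sigma> \<and> (\<forall>r<q. bf_part d ds l c r m (FT \<sigma>) (PT \<sigma>))"

lemma rows_cong:
  assumes "rows d ds l c q \<sigma>" "env \<sigma>'" "par d ds l c \<sigma>'"
    "\<And>r v. r \<le> q \<Longrightarrow> v < n \<Longrightarrow> FT \<sigma>' r v = FT \<sigma> r v" "\<And>r v. r \<le> q \<Longrightarrow> v < n \<Longrightarrow> PT \<sigma>' r v = PT \<sigma> r v"
  shows "rows d ds l c q \<sigma>'"
proof -
  have "bf_part d ds l c r m (FT \<sigma>') (PT \<sigma>')" if "r < q" for r
    using bf_part_cong[of "FT \<sigma>'" r "FT \<sigma>" "PT \<sigma>'" "PT \<sigma>" m d ds l c] assms that by (auto simp: rows_def)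
  then show ?thesis using assms by (simp add: rows_def)
qed

lemma ok_q_copy:
  assumes "rows d ds l c q \<sigma>" "idx \<sigma> ''r'' 0 = q" "q < n"
  shows "ok W S q_copy \<sigma> (n * (1 + 2) + 2) (\<lambda>\<sigma>'. idx \<sigma>' ''r'' 0 = q \<and> rows d ds l c q \<sigma>' \<and>
     bf_part d ds l c q 0 (FT \<sigma>') (PT \<sigma>'))"
  unfolding q_copy_def
proof (rule ok_FOR[where I = "\<lambda>i \<sigma>. idx \<sigma> ''r'' 0 = q \<and> rows d ds l c q \<sigma> \<and> (\<forall>v<i. FT \<sigma> (Suc q) v = FT \<sigma> q v)"])
  show "n < W" "0 < S" using W_large S_large by auto
  show "idx \<sigma> ''r'' 0 = q \<and> rows d ds l c q \<sigma> \<and> (\<forall>v<0. FT \<sigma> (Suc q) v = FT \<sigma> q v)" using assms by simp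
next
  fix i \<sigma> f assume "idx \<sigma> ''r'' 0 = q \<and> rows d ds l c q \<sigma> \<and> (\<forall>v<i. FT \<sigma> (Suc q) v = FT \<sigma> q v)"
  then show "idx (\<sigma>\<lparr>idx := (idx \<sigma>)(''i'' := f)\<rparr>) ''r'' 0 = q \<and> rows d ds l c q (\<sigma>\<lparr>idx := (idx \<sigma>)(''i'' := f)\<rparr>) \<and>
     (\<forall>v<i. FT (\<sigma>\<lparr>idx := (idx \<sigma>)(''i'' := f)\<rparr>) (Suc q) v = FT (\<sigma>\<lparr>idx := (idx \<sigma>)(''i'' := f)\<rparr>) q v)"
    by (simp add: rows_def env_def par_def FT_def[abs_def] PT_def[abs_def])
next
  fix i \<sigma> assume "idx \<sigma> ''r'' 0 = q \<and> rows d ds l c q \<sigma> \<and> (\<forall>v<i. FT \<sigma> (Suc q) v = FT \<sigma> q v)"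
  then show "isafe S \<sigma> (V ''n'') \<and> ival \<sigma> (V ''n'') = n" using S_large by (auto simp: rows_def)
next
  fix i \<sigma> assume I: "idx \<sigma> ''r'' 0 = q \<and> rows d ds l c q \<sigma> \<and> (\<forall>v<i. FT \<sigma> (Suc q) v = FT \<sigma> q v)"
    and i: "i < n" "idx \<sigma> ''i'' 0 = i"
  have e: "env \<sigma>" "par d ds l c \<sigma>" using I by (auto simp: rows_def)
  define \<tau> where "\<tau> = \<sigma>\<lparr>rats := (rats \<sigma>)(''F'' := (rats \<sigma> ''F'')(n + q * n + i := FT \<sigma> q i))\<rparr>"
  have F: "FT \<tau> r v = (if r = Suc q \<and> v = i then FT \<sigma> q i else FT \<sigma> r v)" if "v < n" for r v
    using i that adr_eq[of v i r "Suc q"] by (auto simp: \<tau>_def FT_def simp del: adr_eq)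
  have "rows d ds l c q \<tau>"
    by (rule rows_cong[of d ds l c q \<sigma>]) (use I e F in \<open>auto simp: \<tau>_def PT_def env_def par_def\<close>)
  moreover have "FT \<tau> (Suc q) v = FT \<tau> q v" if "v < Suc i" for v
    using that I i F[of v "Suc q"] F[of v q] by (auto simp: less_Suc_eq)
  ultimately have "idx \<tau> ''i'' 0 = i \<and> idx \<tau> ''r'' 0 = q \<and> rows d ds l c q \<tau> \<and> (\<forall>v<Suc i. FT \<tau> (Suc q) v = FT \<tau> q v)"
    using I i by (simp add: \<tau>_def)
  then have "wp W S (RStore ''F'' (adr (IAdd (V ''r'') (IConst 1)) (V ''i'')) (RLoad ''F'' (adr (V ''r'') (V ''i''))))
     (\<lambda>\<sigma>'. idx \<sigma>' ''i'' 0 = i \<and> idx \<sigma>' ''r'' 0 = q \<and> rows d ds l c q \<sigma>' \<and> (\<forall>v<Suc i. FT \<sigma>' (Suc q) v = FT \<sigma>' q v)) \<sigma>"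
    using I i e adr_less[of q i] adr_less[of "Suc q" i] assms(3) S_large
    by (simp add: adr_def \<tau>_def FT_def)
  from ok_wp[OF this] show "ok W S (RStore ''F'' (adr (IAdd (V ''r'') (IConst 1)) (V ''i'')) (RLoad ''F'' (adr (V ''r'') (V ''i'')))) \<sigma> 1
    (\<lambda>\<sigma>'. idx \<sigma>' ''i'' 0 = i \<and> idx \<sigma>' ''r'' 0 = q \<and> rows d ds l c q \<sigma>' \<and> (\<forall>v<Suc i. FT \<sigma>' (Suc q) v = FT \<sigma>' q v))"
    by simp
next
  fix \<sigma> assume "idx \<sigma> ''r'' 0 = q \<and> rows d ds l c q \<sigma> \<and> (\<forall>v<n. FT \<sigma> (Suc q) v = FT \<sigma> q v)"
  then show "idx \<sigma> ''r'' 0 = q \<and> rows d ds l c q \<sigma> \<and> bf_part d ds l c q 0 (FT \<sigma>) (PT \<sigma>)"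
    by (simp add: bf_part_def)
qed

text \<open>Raising an entry of row \<open>Suc q\<close> preserves the inequalities already
  established, as that row occurs only on their larger side.\<close>

lemma bf_part_improve:
  assumes b: "bf_part d ds l c q e F P" and e: "e < m" and lt: "F (Suc q) (dst e) < F q (src e) + wt d ds l c e"
    and F': "\<And>r v. v < n \<Longrightarrow> F' r v = (if r = Suc q \<and> v = dst e then F q (src e) + wt d ds l c e else F r v)"
    and P': "\<And>r v. v < n \<Longrightarrow> P' r v = (if r = Suc q \<and> v = dst e then e else P r v)"
  shows "bf_part d ds l c q (Suc e) F' P'"
proof -
  have up: "F (Suc q) v \<le> F' (Suc q) v" if "v < n" for v using F'[OF that, of "Suc q"] lt by auto
  have q: "F' q v = F q v" if "v < n" for v using F'[OF that, of q] by simp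
  have *: "F q v \<le> F (Suc q) v" "F (Suc q) v = F q v \<or> P (Suc q) v < m \<and> dst (P (Suc q) v) = v \<and>
     F (Suc q) v = F q (src (P (Suc q) v)) + wt d ds l c (P (Suc q) v)" if "v < n" for v
    using b that unfolding bf_part_def by blast+
  show ?thesis
    unfolding bf_part_def
  proof (intro conjI allI impI)
    fix v assume v: "v < n"
    show "F' q v \<le> F' (Suc q) v" using *(1)[OF v] up[OF v] q[OF v] by simp
    show "F' (Suc q) v = F' q v \<or> P' (Suc q) v < m \<and> dst (P' (Suc q) v) = v \<and>
       F' (Suc q) v = F' q (src (P' (Suc q) v)) + wt d ds l c (P' (Suc q) v)"
    proof (cases "v = dst e")
      case True
      then show ?thesis using F'[OF v, of "Suc q"] P'[OF v, of "Suc q"] e q[OF src_less[OF e]] by simp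
    next
      case False
      then show ?thesis using F'[OF v, of "Suc q"] P'[OF v, of "Suc q"] q[OF v] q[OF src_less] *(2)[OF v] by auto
    qed
  next
    fix e' assume "e' < Suc e"
    then show "F' q (src e') + wt d ds l c e' \<le> F' (Suc q) (dst e')"
    proof (cases "e' = e")
      case True
      then show ?thesis using F'[OF dst_less[OF e], of "Suc q"] q[OF src_less[OF e]] by simp
    next
      case False
      then have e': "e' < e" "e' < m" using \<open>e' < Suc e\<close> e by auto
      then have "F q (src e') + wt d ds l c e' \<le> F (Suc q) (dst e')" using b unfolding bf_part_def by blast
      then show ?thesis using up[OF dst_less[OF e'(2)]] q[OF src_less[OF e'(2)]] by simp
    qed
  qed
qed

lemma bf_part_skip:
  assumes "bf_part d ds l c q e F P" "\<not> F (Suc q) (dst e) < F q (src e) + wt d ds l c e"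
  shows "bf_part d ds l c q (Suc e) F P"
  using assms by (auto simp: bf_part_def less_Suc_eq)

lemma ok_q_edge:
  assumes r: "rows d ds l c q \<sigma>" "idx \<sigma> ''r'' 0 = q" "q < n" and e: "e < m" "idx \<sigma> ''e'' 0 = e"
    and b: "bf_part d ds l c q e (FT \<sigma>) (PT \<sigma>)"
  shows "ok W S q_edge \<sigma> 4 (\<lambda>\<sigma>'. idx \<sigma>' ''e'' 0 = e \<and> idx \<sigma>' ''r'' 0 = q \<and> rows d ds l c q \<sigma>' \<and>
     bf_part d ds l c q (Suc e) (FT \<sigma>') (PT \<sigma>'))"
proof -
  have env: "env \<sigma>" "par d ds l c \<sigma>" using r by (auto simp: rows_def)
  note ee = env_edge[OF env(1) e(1)]
  define cand where "cand = FT \<sigma> q (src e) + wt d ds l c e"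
  let ?r = "(rats \<sigma>)(''cd'' := (rats \<sigma> ''cd'')(0 := cand))"
  define \<tau>1 where "\<tau>1 = \<sigma>\<lparr>rats := ?r\<rparr>"
  define \<tau>2 where "\<tau>2 = \<sigma>\<lparr>rats := ?r(''F'' := (rats \<sigma> ''F'')(n + q * n + dst e := cand)),
     idx := (idx \<sigma>)(''P'' := (idx \<sigma> ''P'')(n + q * n + dst e := e))\<rparr>"
  have T1: "rows d ds l c q \<tau>1" "FT \<tau>1 = FT \<sigma>" "PT \<tau>1 = PT \<sigma>"
    using r(1) by (simp_all add: \<tau>1_def rows_def env_def par_def FT_def[abs_def] PT_def[abs_def])
  have F2: "FT \<tau>2 r v = (if r = Suc q \<and> v = dst e then cand else FT \<sigma> r v)"
    and P2: "PT \<tau>2 r v = (if r = Suc q \<and> v = dst e then e else PT \<sigma> r v)" if "v < n" for r v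
    using that dst_less[OF e(1)] adr_eq[of v "dst e" r "Suc q"] by (auto simp: \<tau>2_def FT_def PT_def simp del: adr_eq)
  have T2: "rows d ds l c q \<tau>2"
    by (rule rows_cong[OF r(1)]) (use env F2 P2 in \<open>auto simp: \<tau>2_def env_def par_def\<close>)
  let ?Q = "\<lambda>\<sigma>'. idx \<sigma>' ''e'' 0 = e \<and> idx \<sigma>' ''r'' 0 = q \<and> rows d ds l c q \<sigma>' \<and> bf_part d ds l c q (Suc e) (FT \<sigma>') (PT \<sigma>')"
  have Q1: "?Q \<tau>1" if "\<not> FT \<sigma> (Suc q) (dst e) < cand"
    using T1 bf_part_skip[OF b] that r e by (auto simp: cand_def) (simp_all add: \<tau>1_def)
  have Q2: "?Q \<tau>2" if "FT \<sigma> (Suc q) (dst e) < cand"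
    using T2 bf_part_improve[OF b e(1), of "FT \<tau>2" "PT \<tau>2"] F2 P2 that r e by (auto simp: cand_def) (simp_all add: \<tau>2_def)
  have "q * n + src e < S" "n + q * n + dst e < S" "0 < S" "3 * n < S" "3 * n < W"
    using adr_less[of q "src e"] adr_less[of "Suc q" "dst e"] r(3) src_less[OF e(1)] dst_less[OF e(1)] S_large W_large
    by auto
  then have "wp W S q_edge ?Q \<sigma>"
    using r(2) env env_n[OF env(1)] e ee Q1 Q2 m_eq
    by (simp add: q_edge_def adr_def cand_def FT_def wt_def par_def \<tau>1_def \<tau>2_def add_diff_eq)
  from ok_wp[OF this] show ?thesis by (simp add: q_edge_def numeral_eq_Suc)
qed

lemma ok_q_level:
  assumes "rows d ds l c q \<sigma>" "idx \<sigma> ''r'' 0 = q" "q < n"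
  shows "ok W S q_level \<sigma> (n * (1 + 2) + 2 + (m * (4 + 2) + 2)) (\<lambda>\<sigma>'. idx \<sigma>' ''r'' 0 = q \<and> rows d ds l c (Suc q) \<sigma>')"
  unfolding q_level_def
proof (rule ok_seq[OF ok_q_copy[OF assms]])
  fix \<sigma>' assume *: "idx \<sigma>' ''r'' 0 = q \<and> rows d ds l c q \<sigma>' \<and> bf_part d ds l c q 0 (FT \<sigma>') (PT \<sigma>')"
  let ?I = "\<lambda>e \<sigma>. idx \<sigma> ''r'' 0 = q \<and> rows d ds l c q \<sigma> \<and> bf_part d ds l c q e (FT \<sigma>) (PT \<sigma>)"
  show "ok W S (FOR ''e'' (IMul (IConst 3) (V ''n'')) q_edge) \<sigma>' (m * (4 + 2) + 2)
     (\<lambda>\<sigma>'. idx \<sigma>' ''r'' 0 = q \<and> rows d ds l c (Suc q) \<sigma>')"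
  proof (rule ok_FOR[where I = ?I])
    show "?I 0 \<sigma>'" by (rule *)
    show "m < W" "0 < S" using W_large S_large m_eq by auto
    show "?I i (\<sigma>\<lparr>idx := (idx \<sigma>)(''e'' := f)\<rparr>)" if "?I i \<sigma>" for i \<sigma> f
      using that by (simp add: rows_def env_def par_def FT_def[abs_def] PT_def[abs_def])
    show "isafe S \<sigma> (IMul (IConst 3) (V ''n'')) \<and> ival \<sigma> (IMul (IConst 3) (V ''n'')) = m" if "?I i \<sigma>" for i \<sigma>
    proof -
      have "idx \<sigma> ''n'' 0 = n" using that by (simp add: rows_def)
      then show ?thesis using m_eq S_large by simp
    qed
    show "ok W S q_edge \<sigma> 4 (\<lambda>\<sigma>'. idx \<sigma>' ''e'' 0 = i \<and> ?I (Suc i) \<sigma>')"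
      if "?I i \<sigma>" "i < m" "idx \<sigma> ''e'' 0 = i" for i \<sigma>
      using ok_q_edge[of d ds l c q \<sigma> i] that assms(3) by simp
    show "idx \<sigma> ''r'' 0 = q \<and> rows d ds l c (Suc q) \<sigma>" if "?I m \<sigma>" for \<sigma>
      using that by (auto simp: rows_def less_Suc_eq)
  qed
qed

lemma ok_q_table:
  assumes "env \<sigma>" "par d ds l c \<sigma>"
  shows "ok W S q_table \<sigma> (n * (1 + 2) + 2 + (n * (n * (1 + 2) + 2 + (m * (4 + 2) + 2) + 2) + 2))
    (\<lambda>\<sigma>'. env \<sigma>' \<and> par d ds l c \<sigma>' \<and> bf_table d ds l c (FT \<sigma>') (PT \<sigma>'))"
  unfolding q_table_def
proof (rule ok_seq[where ?Q1.0 = "\<lambda>\<sigma>. rows d ds l c 0 \<sigma>"])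
  show "ok W S q_zero \<sigma> (n * (1 + 2) + 2) (\<lambda>\<sigma>. rows d ds l c 0 \<sigma>)"
    unfolding q_zero_def
  proof (rule ok_FOR[where I = "\<lambda>i \<sigma>. rows d ds l c 0 \<sigma>"])
    show "rows d ds l c 0 \<sigma>" using assms by (simp add: rows_def)
    show "n < W" "0 < S" using W_large S_large by auto
    show "rows d ds l c 0 (\<sigma>\<lparr>idx := (idx \<sigma>)(''i'' := f)\<rparr>)" if "rows d ds l c 0 \<sigma>" for \<sigma> f
      using that by (simp add: rows_def env_def par_def)
    show "isafe S \<sigma> (V ''n'') \<and> ival \<sigma> (V ''n'') = n" if "rows d ds l c 0 \<sigma>" for \<sigma>
      using that S_large by (simp add: rows_def)
    show "ok W S (RStore ''F'' (V ''i'') (RConst 0)) \<sigma> 1 (\<lambda>\<sigma>'. idx \<sigma>' ''i'' 0 = i \<and> rows d ds l c 0 \<sigma>')"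
      if "rows d ds l c 0 \<sigma>" "i < n" "idx \<sigma> ''i'' 0 = i" for i \<sigma>
    proof -
      have "wp W S (RStore ''F'' (V ''i'') (RConst 0)) (\<lambda>\<sigma>'. idx \<sigma>' ''i'' 0 = i \<and> rows d ds l c 0 \<sigma>') \<sigma>"
        using that S_large by (simp add: rows_def env_def par_def)
      from ok_wp[OF this] show ?thesis by simp
    qed
  qed
  fix \<sigma>' assume *: "rows d ds l c 0 \<sigma>'"
  show "ok W S (FOR ''r'' (V ''n'') q_level) \<sigma>' (n * (n * (1 + 2) + 2 + (m * (4 + 2) + 2) + 2) + 2)
     (\<lambda>\<sigma>'. env \<sigma>' \<and> par d ds l c \<sigma>' \<and> bf_table d ds l c (FT \<sigma>') (PT \<sigma>'))"
  proof (rule ok_FOR[where I = "\<lambda>i \<sigma>. rows d ds l c i \<sigma>"])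
    show "rows d ds l c 0 \<sigma>'" by (rule *)
    show "n < W" "0 < S" using W_large S_large by auto
    show "rows d ds l c i (\<sigma>\<lparr>idx := (idx \<sigma>)(''r'' := f)\<rparr>)" if "rows d ds l c i \<sigma>" for i \<sigma> f
      using that by (simp add: rows_def env_def par_def FT_def[abs_def] PT_def[abs_def])
    show "isafe S \<sigma> (V ''n'') \<and> ival \<sigma> (V ''n'') = n" if "rows d ds l c i \<sigma>" for i \<sigma>
      using that S_large by (simp add: rows_def)
    show "ok W S q_level \<sigma> (n * (1 + 2) + 2 + (m * (4 + 2) + 2)) (\<lambda>\<sigma>'. idx \<sigma>' ''r'' 0 = i \<and> rows d ds l c (Suc i) \<sigma>')"
      if "rows d ds l c i \<sigma>" "i < n" "idx \<sigma> ''r'' 0 = i" for i \<sigma>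
      using ok_q_level that by blast
    show "env \<sigma> \<and> par d ds l c \<sigma> \<and> bf_table d ds l c (FT \<sigma>) (PT \<sigma>)" if "rows d ds l c n \<sigma>" for \<sigma>
      using that by (simp add: rows_def bf_table_part)
  qed
qed

definition tabled :: "rat \<Rightarrow> rat \<Rightarrow> rat \<Rightarrow> rat \<Rightarrow> (nat \<Rightarrow> nat \<Rightarrow> rat) \<Rightarrow> (nat \<Rightarrow> nat \<Rightarrow> nat) \<Rightarrow> state \<Rightarrow> bool" where
  "tabled d ds l c F P \<sigma> \<longleftrightarrow> env \<sigma> \<and> bf_table d ds l c F P \<and> FT \<sigma> = F \<and> PT \<sigma> = P"

lemma tabled_cong:
  assumes "tabled d ds l c F P \<sigma>" "idx \<sigma>' ''n'' 0 = idx \<sigma> ''n'' 0" "idx \<sigma>' ''eu'' = idx \<sigma> ''eu''" "idx \<sigma>' ''ev'' = idx \<sigma> ''ev''"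
    "rats \<sigma>' ''ek'' = rats \<sigma> ''ek''" "rats \<sigma>' ''el'' = rats \<sigma> ''el''" "rats \<sigma>' ''eb'' = rats \<sigma> ''eb''"
    "rats \<sigma>' ''F'' = rats \<sigma> ''F''" "idx \<sigma>' ''P'' = idx \<sigma> ''P''"
  shows "tabled d ds l c F P \<sigma>'"
  using assms env_cong[of \<sigma> \<sigma>'] by (auto simp: tabled_def FT_def[abs_def] PT_def[abs_def])

lemma ok_q_find:
  assumes "tabled d ds l c F P \<sigma>"
  shows "ok W S q_find \<sigma> (1 + (n * (3 + 2) + 2)) (\<lambda>\<sigma>'. tabled d ds l c F P \<sigma>' \<and>
     (idx \<sigma>' ''fe'' 0 = 1 \<and> (\<forall>v<n. F n v \<le> F (n - 1) v) \<or>
      idx \<sigma>' ''fe'' 0 = 0 \<and> idx \<sigma>' ''v'' 0 < n \<and> F (n - 1) (idx \<sigma>' ''v'' 0) < F n (idx \<sigma>' ''v'' 0)))"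
  unfolding q_find_def
proof (rule ok_seq)
  let ?I = "\<lambda>i \<sigma>. tabled d ds l c F P \<sigma> \<and>
     (idx \<sigma> ''fe'' 0 = 1 \<and> (\<forall>v<i. F n v \<le> F (n - 1) v) \<or>
      idx \<sigma> ''fe'' 0 = 0 \<and> idx \<sigma> ''v'' 0 < n \<and> F (n - 1) (idx \<sigma> ''v'' 0) < F n (idx \<sigma> ''v'' 0))"
  have "wp W S (iset ''fe'' (IConst 1)) (?I 0) \<sigma>"
    using assms S_large W_large by (auto intro: tabled_cong)
  from ok_wp[OF this] show "ok W S (iset ''fe'' (IConst 1)) \<sigma> 1 (?I 0)" by simp
  fix \<sigma>' assume I0: "?I 0 \<sigma>'"
  show "ok W S (FOR ''i'' (V ''n'')
     (If (RLess (RLoad ''F'' (adr (ISub (V ''n'') (IConst 1)) (V ''i''))) (RLoad ''F'' (adr (V ''n'') (V ''i''))))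
       (Seq (iset ''fe'' (IConst 0)) (iset ''v'' (V ''i''))) Skip)) \<sigma>' (n * (3 + 2) + 2) (?I n)"
  proof (rule ok_FOR[where I = ?I])
    show "?I 0 \<sigma>'" by (rule I0)
    show "n < W" "0 < S" using W_large S_large by auto
    show "?I i (\<sigma>\<lparr>idx := (idx \<sigma>)(''i'' := f)\<rparr>)" if "?I i \<sigma>" for i \<sigma> f
      using that by (auto intro: tabled_cong[of d ds l c F P \<sigma>])
    show "isafe S \<sigma> (V ''n'') \<and> ival \<sigma> (V ''n'') = n" if "?I i \<sigma>" for i \<sigma>
      using that S_large by (auto simp: tabled_def)
    show "ok W S (If (RLess (RLoad ''F'' (adr (ISub (V ''n'') (IConst 1)) (V ''i''))) (RLoad ''F'' (adr (V ''n'') (V ''i''))))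
       (Seq (iset ''fe'' (IConst 0)) (iset ''v'' (V ''i''))) Skip) \<sigma> 3 (\<lambda>\<sigma>'. idx \<sigma>' ''i'' 0 = i \<and> ?I (Suc i) \<sigma>')"
      if I: "?I i \<sigma>" and i: "i < n" "idx \<sigma> ''i'' 0 = i" for i \<sigma>
    proof -
      have t: "tabled d ds l c F P \<sigma>" using I by blast
      then have n: "idx \<sigma> ''n'' 0 = n" by (simp add: tabled_def)
      have F: "rats \<sigma> ''F'' (r * n + v) = F r v" for r v using t by (auto simp: tabled_def FT_def)
      let ?\<tau> = "\<sigma>\<lparr>idx := (idx \<sigma>)(''fe'' := (idx \<sigma> ''fe'')(0 := 0), ''v'' := (idx \<sigma> ''v'')(0 := i))\<rparr>"
      have t': "tabled d ds l c F P ?\<tau>" by (rule tabled_cong[OF t]) auto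
      have "(n - Suc 0) * n + i < S" "n * n + i < S" "i < W" "0 < W" "0 < S"
        using adr_less[of "n - 1" i] adr_less[of n i] i W_large by auto
      then have "wp W S (If (RLess (RLoad ''F'' (adr (ISub (V ''n'') (IConst 1)) (V ''i''))) (RLoad ''F'' (adr (V ''n'') (V ''i''))))
       (Seq (iset ''fe'' (IConst 0)) (iset ''v'' (V ''i''))) Skip) (\<lambda>\<sigma>'. idx \<sigma>' ''i'' 0 = i \<and> ?I (Suc i) \<sigma>') \<sigma>"
        using I i n t' F by (auto simp: adr_def less_Suc_eq not_less)
      from ok_wp[OF this] show ?thesis by (simp add: numeral_eq_Suc)
    qed
  qed
qed

end

section \<open>Tracing predecessors back to a closed walk\<close>

context qgraph begin

text \<open>For every marked \<open>u\<close>, the saved totals differ from the current ones by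
  those of a walk from the current vertex to \<open>u\<close>. After \<open>n - r\<close> steps
  exactly \<open>n - r\<close> vertices are marked, so an unmarked current vertex forces
  \<open>0 < r\<close> and the trace cannot run out of rows.\<close>

definition traced :: "rat \<Rightarrow> rat \<Rightarrow> rat \<Rightarrow> rat \<Rightarrow> (nat \<Rightarrow> nat \<Rightarrow> rat) \<Rightarrow> (nat \<Rightarrow> nat \<Rightarrow> nat) \<Rightarrow> nat \<Rightarrow> state \<Rightarrow> bool" where
  "traced d ds l c F P r \<sigma> \<longleftrightarrow> tabled d ds l c F P \<sigma> \<and> idx \<sigma> ''r'' 0 = r \<and> r \<le> n \<and> idx \<sigma> ''v'' 0 < n \<and>
     (0 < r \<longrightarrow> F (r - 1) (idx \<sigma> ''v'' 0) < F r (idx \<sigma> ''v'' 0)) \<and>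
     card {u. u < n \<and> idx \<sigma> ''sr'' u \<noteq> 0} = n - r \<and>
     (\<forall>u<n. idx \<sigma> ''sr'' u \<noteq> 0 \<longrightarrow> (let q = idx \<sigma> ''sr'' u in r < q \<and> q \<le> n \<and> F (q - 1) u < F q u \<and>
       (\<exists>es. walk (idx \<sigma> ''v'' 0) es u \<and> length es = q - r \<and> F q u = F r (idx \<sigma> ''v'' 0) + tw d ds l c es \<and>
          of_int (\<Sum>e\<leftarrow>es. kp e) = rats \<sigma> ''tk'' 0 - rats \<sigma> ''sk'' u \<and>
          of_int (\<Sum>e\<leftarrow>es. lm e) = rats \<sigma> ''tl'' 0 - rats \<sigma> ''sl'' u \<and>
          of_int (\<Sum>e\<leftarrow>es. bt e) = rats \<sigma> ''tb'' 0 - rats \<sigma> ''sb'' u)))"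

lemma ok_q_back:
  assumes t: "traced d ds l c F P r \<sigma>" and v: "idx \<sigma> ''sr'' (idx \<sigma> ''v'' 0) = 0"
  shows "\<exists>j. r = Suc j \<and> ok W S q_back \<sigma> 10 (traced d ds l c F P j)"
proof -
  define v where "v = idx \<sigma> ''v'' 0"
  have T: "tabled d ds l c F P \<sigma>" "idx \<sigma> ''r'' 0 = r" "r \<le> n" "v < n" "0 < r \<Longrightarrow> F (r - 1) v < F r v"
    and cd: "card {u. u < n \<and> idx \<sigma> ''sr'' u \<noteq> 0} = n - r"
    using t unfolding traced_def v_def by blast+
  have marks: "r < idx \<sigma> ''sr'' u \<and> idx \<sigma> ''sr'' u \<le> n \<and> F (idx \<sigma> ''sr'' u - 1) u < F (idx \<sigma> ''sr'' u) u \<and>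
       (\<exists>es. walk v es u \<and> length es = idx \<sigma> ''sr'' u - r \<and> F (idx \<sigma> ''sr'' u) u = F r v + tw d ds l c es \<and>
          of_int (\<Sum>e\<leftarrow>es. kp e) = rats \<sigma> ''tk'' 0 - rats \<sigma> ''sk'' u \<and>
          of_int (\<Sum>e\<leftarrow>es. lm e) = rats \<sigma> ''tl'' 0 - rats \<sigma> ''sl'' u \<and>
          of_int (\<Sum>e\<leftarrow>es. bt e) = rats \<sigma> ''tb'' 0 - rats \<sigma> ''sb'' u)"
    if "u < n" "idx \<sigma> ''sr'' u \<noteq> 0" for u
    using t that unfolding traced_def v_def Let_def by blast
  have v0: "idx \<sigma> ''sr'' v = 0" using v by (simp add: v_def)
  have env: "env \<sigma>" and bf: "bf_table d ds l c F P" and FP: "FT \<sigma> = F" "PT \<sigma> = P" using T(1) by (auto simp: tabled_def)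
  have "r \<noteq> 0"
  proof
    assume "r = 0"
    have "{u. u < n \<and> idx \<sigma> ''sr'' u \<noteq> 0} \<subseteq> {..<n} - {v}" using v0 by blast
    then have "card {u. u < n \<and> idx \<sigma> ''sr'' u \<noteq> 0} \<le> card ({..<n} - {v})" by (intro card_mono) auto
    also have "\<dots> < n" using T(4) by simp
    finally have "card {u. u < n \<and> idx \<sigma> ''sr'' u \<noteq> 0} < n" .
    then show False using cd \<open>r = 0\<close> by simp
  qed
  then obtain j where j: "r = Suc j" by (cases r) auto
  have jn: "j < n" using j T(3) by simp
  have lt: "F j v < F (Suc j) v" using T(5) j by simp
  define e where "e = P (Suc j) v"
  have e: "e < m" "dst e = v" "F (Suc j) v = F j (src e) + wt d ds l c e" "0 < j \<Longrightarrow> F (j - 1) (src e) < F j (src e)"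
    using bf_step[OF bf jn T(4) lt] by (auto simp: e_def)
  have un: "src e < n" using src_less e(1) by blast
  note ee = env_edge[OF env e(1)]
  have Pe: "idx \<sigma> ''P'' (n + j * n + v) = e" using FP(2)[symmetric] by (simp add: e_def PT_def)
  let ?i = "(idx \<sigma>)(''sr'' := (idx \<sigma> ''sr'')(v := Suc j), ''e'' := (idx \<sigma> ''e'')(0 := e),
     ''v'' := (idx \<sigma> ''v'')(0 := src e), ''r'' := (idx \<sigma> ''r'')(0 := j))"
  let ?r = "(rats \<sigma>)(''sk'' := (rats \<sigma> ''sk'')(v := rats \<sigma> ''tk'' 0), ''sl'' := (rats \<sigma> ''sl'')(v := rats \<sigma> ''tl'' 0),
     ''sb'' := (rats \<sigma> ''sb'')(v := rats \<sigma> ''tb'' 0), ''tk'' := (rats \<sigma> ''tk'')(0 := rats \<sigma> ''tk'' 0 + of_int (kp e)),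
     ''tl'' := (rats \<sigma> ''tl'')(0 := rats \<sigma> ''tl'' 0 + of_int (lm e)), ''tb'' := (rats \<sigma> ''tb'')(0 := rats \<sigma> ''tb'' 0 + of_int (bt e)))"
  define \<tau> where "\<tau> = \<sigma>\<lparr>rats := ?r, idx := ?i\<rparr>"
  have "traced d ds l c F P j \<tau>"
    unfolding traced_def
  proof (intro conjI allI impI)
    show "tabled d ds l c F P \<tau>" by (rule tabled_cong[OF T(1)]) (simp_all add: \<tau>_def)
    show "idx \<tau> ''r'' 0 = j" "idx \<tau> ''v'' 0 < n" "j \<le> n" using un jn by (simp_all add: \<tau>_def)
    show "F (j - 1) (idx \<tau> ''v'' 0) < F j (idx \<tau> ''v'' 0)" if "0 < j" using e(4) that by (simp add: \<tau>_def)
    have "{u. u < n \<and> idx \<tau> ''sr'' u \<noteq> 0} = insert v {u. u < n \<and> idx \<sigma> ''sr'' u \<noteq> 0}"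
      using T(4) by (auto simp: \<tau>_def)
    then show "card {u. u < n \<and> idx \<tau> ''sr'' u \<noteq> 0} = n - j" using cd v0 j jn by simp
    fix u assume u: "u < n" "idx \<tau> ''sr'' u \<noteq> 0"
    show "let q = idx \<tau> ''sr'' u in j < q \<and> q \<le> n \<and> F (q - 1) u < F q u \<and>
       (\<exists>es. walk (idx \<tau> ''v'' 0) es u \<and> length es = q - j \<and> F q u = F j (idx \<tau> ''v'' 0) + tw d ds l c es \<and>
          of_int (\<Sum>e\<leftarrow>es. kp e) = rats \<tau> ''tk'' 0 - rats \<tau> ''sk'' u \<and>
          of_int (\<Sum>e\<leftarrow>es. lm e) = rats \<tau> ''tl'' 0 - rats \<tau> ''sl'' u \<and>
          of_int (\<Sum>e\<leftarrow>es. bt e) = rats \<tau> ''tb'' 0 - rats \<tau> ''sb'' u)"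
    proof (cases "u = v")
      case True
      then show ?thesis using e lt jn by (auto simp: \<tau>_def Let_def intro!: exI[of _ "[e]"])
    next
      case False
      then have su: "idx \<tau> ''sr'' u = idx \<sigma> ''sr'' u" by (simp add: \<tau>_def)
      obtain es where es: "walk v es u" "length es = idx \<sigma> ''sr'' u - r" "F (idx \<sigma> ''sr'' u) u = F r v + tw d ds l c es"
          "of_int (\<Sum>e\<leftarrow>es. kp e) = rats \<sigma> ''tk'' 0 - rats \<sigma> ''sk'' u"
          "of_int (\<Sum>e\<leftarrow>es. lm e) = rats \<sigma> ''tl'' 0 - rats \<sigma> ''sl'' u"
          "of_int (\<Sum>e\<leftarrow>es. bt e) = rats \<sigma> ''tb'' 0 - rats \<sigma> ''sb'' u"
        and q: "r < idx \<sigma> ''sr'' u" "idx \<sigma> ''sr'' u \<le> n" "F (idx \<sigma> ''sr'' u - 1) u < F (idx \<sigma> ''sr'' u) u"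
        using marks[of u] u su by auto
      show ?thesis unfolding Let_def su
      proof (intro conjI exI[of _ "e # es"])
        show "F (idx \<sigma> ''sr'' u) u = F j (idx \<tau> ''v'' 0) + tw d ds l c (e # es)"
          using es(3) e(3) j by (simp add: \<tau>_def)
      qed (use es q e j False in \<open>simp_all add: \<tau>_def\<close>)
    qed
  qed
  moreover have "n + j * n + v < S" "v < S" "0 < S" "e < S" "e < W" "0 < W" "Suc j < W" "j < W" "src e < W"
    using adr_less[of "Suc j" v] T(4) jn S_large W_large e(1) m_eq un by auto
  ultimately have "wp W S q_back (traced d ds l c F P j) \<sigma>"
    using T(2,4) j v_def[symmetric] env_n[OF env] Pe ee v0
    by (simp add: q_back_def adr_def \<tau>_def fun_upd_twist)
  from ok_wp[OF this] show ?thesis using j by (simp add: q_back_def numeral_eq_Suc)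
qed

definition query_post :: "rat \<Rightarrow> rat \<Rightarrow> rat \<Rightarrow> rat \<Rightarrow> state \<Rightarrow> bool" where
  "query_post d ds l c \<sigma> \<longleftrightarrow>
     idx \<sigma> ''fe'' 0 = 1 \<and> feas d ds l c (\<lambda>v. rats \<sigma> ''F'' (n * n + v)) \<or>
     idx \<sigma> ''fe'' 0 = 0 \<and> (\<exists>k l' a b. valid k l' a b \<and> rats \<sigma> ''Q'' 0 = of_int k \<and> rats \<sigma> ''Q'' 1 = of_int l' \<and>
       rats \<sigma> ''Q'' 2 = of_int a \<and> rats \<sigma> ''Q'' 3 = of_int b \<and> 0 < cval k l' a b d ds l c)"

text \<open>The closed walk starts with the second meeting of \<open>v\<close>, in row
  \<open>r\<close>, and leads to the first one, in row \<open>q\<close>. Its weight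
  \<open>F q v - F r v\<close> is positive because \<open>v\<close> improves strictly in row
  \<open>q\<close>.\<close>

lemma ok_q_result:
  assumes t: "traced d ds l c F P r \<sigma>" and v: "idx \<sigma> ''sr'' (idx \<sigma> ''v'' 0) \<noteq> 0" and fe: "idx \<sigma> ''fe'' 0 = 0"
  shows "ok W S q_result \<sigma> 4 (query_post d ds l c)"
proof -
  define v q where "v = idx \<sigma> ''v'' 0" and "q = idx \<sigma> ''sr'' v"
  have vn: "v < n" using t by (simp add: traced_def v_def)
  have "r < q \<and> q \<le> n \<and> F (q - 1) v < F q v \<and>
       (\<exists>es. walk v es v \<and> length es = q - r \<and> F q v = F r v + tw d ds l c es \<and>
          of_int (\<Sum>e\<leftarrow>es. kp e) = rats \<sigma> ''tk'' 0 - rats \<sigma> ''sk'' v \<and>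
          of_int (\<Sum>e\<leftarrow>es. lm e) = rats \<sigma> ''tl'' 0 - rats \<sigma> ''sl'' v \<and>
          of_int (\<Sum>e\<leftarrow>es. bt e) = rats \<sigma> ''tb'' 0 - rats \<sigma> ''sb'' v)"
    using t v vn unfolding traced_def v_def q_def Let_def by blast
  then obtain es where es: "walk v es v" "length es = q - r" "F q v = F r v + tw d ds l c es"
          "of_int (\<Sum>e\<leftarrow>es. kp e) = rats \<sigma> ''tk'' 0 - rats \<sigma> ''sk'' v"
          "of_int (\<Sum>e\<leftarrow>es. lm e) = rats \<sigma> ''tl'' 0 - rats \<sigma> ''sl'' v"
          "of_int (\<Sum>e\<leftarrow>es. bt e) = rats \<sigma> ''tb'' 0 - rats \<sigma> ''sb'' v"
    and q: "r < q" "q \<le> n" "F (q - 1) v < F q v" by blast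
  have "F r v \<le> F (q - 1) v" using t q vn by (intro bf_mono[of d ds l c F P]) (auto simp: traced_def tabled_def)
  then have "0 < tw d ds l c es" using es(3) q(3) by simp
  moreover have "valid (\<Sum>e\<leftarrow>es. kp e) (\<Sum>e\<leftarrow>es. lm e) (int (length es)) (\<Sum>e\<leftarrow>es. bt e)"
    by (rule closed_walk_valid[OF es(1)]) (use es(2) q in auto)
  ultimately have *: "\<exists>k l' a b. valid k l' a b \<and> rats \<sigma> ''tk'' 0 - rats \<sigma> ''sk'' v = of_int k \<and> rats \<sigma> ''tl'' 0 - rats \<sigma> ''sl'' v = of_int l' \<and>
       of_nat (q - r) = (of_int a :: rat) \<and> rats \<sigma> ''tb'' 0 - rats \<sigma> ''sb'' v = of_int b \<and> 0 < cval k l' a b d ds l c"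
    unfolding es(2)[symmetric]
    by (intro exI[of _ "\<Sum>e\<leftarrow>es. kp e"] exI[of _ "\<Sum>e\<leftarrow>es. lm e"] exI[of _ "int (length es)"] exI[of _ "\<Sum>e\<leftarrow>es. bt e"])
      (simp add: es cval_def tw_def)
  have "wp W S q_result (query_post d ds l c) \<sigma>"
    using * t vn fe S_large v_def[symmetric] q_def[symmetric]
    by (simp add: q_result_def query_post_def traced_def)
  from ok_wp[OF this] show ?thesis by (simp add: q_result_def numeral_eq_Suc)
qed

lemma ok_q_trace:
  assumes t: "tabled d ds l c F P \<sigma>" and fe: "idx \<sigma> ''fe'' 0 = 0"
    and v: "idx \<sigma> ''v'' 0 < n" "F (n - 1) (idx \<sigma> ''v'' 0) < F n (idx \<sigma> ''v'' 0)"
  shows "ok W S q_trace \<sigma> (n * (1 + 2) + 2 + (4 + (n * (10 + 1) + 1 + 4))) (query_post d ds l c)"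
  unfolding q_trace_def
proof (rule ok_seq)
  let ?I = "\<lambda>i \<sigma>. tabled d ds l c F P \<sigma> \<and> idx \<sigma> ''fe'' 0 = 0 \<and> idx \<sigma> ''v'' 0 < n \<and>
     F (n - 1) (idx \<sigma> ''v'' 0) < F n (idx \<sigma> ''v'' 0) \<and> (\<forall>u<i. idx \<sigma> ''sr'' u = 0)"
  show "ok W S q_clear \<sigma> (n * (1 + 2) + 2) (?I n)"
    unfolding q_clear_def
  proof (rule ok_FOR[where I = ?I])
    show "?I 0 \<sigma>" using assms by simp
    show "n < W" "0 < S" using W_large S_large by auto
    show "?I i (\<sigma>\<lparr>idx := (idx \<sigma>)(''i'' := f)\<rparr>)" if "?I i \<sigma>" for i \<sigma> f
      using that by (auto intro: tabled_cong[of d ds l c F P \<sigma>])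
    show "isafe S \<sigma> (V ''n'') \<and> ival \<sigma> (V ''n'') = n" if "?I i \<sigma>" for i \<sigma>
      using that S_large by (auto simp: tabled_def)
    show "ok W S (IStore ''sr'' (V ''i'') (IConst 0)) \<sigma> 1 (\<lambda>\<sigma>'. idx \<sigma>' ''i'' 0 = i \<and> ?I (Suc i) \<sigma>')"
      if I: "?I i \<sigma>" and i: "i < n" "idx \<sigma> ''i'' 0 = i" for i \<sigma>
    proof -
      have "tabled d ds l c F P (\<sigma>\<lparr>idx := (idx \<sigma>)(''sr'' := (idx \<sigma> ''sr'')(i := 0))\<rparr>)"
        by (rule tabled_cong[of d ds l c F P \<sigma>]) (use I in auto)
      then have "wp W S (IStore ''sr'' (V ''i'') (IConst 0)) (\<lambda>\<sigma>'. idx \<sigma>' ''i'' 0 = i \<and> ?I (Suc i) \<sigma>') \<sigma>"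
        using I i S_large W_large by (auto simp: less_Suc_eq)
      from ok_wp[OF this] show ?thesis by simp
    qed
  qed
  fix \<sigma>1 assume I: "?I n \<sigma>1"
  show "ok W S (Seq q_start (Seq (While (ILess (ILoad ''sr'' (V ''v'')) (IConst 1)) q_back) q_result)) \<sigma>1
     (4 + (n * (10 + 1) + 1 + 4)) (query_post d ds l c)"
  proof (rule ok_seq)
    have "tabled d ds l c F P (\<sigma>1\<lparr>idx := (idx \<sigma>1)(''r'' := (idx \<sigma>1 ''r'')(0 := n)),
       rats := (rats \<sigma>1)(''tk'' := (rats \<sigma>1 ''tk'')(0 := 0), ''tl'' := (rats \<sigma>1 ''tl'')(0 := 0), ''tb'' := (rats \<sigma>1 ''tb'')(0 := 0))\<rparr>)"
      by (rule tabled_cong[of d ds l c F P \<sigma>1]) (use I in auto)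
    moreover have none: "{u. u < n \<and> 0 < idx \<sigma>1 ''sr'' u} = {}" using I by auto
    moreover have "idx \<sigma>1 ''n'' 0 = n" using I by (auto simp: tabled_def)
    ultimately have "wp W S q_start (\<lambda>\<sigma>. traced d ds l c F P n \<sigma> \<and> idx \<sigma> ''fe'' 0 = 0) \<sigma>1"
      using I S_large W_large n_pos by (simp add: q_start_def traced_def)
    from ok_wp[OF this] show "ok W S q_start \<sigma>1 4 (\<lambda>\<sigma>. traced d ds l c F P n \<sigma> \<and> idx \<sigma> ''fe'' 0 = 0)"
      by (simp add: q_start_def numeral_eq_Suc)
    fix \<sigma>2 assume T: "traced d ds l c F P n \<sigma>2 \<and> idx \<sigma>2 ''fe'' 0 = 0"
    let ?J = "\<lambda>r \<sigma>. traced d ds l c F P r \<sigma> \<and> idx \<sigma> ''fe'' 0 = 0"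
    show "ok W S (Seq (While (ILess (ILoad ''sr'' (V ''v'')) (IConst 1)) q_back) q_result) \<sigma>2
       (n * (10 + 1) + 1 + 4) (query_post d ds l c)"
    proof (rule ok_seq)
      show "ok W S (While (ILess (ILoad ''sr'' (V ''v'')) (IConst 1)) q_back) \<sigma>2 (n * (10 + 1) + 1)
         (\<lambda>\<sigma>. \<exists>r. ?J r \<sigma> \<and> idx \<sigma> ''sr'' (idx \<sigma> ''v'' 0) \<noteq> 0)"
      proof (rule ok_while[where I = ?J])
        show "?J n \<sigma>2" by (rule T)
        show "bsafe S \<sigma> (ILess (ILoad ''sr'' (V ''v'')) (IConst 1))" if "?J r \<sigma>" for r \<sigma>
          using that S_large by (auto simp: traced_def)
        show "\<exists>j. r = Suc j \<and> ok W S q_back \<sigma> 10 (?J j)"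
          if J: "?J r \<sigma>" "bval \<sigma> (ILess (ILoad ''sr'' (V ''v'')) (IConst 1))" for r \<sigma>
        proof -
          obtain j where j: "r = Suc j" "ok W S q_back \<sigma> 10 (traced d ds l c F P j)"
            using ok_q_back[of d ds l c F P r \<sigma>] J by auto
          have "ok W S q_back \<sigma> 10 (?J j)"
            by (rule ok_mono[OF ok_frame[OF j(2)]]) (use J in \<open>auto simp: q_back_def\<close>)
          then show ?thesis using j by blast
        qed
        show "\<exists>r. ?J r \<sigma> \<and> idx \<sigma> ''sr'' (idx \<sigma> ''v'' 0) \<noteq> 0"
          if "?J r \<sigma>" "\<not> bval \<sigma> (ILess (ILoad ''sr'' (V ''v'')) (IConst 1))" for r \<sigma>
          using that by auto
      qed
      show "ok W S q_result \<sigma> 4 (query_post d ds l c)"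
        if "\<exists>r. ?J r \<sigma> \<and> idx \<sigma> ''sr'' (idx \<sigma> ''v'' 0) \<noteq> 0" for \<sigma>
        using that ok_q_result by blast
    qed
  qed
qed

lemma ok_query:
  assumes "env \<sigma>" "par d ds l c \<sigma>"
  shows "ok W S query \<sigma> (query_time n) (query_post d ds l c)"
proof -
  have "ok W S query \<sigma> (n * (1 + 2) + 2 + (n * (n * (1 + 2) + 2 + (m * (4 + 2) + 2) + 2) + 2) +
     ((1 + (n * (3 + 2) + 2)) + (n * (1 + 2) + 2 + (4 + (n * (10 + 1) + 1 + 4)) + 1))) (query_post d ds l c)"
    unfolding query_def
  proof (rule ok_seq[OF ok_q_table[OF assms]])
    fix \<sigma>1 assume 1: "env \<sigma>1 \<and> par d ds l c \<sigma>1 \<and> bf_table d ds l c (FT \<sigma>1) (PT \<sigma>1)"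
    then have T: "tabled d ds l c (FT \<sigma>1) (PT \<sigma>1) \<sigma>1" by (simp add: tabled_def)
    show "ok W S (Seq q_find (If (ILess (V ''fe'') (IConst 1)) q_trace Skip)) \<sigma>1
       ((1 + (n * (3 + 2) + 2)) + (n * (1 + 2) + 2 + (4 + (n * (10 + 1) + 1 + 4)) + 1)) (query_post d ds l c)"
    proof (rule ok_seq[OF ok_q_find[OF T]])
      fix \<sigma>2 assume 2: "tabled d ds l c (FT \<sigma>1) (PT \<sigma>1) \<sigma>2 \<and>
        (idx \<sigma>2 ''fe'' 0 = 1 \<and> (\<forall>v<n. FT \<sigma>1 n v \<le> FT \<sigma>1 (n - 1) v) \<or>
         idx \<sigma>2 ''fe'' 0 = 0 \<and> idx \<sigma>2 ''v'' 0 < n \<and> FT \<sigma>1 (n - 1) (idx \<sigma>2 ''v'' 0) < FT \<sigma>1 n (idx \<sigma>2 ''v'' 0))"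
      show "ok W S (If (ILess (V ''fe'') (IConst 1)) q_trace Skip) \<sigma>2
         (n * (1 + 2) + 2 + (4 + (n * (10 + 1) + 1 + 4)) + 1) (query_post d ds l c)"
      proof (rule ok_if)
        show "bsafe S \<sigma>2 (ILess (V ''fe'') (IConst 1))" using S_large by simp
        show "ok W S q_trace \<sigma>2 (n * (1 + 2) + 2 + (4 + (n * (10 + 1) + 1 + 4))) (query_post d ds l c)"
          if "bval \<sigma>2 (ILess (V ''fe'') (IConst 1))"
          using ok_q_trace[of d ds l c "FT \<sigma>1" "PT \<sigma>1" \<sigma>2] 2 that by auto
        show "ok W S Skip \<sigma>2 (n * (1 + 2) + 2 + (4 + (n * (10 + 1) + 1 + 4))) (query_post d ds l c)"
          if "\<not> bval \<sigma>2 (ILess (V ''fe'') (IConst 1))"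
        proof -
          have "feas d ds l c (FT \<sigma>1 n)" by (rule bf_feas[of d ds l c _ "PT \<sigma>1"]) (use 1 2 that in auto)
          moreover have "FT \<sigma>1 n = (\<lambda>v. rats \<sigma>2 ''F'' (n * n + v))" using 2 by (auto simp: tabled_def FT_def fun_eq_iff)
          ultimately have "wp W S Skip (query_post d ds l c) \<sigma>2" using 2 that by (auto simp: query_post_def)
          from ok_wp[OF this] show ?thesis by (rule ok_mono) auto
        qed
      qed
    qed
  qed
  then show ?thesis
  proof (rule ok_mono)
    show "n * (1 + 2) + 2 + (n * (n * (1 + 2) + 2 + (m * (4 + 2) + 2) + 2) + 2) +
     ((1 + (n * (3 + 2) + 2)) + (n * (1 + 2) + 2 + (4 + (n * (10 + 1) + 1 + 4)) + 1)) \<le> query_time n"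
      unfolding query_time_def m_eq by (simp add: algebra_simps)
  qed
qed

end

section \<open>Two nested bisections\<close>

definition copy4 :: "name \<Rightarrow> name \<Rightarrow> com" where
  "copy4 x y = Seq (RStore x (IConst 0) (RLoad y (IConst 0))) (Seq (RStore x (IConst 1) (RLoad y (IConst 1)))
     (Seq (RStore x (IConst 2) (RLoad y (IConst 2))) (RStore x (IConst 3) (RLoad y (IConst 3)))))"

definition const4 :: "name \<Rightarrow> rat \<Rightarrow> rat \<Rightarrow> rat \<Rightarrow> rat \<Rightarrow> com" where
  "const4 x k l a b = Seq (RStore x (IConst 0) (RConst k)) (Seq (RStore x (IConst 1) (RConst l))
     (Seq (RStore x (IConst 2) (RConst a)) (RStore x (IConst 3) (RConst b))))"

text \<open>A violated constraint with \<open>0 < k\<close> says that \<open>cq\<close> is too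
  small. Every other outcome moves \<open>hi\<close>: feasibility, recorded in \<open>hf\<close>, or
  a violated constraint with \<open>k \<le> 0\<close>.\<close>

definition inner_update :: com where
  "inner_update = Seq query
     (If (And (ILess (V ''fe'') (IConst 1)) (RLess (RConst 0) (RLoad ''Q'' (IConst 0))))
       (Seq (rset ''lo'' (R ''cq'')) (copy4 ''C1'' ''Q''))
       (Seq (rset ''hi'' (R ''cq'')) (Seq (iset ''hf'' (V ''fe'')) (copy4 ''C2'' ''Q''))))"

text \<open>The tuple \<open>(1, 0, 1, 0)\<close> is the constraint \<open>d \<le> c\<close>,
  violated at \<open>c = 0\<close>.\<close>

definition inner_init :: com where
  "inner_init = Seq (rset ''lo'' (RConst 0)) (Seq (const4 ''C1'' 1 0 1 0) (rset ''cq'' (R ''cm'')))"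

definition halve :: "name \<Rightarrow> name \<Rightarrow> name \<Rightarrow> com" where
  "halve z x y = rset z (RDiv (RAdd (R x) (R y)) (RConst 2))"

definition inner :: com where
  "inner = Seq inner_init (Seq inner_update (FOR ''j1'' (V ''J'') (Seq (halve ''cq'' ''lo'' ''hi'') inner_update)))"

text \<open>The flag \<open>hf = 0\<close> means that feasible values of \<open>c\<close>, if there
  are any, lie strictly inside the final bracket. From a successful length the constraint bounding
  \<open>c\<close> below is kept, from a failed one the constraint with \<open>k \<le> 0\<close>;
  the candidate is the crossing of these two, taken from different lengths.\<close>

definition outer_update :: com where
  "outer_update = Seq inner
     (If (ILess (IConst 0) (V ''hf''))
       (Seq (rset ''lb'' (R ''lq'')) (copy4 ''B1'' ''C1''))
       (Seq (rset ''la'' (R ''lq'')) (copy4 ''A2'' ''C2'')))"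

text \<open>The tuple \<open>(0, -1, 1, 0)\<close> is the constraint \<open>d \<le> l\<close>,
  violated at \<open>l = 0\<close>.\<close>

definition outer_init :: com where
  "outer_init = Seq (rset ''la'' (RConst 0)) (Seq (const4 ''A2'' 0 (-1) 1 0) (rset ''lq'' (R ''lx'')))"

definition search :: com where
  "search = Seq outer_init (Seq outer_update (FOR ''j2'' (V ''J'') (Seq (halve ''lq'' ''la'' ''lb'') outer_update)))"

lemma mods_inner: "imods inner = {''i'', ''r'', ''e'', ''P'', ''fe'', ''v'', ''sr'', ''hf'', ''j1''}"
  "rmods inner = {''F'', ''cd'', ''tk'', ''tl'', ''tb'', ''sk'', ''sl'', ''sb'', ''Q'', ''lo'', ''hi'', ''C1'', ''C2'', ''cq''}"
  unfolding inner_def inner_init_def inner_update_def halve_def copy4_def const4_def by (auto simp: mods_query)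

lemma mods_search: "imods search = {''i'', ''r'', ''e'', ''P'', ''fe'', ''v'', ''sr'', ''hf'', ''j1'', ''j2''}"
  "rmods search = {''F'', ''cd'', ''tk'', ''tl'', ''tb'', ''sk'', ''sl'', ''sb'', ''Q'', ''lo'', ''hi'', ''C1'', ''C2'', ''cq'',
     ''la'', ''lb'', ''A2'', ''B1'', ''lq''}"
  unfolding search_def outer_update_def outer_init_def halve_def copy4_def const4_def by (auto simp: mods_inner)

definition inner_time :: "nat \<Rightarrow> nat \<Rightarrow> nat" where "inner_time n J = (J + 1) * (query_time n + 12) + 10"
definition search_time :: "nat \<Rightarrow> nat \<Rightarrow> nat" where "search_time n J = (J + 1) * (inner_time n J + 12) + 10"

section \<open>Inner bisection over the circumference\<close>

context qgraph
begin

definition tup :: "name \<Rightarrow> state \<Rightarrow> int \<Rightarrow> int \<Rightarrow> int \<Rightarrow> int \<Rightarrow> bool" where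
  "tup X \<sigma> k l a b \<longleftrightarrow> rats \<sigma> X 0 = of_int k \<and> rats \<sigma> X 1 = of_int l \<and> rats \<sigma> X 2 = of_int a \<and> rats \<sigma> X 3 = of_int b"

text \<open>The flag \<open>p\<close> sorts violated constraints by the direction in which
  \<open>c\<close> would have to move.\<close>

definition viol :: "bool \<Rightarrow> name \<Rightarrow> state \<Rightarrow> rat \<Rightarrow> rat \<Rightarrow> rat \<Rightarrow> rat \<Rightarrow> bool" where
  "viol p X \<sigma> d ds L c \<longleftrightarrow> (\<exists>k l a b. valid k l a b \<and> tup X \<sigma> k l a b \<and> 0 < cval k l a b d ds L c \<and> (0 < k \<longleftrightarrow> p))"

lemma viol_cong: "rats \<sigma>' X = rats \<sigma> X \<Longrightarrow> viol p X \<sigma>' d ds L c \<longleftrightarrow> viol p X \<sigma> d ds L c"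
  by (simp add: viol_def tup_def)

lemma tup_copy: "rats \<sigma>' X 0 = rats \<sigma> Y 0 \<Longrightarrow> rats \<sigma>' X 1 = rats \<sigma> Y 1 \<Longrightarrow> rats \<sigma>' X 2 = rats \<sigma> Y 2 \<Longrightarrow> rats \<sigma>' X 3 = rats \<sigma> Y 3 \<Longrightarrow>
   viol p Y \<sigma> d ds L c \<Longrightarrow> viol p X \<sigma>' d ds L c"
  by (simp add: viol_def tup_def)

definition side :: "bool \<Rightarrow> state \<Rightarrow> rat \<Rightarrow> rat \<Rightarrow> rat \<Rightarrow> rat \<Rightarrow> bool" where
  "side f \<sigma> d ds L c \<longleftrightarrow> (if f then (\<exists>x :: nat \<Rightarrow> rat. feas d ds L c x) else viol False ''C2'' \<sigma> d ds L c)"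

definition fixed :: "rat \<Rightarrow> rat \<Rightarrow> rat \<Rightarrow> nat \<Rightarrow> state \<Rightarrow> bool" where
  "fixed d ds cm J \<sigma> \<longleftrightarrow> env \<sigma> \<and> rats \<sigma> ''dd'' 0 = d \<and> rats \<sigma> ''dq'' 0 = ds \<and> rats \<sigma> ''cm'' 0 = cm \<and> idx \<sigma> ''J'' 0 = J"

lemma fixed_cong:
  assumes "fixed d ds cm J \<sigma>" "idx \<sigma>' ''n'' = idx \<sigma> ''n''" "idx \<sigma>' ''eu'' = idx \<sigma> ''eu''" "idx \<sigma>' ''ev'' = idx \<sigma> ''ev''"
    "rats \<sigma>' ''ek'' = rats \<sigma> ''ek''" "rats \<sigma>' ''el'' = rats \<sigma> ''el''" "rats \<sigma>' ''eb'' = rats \<sigma> ''eb''"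
    "rats \<sigma>' ''dd'' = rats \<sigma> ''dd''" "rats \<sigma>' ''dq'' = rats \<sigma> ''dq''" "rats \<sigma>' ''cm'' = rats \<sigma> ''cm''" "idx \<sigma>' ''J'' = idx \<sigma> ''J''"
  shows "fixed d ds cm J \<sigma>'"
  using assms env_cong[of \<sigma> \<sigma>'] by (auto simp: fixed_def)

text \<open>Every feasible \<open>c\<close> lies above \<open>lo\<close>, and also below
  \<open>hi\<close> if \<open>hf = 0\<close>. The width is known exactly because each query halves
  the bracket.\<close>

definition bracket :: "rat \<Rightarrow> rat \<Rightarrow> rat \<Rightarrow> rat \<Rightarrow> nat \<Rightarrow> rat \<Rightarrow> state \<Rightarrow> bool" where
  "bracket d ds L cm J w \<sigma> \<longleftrightarrow> fixed d ds cm J \<sigma> \<and> rats \<sigma> ''lq'' 0 = L \<and>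
     rats \<sigma> ''hi'' 0 - rats \<sigma> ''lo'' 0 = w \<and> viol True ''C1'' \<sigma> d ds L (rats \<sigma> ''lo'' 0) \<and>
     (idx \<sigma> ''hf'' 0 = 0 \<or> idx \<sigma> ''hf'' 0 = 1) \<and> side (idx \<sigma> ''hf'' 0 = 1) \<sigma> d ds L (rats \<sigma> ''hi'' 0)"

lemma bracket_cong:
  assumes b: "bracket d ds L cm J w \<sigma>" and f: "fixed d ds cm J \<sigma>'" and e: "rats \<sigma>' ''lq'' = rats \<sigma> ''lq''" "rats \<sigma>' ''hi'' = rats \<sigma> ''hi''"
    "rats \<sigma>' ''lo'' = rats \<sigma> ''lo''" "rats \<sigma>' ''C1'' = rats \<sigma> ''C1''" "rats \<sigma>' ''C2'' = rats \<sigma> ''C2''" "idx \<sigma>' ''hf'' = idx \<sigma> ''hf''"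
  shows "bracket d ds L cm J w \<sigma>'"
  using b f unfolding bracket_def side_def e viol_cong[OF e(4)] viol_cong[OF e(5)] by blast

lemma S_small [simp]: "0 < S" "Suc 0 < S" "1 < S" "2 < S" "3 < S" using S_large by auto
lemma W_small [simp]: "0 < W" "Suc 0 < W" "1 < W" using W_large by auto

lemma ok_inner_update:
  assumes f: "fixed d ds cm J \<sigma>" and lq: "rats \<sigma> ''lq'' 0 = L" and cq: "rats \<sigma> ''cq'' 0 = c"
  shows "ok W S inner_update \<sigma> (query_time n + 7) (\<lambda>\<sigma>'. fixed d ds cm J \<sigma>' \<and> rats \<sigma>' ''lq'' 0 = L \<and>
     (rats \<sigma>' ''lo'' 0 = c \<and> viol True ''C1'' \<sigma>' d ds L c \<and>
        rats \<sigma>' ''hi'' = rats \<sigma> ''hi'' \<and> idx \<sigma>' ''hf'' = idx \<sigma> ''hf'' \<and> rats \<sigma>' ''C2'' = rats \<sigma> ''C2'' \<or>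
      rats \<sigma>' ''hi'' 0 = c \<and> (idx \<sigma>' ''hf'' 0 = 0 \<or> idx \<sigma>' ''hf'' 0 = 1) \<and> side (idx \<sigma>' ''hf'' 0 = 1) \<sigma>' d ds L c \<and>
        rats \<sigma>' ''lo'' = rats \<sigma> ''lo'' \<and> rats \<sigma>' ''C1'' = rats \<sigma> ''C1''))"
    (is "ok W S _ _ _ ?Q")
proof -
  have env: "env \<sigma>" and par: "par d ds L c \<sigma>" using f lq cq by (auto simp: fixed_def par_def)
  have "ok W S inner_update \<sigma> (query_time n + (6 + 1)) ?Q"
    unfolding inner_update_def
  proof (rule ok_seq[OF ok_frame[OF ok_query[OF env par]]])
    fix \<tau> assume "query_post d ds L c \<tau> \<and> (\<forall>x. x \<notin> imods query \<longrightarrow> idx \<tau> x = idx \<sigma> x) \<and> (\<forall>x. x \<notin> rmods query \<longrightarrow> rats \<tau> x = rats \<sigma> x)"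
    then have q: "query_post d ds L c \<tau>" and fr: "\<And>x. x \<notin> imods query \<Longrightarrow> idx \<tau> x = idx \<sigma> x" "\<And>x. x \<notin> rmods query \<Longrightarrow> rats \<tau> x = rats \<sigma> x"
      by blast+
    have fr': "rats \<tau> ''lq'' 0 = L" "rats \<tau> ''cq'' 0 = c" "rats \<tau> ''hi'' = rats \<sigma> ''hi''" "idx \<tau> ''hf'' = idx \<sigma> ''hf''"
      "rats \<tau> ''lo'' = rats \<sigma> ''lo''" "rats \<tau> ''C1'' = rats \<sigma> ''C1''" "rats \<tau> ''C2'' = rats \<sigma> ''C2''"
      using lq cq by (simp_all add: fr mods_query)
    have ft: "fixed d ds cm J \<tau>" by (rule fixed_cong[OF f]) (simp_all add: fr mods_query)
    show "ok W S (If (And (ILess (V ''fe'') (IConst 1)) (RLess (RConst 0) (RLoad ''Q'' (IConst 0))))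
       (Seq (rset ''lo'' (R ''cq'')) (copy4 ''C1'' ''Q''))
       (Seq (rset ''hi'' (R ''cq'')) (Seq (iset ''hf'' (V ''fe'')) (copy4 ''C2'' ''Q'')))) \<tau> (6 + 1) ?Q"
    proof (rule ok_if)
      assume b: "bval \<tau> (And (ILess (V ''fe'') (IConst 1)) (RLess (RConst 0) (RLoad ''Q'' (IConst 0))))"
      then have v: "viol True ''Q'' \<tau> d ds L c" using q unfolding query_post_def viol_def tup_def by fastforce
      define \<tau>' where "\<tau>' = \<tau>\<lparr>rats := (rats \<tau>)(''lo'' := (rats \<tau> ''lo'')(0 := c),
        ''C1'' := (rats \<tau> ''C1'')(0 := rats \<tau> ''Q'' 0, 1 := rats \<tau> ''Q'' 1, 2 := rats \<tau> ''Q'' 2, 3 := rats \<tau> ''Q'' 3))\<rparr>"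
      have "fixed d ds cm J \<tau>'" by (rule fixed_cong[OF ft]) (simp_all add: \<tau>'_def)
      moreover have "viol True ''C1'' \<tau>' d ds L c" by (rule tup_copy[OF _ _ _ _ v]) (simp_all add: \<tau>'_def)
      ultimately have "?Q \<tau>'" using fr' by (simp add: \<tau>'_def)
      then have "wp W S (Seq (rset ''lo'' (R ''cq'')) (copy4 ''C1'' ''Q'')) ?Q \<tau>"
        by (simp add: copy4_def \<tau>'_def fr')
      from ok_wp[OF this] show "ok W S (Seq (rset ''lo'' (R ''cq'')) (copy4 ''C1'' ''Q'')) \<tau> 6 ?Q"
        by (rule ok_mono) (auto simp: copy4_def)
    next
      assume b: "\<not> bval \<tau> (And (ILess (V ''fe'') (IConst 1)) (RLess (RConst 0) (RLoad ''Q'' (IConst 0))))"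
      have fe: "idx \<tau> ''fe'' 0 = 0 \<and> viol False ''Q'' \<tau> d ds L c \<or> idx \<tau> ''fe'' 0 = 1 \<and> (\<exists>x :: nat \<Rightarrow> rat. feas d ds L c x)"
        using q b unfolding query_post_def viol_def tup_def by fastforce
      define \<tau>' where "\<tau>' = \<tau>\<lparr>idx := (idx \<tau>)(''hf'' := (idx \<tau> ''hf'')(0 := idx \<tau> ''fe'' 0)),
        rats := (rats \<tau>)(''hi'' := (rats \<tau> ''hi'')(0 := c),
        ''C2'' := (rats \<tau> ''C2'')(0 := rats \<tau> ''Q'' 0, 1 := rats \<tau> ''Q'' 1, 2 := rats \<tau> ''Q'' 2, 3 := rats \<tau> ''Q'' 3))\<rparr>"
      have ft': "fixed d ds cm J \<tau>'" by (rule fixed_cong[OF ft]) (simp_all add: \<tau>'_def)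
      have "viol False ''C2'' \<tau>' d ds L c" if "viol False ''Q'' \<tau> d ds L c"
        by (rule tup_copy[OF _ _ _ _ that]) (simp_all add: \<tau>'_def)
      then have "side (idx \<tau>' ''hf'' 0 = 1) \<tau>' d ds L c" "idx \<tau>' ''hf'' 0 = 0 \<or> idx \<tau>' ''hf'' 0 = 1"
        using fe by (auto simp: side_def \<tau>'_def)
      then have "?Q \<tau>'" using ft' fr' by (simp add: \<tau>'_def)
      moreover have "idx \<tau> ''fe'' 0 < W" using fe by auto
      ultimately have "wp W S (Seq (rset ''hi'' (R ''cq'')) (Seq (iset ''hf'' (V ''fe'')) (copy4 ''C2'' ''Q''))) ?Q \<tau>"
        by (simp add: copy4_def \<tau>'_def fr')
      from ok_wp[OF this] show "ok W S (Seq (rset ''hi'' (R ''cq'')) (Seq (iset ''hf'' (V ''fe'')) (copy4 ''C2'' ''Q''))) \<tau> 6 ?Q"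
        by (rule ok_mono) (auto simp: copy4_def)
    qed simp
  qed
  then show ?thesis by simp
qed

lemma ok_inner:
  assumes f: "fixed d ds cm J \<sigma>" and lq: "rats \<sigma> ''lq'' 0 = L" and d: "0 < d"
    and C1: "valid 1 0 1 0" and J: "J < W"
    and top: "\<And>k l a b. valid k l a b \<Longrightarrow> 0 < k \<Longrightarrow> cval k l a b d ds L cm \<le> 0"
  shows "ok W S inner \<sigma> (inner_time n J) (bracket d ds L cm J (cm / 2 ^ J))"
proof -
  let ?U = "query_time n + 7"
  have "ok W S inner \<sigma> (6 + (?U + (J * (1 + ?U + 2) + 2))) (bracket d ds L cm J (cm / 2 ^ J))"
    unfolding inner_def
  proof (rule ok_seq)
    let ?Q = "\<lambda>\<sigma>. fixed d ds cm J \<sigma> \<and> rats \<sigma> ''lq'' 0 = L \<and> rats \<sigma> ''cq'' 0 = cm \<and> rats \<sigma> ''lo'' 0 = 0 \<and> viol True ''C1'' \<sigma> d ds L 0"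
    define \<tau> where "\<tau> = \<sigma>\<lparr>rats := (rats \<sigma>)(''lo'' := (rats \<sigma> ''lo'')(0 := 0), ''C1'' := (rats \<sigma> ''C1'')(0 := 1, 1 := 0, 2 := 1, 3 := 0),
      ''cq'' := (rats \<sigma> ''cq'')(0 := cm))\<rparr>"
    have "fixed d ds cm J \<tau>" by (rule fixed_cong[OF f]) (simp_all add: \<tau>_def)
    moreover have "viol True ''C1'' \<tau> d ds L 0"
      unfolding viol_def using C1 d by (intro exI[of _ 1] exI[of _ 0]) (simp add: tup_def \<tau>_def cval_def)
    ultimately have "wp W S inner_init ?Q \<sigma>"
      using f lq by (simp add: inner_init_def const4_def \<tau>_def fixed_def)
    from ok_wp[OF this] show "ok W S inner_init \<sigma> 6 ?Q" by (simp add: inner_init_def const4_def numeral_eq_Suc)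
    fix \<sigma>1 assume 1: "?Q \<sigma>1"
    show "ok W S (Seq inner_update (FOR ''j1'' (V ''J'') (Seq (halve ''cq'' ''lo'' ''hi'') inner_update))) \<sigma>1
       (?U + (J * (1 + ?U + 2) + 2)) (bracket d ds L cm J (cm / 2 ^ J))"
    proof (rule ok_seq)
      show "ok W S inner_update \<sigma>1 ?U (bracket d ds L cm J (cm / 2 ^ 0))"
      proof (rule ok_mono[OF ok_inner_update[of d ds cm J \<sigma>1 L cm]])
        fix \<sigma>' assume *: "fixed d ds cm J \<sigma>' \<and> rats \<sigma>' ''lq'' 0 = L \<and>
     (rats \<sigma>' ''lo'' 0 = cm \<and> viol True ''C1'' \<sigma>' d ds L cm \<and>
        rats \<sigma>' ''hi'' = rats \<sigma>1 ''hi'' \<and> idx \<sigma>' ''hf'' = idx \<sigma>1 ''hf'' \<and> rats \<sigma>' ''C2'' = rats \<sigma>1 ''C2'' \<or>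
      rats \<sigma>' ''hi'' 0 = cm \<and> (idx \<sigma>' ''hf'' 0 = 0 \<or> idx \<sigma>' ''hf'' 0 = 1) \<and> side (idx \<sigma>' ''hf'' 0 = 1) \<sigma>' d ds L cm \<and>
        rats \<sigma>' ''lo'' = rats \<sigma>1 ''lo'' \<and> rats \<sigma>' ''C1'' = rats \<sigma>1 ''C1'')"
        \<comment> \<open>By the choice of \<open>cm\<close> no lower bound on \<open>c\<close> is
          violated there, so the first update can only have set \<open>hi\<close>.\<close>
        moreover have "\<not> viol True ''C1'' \<sigma>' d ds L cm" using top unfolding viol_def by (meson not_le)
        ultimately show "bracket d ds L cm J (cm / 2 ^ 0) \<sigma>'"
          using 1 viol_cong[of \<sigma>' "''C1''" \<sigma>1 True d ds L 0] unfolding bracket_def by auto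
      qed (use 1 in auto)
      fix \<sigma>2 assume 2: "bracket d ds L cm J (cm / 2 ^ 0) \<sigma>2"
      show "ok W S (FOR ''j1'' (V ''J'') (Seq (halve ''cq'' ''lo'' ''hi'') inner_update)) \<sigma>2
         (J * (1 + ?U + 2) + 2) (bracket d ds L cm J (cm / 2 ^ J))"
      proof (rule ok_FOR[where I = "\<lambda>i. bracket d ds L cm J (cm / 2 ^ i)"])
        show "bracket d ds L cm J (cm / 2 ^ 0) \<sigma>2" by (rule 2)
        show "J < W" by (rule J)
        show "bracket d ds L cm J (cm / 2 ^ i) (\<sigma>\<lparr>idx := (idx \<sigma>)(''j1'' := g)\<rparr>)" if "bracket d ds L cm J (cm / 2 ^ i) \<sigma>" for i \<sigma> g
        proof -
          have "fixed d ds cm J (\<sigma>\<lparr>idx := (idx \<sigma>)(''j1'' := g)\<rparr>)"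
            by (rule fixed_cong[of d ds cm J \<sigma>]) (use that in \<open>simp_all add: bracket_def\<close>)
          then show ?thesis by (rule bracket_cong[OF that]) simp_all
        qed
        show "isafe S \<sigma> (V ''J'') \<and> ival \<sigma> (V ''J'') = J" if "bracket d ds L cm J (cm / 2 ^ i) \<sigma>" for i \<sigma>
          using that by (simp add: bracket_def fixed_def)
        show "ok W S (Seq (halve ''cq'' ''lo'' ''hi'') inner_update) \<sigma> (1 + ?U)
           (\<lambda>\<sigma>'. idx \<sigma>' ''j1'' 0 = i \<and> bracket d ds L cm J (cm / 2 ^ Suc i) \<sigma>')"
          if b: "bracket d ds L cm J (cm / 2 ^ i) \<sigma>" and i: "i < J" "idx \<sigma> ''j1'' 0 = i" for i \<sigma>
        proof (rule ok_seq)
          define c where "c = (rats \<sigma> ''lo'' 0 + rats \<sigma> ''hi'' 0) / 2"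
          let ?Q = "\<lambda>\<sigma>'. bracket d ds L cm J (cm / 2 ^ i) \<sigma>' \<and> idx \<sigma>' ''j1'' 0 = i \<and> rats \<sigma>' ''cq'' 0 = c \<and>
             rats \<sigma>' ''lo'' = rats \<sigma> ''lo'' \<and> rats \<sigma>' ''hi'' = rats \<sigma> ''hi''"
          define \<tau> where "\<tau> = \<sigma>\<lparr>rats := (rats \<sigma>)(''cq'' := (rats \<sigma> ''cq'')(0 := c))\<rparr>"
          have "fixed d ds cm J \<tau>" by (rule fixed_cong[of d ds cm J \<sigma>]) (use b in \<open>simp_all add: \<tau>_def bracket_def\<close>)
          then have "bracket d ds L cm J (cm / 2 ^ i) \<tau>"
            by (rule bracket_cong[OF b]) (simp_all add: \<tau>_def)
          then have "wp W S (halve ''cq'' ''lo'' ''hi'') ?Q \<sigma>"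
            using i by (simp add: halve_def \<tau>_def c_def)
          from ok_wp[OF this] show "ok W S (halve ''cq'' ''lo'' ''hi'') \<sigma> 1 ?Q" by (simp add: halve_def)
          fix \<sigma>3 assume 3: "?Q \<sigma>3"
          then have f3: "fixed d ds cm J \<sigma>3" "rats \<sigma>3 ''lq'' 0 = L" by (auto simp: bracket_def)
          show "ok W S inner_update \<sigma>3 ?U (\<lambda>\<sigma>'. idx \<sigma>' ''j1'' 0 = i \<and> bracket d ds L cm J (cm / 2 ^ Suc i) \<sigma>')"
          proof (rule ok_mono[OF ok_frame[OF ok_inner_update[of d ds cm J \<sigma>3 L c]]])
            have w: "rats \<sigma>3 ''hi'' 0 - rats \<sigma>3 ''lo'' 0 = cm / 2 ^ i" using 3 unfolding bracket_def by blast
            have c: "c = (rats \<sigma>3 ''lo'' 0 + rats \<sigma>3 ''hi'' 0) / 2" using 3 by (simp add: c_def)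
            have w': "rats \<sigma>3 ''hi'' 0 - c = cm / 2 ^ Suc i" "c - rats \<sigma>3 ''lo'' 0 = cm / 2 ^ Suc i"
              using w unfolding c by (simp_all add: field_simps)
            fix \<sigma>' assume *: "(fixed d ds cm J \<sigma>' \<and> rats \<sigma>' ''lq'' 0 = L \<and>
               (rats \<sigma>' ''lo'' 0 = c \<and> viol True ''C1'' \<sigma>' d ds L c \<and>
                  rats \<sigma>' ''hi'' = rats \<sigma>3 ''hi'' \<and> idx \<sigma>' ''hf'' = idx \<sigma>3 ''hf'' \<and> rats \<sigma>' ''C2'' = rats \<sigma>3 ''C2'' \<or>
                rats \<sigma>' ''hi'' 0 = c \<and> (idx \<sigma>' ''hf'' 0 = 0 \<or> idx \<sigma>' ''hf'' 0 = 1) \<and> side (idx \<sigma>' ''hf'' 0 = 1) \<sigma>' d ds L c \<and>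
                  rats \<sigma>' ''lo'' = rats \<sigma>3 ''lo'' \<and> rats \<sigma>' ''C1'' = rats \<sigma>3 ''C1'')) \<and>
               (\<forall>x. x \<notin> imods inner_update \<longrightarrow> idx \<sigma>' x = idx \<sigma>3 x) \<and> (\<forall>x. x \<notin> rmods inner_update \<longrightarrow> rats \<sigma>' x = rats \<sigma>3 x)"
            have j: "idx \<sigma>' ''j1'' 0 = i" using * 3 by (auto simp: inner_update_def copy4_def mods_query)
            have s: "side (idx \<sigma>' ''hf'' 0 = 1) \<sigma>' d ds L z = side (idx \<sigma>3 ''hf'' 0 = 1) \<sigma>3 d ds L z"
              if "rats \<sigma>' ''C2'' = rats \<sigma>3 ''C2''" "idx \<sigma>' ''hf'' = idx \<sigma>3 ''hf''" for z
              using that viol_cong[of \<sigma>' "''C2''" \<sigma>3] by (simp add: side_def)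
            have v: "viol True ''C1'' \<sigma>' d ds L z = viol True ''C1'' \<sigma>3 d ds L z" if "rats \<sigma>' ''C1'' = rats \<sigma>3 ''C1''" for z
              using that viol_cong[of \<sigma>' "''C1''" \<sigma>3] by simp
            have "bracket d ds L cm J (cm / 2 ^ i) \<sigma>3" using 3 by blast
            then show "idx \<sigma>' ''j1'' 0 = i \<and> bracket d ds L cm J (cm / 2 ^ Suc i) \<sigma>'"
              using * j w' s v unfolding bracket_def by (elim conjE disjE) simp_all
          qed (use f3 3 in auto)
        qed
      qed auto
    qed
  qed
  then show ?thesis by (rule ok_mono) (auto simp: inner_time_def algebra_simps)
qed

end

section \<open>Outer bisection over the arc length\<close>

locale search_graph = qgraph +
  fixes d0 l0 c0 :: real and xr :: "nat \<Rightarrow> real" and dN dsN J :: nat and d ds lx cm eta :: rat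
  assumes ref: "feas d0 0 l0 c0 xr" "0 < d0" "0 < l0" "0 \<le> c0"
    and valid_c: "valid 1 0 1 0" and valid_l: "valid 0 (-1) 1 0"
    and dN: "0 < dN" and d_eq: "d = of_nat dN" and ds_eq: "ds = of_nat dsN"
    and lx_eq: "lx = 4 * of_nat (n\<^sup>2 * (dN + dsN)) + 1"
    and cm_eq: "cm = of_nat n * of_nat (dN + dsN) + of_nat n * lx"
    and eta_eq: "eta = cm / 2 ^ J" and J: "J < W"
    and eta_small: "64 * of_nat n ^ 3 * eta \<le> 1" and eps_small: "64 * of_nat n ^ 4 * (lx / 2 ^ J) \<le> 1"
begin

lemma d_pos: "0 < d" "0 \<le> ds" and lx_pos: "0 < lx" and cm_pos: "0 \<le> cm" and eta_pos: "0 \<le> eta"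
proof -
  show "0 < d" "0 \<le> ds" using dN by (simp_all add: d_eq ds_eq)
  have "0 \<le> (of_nat (n\<^sup>2 * (dN + dsN)) :: rat)" by (rule of_nat_0_le_iff)
  then show "0 < lx" unfolding lx_eq by linarith
  then show "0 \<le> cm" by (simp add: cm_eq)
  then show "0 \<le> eta" by (simp add: eta_eq)
qed

definition gap :: "int \<Rightarrow> int \<Rightarrow> int" where "gap a b = a * int dN + b * int dsN"

lemma cval_gap: "cval k l a b d ds L c = of_int (gap a b) + of_int l * L - of_int k * c"
  by (simp add: cval_def gap_def d_eq ds_eq)

lemma gap_bounds:
  assumes "valid k l a b" shows "0 \<le> gap a b" "gap a b \<le> int n * int (dN + dsN)"
proof -
  have "a * int dN \<le> int n * int dN" "b * int dsN \<le> int n * int dsN" "0 \<le> a * int dN" "0 \<le> b * int dsN"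
    using validD(3-6)[OF assms] by (auto intro: mult_right_mono)
  then show "0 \<le> gap a b" "gap a b \<le> int n * int (dN + dsN)" by (simp_all add: gap_def distrib_left)
qed

text \<open>The value of \<open>cm\<close> is made for this: the gap total of a constraint is at
  most \<open>n * (dN + dsN)\<close> and its length term at most \<open>n * lx\<close>, while
  \<open>0 < k\<close> provides at least one full \<open>cm\<close>.\<close>

lemma top_holds:
  assumes "0 \<le> L" "L \<le> lx" "valid k l a b" "0 < k"
  shows "cval k l a b d ds L cm \<le> 0"
proof -
  have "of_int (gap a b) \<le> (of_int (int n * int (dN + dsN)) :: rat)" using gap_bounds[OF assms(3)] unfolding of_int_le_iff by simp
  then have g: "of_int (gap a b) \<le> of_nat n * (of_nat (dN + dsN) :: rat)" by simp
  have "\<bar>of_int l\<bar> \<le> (of_int (int n) :: rat)" using validD(2)[OF assms(3)] by (rule abs_of_int_le)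
  then have "\<bar>of_int l * L\<bar> \<le> of_nat n * lx" using assms(1,2) by (intro abs_mult_le) auto
  then have "of_int l * L \<le> of_nat n * lx" by linarith
  moreover have "cm \<le> of_int k * cm" using assms(4) cm_pos by (intro le_mult_of_one_le) auto
  ultimately show ?thesis using g unfolding cval_gap cm_eq by linarith
qed

text \<open>The lower bound on \<open>c\<close> is only asserted to exist. The machine forgets it,
  but it plays constraint 0 in \<open>crossing_satisfies\<close>, bounding the slack of
  \<open>A2\<close> at the neighbouring successful length.\<close>

definition sideA :: "state \<Rightarrow> rat \<Rightarrow> bool" where
  "sideA \<sigma> L \<longleftrightarrow> (\<exists>lo hi k l a b. hi - lo \<le> eta \<and> valid k l a b \<and> 0 < k \<and> 0 < cval k l a b d ds L lo \<and> viol False ''A2'' \<sigma> d ds L hi)"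

definition sideB :: "state \<Rightarrow> rat \<Rightarrow> bool" where
  "sideB \<sigma> L \<longleftrightarrow> (\<exists>cb cl (x :: nat \<Rightarrow> rat). cb - cl \<le> eta \<and> feas d ds L cb x \<and> viol True ''B1'' \<sigma> d ds L cl)"

lemma sideA_cong: "sideA \<sigma> L \<Longrightarrow> rats \<sigma>' ''A2'' = rats \<sigma> ''A2'' \<Longrightarrow> sideA \<sigma>' L"
  using viol_cong[of \<sigma>' "''A2''" \<sigma>] by (simp add: sideA_def)

lemma sideB_cong: "sideB \<sigma> L \<Longrightarrow> rats \<sigma>' ''B1'' = rats \<sigma> ''B1'' \<Longrightarrow> sideB \<sigma>' L"
  using viol_cong[of \<sigma>' "''B1''" \<sigma>] by (simp add: sideB_def)

lemma ok_outer_update: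
  assumes f: "fixed d ds cm J \<sigma>" and lq: "rats \<sigma> ''lq'' 0 = L" and L: "0 \<le> L" "L \<le> lx"
  shows "ok W S outer_update \<sigma> (inner_time n J + 6) (\<lambda>\<sigma>'. fixed d ds cm J \<sigma>' \<and>
     (rats \<sigma>' ''lb'' 0 = L \<and> sideB \<sigma>' L \<and> rats \<sigma>' ''la'' = rats \<sigma> ''la'' \<and> rats \<sigma>' ''A2'' = rats \<sigma> ''A2'' \<or>
      L \<noteq> lx \<and> rats \<sigma>' ''la'' 0 = L \<and> sideA \<sigma>' L \<and> rats \<sigma>' ''lb'' = rats \<sigma> ''lb'' \<and> rats \<sigma>' ''B1'' = rats \<sigma> ''B1''))"
    (is "ok W S _ _ _ ?Q")
proof -
  have "ok W S outer_update \<sigma> (inner_time n J + (5 + 1)) ?Q"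
    unfolding outer_update_def
  proof (rule ok_seq[OF ok_frame[OF ok_inner[OF f lq d_pos(1) valid_c J top_holds[OF L]]]])
    fix \<tau> assume "bracket d ds L cm J (cm / 2 ^ J) \<tau> \<and> (\<forall>x. x \<notin> imods inner \<longrightarrow> idx \<tau> x = idx \<sigma> x) \<and> (\<forall>x. x \<notin> rmods inner \<longrightarrow> rats \<tau> x = rats \<sigma> x)"
    then have b: "bracket d ds L cm J eta \<tau>" and fr: "\<And>x. x \<notin> imods inner \<Longrightarrow> idx \<tau> x = idx \<sigma> x" "\<And>x. x \<notin> rmods inner \<Longrightarrow> rats \<tau> x = rats \<sigma> x"
      unfolding eta_eq by blast+
    have fr': "rats \<tau> ''la'' = rats \<sigma> ''la''" "rats \<tau> ''lb'' = rats \<sigma> ''lb''" "rats \<tau> ''A2'' = rats \<sigma> ''A2''" "rats \<tau> ''B1'' = rats \<sigma> ''B1''"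
      by (simp_all add: fr mods_inner)
    have ft: "fixed d ds cm J \<tau>" and lq': "rats \<tau> ''lq'' 0 = L" using b by (auto simp: bracket_def)
    have w: "rats \<tau> ''hi'' 0 - rats \<tau> ''lo'' 0 \<le> eta" and v1: "viol True ''C1'' \<tau> d ds L (rats \<tau> ''lo'' 0)"
      and s: "side (idx \<tau> ''hf'' 0 = 1) \<tau> d ds L (rats \<tau> ''hi'' 0)" and hf: "idx \<tau> ''hf'' 0 = 0 \<or> idx \<tau> ''hf'' 0 = 1"
      using b by (auto simp: bracket_def)
    show "ok W S (If (ILess (IConst 0) (V ''hf''))
       (Seq (rset ''lb'' (R ''lq'')) (copy4 ''B1'' ''C1''))
       (Seq (rset ''la'' (R ''lq'')) (copy4 ''A2'' ''C2''))) \<tau> (5 + 1) ?Q"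
    proof (rule ok_if)
      assume "bval \<tau> (ILess (IConst 0) (V ''hf''))"
      then obtain x where x: "feas d ds L (rats \<tau> ''hi'' 0) (x :: nat \<Rightarrow> rat)" using s hf by (auto simp: side_def)
      define \<tau>' where "\<tau>' = \<tau>\<lparr>rats := (rats \<tau>)(''lb'' := (rats \<tau> ''lb'')(0 := L),
        ''B1'' := (rats \<tau> ''B1'')(0 := rats \<tau> ''C1'' 0, 1 := rats \<tau> ''C1'' 1, 2 := rats \<tau> ''C1'' 2, 3 := rats \<tau> ''C1'' 3))\<rparr>"
      have "fixed d ds cm J \<tau>'" by (rule fixed_cong[OF ft]) (simp_all add: \<tau>'_def)
      moreover have "viol True ''B1'' \<tau>' d ds L (rats \<tau> ''lo'' 0)" by (rule tup_copy[OF _ _ _ _ v1]) (simp_all add: \<tau>'_def)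
      then have "sideB \<tau>' L" using w x unfolding sideB_def by blast
      ultimately have "?Q \<tau>'" using fr' by (simp add: \<tau>'_def)
      then have "wp W S (Seq (rset ''lb'' (R ''lq'')) (copy4 ''B1'' ''C1'')) ?Q \<tau>"
        by (simp add: copy4_def \<tau>'_def lq')
      from ok_wp[OF this] show "ok W S (Seq (rset ''lb'' (R ''lq'')) (copy4 ''B1'' ''C1'')) \<tau> 5 ?Q"
        by (rule ok_mono) (auto simp: copy4_def)
    next
      assume "\<not> bval \<tau> (ILess (IConst 0) (V ''hf''))"
      then have v2: "viol False ''C2'' \<tau> d ds L (rats \<tau> ''hi'' 0)" using s hf by (auto simp: side_def)
      obtain k1 l1 a1 b1 where c1: "valid k1 l1 a1 b1" "0 < k1" "0 < cval k1 l1 a1 b1 d ds L (rats \<tau> ''lo'' 0)"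
        using v1 by (auto simp: viol_def)
      obtain k2 l2 a2 b2 where c2: "valid k2 l2 a2 b2" "k2 \<le> 0" "0 < cval k2 l2 a2 b2 d ds L (rats \<tau> ''hi'' 0)"
        using v2 by (auto simp: viol_def not_less)
      \<comment> \<open>\<open>lx\<close> is the threshold of
        \<open>wide_bracket_impossible\<close>, so the first length tried succeeds and becomes
        \<open>lb\<close>.\<close>
      have "L \<noteq> lx"
      proof
        assume Lx: "L = lx"
        show False
        proof (rule wide_bracket_impossible[of "int n" k1 k2 "gap a1 b1" "int (dN + dsN)" "gap a2 b2" eta l1 L "rats \<tau> ''lo'' 0" l2 "rats \<tau> ''hi'' 0"])
          show "0 < l1 * k2 - l2 * k1" by (rule valid_det_pos[OF ref c1(1) c2(1) c1(2) c2(2)])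
          show "4 * of_int ((int n)\<^sup>2 * int (dN + dsN)) + 1 \<le> L" unfolding Lx lx_eq by simp
          show "64 * of_int (int n) ^ 3 * eta \<le> 1" using eta_small by simp
        qed (use c1 c2 gap_bounds w eta_pos n_pos validD(1)[OF c1(1)] validD(1)[OF c2(1)] in \<open>auto simp: cval_gap\<close>)
      qed
      define \<tau>' where "\<tau>' = \<tau>\<lparr>rats := (rats \<tau>)(''la'' := (rats \<tau> ''la'')(0 := L),
        ''A2'' := (rats \<tau> ''A2'')(0 := rats \<tau> ''C2'' 0, 1 := rats \<tau> ''C2'' 1, 2 := rats \<tau> ''C2'' 2, 3 := rats \<tau> ''C2'' 3))\<rparr>"
      have "fixed d ds cm J \<tau>'" by (rule fixed_cong[OF ft]) (simp_all add: \<tau>'_def)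
      moreover have "viol False ''A2'' \<tau>' d ds L (rats \<tau> ''hi'' 0)" by (rule tup_copy[OF _ _ _ _ v2]) (simp_all add: \<tau>'_def)
      then have "sideA \<tau>' L" using w c1 unfolding sideA_def by blast
      ultimately have "?Q \<tau>'" using fr' \<open>L \<noteq> lx\<close> by (simp add: \<tau>'_def)
      then have "wp W S (Seq (rset ''la'' (R ''lq'')) (copy4 ''A2'' ''C2'')) ?Q \<tau>"
        by (simp add: copy4_def \<tau>'_def lq')
      from ok_wp[OF this] show "ok W S (Seq (rset ''la'' (R ''lq'')) (copy4 ''A2'' ''C2'')) \<tau> 5 ?Q"
        by (rule ok_mono) (auto simp: copy4_def)
    qed simp
  qed
  then show ?thesis by simp
qed

definition outer_inv :: "rat \<Rightarrow> state \<Rightarrow> bool" where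
  "outer_inv w \<sigma> \<longleftrightarrow> fixed d ds cm J \<sigma> \<and> rats \<sigma> ''lb'' 0 - rats \<sigma> ''la'' 0 = w \<and> 0 \<le> rats \<sigma> ''la'' 0 \<and> rats \<sigma> ''lb'' 0 \<le> lx \<and>
     sideA \<sigma> (rats \<sigma> ''la'' 0) \<and> sideB \<sigma> (rats \<sigma> ''lb'' 0)"

text \<open>The last condition is, multiplied by a positive determinant, that the crossing of
  \<open>B1\<close> and \<open>A2\<close> satisfies every valid constraint. The surrogates enter
  only through \<open>gap\<close>, so the signs can be transferred to the original
  parameters.\<close>

definition found :: "state \<Rightarrow> bool" where
  "found \<sigma> \<longleftrightarrow> (\<exists>k1 l1 a1 b1 k2 l2 a2 b2. valid k1 l1 a1 b1 \<and> valid k2 l2 a2 b2 \<and> tup ''B1'' \<sigma> k1 l1 a1 b1 \<and> tup ''A2'' \<sigma> k2 l2 a2 b2 \<and>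
     0 < k1 \<and> k2 \<le> 0 \<and> 0 < l1 * k2 - l2 * k1 \<and>
     (\<forall>k3 l3 a3 b3. valid k3 l3 a3 b3 \<longrightarrow> (l1 * k2 - l2 * k1) * gap a3 b3 + l3 * (k1 * gap a2 b2 - k2 * gap a1 b1)
        - k3 * (l1 * gap a2 b2 - l2 * gap a1 b1) \<le> 0))"

lemma outer_inv_found:
  assumes "outer_inv (lx / 2 ^ J) \<sigma>" shows "found \<sigma>"
proof -
  define la lb where "la = rats \<sigma> ''la'' 0" and "lb = rats \<sigma> ''lb'' 0"
  have ab: "lb - la = lx / 2 ^ J" and A: "sideA \<sigma> la" and B: "sideB \<sigma> lb" using assms by (auto simp: outer_inv_def la_def lb_def)
  obtain lo hi k0 l0' a0 b0 k2 l2 a2 b2 where a: "hi - lo \<le> eta" "valid k0 l0' a0 b0" "0 < k0" "0 < cval k0 l0' a0 b0 d ds la lo"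
     "valid k2 l2 a2 b2" "tup ''A2'' \<sigma> k2 l2 a2 b2" "0 < cval k2 l2 a2 b2 d ds la hi" "k2 \<le> 0"
    using A by (auto simp: sideA_def viol_def not_less)
  obtain cb cl x k1 l1 a1 b1 where b: "cb - cl \<le> eta" "feas d ds lb cb (x :: nat \<Rightarrow> rat)" "valid k1 l1 a1 b1" "tup ''B1'' \<sigma> k1 l1 a1 b1"
     "0 < cval k1 l1 a1 b1 d ds lb cl" "0 < k1"
    using B by (auto simp: sideB_def viol_def)
  have m: "0 < l1 * k2 - l2 * k1" by (rule valid_det_pos[OF ref b(3) a(5) b(6) a(8)])
  have fb: "of_int (gap a' b') + of_int l * lb - of_int k * cb \<le> 0" if "valid k l a' b'" for k l a' b'
    using valid_rat[OF that _ _ b(2)] d_pos by (simp add: cval_gap)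
  have "(l1 * k2 - l2 * k1) * gap a3 b3 + l3 * (k1 * gap a2 b2 - k2 * gap a1 b1) - k3 * (l1 * gap a2 b2 - l2 * gap a1 b1) \<le> 0"
    if v: "valid k3 l3 a3 b3" for k3 l3 a3 b3
  proof (rule crossing_satisfies[of "int n" k0 k1 k2 k3 l0' l1 l2 l3 eta "lx / 2 ^ J" "gap a0 b0" la lo "gap a2 b2" hi lb cb "gap a1 b1" "gap a3 b3" cl])
    show "64 * of_int (int n) ^ 3 * eta \<le> 1" "64 * of_int (int n) ^ 4 * (lx / 2 ^ J) \<le> 1" using eta_small eps_small by simp_all
    have "0 \<le> lx / 2 ^ J" using lx_pos by simp
    then show "0 \<le> lx / 2 ^ J" "la \<le> lb" "lb - la \<le> lx / 2 ^ J" using ab by linarith+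
  qed (use a b m v n_pos eta_pos fb validD(1,2)[OF a(2)] validD(1,2)[OF a(5)] validD(1,2)[OF b(3)] validD(1,2)[OF v]
      in \<open>auto simp: cval_gap\<close>)
  then show ?thesis unfolding found_def using a b m by blast
qed

lemma ok_search:
  assumes f: "fixed d ds cm J \<sigma>" and lx: "rats \<sigma> ''lx'' 0 = lx"
  shows "ok W S search \<sigma> (search_time n J) (\<lambda>\<sigma>'. found \<sigma>' \<and> fixed d ds cm J \<sigma>')"
proof -
  let ?U = "inner_time n J + 6"
  have inv_cong: "outer_inv w \<sigma>'" if "outer_inv w \<sigma>" "fixed d ds cm J \<sigma>'" "rats \<sigma>' ''la'' = rats \<sigma> ''la''" "rats \<sigma>' ''lb'' = rats \<sigma> ''lb''"
    "rats \<sigma>' ''A2'' = rats \<sigma> ''A2''" "rats \<sigma>' ''B1'' = rats \<sigma> ''B1''" for w \<sigma> \<sigma>'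
    using that sideA_cong[of \<sigma> _ \<sigma>'] sideB_cong[of \<sigma> _ \<sigma>'] by (simp add: outer_inv_def)
  have "ok W S search \<sigma> (6 + (?U + (J * (1 + ?U + 2) + 2))) (\<lambda>\<sigma>'. found \<sigma>' \<and> fixed d ds cm J \<sigma>')"
    unfolding search_def
  proof (rule ok_seq)
    let ?Q = "\<lambda>\<sigma>. fixed d ds cm J \<sigma> \<and> rats \<sigma> ''lq'' 0 = lx \<and> rats \<sigma> ''la'' 0 = 0 \<and> sideA \<sigma> 0"
    define \<tau> where "\<tau> = \<sigma>\<lparr>rats := (rats \<sigma>)(''la'' := (rats \<sigma> ''la'')(0 := 0), ''A2'' := (rats \<sigma> ''A2'')(0 := 0, 1 := -1, 2 := 1, 3 := 0),
      ''lq'' := (rats \<sigma> ''lq'')(0 := lx))\<rparr>"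
    have "fixed d ds cm J \<tau>" by (rule fixed_cong[OF f]) (simp_all add: \<tau>_def)
    moreover have "viol False ''A2'' \<tau> d ds 0 0"
      unfolding viol_def using valid_l d_pos by (intro exI[of _ 0] exI[of _ "-1"] exI[of _ 1]) (simp add: tup_def \<tau>_def cval_def)
    then have "sideA \<tau> 0" unfolding sideA_def
      using valid_c d_pos eta_pos by (intro exI[of _ 0] exI[of _ 1]) (auto simp: cval_def intro!: exI[of _ "1::int"] exI[of _ "0::int"])
    ultimately have "wp W S outer_init ?Q \<sigma>"
      by (simp add: outer_init_def const4_def \<tau>_def lx)
    from ok_wp[OF this] show "ok W S outer_init \<sigma> 6 ?Q" by (simp add: outer_init_def const4_def numeral_eq_Suc)
    fix \<sigma>1 assume 1: "?Q \<sigma>1"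
    show "ok W S (Seq outer_update (FOR ''j2'' (V ''J'') (Seq (halve ''lq'' ''la'' ''lb'') outer_update))) \<sigma>1
       (?U + (J * (1 + ?U + 2) + 2)) (\<lambda>\<sigma>'. found \<sigma>' \<and> fixed d ds cm J \<sigma>')"
    proof (rule ok_seq)
      show "ok W S outer_update \<sigma>1 ?U (outer_inv (lx / 2 ^ 0))"
      proof (rule ok_mono[OF ok_outer_update[of \<sigma>1 lx]])
        fix \<sigma>' assume "fixed d ds cm J \<sigma>' \<and>
           (rats \<sigma>' ''lb'' 0 = lx \<and> sideB \<sigma>' lx \<and> rats \<sigma>' ''la'' = rats \<sigma>1 ''la'' \<and> rats \<sigma>' ''A2'' = rats \<sigma>1 ''A2'' \<or>
            lx \<noteq> lx \<and> rats \<sigma>' ''la'' 0 = lx \<and> sideA \<sigma>' lx \<and> rats \<sigma>' ''lb'' = rats \<sigma>1 ''lb'' \<and> rats \<sigma>' ''B1'' = rats \<sigma>1 ''B1'')"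
        then show "outer_inv (lx / 2 ^ 0) \<sigma>'"
          using 1 sideA_cong[of \<sigma>1 0 \<sigma>'] by (auto simp: outer_inv_def)
      qed (use 1 lx_pos in auto)
      fix \<sigma>2 assume 2: "outer_inv (lx / 2 ^ 0) \<sigma>2"
      show "ok W S (FOR ''j2'' (V ''J'') (Seq (halve ''lq'' ''la'' ''lb'') outer_update)) \<sigma>2 (J * (1 + ?U + 2) + 2)
         (\<lambda>\<sigma>'. found \<sigma>' \<and> fixed d ds cm J \<sigma>')"
      proof (rule ok_FOR[where I = "\<lambda>i. outer_inv (lx / 2 ^ i)"])
        show "outer_inv (lx / 2 ^ 0) \<sigma>2" by (rule 2)
        show "J < W" by (rule J)
        show "outer_inv (lx / 2 ^ i) (\<sigma>\<lparr>idx := (idx \<sigma>)(''j2'' := g)\<rparr>)" if "outer_inv (lx / 2 ^ i) \<sigma>" for i \<sigma> g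
        proof -
          have "fixed d ds cm J (\<sigma>\<lparr>idx := (idx \<sigma>)(''j2'' := g)\<rparr>)"
            by (rule fixed_cong[of d ds cm J \<sigma>]) (use that in \<open>simp_all add: outer_inv_def\<close>)
          then show ?thesis by (rule inv_cong[OF that]) simp_all
        qed
        show "isafe S \<sigma> (V ''J'') \<and> ival \<sigma> (V ''J'') = J" if "outer_inv (lx / 2 ^ i) \<sigma>" for i \<sigma>
          using that by (simp add: outer_inv_def fixed_def)
        show "ok W S (Seq (halve ''lq'' ''la'' ''lb'') outer_update) \<sigma> (1 + ?U)
           (\<lambda>\<sigma>'. idx \<sigma>' ''j2'' 0 = i \<and> outer_inv (lx / 2 ^ Suc i) \<sigma>')"
          if b: "outer_inv (lx / 2 ^ i) \<sigma>" and i: "i < J" "idx \<sigma> ''j2'' 0 = i" for i \<sigma>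
        proof (rule ok_seq)
          define L where "L = (rats \<sigma> ''la'' 0 + rats \<sigma> ''lb'' 0) / 2"
          let ?Q = "\<lambda>\<sigma>'. outer_inv (lx / 2 ^ i) \<sigma>' \<and> idx \<sigma>' ''j2'' 0 = i \<and> rats \<sigma>' ''lq'' 0 = L \<and>
             rats \<sigma>' ''la'' = rats \<sigma> ''la'' \<and> rats \<sigma>' ''lb'' = rats \<sigma> ''lb''"
          define \<tau> where "\<tau> = \<sigma>\<lparr>rats := (rats \<sigma>)(''lq'' := (rats \<sigma> ''lq'')(0 := L))\<rparr>"
          have "fixed d ds cm J \<tau>" by (rule fixed_cong[of d ds cm J \<sigma>]) (use b in \<open>simp_all add: \<tau>_def outer_inv_def\<close>)
          then have "outer_inv (lx / 2 ^ i) \<tau>" by (rule inv_cong[OF b]) (simp_all add: \<tau>_def)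
          then have "wp W S (halve ''lq'' ''la'' ''lb'') ?Q \<sigma>" using i by (simp add: halve_def \<tau>_def L_def)
          from ok_wp[OF this] show "ok W S (halve ''lq'' ''la'' ''lb'') \<sigma> 1 ?Q" by (simp add: halve_def)
          fix \<sigma>3 assume 3: "?Q \<sigma>3"
          then have f3: "fixed d ds cm J \<sigma>3" by (auto simp: outer_inv_def)
          have w: "rats \<sigma>3 ''lb'' 0 - rats \<sigma>3 ''la'' 0 = lx / 2 ^ i" "0 \<le> rats \<sigma>3 ''la'' 0" "rats \<sigma>3 ''lb'' 0 \<le> lx"
            "sideA \<sigma>3 (rats \<sigma>3 ''la'' 0)" "sideB \<sigma>3 (rats \<sigma>3 ''lb'' 0)" using 3 unfolding outer_inv_def by blast+
          have Leq: "L = (rats \<sigma>3 ''la'' 0 + rats \<sigma>3 ''lb'' 0) / 2" using 3 by (simp add: L_def)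
          have "0 \<le> lx / 2 ^ i" using lx_pos by simp
          then have "rats \<sigma>3 ''la'' 0 \<le> rats \<sigma>3 ''lb'' 0" using w(1) by (metis diff_ge_0_iff_ge)
          then have "0 \<le> L" "L \<le> lx" using w(2,3) unfolding Leq by (simp_all add: field_simps)
          then have L: "0 \<le> L" "L \<le> lx" .
          have w': "rats \<sigma>3 ''lb'' 0 - L = lx / 2 ^ Suc i" "L - rats \<sigma>3 ''la'' 0 = lx / 2 ^ Suc i"
            using w unfolding Leq by (simp_all add: field_simps)
          show "ok W S outer_update \<sigma>3 ?U (\<lambda>\<sigma>'. idx \<sigma>' ''j2'' 0 = i \<and> outer_inv (lx / 2 ^ Suc i) \<sigma>')"
          proof (rule ok_mono[OF ok_frame[OF ok_outer_update[of \<sigma>3 L]]])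
            fix \<sigma>' assume *: "(fixed d ds cm J \<sigma>' \<and>
               (rats \<sigma>' ''lb'' 0 = L \<and> sideB \<sigma>' L \<and> rats \<sigma>' ''la'' = rats \<sigma>3 ''la'' \<and> rats \<sigma>' ''A2'' = rats \<sigma>3 ''A2'' \<or>
                L \<noteq> lx \<and> rats \<sigma>' ''la'' 0 = L \<and> sideA \<sigma>' L \<and> rats \<sigma>' ''lb'' = rats \<sigma>3 ''lb'' \<and> rats \<sigma>' ''B1'' = rats \<sigma>3 ''B1'')) \<and>
               (\<forall>x. x \<notin> imods outer_update \<longrightarrow> idx \<sigma>' x = idx \<sigma>3 x) \<and> (\<forall>x. x \<notin> rmods outer_update \<longrightarrow> rats \<sigma>' x = rats \<sigma>3 x)"
            have j: "idx \<sigma>' ''j2'' 0 = i" using * 3 by (auto simp: outer_update_def copy4_def mods_inner)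
            have sA: "sideA \<sigma>' (rats \<sigma>3 ''la'' 0)" if "rats \<sigma>' ''A2'' = rats \<sigma>3 ''A2''" using sideA_cong[OF w(4) that] .
            have sB: "sideB \<sigma>' (rats \<sigma>3 ''lb'' 0)" if "rats \<sigma>' ''B1'' = rats \<sigma>3 ''B1''" using sideB_cong[OF w(5) that] .
            show "idx \<sigma>' ''j2'' 0 = i \<and> outer_inv (lx / 2 ^ Suc i) \<sigma>'"
              using * j w w' L sA sB unfolding outer_inv_def by (elim conjE disjE) simp_all
          qed (use f3 3 L in auto)
        qed
        show "found \<sigma> \<and> fixed d ds cm J \<sigma>" if "outer_inv (lx / 2 ^ J) \<sigma>" for \<sigma>
          using that outer_inv_found by (auto simp: outer_inv_def)
      qed simp
    qed
  qed
  then show ?thesis by (rule ok_mono) (auto simp: search_time_def algebra_simps)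
qed

end

section \<open>The constraint graph of a clockwise order\<close>

locale clockwise_order =
  fixes n :: nat and os :: "nat list"
  assumes n_pos: "0 < n" and os: "distinct os" "set os = {..<2 * n}"
begin

lemma len: "length os = 2 * n" using os distinct_card[of os] by simp

definition pos :: "nat \<Rightarrow> nat" where "pos y = (THE k. k < 2 * n \<and> os ! k = y)"

lemma nth_less: "k < 2 * n \<Longrightarrow> os ! k < 2 * n" using os(2) len nth_mem[of k os] by auto

lemma pos_nth: "k < 2 * n \<Longrightarrow> pos (os ! k) = k"
  unfolding pos_def using os(1) len by (intro the_equality) (auto simp: nth_eq_iff_index_eq)

lemma nth_pos: assumes "y < 2 * n" shows "pos y < 2 * n" "os ! pos y = y"
proof -
  have "y \<in> set os" using assms os(2) by simp
  then obtain k where "k < 2 * n" "os ! k = y" using len by (auto simp: in_set_conv_nth)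
  then show "pos y < 2 * n" "os ! pos y = y" using pos_nth by auto
qed

text \<open>Tells whether arc \<open>i\<close> passes the point 0; in that case its end has the
  coordinate \<open>x i + l - c\<close>. This is visible in the order alone.\<close>

definition om :: "nat \<Rightarrow> nat" where "om i = (if pos (2 * i) < pos (2 * i + 1) then 0 else 1)"

lemma om_le: "om i \<le> 1" by (simp add: om_def)

definition nxt :: "nat \<Rightarrow> nat" where "nxt k = os ! ((k + 1) mod (2 * n))"

lemma nxt_less: "nxt k < 2 * n" unfolding nxt_def using n_pos by (intro nth_less) simp

definition before :: "nat \<Rightarrow> nat set" where "before k = {j. j < k \<and> even (os ! j)}"
definition pst :: "nat \<Rightarrow> nat" where
  "pst k = (if before k = {} then os ! Max (before (2 * n)) else os ! Max (before k)) div 2"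
definition pfl :: "nat \<Rightarrow> nat" where "pfl k = (if before k = {} then 1 else 0)"

lemma finite_before [simp]: "finite (before k)"
  by (rule finite_subset[of _ "{..<k}"]) (auto simp: before_def)

lemma before_Suc: "before (Suc k) = (if even (os ! k) then insert k (before k) else before k)"
  by (auto simp: before_def less_Suc_eq)

lemma pst_Suc: "pst (Suc k) = (if even (os ! k) then os ! k div 2 else pst k)"
proof -
  have "Max (insert k (before k)) = k" by (intro Max_eqI) (auto simp: before_def)
  then show ?thesis by (auto simp: pst_def before_Suc)
qed

lemma pfl_Suc: "pfl (Suc k) = (if even (os ! k) then 0 else pfl k)"
  by (auto simp: pfl_def before_Suc)

lemma before_all: "before (2 * n) \<noteq> {}"
proof -
  have "pos 0 < 2 * n" "os ! pos 0 = 0" using nth_pos[of 0] n_pos by auto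
  then show ?thesis by (auto simp: before_def)
qed

lemma Max_before: assumes "before k \<noteq> {}" shows "Max (before k) < k" "even (os ! Max (before k))"
  "j < k \<Longrightarrow> even (os ! j) \<Longrightarrow> j \<le> Max (before k)"
proof -
  have "Max (before k) \<in> before k" using assms by (intro Max_in) auto
  then show "Max (before k) < k" "even (os ! Max (before k))" by (auto simp: before_def)
  show "j < k \<Longrightarrow> even (os ! j) \<Longrightarrow> j \<le> Max (before k)" by (intro Max_ge) (auto simp: before_def)
qed

text \<open>Edges \<open>e < 2 * n\<close> are the gaps between consecutive extremes; edge \<open>2 * n + i\<close> is the gap
  between the beginning of arc \<open>i\<close> and the preceding beginning. For a single arc the latter gap is
  the whole circle and is not subject to \<open>ds\<close>.\<close>

definition g_src :: "nat \<Rightarrow> nat" where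
  "g_src e = (if e < 2 * n then os ! e div 2 else pst (pos (2 * (e - 2 * n))))"
definition g_dst :: "nat \<Rightarrow> nat" where
  "g_dst e = (if e < 2 * n then nxt e div 2 else e - 2 * n)"
definition g_lm :: "nat \<Rightarrow> int" where
  "g_lm e = (if e < 2 * n then int (os ! e mod 2) - int (nxt e mod 2) else 0)"
text \<open>The first summand is 1 exactly for the last gap, which contains the point 0. The other
  two account for ends of arcs that pass 0, where \<open>c\<close> has been subtracted.\<close>

definition g_kp :: "nat \<Rightarrow> int" where
  "g_kp e = (if e < 2 * n then int ((e + 1) div (2 * n)) + int (os ! e mod 2 * om (os ! e div 2)) - int (nxt e mod 2 * om (nxt e div 2))
     else int (pfl (pos (2 * (e - 2 * n)))))"
definition g_bt :: "nat \<Rightarrow> int" where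
  "g_bt e = (if e < 2 * n \<or> n < 2 then 0 else 1)"

lemma half_less: "k < 2 * n \<Longrightarrow> os ! k div 2 < n"
  using nth_less[of k] by simp

lemma pst_less: "k \<le> 2 * n \<Longrightarrow> pst k < n"
  using half_less[of "Max (before k)"] half_less[of "Max (before (2 * n))"] Max_before(1)[of k] Max_before(1)[OF before_all]
  by (cases "before k = {}") (simp_all add: pst_def del: Max_less_iff)

sublocale bgraph n "3 * n" g_src g_dst g_kp g_lm g_bt
proof
  show "0 < n" by (rule n_pos)
  fix e assume e: "e < 3 * n"
  show "g_src e < n"
  proof (cases "e < 2 * n")
    case True
    then show ?thesis using nth_less[of e] by (simp add: g_src_def)
  next
    case False
    then have "2 * (e - 2 * n) < 2 * n" using e by simp
    from nth_pos(1)[OF this] show ?thesis using pst_less False by (simp add: g_src_def)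
  qed
  have "nxt e div 2 < n" using nxt_less[of e] by simp
  then show "g_dst e < n" using e by (auto simp: g_dst_def)
  have w: "(e + 1) div (2 * n) \<le> 1" if "e < 2 * n" using that n_pos by (cases "e + 1 = 2 * n") auto
  have o: "y mod 2 * om i \<le> 1" for y i :: nat using mult_le_mono[of "y mod 2" 1 "om i" 1] om_le[of i] by simp
  show "\<bar>g_kp e\<bar> \<le> 2"
  proof (cases "e < 2 * n")
    case True
    have "\<bar>int a + int b - int c\<bar> \<le> 2" if "a \<le> 1" "b \<le> 1" "c \<le> 1" for a b c :: nat using that by linarith
    from this[OF w[OF True] o o] show ?thesis using True by (simp only: g_kp_def if_True)
  next
    case False
    then show ?thesis by (simp add: g_kp_def pfl_def)
  qed
  have "\<bar>int (a mod 2) - int (b mod 2)\<bar> \<le> 1" for a b :: nat by linarith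
  then show "\<bar>g_lm e\<bar> \<le> 1" by (simp add: g_lm_def)
  show "0 \<le> g_bt e \<and> g_bt e \<le> 1" by (simp add: g_bt_def)
qed

definition place :: "real \<Rightarrow> real \<Rightarrow> (nat \<Rightarrow> real) \<Rightarrow> nat \<Rightarrow> real" where
  "place l c x y = x (y div 2) + of_nat (y mod 2) * (l - of_nat (om (y div 2)) * c)"

lemma place_simps [simp]: "place l c x (2 * i) = x i" "place l c x (Suc (2 * i)) = x i + l - of_nat (om i) * c"
  by (simp_all add: place_def)

definition pnext :: "real \<Rightarrow> (nat \<Rightarrow> real) \<Rightarrow> nat \<Rightarrow> real" where
  "pnext c p k = p (nxt k) + of_nat ((k + 1) div (2 * n)) * c"

lemma pnext_simps: "k + 1 < 2 * n \<Longrightarrow> pnext c p k = p (os ! (k + 1))" "pnext c p (2 * n - 1) = p (os ! 0) + c"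
  using n_pos by (auto simp: pnext_def nxt_def)

lemma gap_edge:
  assumes "e < 2 * n"
  shows "x (g_src e) + wt d ds l c e \<le> x (g_dst e) \<longleftrightarrow> place l c x (os ! e) + d \<le> pnext c (place l c x) e"
  using assms by (simp add: g_src_def g_dst_def wt_def g_lm_def g_kp_def g_bt_def place_def pnext_def algebra_simps)

definition layout :: "real \<Rightarrow> real \<Rightarrow> real \<Rightarrow> (nat \<Rightarrow> real) \<Rightarrow> bool" where
  "layout d ds c p \<longleftrightarrow> (\<forall>k<2 * n. p (os ! k) + d \<le> pnext c p k) \<and>
     (\<forall>i<n. \<forall>j<n. i \<noteq> j \<longrightarrow> d + ds \<le> cw_dist c (p (2 * i)) (p (2 * j)))"

text \<open>The gaps are summed along the list; the last gap closes the turn, so all extremes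
  together leave room for one more \<open>d\<close> within \<open>c\<close>.\<close>

lemma chain:
  assumes g: "\<And>k. k < 2 * n \<Longrightarrow> p (os ! k) + d \<le> pnext c p k" and d: "0 \<le> d"
  shows "k < k' \<Longrightarrow> k' < 2 * n \<Longrightarrow> p (os ! k) + d \<le> p (os ! k')"
    and "k < 2 * n \<Longrightarrow> k' < 2 * n \<Longrightarrow> p (os ! k') + d \<le> p (os ! k) + c"
proof -
  show mono: "k < k' \<Longrightarrow> k' < 2 * n \<Longrightarrow> p (os ! k) + d \<le> p (os ! k')" for k k'
  proof (induction k')
    case (Suc k')
    have "p (os ! k') + d \<le> p (os ! Suc k')" using g[of k'] Suc.prems by (simp add: pnext_simps)
    then show ?case using Suc d by (cases "k = k'") auto
  qed simp
  have le: "p (os ! k) \<le> p (os ! k')" if "k \<le> k'" "k' < 2 * n" for k k'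
    using mono[of k k'] that d by (cases "k = k'") auto
  have last: "p (os ! (2 * n - 1)) + d \<le> p (os ! 0) + c"
    using g[of "2 * n - 1"] n_pos unfolding pnext_simps(2) by linarith
  show "k < 2 * n \<Longrightarrow> k' < 2 * n \<Longrightarrow> p (os ! k') + d \<le> p (os ! k) + c" for k k'
    using le[of 0 k] le[of k' "2 * n - 1"] last n_pos by force
qed

lemma chain_codes:
  assumes g: "\<And>k. k < 2 * n \<Longrightarrow> p (os ! k) + d \<le> pnext c p k" and d: "0 \<le> d" and y: "y < 2 * n" "z < 2 * n"
  shows "pos y < pos z \<Longrightarrow> p y + d \<le> p z" "p y + d \<le> p z + c"
  using chain[OF g d, of "pos y" "pos z"] chain(2)[OF g d, of "pos z" "pos y"] nth_pos[OF y(1)] nth_pos[OF y(2)] by auto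

text \<open>If \<open>pfl q = 1\<close> then the preceding beginning is met only on the previous turn, before the point \<open>0\<close>.\<close>

lemma prev_start:
  assumes i: "i < n"
  defines "q \<equiv> pos (2 * i)"
  shows "pst q < n" "pfl q = 0 \<Longrightarrow> pos (2 * pst q) < q"
    "pfl q = 0 \<Longrightarrow> j < n \<Longrightarrow> pos (2 * j) < q \<Longrightarrow> pos (2 * j) \<le> pos (2 * pst q)"
    "pfl q = 1 \<Longrightarrow> j < n \<Longrightarrow> pos (2 * j) \<le> pos (2 * pst q)"
    "pfl q = 1 \<Longrightarrow> j < n \<Longrightarrow> q \<le> pos (2 * j)" "pfl q = 0 \<or> pfl q = 1"
proof -
  have q: "q < 2 * n" "os ! q = 2 * i" using nth_pos[of "2 * i"] i by (auto simp: q_def)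
  show "pst q < n" using pst_less q by simp
  show "pfl q = 0 \<or> pfl q = 1" by (simp add: pfl_def)
  have st: "pos (2 * j) < 2 * n" "even (os ! pos (2 * j))" if "j < n" for j using nth_pos[of "2 * j"] that by auto
  have ps: "pos (2 * (os ! k div 2)) = k" if "k < 2 * n" "even (os ! k)" for k using pos_nth[of k] that by simp
  have A: "pos (2 * pst q) = Max (before q)" if "before q \<noteq> {}"
  proof -
    have "Max (before q) < 2 * n" using Max_before(1)[OF that] q by linarith
    then show ?thesis using that Max_before(2)[OF that] ps by (simp add: pst_def)
  qed
  have B: "pos (2 * pst q) = Max (before (2 * n))" if "before q = {}"
    using that Max_before[OF before_all] ps[of "Max (before (2 * n))"] by (simp add: pst_def)
  show "pfl q = 0 \<Longrightarrow> pos (2 * pst q) < q" using A Max_before(1) by (auto simp: pfl_def split: if_splits)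
  show "pfl q = 0 \<Longrightarrow> j < n \<Longrightarrow> pos (2 * j) < q \<Longrightarrow> pos (2 * j) \<le> pos (2 * pst q)" for j
    using A Max_before(3) st by (auto simp: pfl_def split: if_splits)
  show "pfl q = 1 \<Longrightarrow> j < n \<Longrightarrow> pos (2 * j) \<le> pos (2 * pst q)" for j
    using B Max_before(3)[OF before_all] st by (auto simp: pfl_def split: if_splits)
  show "q \<le> pos (2 * j)" if "pfl q = 1" "j < n" for j
  proof (rule ccontr)
    assume "\<not> q \<le> pos (2 * j)"
    then have "pos (2 * j) \<in> before q" using st[OF that(2)] by (simp add: before_def)
    then show False using that(1) by (auto simp: pfl_def split: if_splits)
  qed
qed

lemma start_edge:
  assumes "i < n"
  shows "x (g_src (2 * n + i)) + wt d ds l c (2 * n + i) \<le> x (g_dst (2 * n + i)) \<longleftrightarrow>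
     x (pst (pos (2 * i))) + d + (if n < 2 then 0 else ds) \<le> x i + of_nat (pfl (pos (2 * i))) * c"
  by (simp add: g_src_def g_dst_def wt_def g_lm_def g_kp_def g_bt_def algebra_simps)

lemma pos_inj: "y < 2 * n \<Longrightarrow> z < 2 * n \<Longrightarrow> pos y = pos z \<Longrightarrow> y = z" using nth_pos by metis

text \<open>The graph constrains only a beginning and its cyclic predecessor. Any other beginning
  lies farther back on the turn, so the distance from it is larger still. For a single arc the
  predecessor is the arc itself, one turn earlier, and the edge reduces to
  \<open>d \<le> c\<close>.\<close>

theorem feas_iff_layout:
  assumes d: "0 < d"
  shows "feas d ds l c x \<longleftrightarrow> layout d ds c (place l c x)"
proof
  assume f: "feas d ds l c x"
  let ?p = "place l c x"
  note d' = less_imp_le[OF d]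
  have g: "?p (os ! k) + d \<le> pnext c ?p k" if "k < 2 * n" for k
  proof -
    have "x (g_src k) + wt d ds l c k \<le> x (g_dst k)" using f that by (simp add: feas_def)
    then show ?thesis using gap_edge[OF that] by blast
  qed
  have s: "x (pst (pos (2 * i))) + d + (if n < 2 then 0 else ds) \<le> x i + of_nat (pfl (pos (2 * i))) * c" if "i < n" for i
  proof -
    have "x (g_src (2 * n + i)) + wt d ds l c (2 * n + i) \<le> x (g_dst (2 * n + i))" using f that by (simp add: feas_def)
    then show ?thesis using start_edge[OF that] by blast
  qed
  have less: "x i < x j" if "i < n" "j < n" "pos (2 * i) < pos (2 * j)" for i j
    using chain_codes(1)[OF g d', of "2 * i" "2 * j"] that d by simp
  have mono: "x i \<le> x j" if "i < n" "j < n" "pos (2 * i) \<le> pos (2 * j)" for i j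
  proof (cases "i = j")
    case False
    then have "pos (2 * i) \<noteq> pos (2 * j)" using pos_inj[of "2 * i" "2 * j"] that by auto
    then have "x i < x j" using less that by simp
    then show ?thesis by simp
  qed simp
  have wrap: "x i + d \<le> x j + c" if "i < n" "j < n" for i j
    using chain_codes(2)[OF g d', of "2 * i" "2 * j"] that by simp
  have "d + ds \<le> cw_dist c (x i) (x j)" if ij: "i < n" "j < n" "i \<noteq> j" for i j
  proof -
    have n2: "\<not> n < 2" using ij by auto
    note P = prev_start[OF ij(2)]
    have ne: "pos (2 * i) \<noteq> pos (2 * j)" using pos_inj[of "2 * i" "2 * j"] ij by auto
    have s': "x (pst (pos (2 * j))) + d + ds \<le> x j + of_nat (pfl (pos (2 * j))) * c" using s[OF ij(2)] n2 by simp
    show ?thesis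
    proof (cases "pfl (pos (2 * j)) = 0")
      case z: True
      show ?thesis
      proof (cases "pos (2 * i) < pos (2 * j)")
        case lt: True
        have "x i \<le> x (pst (pos (2 * j)))" by (rule mono[OF ij(1) P(1) P(3)[OF z ij(1) lt]])
        moreover have "x i < x j" by (rule less[OF ij(1,2) lt])
        ultimately show ?thesis using s' z by (simp add: cw_dist_def)
      next
        case False
        have "x i + d \<le> x (pst (pos (2 * j))) + c" by (rule wrap[OF ij(1) P(1)])
        moreover have "x j < x i" by (rule less[OF ij(2,1)]) (use False ne in simp)
        ultimately show ?thesis using s' z d by (simp add: cw_dist_def)
      qed
    next
      case False
      then have o: "pfl (pos (2 * j)) = 1" using P(6) by simp
      have "x i \<le> x (pst (pos (2 * j)))" by (rule mono[OF ij(1) P(1) P(4)[OF o ij(1)]])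
      moreover have "x j < x i" by (rule less[OF ij(2,1)]) (use P(5)[OF o ij(1)] ne in simp)
      ultimately show ?thesis using s' o by (simp add: cw_dist_def)
    qed
  qed
  then show "layout d ds c ?p" using g by (simp add: layout_def)
next
  let ?p = "place l c x"
  note d' = less_imp_le[OF d]
  assume "layout d ds c ?p"
  then have g: "?p (os ! k) + d \<le> pnext c ?p k" if "k < 2 * n" for k using that by (simp add: layout_def)
  have cw: "d + ds \<le> cw_dist c (x i) (x j)" if "i < n" "j < n" "i \<noteq> j" for i j
    using \<open>layout d ds c ?p\<close> that unfolding layout_def place_simps by blast
  have less: "x i < x j" if "i < n" "j < n" "pos (2 * i) < pos (2 * j)" for i j
    using chain_codes(1)[OF g d', of "2 * i" "2 * j"] that d by simp
  have wrap: "x i + d \<le> x j + c" if "i < n" "j < n" for i j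
    using chain_codes(2)[OF g d', of "2 * i" "2 * j"] that by simp
  have st: "x (pst (pos (2 * i))) + d + (if n < 2 then 0 else ds) \<le> x i + of_nat (pfl (pos (2 * i))) * c" if i: "i < n" for i
  proof -
    note P = prev_start[OF i]
    define j where "j = pst (pos (2 * i))"
    have j: "j < n" using P(1) by (simp add: j_def)
    show ?thesis
    proof (cases "pfl (pos (2 * i)) = 0")
      case True
      have lt: "pos (2 * j) < pos (2 * i)" using P(2)[OF True] by (simp add: j_def)
      then have "j \<noteq> i" by auto
      then have "\<not> n < 2" using i j by auto
      then show ?thesis using cw[OF j i \<open>j \<noteq> i\<close>] less[OF j i lt] True by (simp add: cw_dist_def j_def)
    next
      case False
      then have o: "pfl (pos (2 * i)) = 1" using P(6) by simp
      show ?thesis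
      proof (cases "n < 2")
        case True
        then show ?thesis using wrap[OF j i] o by (simp add: j_def)
      next
        case n2: False
        then obtain k where k: "k < n" "k \<noteq> i" by (cases "i = 0") (use that[of 0] that[of 1] in auto)
        have "pos (2 * i) \<noteq> pos (2 * k)" using pos_inj[of "2 * i" "2 * k"] i k by auto
        then have "pos (2 * i) < pos (2 * j)" using P(5)[OF o k(1)] P(4)[OF o k(1)] by (simp add: j_def)
        then have "x i < x j" "j \<noteq> i" using less[OF i j] by auto
        then show ?thesis using cw[OF j i] o n2 by (simp add: cw_dist_def j_def)
      qed
    qed
  qed
  show "feas d ds l c x"
    unfolding feas_def
  proof (intro allI impI)
    fix e assume e: "e < 3 * n"
    show "x (g_src e) + wt d ds l c e \<le> x (g_dst e)"
    proof (cases "e < 2 * n")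
      case True
      then show ?thesis using gap_edge[OF True] g by blast
    next
      case False
      then obtain i where "e = 2 * n + i" "i < n" using that[of "e - 2 * n"] e by auto
      then show ?thesis using start_edge st by blast
    qed
  qed
qed

text \<open>Together with \<open>valid_length\<close> this supplies the lower ends of the two
  bisections.\<close>

lemma valid_circumference: "valid 1 0 1 0"
proof -
  have "d \<le> c" if "0 \<le> d" "feas d ds l c x" for d ds l c :: real and x
  proof -
    have g: "place l c x (os ! k) + d \<le> pnext c (place l c x) k" if "k < 2 * n" for k
    proof -
      have "x (g_src k) + wt d ds l c k \<le> x (g_dst k)" using \<open>feas d ds l c x\<close> that by (simp add: feas_def)
      then show ?thesis using gap_edge[OF that] by blast
    qed
    show ?thesis using chain(2)[OF g \<open>0 \<le> d\<close>, of 0 0] n_pos by simp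
  qed
  then show ?thesis using n_pos unfolding valid_def cval_def by auto
qed

lemma valid_length: "valid 0 (-1) 1 0"
proof -
  have "d \<le> l" if "0 \<le> d" "feas d ds l c x" for d ds l c :: real and x
  proof -
    have g: "place l c x (os ! k) + d \<le> pnext c (place l c x) k" if "k < 2 * n" for k
    proof -
      have "x (g_src k) + wt d ds l c k \<le> x (g_dst k)" using \<open>feas d ds l c x\<close> that by (simp add: feas_def)
      then show ?thesis using gap_edge[OF that] by blast
    qed
    have "place l c x (2 * 0) = x 0" "place l c x 1 = x 0 + l - of_nat (om 0) * c"
      by (simp_all add: place_def)
    then show ?thesis using chain_codes[OF g \<open>0 \<le> d\<close>, of 0 1] n_pos by (auto simp: om_def split: if_splits)
  qed
  then show ?thesis using n_pos unfolding valid_def cval_def by auto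
qed

end

section \<open>Least descriptors\<close>

text \<open>The reference is obtained from the input model, which solves the constraints for
  \<open>ds = 0\<close> and some \<open>d0\<close>. It draws the graph and fixes the sign of
  determinants; its real coordinates never reach the machine.\<close>

locale ref_order = clockwise_order +
  fixes d0 l0 c0 :: real and x0 :: "nat \<Rightarrow> real"
  assumes ref_layout: "layout d0 0 c0 (place l0 c0 x0)" and d0: "0 < d0" and l0: "0 < l0"
    and ref_range: "y < 2 * n \<Longrightarrow> 0 \<le> place l0 c0 x0 y \<and> place l0 c0 x0 y < c0"
begin

abbreviation "rp \<equiv> place l0 c0 x0"

lemma ref_gap: "k < 2 * n \<Longrightarrow> rp (os ! k) + d0 \<le> pnext c0 rp k"
  using ref_layout by (simp add: layout_def)

lemma ref_less: "y < 2 * n \<Longrightarrow> z < 2 * n \<Longrightarrow> pos y < pos z \<Longrightarrow> rp y < rp z"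
  using chain_codes(1)[OF ref_gap, of y z] d0 by fastforce

lemma c0_pos: "0 < c0" using ref_range[of 0] n_pos by simp

lemma ref_lift_eq:
  assumes "y < 2 * n" "z < 2 * n" "rp y + of_int q * c0 = rp z + of_int r * c0"
  shows "y = z \<and> q = r"
proof -
  have "\<bar>rp y - rp z\<bar> < c0" using ref_range[OF assms(1)] ref_range[OF assms(2)] by linarith
  moreover have "rp y - rp z = of_int (r - q) * c0" using assms(3) by (simp add: algebra_simps)
  ultimately have "\<bar>of_int (r - q)\<bar> * c0 < 1 * c0" using c0_pos by (simp add: abs_mult)
  then have "\<bar>of_int (r - q) :: real\<bar> < 1" using c0_pos by (simp only: mult_less_cancel_right)
  then have qr: "q = r" by linarith
  then have "rp y = rp z" using assms(3) by simp
  then have "pos y = pos z" using ref_less[OF assms(1,2)] ref_less[OF assms(2,1)] by (metis less_irrefl nat_neq_iff)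
  then show ?thesis using pos_inj assms qr by blast
qed

text \<open>Besides extremes of the same turn, lifts from other turns have to be excluded: later
  ones lie at or beyond the first extreme of the next turn, earlier ones before the start of the
  present turn.\<close>

lemma no_extreme_between:
  assumes k: "k < 2 * n" and y: "y < 2 * n"
  shows "\<not> (rp (os ! k) + of_int q * c0 < rp y + of_int r * c0 \<and> rp y + of_int r * c0 < pnext c0 rp k + of_int q * c0)"
proof
  assume *: "rp (os ! k) + of_int q * c0 < rp y + of_int r * c0 \<and> rp y + of_int r * c0 < pnext c0 rp k + of_int q * c0"
  define t where "t = r - q"
  have t: "rp (os ! k) < rp y + of_int t * c0" "rp y + of_int t * c0 < pnext c0 rp k"
    using * by (simp_all add: t_def algebra_simps)
  note ry = ref_range[OF y] and rk = ref_range[OF nth_less[OF k]]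
  have o0: "rp (os ! 0) \<le> rp y"
    using chain(1)[OF ref_gap, of 0 "pos y"] nth_pos[OF y] d0 by (cases "pos y = 0") auto
  have nx: "pnext c0 rp k \<le> rp (os ! 0) + c0"
  proof (cases "k + 1 < 2 * n")
    case True
    then have "rp (os ! (k + 1)) + d0 \<le> rp (os ! 0) + c0" using chain(2)[OF ref_gap, of 0 "k + 1"] d0 n_pos by simp
    then show ?thesis using True d0 by (simp add: pnext_simps)
  next
    case False
    then have "k = 2 * n - 1" using k by simp
    then show ?thesis using pnext_simps(2) by simp
  qed
  consider "1 \<le> t" | "t \<le> -1" | "t = 0" by linarith
  then show False
  proof cases
    case 1
    then have "1 * c0 \<le> of_int t * c0" using c0_pos by (intro mult_right_mono) auto
    then show False using t nx o0 by linarith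
  next
    case 2
    then have "of_int t * c0 \<le> -1 * c0" using c0_pos by (intro mult_right_mono) auto
    then show False using t ry rk by linarith
  next
    case 3
    then have lt: "rp (os ! k) < rp y" "rp y < pnext c0 rp k" using t by auto
    have "k < pos y"
    proof (rule ccontr)
      assume "\<not> k < pos y"
      then have "rp y \<le> rp (os ! k)"
        using ref_less[OF y nth_less[OF k]] pos_nth[OF k] nth_pos[OF y] by (cases "pos y = k") auto
      then show False using lt by simp
    qed
    then have k1: "k + 1 < 2 * n" "k + 1 \<le> pos y" using nth_pos[OF y] by auto
    then have "rp (os ! (k + 1)) \<le> rp y"
      using ref_less[OF nth_less[OF k1(1)] y] pos_nth[OF k1(1)] nth_pos[OF y] by (cases "pos y = k + 1") auto
    then show False using lt k1 by (simp add: pnext_simps)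
  qed
qed

definition lifts :: "real set" where "lifts = {x0 i + of_int q * c0 | i q. i < n}"

text \<open>The turn of an end exceeds that of its beginning by \<open>om i\<close>, which makes up
  for the multiple of \<open>c0\<close> subtracted in \<open>place\<close>.\<close>

lemma lift_end: "x0 i + of_int q * c0 + l0 = rp (2 * i + 1) + of_int (q + int (om i)) * c0"
  by (simp add: distrib_right)

lemma lift_start: "x0 i + of_int q * c0 = rp (2 * i) + of_int q * c0" by simp

sublocale strip lifts l0
proof
  show "0 < l0" by (rule l0)
  fix x y assume "x \<in> lifts" "y \<in> lifts"
  then obtain i q j r where ij: "x = x0 i + of_int q * c0" "y = x0 j + of_int r * c0" "i < n" "j < n" by (auto simp: lifts_def)
  show "x \<noteq> y + l0"
  proof
    assume "x = y + l0"
    then have "rp (2 * i) + of_int q * c0 = rp (2 * j + 1) + of_int (r + int (om j)) * c0"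
      unfolding ij lift_end unfolding lift_start .
    from ref_lift_eq[OF _ _ this] have "2 * i = 2 * j + 1" using ij by simp
    then show False by presburger
  qed
qed

lemma no_lift_between:
  assumes k: "k < 2 * n" and r: "r \<in> lifts"
  shows "\<not> (rp (os ! k) + of_int q * c0 < r \<and> r < pnext c0 rp k + of_int q * c0)"
    and "\<not> (rp (os ! k) + of_int q * c0 < r + l0 \<and> r + l0 < pnext c0 rp k + of_int q * c0)"
proof -
  obtain i s where i: "r = x0 i + of_int s * c0" "i < n" using r by (auto simp: lifts_def)
  show "\<not> (rp (os ! k) + of_int q * c0 < r \<and> r < pnext c0 rp k + of_int q * c0)"
    unfolding i lift_start using i by (intro no_extreme_between[OF k]) simp
  show "\<not> (rp (os ! k) + of_int q * c0 < r + l0 \<and> r + l0 < pnext c0 rp k + of_int q * c0)"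
    unfolding i lift_end using i by (intro no_extreme_between[OF k]) simp
qed

lemma drawn_gap:
  assumes e: "e < 2 * n"
  shows "step (x0 (g_src e) + of_int q * c0) h (x0 (g_dst e) + of_int (q + g_kp e) * c0) (h + g_lm e)"
proof -
  define a b where "a = os ! e" and "b = nxt e"
  define i j where "i = a div 2" and "j = b div 2"
  define w where "w = int ((e + 1) div (2 * n))"
  have ij: "i < n" "j < n" using nth_less[OF e] nxt_less[of e] by (auto simp: i_def j_def a_def b_def)
  have g: "g_src e = i" "g_dst e = j" "g_lm e = int (a mod 2) - int (b mod 2)"
    "g_kp e = w + int (a mod 2 * om i) - int (b mod 2 * om j)"
    using e by (simp_all add: g_src_def g_dst_def g_lm_def g_kp_def a_def b_def i_def j_def w_def)
  have pn: "pnext c0 rp e = rp b + of_int w * c0" by (simp add: pnext_def b_def w_def)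
  have gap: "rp a < rp b + of_int w * c0" using ref_gap[OF e] d0 unfolding pn by (simp add: a_def)
  define v v' where "v = x0 i + of_int q * c0" and "v' = x0 j + of_int (q + g_kp e) * c0"
  have mem: "v \<in> lifts" "v' \<in> lifts" using ij unfolding v_def v'_def lifts_def by blast+
  have nb: "\<not> (rp a + of_int s * c0 < r \<and> r < rp b + of_int (w + s) * c0)"
    "\<not> (rp a + of_int s * c0 < r + l0 \<and> r + l0 < rp b + of_int (w + s) * c0)" if "r \<in> lifts" for r s
    using no_lift_between[OF e that, of s] unfolding pn a_def by (simp_all add: algebra_simps)
  \<comment> \<open>The parities of the two codes select the clause of \<open>step\<close>. Between
    two ends the row is kept, and the gap is translated back by \<open>l0\<close> to one between
    beginnings.\<close>
  have a_cases: "a mod 2 = 0 \<and> a = 2 * i \<or> a mod 2 = 1 \<and> a = 2 * i + 1" and b_cases: "b mod 2 = 0 \<and> b = 2 * j \<or> b mod 2 = 1 \<and> b = 2 * j + 1"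
    unfolding i_def j_def by presburger+
  have A0: "v = rp a + of_int q * c0" if "a = 2 * i" using that by (simp add: v_def)
  have A1: "v + l0 = rp a + of_int (q + int (om i)) * c0" if "a = 2 * i + 1" unfolding that v_def by (rule lift_end)
  have B0: "v' = rp b + of_int (q + g_kp e) * c0" if "b = 2 * j" using that by (simp add: v'_def)
  have B1: "v' + l0 = rp b + of_int (q + g_kp e + int (om j)) * c0" if "b = 2 * j + 1" unfolding that v'_def by (rule lift_end)
  have sh: "rp a + of_int s * c0 < rp b + of_int (w + s) * c0" for s using gap by (simp add: algebra_simps)
  show ?thesis
    unfolding g(1,2) v_def[symmetric] v'_def[symmetric]
    using a_cases b_cases
  proof (elim disjE conjE)
    assume ab: "a mod 2 = 0" "a = 2 * i" "b mod 2 = 0" "b = 2 * j"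
    have k: "q + g_kp e = w + q" using ab g(4) by simp
    show "step v h v' (h + g_lm e)"
      unfolding step_def A0[OF ab(2)] B0[OF ab(4)] k g(3) ab(1,3)
      using mem nb(1)[of _ q] sh[of q] unfolding A0[OF ab(2)] B0[OF ab(4)] k by simp
  next
    assume ab: "a mod 2 = 0" "a = 2 * i" "b mod 2 = 1" "b = 2 * j + 1"
    have k: "q + g_kp e + int (om j) = w + q" using ab g(4) by simp
    show "step v h v' (h + g_lm e)"
      using mem nb[of _ q] sh[of q] B1[OF ab(4)] A0[OF ab(2)] unfolding step_def k g(3) ab(1,3) by simp
  next
    assume ab: "a mod 2 = 1" "a = 2 * i + 1" "b mod 2 = 0" "b = 2 * j"
    have k: "q + g_kp e = w + (q + int (om i))" using ab g(4) by simp
    show "step v h v' (h + g_lm e)"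
      using mem nb[of _ "q + int (om i)"] sh[of "q + int (om i)"] A1[OF ab(2)] B0[OF ab(4)] unfolding step_def k g(3) ab(1,3) by simp
  next
    assume ab: "a mod 2 = 1" "a = 2 * i + 1" "b mod 2 = 1" "b = 2 * j + 1"
    have k: "q + g_kp e + int (om j) = w + (q + int (om i))" using ab g(4) by simp
    have le: "v + l0 < v' + l0" and no: "\<not> (v + l0 < r + l0 \<and> r + l0 < v' + l0)" if "r \<in> lifts" for r
      using nb(2)[OF that, of "q + int (om i)"] sh[of "q + int (om i)"] A1[OF ab(2)] B1[OF ab(4)] unfolding k by simp_all
    have "v < v'" using le[OF mem(1)] by simp
    then show "step v h v' (h + g_lm e)"
      using mem no unfolding step_def g(3) ab(1,3) by simp
  qed
qed

text \<open>If \<open>f = 1\<close>, the step leads from the last beginning of a turn to the first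
  of the next, and no lift of a beginning fits between them.\<close>

lemma drawn_start:
  assumes i: "i < n"
  shows "step (x0 (g_src (2 * n + i)) + of_int q * c0) h (x0 (g_dst (2 * n + i)) + of_int (q + g_kp (2 * n + i)) * c0) (h + g_lm (2 * n + i))"
proof -
  define j f where "j = pst (pos (2 * i))" and "f = pfl (pos (2 * i))"
  note P = prev_start[OF i, folded j_def f_def]
  have g: "g_src (2 * n + i) = j" "g_dst (2 * n + i) = i" "g_lm (2 * n + i) = 0" "g_kp (2 * n + i) = int f"
    by (simp_all add: g_src_def g_dst_def g_lm_def g_kp_def j_def f_def)
  have less: "x0 k < x0 k'" if "k < n" "k' < n" "pos (2 * k) < pos (2 * k')" for k k'
    using ref_less[of "2 * k" "2 * k'"] that by simp
  have le: "x0 k \<le> x0 k'" if "k < n" "k' < n" "pos (2 * k) \<le> pos (2 * k')" for k k'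
    using less[OF that(1,2)] pos_inj[of "2 * k" "2 * k'"] that by (cases "pos (2 * k) = pos (2 * k')") auto
  have rng: "0 \<le> x0 k \<and> x0 k < c0" if "k < n" for k using ref_range[of "2 * k"] that by simp
  have lt: "x0 j < x0 i + of_nat f * c0"
    using P(6) less[OF P(1) i P(2)] rng[OF i] rng[OF P(1)] by auto
  have no: "\<not> (x0 j + of_int q * c0 < x0 k + of_int r * c0 \<and> x0 k + of_int r * c0 < x0 i + of_int (q + int f) * c0)" if k: "k < n" for k r
  proof
    assume *: "x0 j + of_int q * c0 < x0 k + of_int r * c0 \<and> x0 k + of_int r * c0 < x0 i + of_int (q + int f) * c0"
    define t where "t = r - q"
    have t: "x0 j < x0 k + of_int t * c0" "x0 k + of_int t * c0 < x0 i + of_nat f * c0"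
      using * by (simp_all add: t_def algebra_simps)
    consider "2 \<le> t" | "t = 1" | "t \<le> -1" | "t = 0" by linarith
    then show False
    proof cases
      case 1
      then have "2 * c0 \<le> of_int t * c0" using c0_pos by (intro mult_right_mono) auto
      moreover have "of_nat f * c0 \<le> c0" using P(6) c0_pos by auto
      ultimately show False using t rng[OF k] rng[OF i] by linarith
    next
      case 2
      then show False using P(6)
      proof (elim disjE)
        assume "f = 1" then show False using t 2 le[OF i k P(5)[OF _ k]] by simp
      qed (use t 2 rng[OF k] rng[OF i] in simp)
    next
      case 3
      then have "of_int t * c0 \<le> -1 * c0" using c0_pos by (intro mult_right_mono) auto
      then show False using t rng[OF k] rng[OF P(1)] by linarith
    next
      case 4
      then show False using P(6)
      proof (elim disjE)
        assume f: "f = 0"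
        then have "\<not> pos (2 * i) \<le> pos (2 * k)" using le[OF i k] t 4 by auto
        then show False using le[OF k P(1) P(3)[OF f k]] t 4 by simp
      qed (use t 4 le[OF k P(1) P(4)[OF _ k]] in simp)
    qed
  qed
  have "x0 j + of_int q * c0 \<in> lifts" "x0 i + of_int (q + int f) * c0 \<in> lifts" using i P(1) unfolding lifts_def by blast+
  moreover have "x0 j + of_int q * c0 < x0 i + of_int (q + int f) * c0" using lt by (simp add: algebra_simps)
  ultimately show ?thesis unfolding g step_def using no by (auto simp: lifts_def)
qed

sublocale drawn_graph n "3 * n" g_src g_dst g_kp g_lm g_bt lifts l0 x0 c0
proof
  show "0 \<le> x0 v \<and> x0 v < c0" if "v < n" for v using ref_range[of "2 * v"] that by simp
  show "inj_on x0 {..<n}"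
  proof (rule inj_onI)
    fix i j assume "i \<in> {..<n}" "j \<in> {..<n}" "x0 i = x0 j"
    then show "i = j" using ref_lift_eq[of "2 * i" "2 * j" 0 0] by auto
  qed
  show "step (x0 (g_src e) + of_int q * c0) h (x0 (g_dst e) + of_int (q + g_kp e) * c0) (h + g_lm e)" if "e < 3 * n" for e q h
  proof (cases "e < 2 * n")
    case False
    then have "e = 2 * n + (e - 2 * n)" "e - 2 * n < n" using that by auto
    then show ?thesis using drawn_start[of "e - 2 * n" q h] by simp
  qed (use drawn_gap in blast)
qed

lemma ref_feas: "feas d0 0 l0 c0 x0" using ref_layout feas_iff_layout[OF d0] by simp

text \<open>Eliminating \<open>c\<close> from the two constraints bounds \<open>l'\<close> from
  below by the value where both are tight. If \<open>c'\<close> were smaller than \<open>c\<close>,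
  then by the lattice property it would be feasible together with \<open>l\<close>, against the
  first constraint, which is tight at \<open>(l, c)\<close> and has \<open>0 < k1\<close>.\<close>

theorem least_descriptor:
  assumes v: "valid k1 l1 a1 b1" "valid k2 l2 a2 b2" "0 < k1" "k2 \<le> 0"
    and tight: "cval k1 l1 a1 b1 d ds l c = 0" "cval k2 l2 a2 b2 d ds l c = 0"
    and d: "0 \<le> d" "0 \<le> ds" and f: "feas d ds l c (x :: nat \<Rightarrow> real)" and f': "feas d ds l' c' (x' :: nat \<Rightarrow> real)"
  shows "l \<le> l' \<and> c \<le> c'"
proof -
  have m: "0 < l1 * k2 - l2 * k1" by (rule valid_det_pos[OF ref_feas d0 l0 less_imp_le[OF c0_pos] v])
  have w: "cval k1 l1 a1 b1 d ds l' c' \<le> 0" "cval k2 l2 a2 b2 d ds l' c' \<le> 0"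
    using validD(7)[OF v(1) d f'] validD(7)[OF v(2) d f'] by auto
  have "of_int k1 * cval k2 l2 a2 b2 d ds l' c' \<le> 0" "0 \<le> of_int k2 * cval k1 l1 a1 b1 d ds l' c'"
    using w v(3,4) by (auto simp: mult_le_0_iff zero_le_mult_iff)
  moreover define X where "X = of_int (l1 * k2 - l2 * k1) * (l' - l)"
  have "X =
     of_int k2 * (cval k1 l1 a1 b1 d ds l' c' - cval k1 l1 a1 b1 d ds l c) - of_int k1 * (cval k2 l2 a2 b2 d ds l' c' - cval k2 l2 a2 b2 d ds l c)"
    by (simp add: X_def cval_def algebra_simps)
  ultimately have "0 \<le> X" unfolding tight diff_zero by (metis diff_ge_0_iff_ge order_trans)
  then have l: "l \<le> l'" using m by (simp add: X_def zero_le_mult_iff del: of_int_diff of_int_mult)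
  moreover have "c \<le> c'"
  proof (rule ccontr)
    assume "\<not> c \<le> c'"
    then obtain y where "feas d ds l c' (y :: nat \<Rightarrow> real)" using feas_lattice[OF f' f l] by auto
    from validD(7)[OF v(1) d this] have "of_int k1 * c \<le> of_int k1 * c'" using tight(1) by (simp add: cval_def)
    then show False using v(3) \<open>\<not> c \<le> c'\<close> by simp
  qed
  ultimately show ?thesis by simp
qed

end

section \<open>Models and layouts\<close>

lemma open_arc_iff:
  assumes "0 \<le> p" "p < c" "0 \<le> q" "q < c" "p \<noteq> q"
  shows "x \<in> open_arc c p q \<longleftrightarrow> 0 \<le> x \<and> x < c \<and> (if p < q then p < x \<and> x < q else p < x \<or> x < q)"
  using assms by (auto simp: open_arc_def cw_dist_def)

lemma cw_dist_eqD: "cw_dist c s t = l \<Longrightarrow> t = s + l - (if s \<le> t then 0 else c)"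
  by (auto simp: cw_dist_def split: if_splits)

text \<open>For arcs of equal length, the extremes of one lie both inside the other only if the two arcs
  cover the circle. Unlike covering, this is visible in the order of the extremes.\<close>

lemma equal_arcs_cover:
  assumes r: "0 \<le> s" "s < c" "0 \<le> t" "t < c" "0 \<le> s'" "s' < c" "0 \<le> t'" "t' < c"
    and ne: "s \<noteq> t" "s' \<noteq> t'" "s \<noteq> s'" "t \<noteq> t'" "s \<noteq> t'" "s' \<noteq> t"
    and l: "cw_dist c s t = l" "cw_dist c s' t' = l"
    and i: "s \<in> open_arc c s' t'" "t \<in> open_arc c s' t'"
  shows "open_arc c s t \<union> open_arc c s' t' = {0..<c}"
proof -
  have "x \<in> open_arc c s t \<union> open_arc c s' t'" if "0 \<le> x" "x < c" for x
    using i that l unfolding Un_iff open_arc_iff[OF r(1-4) ne(1)] open_arc_iff[OF r(5-8) ne(2)]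
    using r ne by (auto simp: cw_dist_def split: if_splits)
  moreover have "open_arc c p q \<subseteq> {0..<c}" for p q by (auto simp: open_arc_def)
  ultimately show ?thesis by (intro subset_antisym Un_least subsetI[of "{0..<c}"]) auto
qed

text \<open>Of two arcs of equal length, an arc that starts inside the other outlasts it. This will
  exclude containment.\<close>

lemma equal_arcs_end_inside:
  assumes r: "0 \<le> s" "s < c" "0 \<le> t" "t < c" "0 \<le> s'" "s' < c" "0 \<le> t'" "t' < c"
    and ne: "s \<noteq> t" "s' \<noteq> t'" "s \<noteq> s'" "t \<noteq> t'" "s \<noteq> t'" "s' \<noteq> t"
    and l: "cw_dist c s t = l" "cw_dist c s' t' = l" and i: "s \<in> open_arc c s' t'"
  shows "t' \<in> open_arc c s t"
proof (cases "s < t"; cases "s' < t'")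
qed (use i l r ne in \<open>simp_all add: open_arc_iff[OF r(1-4) ne(1)] open_arc_iff[OF r(5-8) ne(2)] cw_dist_def split: if_splits; linarith\<close>)+

lemma not_in_own_arc: "fst A \<notin> arc_points N A" "snd A \<notin> arc_points N A"
  by (auto simp: arc_points_def open_arc_def cw_dist_def)

lemma extreme_pos_simps [simp]: "extreme_pos As (2 * i) = fst (As ! i)" "extreme_pos As (Suc (2 * i)) = snd (As ! i)"
  by (simp_all add: extreme_pos_def)

lemma extreme_pos_range:
  assumes N: "PCA_model N" and As: "set As = arcs N" and y: "y < 2 * length As"
  shows "0 \<le> extreme_pos As y \<and> extreme_pos As y < circumference N"
proof -
  have "As ! (y div 2) \<in> arcs N" using y As by (metis less_mult_imp_div_less mult.commute nth_mem)
  then have "extreme_pos As y \<in> extremes N" by (auto simp: extreme_pos_def extremes_def)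
  then show ?thesis using N by (auto simp: PCA_model_def)
qed

lemma extreme_pos_inj:
  assumes N: "PCA_model N" and As: "distinct As" "set As = arcs N"
  shows "inj_on (extreme_pos As) {..<2 * length As}"
proof (rule inj_onI)
  fix y z assume yz: "y \<in> {..<2 * length As}" "z \<in> {..<2 * length As}" and eq: "extreme_pos As y = extreme_pos As z"
  have l: "y div 2 < length As" "z div 2 < length As" using yz unfolding lessThan_iff by presburger+
  have m: "As ! (y div 2) \<in> arcs N" "As ! (z div 2) \<in> arcs N" using nth_mem[OF l(1)] nth_mem[OF l(2)] As(2) by simp_all
  have f: "inj_on fst (arcs N)" "inj_on snd (arcs N)" "fst ` arcs N \<inter> snd ` arcs N = {}" using N unfolding PCA_model_def by blast+
  have ne': "fst A \<noteq> snd B" if "A \<in> arcs N" "B \<in> arcs N" for A B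
  proof
    assume "fst A = snd B"
    then have "fst A \<in> fst ` arcs N \<inter> snd ` arcs N" using imageI[OF that(1), of fst] imageI[OF that(2), of snd] by (metis IntI)
    then show False unfolding f(3) by (rule emptyE)
  qed
  note ne = ne'[OF m] ne'[OF m(2,1)]
  have "(even y \<longleftrightarrow> even z) \<and> As ! (y div 2) = As ! (z div 2)"
    using eq ne inj_onD[OF f(1) _ m] inj_onD[OF f(2) _ m]
    unfolding extreme_pos_def by (cases "even y"; cases "even z") simp_all
  then have "even y \<longleftrightarrow> even z" "y div 2 = z div 2" using nth_eq_iff_index_eq[OF As(1) l] by simp_all
  then show "y = z" by presburger
qed

context clockwise_order
begin

text \<open>Realising the clockwise order \<open>os\<close>. Equivalence of models is handled as the
  existence of listings of their arcs that realise one common order.\<close>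

definition sorted_by :: "(nat \<Rightarrow> real) \<Rightarrow> bool" where
  "sorted_by p \<longleftrightarrow> (\<forall>y<2 * n. \<forall>z<2 * n. p y < p z \<longleftrightarrow> pos y < pos z)"

lemma sorted_byD: "sorted_by p \<Longrightarrow> y < 2 * n \<Longrightarrow> z < 2 * n \<Longrightarrow> p y < p z \<longleftrightarrow> pos y < pos z"
  by (simp add: sorted_by_def)

lemma sorted_byI:
  assumes "\<And>y z. y < 2 * n \<Longrightarrow> z < 2 * n \<Longrightarrow> pos y < pos z \<Longrightarrow> p y < p z"
  shows "sorted_by p"
    unfolding sorted_by_def
proof (intro allI impI)
  fix y z assume "y < 2 * n" "z < 2 * n"
  then show "p y < p z \<longleftrightarrow> pos y < pos z"
    using assms[of y z] assms[of z y] pos_inj[of y z] by (cases "pos y" "pos z" rule: linorder_cases) auto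
qed

lemma sorted_by_inj: "sorted_by p \<Longrightarrow> y < 2 * n \<Longrightarrow> z < 2 * n \<Longrightarrow> p y = p z \<longleftrightarrow> y = z"
  using sorted_byD[of p y z] sorted_byD[of p z y] pos_inj[of y z] by fastforce

lemma nth_order:
  assumes "sorted_by p" "j < 2 * n" "k < 2 * n"
  shows "p (os ! j) < p (os ! k) \<longleftrightarrow> j < k"
  using sorted_byD[OF assms(1) nth_less[OF assms(2)] nth_less[OF assms(3)]] pos_nth[OF assms(2)] pos_nth[OF assms(3)] by simp

lemma layout_cong: "(\<And>y. y < 2 * n \<Longrightarrow> p y = p' y) \<Longrightarrow> layout d ds c p \<longleftrightarrow> layout d ds c p'"
  using nth_less nxt_less by (simp add: layout_def pnext_def)

text \<open>Since the order decides which arcs pass 0, equal lengths make the ends a function of the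
  beginnings, \<open>l\<close> and the circumference.\<close>

lemma model_place:
  assumes N: "PCA_model N" and As: "distinct As" "set As = arcs N" "length As = n"
    and s: "sorted_by (extreme_pos As)" and l: "\<And>A. A \<in> arcs N \<Longrightarrow> arc_length N A = l" and y: "y < 2 * n"
  shows "extreme_pos As y = place l (circumference N) (\<lambda>i. fst (As ! i)) y"
proof -
  define i where "i = y div 2"
  have i: "i < n" using y by (simp add: i_def)
  have "cw_dist (circumference N) (fst (As ! i)) (snd (As ! i)) = l" using l[of "As ! i"] nth_mem[of i As] As i by (simp add: arc_length_def)
  from cw_dist_eqD[OF this]
  have t: "snd (As ! i) = fst (As ! i) + l - (if fst (As ! i) \<le> snd (As ! i) then 0 else circumference N)" .
  have "fst (As ! i) < snd (As ! i) \<longleftrightarrow> pos (2 * i) < pos (2 * i + 1)" "fst (As ! i) \<noteq> snd (As ! i)"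
    using sorted_byD[OF s, of "2 * i" "Suc (2 * i)"] sorted_by_inj[OF s, of "2 * i" "Suc (2 * i)"] i by auto
  then have t': "snd (As ! i) = fst (As ! i) + l - of_nat (om i) * circumference N" by (subst t) (auto simp: om_def)
  have "y = 2 * i \<or> y = Suc (2 * i)" unfolding i_def by presburger
  then show ?thesis using t' by auto
qed

lemma gap_cw_dist:
  assumes s: "sorted_by p" and k: "k < 2 * n"
  shows "cw_dist c (p (os ! k)) (p (nxt k)) = pnext c p k - p (os ! k)"
proof (cases "k + 1 < 2 * n")
  case True
  then have "p (os ! k) < p (os ! (k + 1))" using nth_order[OF s] by simp
  then show ?thesis using True by (simp add: cw_dist_def pnext_def nxt_def)
next
  case False
  then have k': "k + 1 = 2 * n" using k by simp
  then have "p (os ! 0) < p (os ! k)" using nth_order[OF s, of 0 k] n_pos k by simp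
  then show ?thesis using k' n_pos by (simp add: cw_dist_def pnext_def nxt_def)
qed

lemma model_extremes:
  assumes "set As = arcs N" "length As = n"
  shows "extremes N = extreme_pos As ` {..<2 * n}"
proof -
  have "extremes N = (\<Union>i<n. {fst (As ! i), snd (As ! i)})"
    unfolding extremes_def assms(1)[symmetric] set_conv_nth assms(2) by blast
  also have "\<dots> = (\<Union>i<n. {extreme_pos As (2 * i), extreme_pos As (Suc (2 * i))})" by simp
  also have "\<dots> = extreme_pos As ` (\<Union>i<n. {2 * i, Suc (2 * i)})" by blast
  also have "(\<Union>i<n. {2 * i, Suc (2 * i)}) = {..<2 * n}"
  proof safe
    fix y assume "y < 2 * n"
    then have "y div 2 < n" "y \<in> {2 * (y div 2), Suc (2 * (y div 2))}" by auto
    then show "y \<in> (\<Union>i<n. {2 * i, Suc (2 * i)})" by blast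
  qed auto
  finally show ?thesis .
qed

lemma consecutive_nth:
  assumes N: "PCA_model N" and As: "distinct As" "set As = arcs N" "length As = n"
    and s: "sorted_by (extreme_pos As)" and k: "k < 2 * n"
  shows "consecutive N (extreme_pos As (os ! k)) (extreme_pos As (nxt k))"
proof -
  let ?p = "extreme_pos As" and ?c = "circumference N"
  have ext: "extremes N = ?p ` {..<2 * n}" by (rule model_extremes[OF As(2,3)])
  have r: "0 \<le> ?p y" "?p y < ?c" if "y < 2 * n" for y using extreme_pos_range[OF N As(2)] that As(3) by auto
  have "(k + 1) mod (2 * n) \<noteq> k"
  proof (cases "k + 1 < 2 * n")
    case False
    then have e: "k + 1 = 2 * n" using k by simp
    then have "0 < k" using n_pos by presburger
    then show ?thesis using e by simp
  qed simp
  then have "pos (nxt k) \<noteq> pos (os ! k)" using pos_nth k n_pos by (simp add: nxt_def)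
  then have ne: "?p (os ! k) \<noteq> ?p (nxt k)" using sorted_by_inj[OF s nth_less[OF k] nxt_less[of k]] by auto
  have "?p y \<notin> open_arc ?c (?p (os ! k)) (?p (nxt k))" if y: "y < 2 * n" for y
  proof
    assume i: "?p y \<in> open_arc ?c (?p (os ! k)) (?p (nxt k))"
    have y': "?p y = ?p (os ! pos y)" "pos y < 2 * n" using nth_pos[OF y] by auto
    show False
    proof (cases "k + 1 < 2 * n")
      case True
      then have nx: "nxt k = os ! (k + 1)" "?p (os ! k) < ?p (nxt k)" using nth_order[OF s] by (auto simp: nxt_def)
      have "?p (os ! k) < ?p y" "?p y < ?p (nxt k)"
        using i nx(2) unfolding open_arc_iff[OF r[OF nth_less[OF k]] r[OF nxt_less[of k]] ne] by auto
      then show False unfolding y'(1) nx(1) using nth_order[OF s] y'(2) True k by simp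
    next
      case False
      then have "k + 1 = 2 * n" using k by simp
      then have nx: "nxt k = os ! 0" "k = 2 * n - 1" by (auto simp: nxt_def)
      have "\<not> ?p (os ! k) < ?p (nxt k)" unfolding nx(1) using nth_order[OF s k, of 0] n_pos by simp
      then have "?p (os ! k) < ?p y \<or> ?p y < ?p (nxt k)"
        using i unfolding open_arc_iff[OF r[OF nth_less[OF k]] r[OF nxt_less[of k]] ne] by auto
      then show False unfolding y'(1) nx(1) using nth_order[OF s k y'(2)] nth_order[OF s y'(2), of 0] y'(2) nx(2) n_pos by auto
    qed
  qed
  then show ?thesis using ne nth_less[OF k] nxt_less[of k] unfolding consecutive_def ext by auto
qed

lemma model_layout:
  assumes N: "u_CA_model (c, l, d, ds) N" and As: "distinct As" "set As = arcs N" "length As = n"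
    and s: "sorted_by (extreme_pos As)"
  shows "layout d ds c (place l c (\<lambda>i. fst (As ! i)))"
proof -
  let ?p = "extreme_pos As"
  have P: "PCA_model N" and c: "circumference N = c" and l: "\<And>A. A \<in> arcs N \<Longrightarrow> arc_length N A = l"
    and g: "\<And>p q. consecutive N p q \<Longrightarrow> d \<le> cw_dist c p q"
    and st: "\<And>A B. A \<in> arcs N \<Longrightarrow> B \<in> arcs N \<Longrightarrow> A \<noteq> B \<Longrightarrow> d + ds \<le> cw_dist c (fst A) (fst B)"
    using N by auto
  have "layout d ds c ?p"
    unfolding layout_def
  proof (intro conjI allI impI)
    fix k assume k: "k < 2 * n"
    show "?p (os ! k) + d \<le> pnext c ?p k"
      using g[OF consecutive_nth[OF P As s k]] gap_cw_dist[OF s k, of c] by simp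
  next
    fix i j assume "i < n" "j < n" "i \<noteq> j"
    then have "As ! i \<in> arcs N" "As ! j \<in> arcs N" "As ! i \<noteq> As ! j"
      using As nth_mem[of i As] nth_mem[of j As] nth_eq_iff_index_eq[of As i j] by simp_all
    then show "d + ds \<le> cw_dist c (?p (2 * i)) (?p (2 * j))" using st by simp
  qed
  then show ?thesis using layout_cong[of ?p "place l c (\<lambda>i. fst (As ! i))"] model_place[OF P As s l] c by simp
qed

text \<open>Every model with equal arcs is a solution for \<open>ds = 0\<close>, with its smallest
  gap as \<open>d0\<close>. This provides the reference point from the input.\<close>

lemma model_small_layout:
  assumes N: "PCA_model N" and As: "distinct As" "set As = arcs N" "length As = n"
    and s: "sorted_by (extreme_pos As)" and l: "\<And>A. A \<in> arcs N \<Longrightarrow> arc_length N A = l"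
  obtains d0 where "0 < d0" "layout d0 0 (circumference N) (place l (circumference N) (\<lambda>i. fst (As ! i)))"
proof -
  let ?p = "extreme_pos As" and ?c = "circumference N"
  have r: "0 \<le> ?p y" "?p y < ?c" if "y < 2 * n" for y using extreme_pos_range[OF N As(2)] that As(3) by auto
  define G where "G = (\<lambda>k. pnext ?c ?p k - ?p (os ! k)) ` {..<2 * n}"
  have G: "finite G" "G \<noteq> {}" using n_pos by (auto simp: G_def lessThan_empty_iff)
  have pos: "0 < g" if "g \<in> G" for g
  proof -
    obtain k where k: "k < 2 * n" "g = pnext ?c ?p k - ?p (os ! k)" using \<open>g \<in> G\<close> by (auto simp: G_def)
    show ?thesis
    proof (cases "k + 1 < 2 * n")
      case True
      then show ?thesis using nth_order[OF s, of k "k + 1"] k by (simp add: pnext_simps)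
    next
      case False
      then have "k = 2 * n - 1" using k by simp
      then have "pnext ?c ?p k = ?p (os ! 0) + ?c" using pnext_simps(2) by simp
      then show ?thesis using r[OF nth_less[of 0]] r[OF nth_less[OF k(1)]] n_pos k by simp
    qed
  qed
  define d0 where "d0 = Min G"
  have d0: "0 < d0" unfolding d0_def using G pos by simp
  have g: "?p (os ! k) + d0 \<le> pnext ?c ?p k" if "k < 2 * n" for k
  proof -
    have "d0 \<le> pnext ?c ?p k - ?p (os ! k)" unfolding d0_def by (rule Min_le[OF G(1)]) (use that in \<open>auto simp: G_def\<close>)
    then show ?thesis by simp
  qed
  have "layout d0 0 ?c ?p"
    unfolding layout_def
  proof (intro conjI allI impI)
    fix i j assume ij: "i < n" "j < n" "i \<noteq> j"
    have w: "?p (2 * i) + d0 \<le> ?p (2 * j) + ?c" using chain_codes(2)[OF g less_imp_le[OF d0], of "2 * i" "2 * j"] ij by simp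
    show "d0 + 0 \<le> cw_dist ?c (?p (2 * i)) (?p (2 * j))"
    proof (cases "pos (2 * i) < pos (2 * j)")
      case True
      then show ?thesis using chain_codes(1)[OF g less_imp_le[OF d0], of "2 * i" "2 * j"] ij d0 by (simp add: cw_dist_def)
    next
      case False
      then have "\<not> ?p (2 * i) < ?p (2 * j)" "?p (2 * i) \<noteq> ?p (2 * j)"
        using sorted_byD[OF s, of "2 * i" "2 * j"] sorted_by_inj[OF s, of "2 * i" "2 * j"] ij by (simp_all del: extreme_pos_simps)
      then show ?thesis using w by (simp add: cw_dist_def)
    qed
  qed (rule g)
  then show ?thesis
    using that[OF d0] layout_cong[of ?p "place l ?c (\<lambda>i. fst (As ! i))"] model_place[OF N As s l] by simp
qed

text \<open>Membership of an extreme in an open arc, expressed by the order and hence common to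
  equivalent models.\<close>

definition inside :: "nat \<Rightarrow> nat \<Rightarrow> bool" where
  "inside y j \<longleftrightarrow> (if pos (2 * j) < pos (2 * j + 1) then pos (2 * j) < pos y \<and> pos y < pos (2 * j + 1)
     else pos (2 * j) < pos y \<or> pos y < pos (2 * j + 1))"

lemma inside_iff:
  assumes s: "sorted_by p" and r: "\<And>y. y < 2 * n \<Longrightarrow> 0 \<le> p y \<and> p y < c" and "y < 2 * n" "j < n"
  shows "p y \<in> open_arc c (p (2 * j)) (p (2 * j + 1)) \<longleftrightarrow> inside y j"
proof -
  have j: "2 * j < 2 * n" "2 * j + 1 < 2 * n" using assms by auto
  have "p (2 * j) \<noteq> p (2 * j + 1)" using sorted_by_inj[OF s j] by simp
  then show ?thesis
    using open_arc_iff[of "p (2 * j)" c "p (2 * j + 1)" "p y"] r[OF j(1)] r[OF j(2)] r[OF assms(3)]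
      sorted_byD[OF s j] sorted_byD[OF s j(1) assms(3)] sorted_byD[OF s assms(3) j(2)]
    by (simp add: inside_def)
qed

text \<open>Turns the covering condition of the input into one on the order, in which form it passes
  to the output.\<close>

lemma model_inside:
  assumes N: "PCA_model N" and As: "distinct As" "set As = arcs N" "length As = n"
    and s: "sorted_by (extreme_pos As)" and l: "\<And>A. A \<in> arcs N \<Longrightarrow> arc_length N A = l"
    and ij: "i < n" "j < n" "i \<noteq> j"
  shows "\<not> (inside (2 * i) j \<and> inside (2 * i + 1) j)"
proof
  let ?p = "extreme_pos As" and ?c = "circumference N"
  assume *: "inside (2 * i) j \<and> inside (2 * i + 1) j"
  have r: "0 \<le> ?p y \<and> ?p y < ?c" if "y < 2 * n" for y using extreme_pos_range[OF N As(2)] that As(3) by auto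
  have b: "2 * i < 2 * n" "2 * i + 1 < 2 * n" "2 * j < 2 * n" "2 * j + 1 < 2 * n" using ij by auto
  have m: "As ! i \<in> arcs N" "As ! j \<in> arcs N" "As ! i \<noteq> As ! j"
    using As ij nth_mem[of i As] nth_mem[of j As] nth_eq_iff_index_eq[of As i j] by simp_all
  have in': "?p (2 * i) \<in> open_arc ?c (?p (2 * j)) (?p (2 * j + 1))" "?p (2 * i + 1) \<in> open_arc ?c (?p (2 * j)) (?p (2 * j + 1))"
    using * inside_iff[OF s r b(1) ij(2)] inside_iff[OF s r b(2) ij(2)] by auto
  have ne: "?p y \<noteq> ?p z" if "y < 2 * n" "z < 2 * n" "y \<noteq> z" for y z using sorted_by_inj[OF s that(1,2)] that(3) by simp
  have "open_arc ?c (?p (2 * i)) (?p (2 * i + 1)) \<union> open_arc ?c (?p (2 * j)) (?p (2 * j + 1)) = {0..<?c}"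
  proof (rule equal_arcs_cover[OF _ _ _ _ _ _ _ _ _ _ _ _ _ _ _ _ in'])
    show "cw_dist ?c (?p (2 * i)) (?p (2 * i + 1)) = l" "cw_dist ?c (?p (2 * j)) (?p (2 * j + 1)) = l"
      using l m by (simp_all add: arc_length_def)
    show "?p (2 * i) \<noteq> ?p (2 * i + 1)" "?p (2 * j) \<noteq> ?p (2 * j + 1)" "?p (2 * i) \<noteq> ?p (2 * j)" by (rule ne; use b ij in simp)+
    show "?p (2 * i + 1) \<noteq> ?p (2 * j + 1)" by (rule ne; use b ij in simp)
    show "?p (2 * i) \<noteq> ?p (2 * j + 1)" "?p (2 * j) \<noteq> ?p (2 * i + 1)" by (rule ne[OF b(1) b(4)] ne[OF b(3) b(2)]; presburger)+
  qed (use r[OF b(1)] r[OF b(2)] r[OF b(3)] r[OF b(4)] in auto)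
  then have "arc_points N (As ! i) \<union> arc_points N (As ! j) = {0..<?c}" by (simp add: arc_points_def)
  then show False using N m by (auto simp: PCA_model_def)
qed

definition build :: "real \<Rightarrow> (nat \<Rightarrow> real) \<Rightarrow> model" where
  "build c p = \<lparr>circumference = c, arcs = {(p (2 * i), p (2 * i + 1)) | i. i < n}\<rparr>"

lemma build_simps [simp]: "circumference (build c p) = c" "arcs (build c p) = {(p (2 * i), p (2 * i + 1)) | i. i < n}"
  by (simp_all add: build_def)

text \<open>The distances come from the layout. Two arcs covering the circle would contain both
  extremes of one in the other, against \<open>ins\<close>; containment fails because the arcs are
  equally long.\<close>

theorem build_model:
  assumes d: "0 < d" "0 \<le> ds" and lay: "layout d ds c p" and p0: "p (os ! 0) = 0"
    and len_l: "\<And>i. i < n \<Longrightarrow> p (2 * i + 1) = p (2 * i) + l - of_nat (om i) * c"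
    and ins: "\<And>i j. i < n \<Longrightarrow> j < n \<Longrightarrow> i \<noteq> j \<Longrightarrow> \<not> (inside (2 * i) j \<and> inside (2 * i + 1) j)"
  shows "u_CA_model (c, l, d, ds) (build c p)" "sorted_by p"
proof -
  let ?N = "build c p"
  have g: "p (os ! k) + d \<le> pnext c p k" if "k < 2 * n" for k using lay that by (simp add: layout_def)
  have ch: "pos y < pos z \<Longrightarrow> p y + d \<le> p z" "p y + d \<le> p z + c" if "y < 2 * n" "z < 2 * n" for y z
    using chain_codes[OF g less_imp_le[OF d(1)] that] by simp_all
  show s: "sorted_by p" by (rule sorted_byI) (use ch(1) d(1) in fastforce)
  have sep: "p y + d \<le> p z" if "y < 2 * n" "z < 2 * n" "p y < p z" for y z
    using ch(1)[OF that(1,2)] sorted_byD[OF s that(1,2)] that(3) by blast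
  have z0: "os ! 0 < 2 * n" using nth_less[of 0] n_pos by simp
  have r: "0 \<le> p y" "p y + d \<le> c" if "y < 2 * n" for y
    using ch(1)[OF z0 that] ch(2)[OF that z0] p0 pos_nth[of 0] n_pos d(1) nth_pos[OF that] by (cases "pos y = 0", auto)
  have r': "0 \<le> p y \<and> p y < c" if "y < 2 * n" for y using r[OF that] d(1) by auto
  have c: "0 < c" using r'[OF z0] by simp
  have ne: "p y \<noteq> p z" if "y < 2 * n" "z < 2 * n" "y \<noteq> z" for y z using sorted_by_inj[OF s that(1,2)] that(3) by simp
  have bnd: "2 * i < 2 * n" "2 * i + 1 < 2 * n" if "i < n" for i using that by auto
  have ll: "cw_dist c (p (2 * i)) (p (2 * i + 1)) = l" if i: "i < n" for i
  proof -
    have "p (2 * i) < p (2 * i + 1) \<longleftrightarrow> pos (2 * i) < pos (2 * i + 1)" "p (2 * i) \<noteq> p (2 * i + 1)"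
      using sorted_byD[OF s bnd[OF i]] ne[OF bnd[OF i]] by auto
    then show ?thesis using len_l[OF i] by (auto simp: cw_dist_def om_def)
  qed
  have l: "d \<le> l"
  proof -
    have "d \<le> cw_dist c (p (2 * 0)) (p (2 * 0 + 1))"
      using sep[OF bnd[OF n_pos]] ch(2)[OF bnd[OF n_pos]] ne[OF bnd[OF n_pos]] by (auto simp: cw_dist_def)
    then show ?thesis using ll[OF n_pos] by simp
  qed
  have ext: "extremes ?N = p ` {..<2 * n}"
  proof -
    have "extremes ?N = p ` (\<Union>i<n. {2 * i, Suc (2 * i)})" by (force simp: extremes_def)
    also have "(\<Union>i<n. {2 * i, Suc (2 * i)}) = {..<2 * n}"
    proof safe
      fix y assume "y < 2 * n"
      then have "y div 2 < n" "y \<in> {2 * (y div 2), Suc (2 * (y div 2))}" by auto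
      then show "y \<in> (\<Union>i<n. {2 * i, Suc (2 * i)})" by blast
    qed auto
    finally show ?thesis .
  qed
  have pca: "PCA_model ?N"
    unfolding PCA_model_def
  proof (intro conjI ballI impI)
    show "0 < circumference ?N" using c by simp
    show "finite (arcs ?N)" by simp
    show "extremes ?N \<subseteq> {0..<circumference ?N}" unfolding ext using r' by auto
    have inj: "p (2 * i) = p (2 * j) \<Longrightarrow> i = j" "p (2 * i + 1) = p (2 * j + 1) \<Longrightarrow> i = j" "p (2 * i) \<noteq> p (2 * j + 1)"
      if "i < n" "j < n" for i j
    proof -
      show "p (2 * i) = p (2 * j) \<Longrightarrow> i = j" using ne[OF bnd(1)[OF that(1)] bnd(1)[OF that(2)]] by (cases "i = j") simp_all
      show "p (2 * i + 1) = p (2 * j + 1) \<Longrightarrow> i = j" using ne[OF bnd(2)[OF that(1)] bnd(2)[OF that(2)]] by (cases "i = j") simp_all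
      show "p (2 * i) \<noteq> p (2 * j + 1)" by (rule ne[OF bnd(1)[OF that(1)] bnd(2)[OF that(2)]]) presburger
    qed
    show "inj_on fst (arcs ?N)"
    proof (rule inj_onI)
      fix A B assume "A \<in> arcs ?N" "B \<in> arcs ?N" and eq: "fst A = fst B"
      then obtain i j where ij: "A = (p (2 * i), p (2 * i + 1))" "B = (p (2 * j), p (2 * j + 1))" "i < n" "j < n" by auto
      then show "A = B" using inj(1)[OF ij(3,4)] eq by simp
    qed
    show "inj_on snd (arcs ?N)"
    proof (rule inj_onI)
      fix A B assume "A \<in> arcs ?N" "B \<in> arcs ?N" and eq: "snd A = snd B"
      then obtain i j where ij: "A = (p (2 * i), p (2 * i + 1))" "B = (p (2 * j), p (2 * j + 1))" "i < n" "j < n" by auto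
      then show "A = B" using inj(2)[OF ij(3,4)] eq by simp
    qed
    show "fst ` arcs ?N \<inter> snd ` arcs ?N = {}" using inj(3) by auto
    fix A B assume "A \<in> arcs ?N" "B \<in> arcs ?N" "A \<noteq> B"
    then obtain i j where ij: "A = (p (2 * i), p (2 * i + 1))" "B = (p (2 * j), p (2 * j + 1))" "i < n" "j < n" "i \<noteq> j" by auto
    note bi = bnd[OF ij(3)] and bj = bnd[OF ij(4)]
    have AB: "arc_points ?N A = open_arc c (p (2 * i)) (p (2 * i + 1))" "arc_points ?N B = open_arc c (p (2 * j)) (p (2 * j + 1))"
      by (simp_all add: arc_points_def ij)
    have nes: "p (2 * i) \<noteq> p (2 * i + 1)" "p (2 * j) \<noteq> p (2 * j + 1)" "p (2 * i) \<noteq> p (2 * j)" "p (2 * i + 1) \<noteq> p (2 * j + 1)"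
      "p (2 * i) \<noteq> p (2 * j + 1)" "p (2 * j) \<noteq> p (2 * i + 1)"
      using ne[OF bi(1) bi(2)] ne[OF bj(1) bj(2)] ne[OF bi(1) bj(1)] ne[OF bi(2) bj(2)] ne[OF bi(1) bj(2)] ne[OF bj(1) bi(2)] ij(5)
      by (presburger | simp)+
    show "arc_points ?N A \<union> arc_points ?N B \<noteq> {0..<circumference ?N}"
    proof
      assume cov: "arc_points ?N A \<union> arc_points ?N B = {0..<circumference ?N}"
      have "p (2 * i) \<in> arc_points ?N B" "p (2 * i + 1) \<in> arc_points ?N B"
      proof -
        have "p (2 * i) \<in> arc_points ?N A \<union> arc_points ?N B" "p (2 * i + 1) \<in> arc_points ?N A \<union> arc_points ?N B"
          unfolding cov using r'[OF bi(1)] r'[OF bi(2)] by simp_all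
        moreover have "p (2 * i) \<notin> arc_points ?N A" "p (2 * i + 1) \<notin> arc_points ?N A"
          using not_in_own_arc[of A ?N] unfolding ij(1) fst_conv snd_conv by blast+
        ultimately show "p (2 * i) \<in> arc_points ?N B" "p (2 * i + 1) \<in> arc_points ?N B" by blast+
      qed
      then show False using ins[OF ij(3,4,5)] inside_iff[OF s r' bi(1) ij(4)] inside_iff[OF s r' bi(2) ij(4)] unfolding AB by simp
    qed
    show "\<not> arc_points ?N A \<subseteq> arc_points ?N B"
    proof
      assume sub: "arc_points ?N A \<subseteq> arc_points ?N B"
      \<comment> \<open>A point of \<open>A\<close> before the next extreme, as distinct extremes
        are at least \<open>d\<close> apart. Containment puts it, and then the beginning of
        \<open>A\<close>, inside \<open>B\<close>; hence the end of \<open>B\<close> is inside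
        \<open>A\<close> and would lie in its own arc.\<close>
      define x where "x = p (2 * i) + d / 2"
      note oA = open_arc_iff[OF r'[OF bi(1), THEN conjunct1] r'[OF bi(1), THEN conjunct2] r'[OF bi(2), THEN conjunct1] r'[OF bi(2), THEN conjunct2] nes(1)]
        and oB = open_arc_iff[OF r'[OF bj(1), THEN conjunct1] r'[OF bj(1), THEN conjunct2] r'[OF bj(2), THEN conjunct1] r'[OF bj(2), THEN conjunct2] nes(2)]
      have x: "0 \<le> x" "x < c" using r[OF bi(1)] d(1) by (auto simp: x_def)
      have "x \<in> arc_points ?N A" unfolding AB oA using x sep[OF bi] d(1) by (auto simp: x_def)
      then have "x \<in> arc_points ?N B" using sub by blast
      moreover have "p (2 * j) < x \<Longrightarrow> p (2 * j) < p (2 * i)"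
        using sep[OF bi(1) bj(1)] nes(3) d(1) by (auto simp: x_def intro: ccontr)
      moreover have "x < p (2 * j + 1) \<Longrightarrow> p (2 * i) < p (2 * j + 1)" using d(1) by (simp add: x_def)
      ultimately have inB: "p (2 * i) \<in> open_arc c (p (2 * j)) (p (2 * j + 1))" unfolding AB oB using r'[OF bi(1)] by (simp split: if_splits) blast
      have "p (2 * j + 1) \<in> arc_points ?N A"
        unfolding AB by (rule equal_arcs_end_inside[OF _ _ _ _ _ _ _ _ nes ll[OF ij(3)] ll[OF ij(4)] inB])
          (use r'[OF bi(1)] r'[OF bi(2)] r'[OF bj(1)] r'[OF bj(2)] in blast)+
      then show False using sub not_in_own_arc(2)[of B ?N] unfolding ij(2) snd_conv by blast
    qed
  qed
  have cons: "d \<le> cw_dist c a b" if co: "consecutive ?N a b" for a b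
  proof -
    obtain y z where yz: "a = p y" "b = p z" "y < 2 * n" "z < 2 * n" "a \<noteq> b" using co unfolding consecutive_def ext by blast
    show ?thesis using sep[OF yz(3,4)] ch(2)[OF yz(3,4)] yz(5) unfolding yz(1,2) cw_dist_def by (cases "p y < p z") auto
  qed
  have len: "arc_length ?N A = l" if A: "A \<in> arcs ?N" for A
  proof -
    obtain i where "A = (p (2 * i), p (2 * i + 1))" "i < n" using A by auto
    then show ?thesis using ll by (simp add: arc_length_def)
  qed
  have st: "d + ds \<le> cw_dist c (fst A) (fst B)" if AB: "A \<in> arcs ?N" "B \<in> arcs ?N" "A \<noteq> B" for A B
  proof -
    obtain i j where ij: "A = (p (2 * i), p (2 * i + 1))" "B = (p (2 * j), p (2 * j + 1))" "i < n" "j < n" using AB(1,2) by auto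
    then have "i \<noteq> j" using AB(3) by auto
    then show ?thesis using lay ij by (simp add: layout_def)
  qed
  have "0 < l" using l d by simp
  moreover have "circumference ?N = c" by simp
  ultimately show "u_CA_model (c, l, d, ds) ?N"
    unfolding u_CA_model.simps UCA_descriptor.simps using c d pca len cons st by blast
qed

end

section \<open>Building the constraint graph\<close>

abbreviation "half x \<equiv> IDiv (V x) (IConst 2)"
abbreviation "parity x \<equiv> IMod (V x) (IConst 2)"

text \<open>\<open>om\<close> of an arc is decided when its end is met: it is 1 unless
  \<open>ss\<close> records that the beginning was seen before. Afterwards \<open>ls\<close> holds
  the last beginning of the list.\<close>

definition scan_step :: com where
  "scan_step = Seq (iset ''x'' (ILoad ''order'' (V ''k'')))
     (If (ILess (parity ''x'') (IConst 1))
       (Seq (IStore ''ss'' (half ''x'') (IConst 1)) (iset ''ls'' (half ''x'')))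
       (IStore ''om'' (half ''x'') (ISub (IConst 1) (ILoad ''ss'' (half ''x'')))))"

definition scan :: com where "scan = FOR ''k'' (IMul (IConst 2) (V ''n'')) scan_step"

definition gap_store :: com where
  "gap_store =
     Seq (IStore ''eu'' (V ''k'') (half ''x''))
    (Seq (IStore ''ev'' (V ''k'') (half ''y''))
    (Seq (RStore ''el'' (V ''k'') (RSub (ROfIdx (parity ''x'')) (ROfIdx (parity ''y''))))
    (Seq (RStore ''ek'' (V ''k'') (RSub (RAdd (ROfIdx (IDiv (IAdd (V ''k'') (IConst 1)) (IMul (IConst 2) (V ''n''))))
        (ROfIdx (IMul (parity ''x'') (ILoad ''om'' (half ''x''))))) (ROfIdx (IMul (parity ''y'') (ILoad ''om'' (half ''y''))))))
     (RStore ''eb'' (V ''k'') (RConst 0)))))"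

definition start_store :: com where
  "start_store =
     Seq (IStore ''eu'' (IAdd (IMul (IConst 2) (V ''n'')) (half ''x'')) (V ''pv''))
    (Seq (IStore ''ev'' (IAdd (IMul (IConst 2) (V ''n'')) (half ''x'')) (half ''x''))
    (Seq (RStore ''el'' (IAdd (IMul (IConst 2) (V ''n'')) (half ''x'')) (RConst 0))
    (Seq (RStore ''ek'' (IAdd (IMul (IConst 2) (V ''n'')) (half ''x'')) (ROfIdx (V ''pk'')))
    (Seq (RStore ''eb'' (IAdd (IMul (IConst 2) (V ''n'')) (half ''x'')) (ROfIdx (V ''bb'')))
    (Seq (iset ''pv'' (half ''x'')) (iset ''pk'' (IConst 0)))))))"

definition edge_step :: com where
  "edge_step = Seq (iset ''x'' (ILoad ''order'' (V ''k'')))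
    (Seq (iset ''y'' (ILoad ''order'' (IMod (IAdd (V ''k'') (IConst 1)) (IMul (IConst 2) (V ''n'')))))
    (Seq gap_store (If (ILess (parity ''x'') (IConst 1)) start_store Skip)))"

text \<open>\<open>pv\<close> and \<open>pk\<close> track \<open>pst\<close> and \<open>pfl\<close>.
  At position 0 the preceding beginning is the last one of the list, one turn earlier.\<close>

definition edge_init :: com where
  "edge_init = Seq (iset ''pv'' (V ''ls'')) (Seq (iset ''pk'' (IConst 1))
     (If (ILess (V ''n'') (IConst 2)) (iset ''bb'' (IConst 0)) (iset ''bb'' (IConst 1))))"

definition edges :: com where "edges = FOR ''k'' (IMul (IConst 2) (V ''n'')) edge_step"

definition setup_graph :: com where "setup_graph = Seq scan (Seq edge_init edges)"

lemmas setup_defs = scan_step_def scan_def gap_store_def start_store_def edge_step_def edge_init_def edges_def setup_graph_def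

lemma mods_setup: "imods setup_graph = {''k'', ''x'', ''y'', ''ss'', ''ls'', ''om'', ''eu'', ''ev'', ''pv'', ''pk'', ''bb''}"
  "rmods setup_graph = {''el'', ''ek'', ''eb''}"
  unfolding setup_defs by auto

text \<open>The cubic word bound accommodates the Stern-Brocot entries, whose sum can reach
  \<open>48 * n ^ 3 + 2\<close>.\<close>

locale clockwise_machine = clockwise_order +
  fixes W S :: nat
  assumes S_large: "n * n + 5 * n + 10 \<le> S" and W_cube: "100 * n ^ 3 + 100 \<le> W"
begin

lemma n_le_cube: "n \<le> n ^ 3"
  using power_increasing[of 1 3 n] n_pos by simp

sublocale qgraph n "3 * n" g_src g_dst g_kp g_lm g_bt W S
  by unfold_locales (use S_large W_cube n_le_cube in auto)

definition listed :: "state \<Rightarrow> bool" where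
  "listed \<sigma> \<longleftrightarrow> idx \<sigma> ''n'' 0 = n \<and> (\<forall>k<2 * n. idx \<sigma> ''order'' k = os ! k)"

definition scanned :: "nat \<Rightarrow> state \<Rightarrow> bool" where
  "scanned i \<sigma> \<longleftrightarrow> listed \<sigma> \<and> (\<forall>a<n. idx \<sigma> ''ss'' a = (if pos (2 * a) < i then 1 else 0)) \<and>
     (\<forall>a<n. pos (Suc (2 * a)) < i \<longrightarrow> idx \<sigma> ''om'' a = om a) \<and> (pfl i = 0 \<longrightarrow> idx \<sigma> ''ls'' 0 = pst i)"

lemma pos_less_Suc: "y < 2 * n \<Longrightarrow> i < 2 * n \<Longrightarrow> pos y < Suc i \<longleftrightarrow> pos y < i \<or> y = os ! i"
  using pos_nth[of i] nth_pos[of y] by (auto simp: less_Suc_eq)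

lemma ok_scan_step:
  assumes I: "scanned i \<sigma>" and i: "i < 2 * n" "idx \<sigma> ''k'' 0 = i"
  shows "ok W S scan_step \<sigma> 4 (\<lambda>\<sigma>'. idx \<sigma>' ''k'' 0 = i \<and> scanned (Suc i) \<sigma>')"
proof -
  have o: "idx \<sigma> ''order'' i = os ! i" and nn: "idx \<sigma> ''n'' 0 = n" using I i by (auto simp: scanned_def listed_def)
  have x: "os ! i < 2 * n" "os ! i div 2 < n" using nth_less[OF i(1)] by auto
  have b: "os ! i < W" "os ! i div 2 < W" "i < S" "os ! i div 2 < S" using x i S_large W_large by auto
  have less: "pos (2 * a) < Suc i \<longleftrightarrow> pos (2 * a) < i \<or> 2 * a = os ! i" "pos (Suc (2 * a)) < Suc i \<longleftrightarrow> pos (Suc (2 * a)) < i \<or> Suc (2 * a) = os ! i"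
    if "a < n" for a using pos_less_Suc[of "2 * a" i] pos_less_Suc[of "Suc (2 * a)" i] that i by auto
  have "wp W S scan_step (\<lambda>\<sigma>'. idx \<sigma>' ''k'' 0 = i \<and> scanned (Suc i) \<sigma>') \<sigma>"
  proof (cases "even (os ! i)")
    case True
    then obtain a where a: "os ! i = 2 * a" "a < n" using x by (auto elim: evenE)
    have ne: "Suc (2 * a') \<noteq> 2 * a" for a' by presburger
    define \<tau> where "\<tau> = \<sigma>\<lparr>idx := (idx \<sigma>)(''x'' := (idx \<sigma> ''x'')(0 := 2 * a), ''ss'' := (idx \<sigma> ''ss'')(a := 1), ''ls'' := (idx \<sigma> ''ls'')(0 := a))\<rparr>"
    have "scanned (Suc i) \<tau>"
      using I a less ne by (auto simp: scanned_def listed_def \<tau>_def pst_Suc pfl_Suc)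
    then show ?thesis using a b i o by (simp add: scan_step_def \<tau>_def)
  next
    case False
    then obtain a where a: "os ! i = Suc (2 * a)" "a < n" using x by (auto elim: oddE)
    have ne: "2 * a' \<noteq> Suc (2 * a)" for a' by presburger
    define \<tau> where "\<tau> = \<sigma>\<lparr>idx := (idx \<sigma>)(''x'' := (idx \<sigma> ''x'')(0 := Suc (2 * a)), ''om'' := (idx \<sigma> ''om'')(a := 1 - idx \<sigma> ''ss'' a))\<rparr>"
    have "pos (Suc (2 * a)) = i" using pos_nth[OF i(1)] a by simp
    then have "om a = 1 - idx \<sigma> ''ss'' a" using I a by (simp add: scanned_def om_def)
    then have "scanned (Suc i) \<tau>"
      using I a less ne by (auto simp: scanned_def listed_def \<tau>_def pst_Suc pfl_Suc)
    moreover have "1 - idx \<sigma> ''ss'' a < W" using W_large by simp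
    ultimately show ?thesis using a b i o by (simp add: scan_step_def \<tau>_def)
  qed
  from ok_wp[OF this] show ?thesis by (rule ok_mono) (auto simp: scan_step_def)
qed

lemma ok_scan:
  assumes "listed \<sigma>" "\<And>a. idx \<sigma> ''ss'' a = 0"
  shows "ok W S scan \<sigma> (2 * n * (4 + 2) + 2) (scanned (2 * n))"
  unfolding scan_def
proof (rule ok_FOR[where I = scanned])
  show "scanned 0 \<sigma>" using assms by (auto simp: scanned_def pfl_def before_def)
  show "2 * n < W" "0 < S" using W_large S_large by auto
  show "scanned i (\<sigma>\<lparr>idx := (idx \<sigma>)(''k'' := f)\<rparr>)" if "scanned i \<sigma>" for i \<sigma> f
    using that by (auto simp: scanned_def listed_def)
  show "isafe S \<sigma> (IMul (IConst 2) (V ''n'')) \<and> ival \<sigma> (IMul (IConst 2) (V ''n'')) = 2 * n" if "scanned i \<sigma>" for i \<sigma>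
    using that S_large by (auto simp: scanned_def listed_def)
qed (use ok_scan_step in auto)

definition edge_ok :: "state \<Rightarrow> nat \<Rightarrow> bool" where
  "edge_ok \<sigma> e \<longleftrightarrow> idx \<sigma> ''eu'' e = g_src e \<and> idx \<sigma> ''ev'' e = g_dst e \<and>
     rats \<sigma> ''ek'' e = of_int (g_kp e) \<and> rats \<sigma> ''el'' e = of_int (g_lm e) \<and> rats \<sigma> ''eb'' e = of_int (g_bt e)"

definition edged :: "nat \<Rightarrow> state \<Rightarrow> bool" where
  "edged i \<sigma> \<longleftrightarrow> listed \<sigma> \<and> (\<forall>a<n. idx \<sigma> ''om'' a = om a) \<and> idx \<sigma> ''bb'' 0 = (if n < 2 then 0 else 1) \<and>
     idx \<sigma> ''pv'' 0 = pst i \<and> idx \<sigma> ''pk'' 0 = pfl i \<and> (\<forall>e<i. edge_ok \<sigma> e) \<and> (\<forall>a<n. pos (2 * a) < i \<longrightarrow> edge_ok \<sigma> (2 * n + a))"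

lemma ok_edge_step:
  assumes I: "edged i \<sigma>" and i: "i < 2 * n" "idx \<sigma> ''k'' 0 = i"
  shows "ok W S edge_step \<sigma> 15 (\<lambda>\<sigma>'. idx \<sigma>' ''k'' 0 = i \<and> edged (Suc i) \<sigma>')"
proof -
  define y where "y = nxt i"
  have o: "idx \<sigma> ''order'' i = os ! i" "idx \<sigma> ''order'' (Suc i mod (2 * n)) = y" and nn: "idx \<sigma> ''n'' 0 = n"
    using I i n_pos by (auto simp: edged_def listed_def nxt_def y_def)
  have x: "os ! i < 2 * n" "os ! i div 2 < n" "y < 2 * n" "y div 2 < n" using nth_less[OF i(1)] nxt_less[of i] by (auto simp: y_def)
  have xs: "os ! i < W" "os ! i div 2 < W" "y < W" "y div 2 < W" "i < S" "Suc i mod (2 * n) < S" "2 * n + os ! i div 2 < S" "os ! i div 2 < S" "y div 2 < S"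
    "pst i < W" "0 < S" "0 < W"
    using x i S_large W_large pst_less[of i] n_pos mod_less_divisor[of "2 * n" "Suc i"] by linarith+
  have oms: "idx \<sigma> ''om'' (os ! i div 2) = om (os ! i div 2)" "idx \<sigma> ''om'' (y div 2) = om (y div 2)" using I x by (auto simp: edged_def)
  have pv: "idx \<sigma> ''pv'' 0 = pst i" "idx \<sigma> ''pk'' 0 = pfl i" "idx \<sigma> ''bb'' 0 = (if n < 2 then 0 else 1)" using I by (auto simp: edged_def)
  define kk :: rat where "kk = of_nat (Suc i div (2 * n)) + of_nat (os ! i mod 2 * om (os ! i div 2)) - of_nat (y mod 2 * om (y div 2))"
  define ll :: rat where "ll = of_nat (os ! i mod 2) - of_nat (y mod 2)"
  define \<tau> where "\<tau> = \<sigma>\<lparr>idx := (idx \<sigma>)(''x'' := (idx \<sigma> ''x'')(0 := os ! i), ''y'' := (idx \<sigma> ''y'')(0 := y),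
       ''eu'' := (idx \<sigma> ''eu'')(i := os ! i div 2), ''ev'' := (idx \<sigma> ''ev'')(i := y div 2)),
     rats := (rats \<sigma>)(''el'' := (rats \<sigma> ''el'')(i := ll), ''ek'' := (rats \<sigma> ''ek'')(i := kk), ''eb'' := (rats \<sigma> ''eb'')(i := 0))\<rparr>"
  have ei: "edge_ok \<tau> i"
    using i by (simp add: edge_ok_def \<tau>_def g_src_def g_dst_def g_kp_def g_lm_def g_bt_def y_def kk_def ll_def)
  have eo: "edge_ok \<tau> e \<longleftrightarrow> edge_ok \<sigma> e" if "e \<noteq> i" for e using that by (simp add: edge_ok_def \<tau>_def)
  have e1: "\<forall>e<Suc i. edge_ok \<tau> e" using I ei eo by (auto simp: edged_def less_Suc_eq)
  have e2: "\<forall>a<n. pos (2 * a) < i \<longrightarrow> edge_ok \<tau> (2 * n + a)" using I eo i by (auto simp: edged_def)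
  have lt: "listed \<tau>" "\<forall>a<n. idx \<tau> ''om'' a = om a" using I by (auto simp: edged_def listed_def \<tau>_def)
  have less: "pos (2 * a) < Suc i \<longleftrightarrow> pos (2 * a) < i \<or> 2 * a = os ! i" if "a < n" for a using pos_less_Suc[of "2 * a" i] that i by auto
  let ?Q = "\<lambda>\<sigma>'. idx \<sigma>' ''k'' 0 = i \<and> edged (Suc i) \<sigma>'"
  have step: "wp W S (If (ILess (parity ''x'') (IConst 1)) start_store Skip) ?Q \<tau> \<Longrightarrow> wp W S edge_step ?Q \<sigma>"
    using o nn xs oms i unfolding edge_step_def gap_store_def \<tau>_def kk_def ll_def by simp
  have "wp W S (If (ILess (parity ''x'') (IConst 1)) start_store Skip) ?Q \<tau>"
  proof (cases "even (os ! i)")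
    case True
    then obtain a where a: "os ! i = 2 * a" "a < n" using x by (auto elim: evenE)
    define b :: nat where "b = (if n < 2 then 0 else 1)"
    define \<rho> where "\<rho> = \<tau>\<lparr>rats := (rats \<tau>)(''el'' := (rats \<tau> ''el'')(2 * n + a := 0), ''ek'' := (rats \<tau> ''ek'')(2 * n + a := of_nat (pfl i)),
         ''eb'' := (rats \<tau> ''eb'')(2 * n + a := of_nat b)),
       idx := (idx \<tau>)(''eu'' := (idx \<tau> ''eu'')(2 * n + a := pst i), ''ev'' := (idx \<tau> ''ev'')(2 * n + a := a),
         ''pv'' := (idx \<tau> ''pv'')(0 := a), ''pk'' := (idx \<tau> ''pk'')(0 := 0))\<rparr>"
    have pa: "pos (2 * a) = i" using pos_nth[OF i(1)] a by simp
    have "edge_ok \<rho> (2 * n + a)"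
      using a pa by (simp add: edge_ok_def \<rho>_def b_def g_src_def g_dst_def g_kp_def g_lm_def g_bt_def)
    moreover have "edge_ok \<rho> e \<longleftrightarrow> edge_ok \<tau> e" if "e \<noteq> 2 * n + a" for e using that by (simp add: edge_ok_def \<rho>_def)
    ultimately have "\<forall>e<Suc i. edge_ok \<rho> e" "\<forall>a<n. pos (2 * a) < Suc i \<longrightarrow> edge_ok \<rho> (2 * n + a)"
      using e1 e2 less a i by (auto, metis)
    moreover have "listed \<rho>" "\<forall>a<n. idx \<rho> ''om'' a = om a" using lt by (auto simp: listed_def \<rho>_def)
    ultimately have "edged (Suc i) \<rho>"
      using a pv unfolding edged_def by (simp add: \<rho>_def \<tau>_def pst_Suc pfl_Suc)
    moreover have "idx \<tau> ''x'' 0 = 2 * a" "idx \<tau> ''n'' 0 = n" "idx \<tau> ''pv'' 0 = pst i" "idx \<tau> ''pk'' 0 = pfl i" "idx \<tau> ''k'' 0 = i"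
      "idx \<tau> ''bb'' 0 = b"
      using a nn pv i by (simp_all add: \<tau>_def b_def)
    ultimately show ?thesis using a xs i unfolding start_store_def \<rho>_def by simp
  next
    case False
    have "2 * a \<noteq> os ! i" for a using False by presburger
    then have "edged (Suc i) \<tau>" using e1 e2 lt less pv False unfolding edged_def by (simp add: \<tau>_def pst_Suc pfl_Suc)
    moreover have "idx \<tau> ''x'' 0 mod 2 = 1" using False by (simp add: \<tau>_def) presburger
    ultimately show ?thesis using i xs by (simp add: \<tau>_def)
  qed
  from ok_wp[OF step[OF this]] show ?thesis
    by (rule ok_mono) (auto simp: edge_step_def gap_store_def start_store_def)
qed

lemma ok_edges:
  assumes "edged 0 \<sigma>"
  shows "ok W S edges \<sigma> (2 * n * (15 + 2) + 2) (edged (2 * n))"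
  unfolding edges_def
proof (rule ok_FOR[where I = edged])
  show "edged 0 \<sigma>" by (rule assms)
  show "2 * n < W" "0 < S" using W_large S_large by auto
  show "edged i (\<sigma>\<lparr>idx := (idx \<sigma>)(''k'' := f)\<rparr>)" if "edged i \<sigma>" for i \<sigma> f
    using that by (auto simp: edged_def listed_def edge_ok_def)
  show "isafe S \<sigma> (IMul (IConst 2) (V ''n'')) \<and> ival \<sigma> (IMul (IConst 2) (V ''n'')) = 2 * n" if "edged i \<sigma>" for i \<sigma>
    using that S_large by (auto simp: edged_def listed_def)
qed (use ok_edge_step in auto)

lemma ok_setup_graph:
  assumes "listed \<sigma>" "\<And>a. idx \<sigma> ''ss'' a = 0"
  shows "ok W S setup_graph \<sigma> (50 * n + 10) (\<lambda>\<sigma>'. env \<sigma>' \<and> listed \<sigma>' \<and> (\<forall>a<n. idx \<sigma>' ''om'' a = om a))"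
proof -
  have "ok W S setup_graph \<sigma> ((2 * n * (4 + 2) + 2) + (4 + (2 * n * (15 + 2) + 2)))
     (\<lambda>\<sigma>'. env \<sigma>' \<and> listed \<sigma>' \<and> (\<forall>a<n. idx \<sigma>' ''om'' a = om a))"
    unfolding setup_graph_def
  proof (rule ok_seq[OF ok_scan[OF assms]])
    fix \<sigma>1 assume 1: "scanned (2 * n) \<sigma>1"
    show "ok W S (Seq edge_init edges) \<sigma>1 (4 + (2 * n * (15 + 2) + 2)) (\<lambda>\<sigma>'. env \<sigma>' \<and> listed \<sigma>' \<and> (\<forall>a<n. idx \<sigma>' ''om'' a = om a))"
    proof (rule ok_seq)
      have "idx \<sigma>1 ''ls'' 0 = pst (2 * n)" using 1 before_all by (simp add: scanned_def pfl_def)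
      then have "idx \<sigma>1 ''ls'' 0 = pst 0" by (simp add: pst_def before_def)
      moreover have "pfl 0 = 1" by (simp add: pfl_def before_def)
      moreover have "idx \<sigma>1 ''om'' a = om a" if "a < n" for a
        using 1 that nth_pos(1)[of "Suc (2 * a)"] by (simp add: scanned_def)
      moreover have "pst 0 < W" using pst_less[of 0] W_large by simp
      moreover have "idx \<sigma>1 ''n'' 0 = n" "\<forall>k<2 * n. idx \<sigma>1 ''order'' k = os ! k" using 1 by (auto simp: scanned_def listed_def)
      ultimately have "wp W S edge_init (edged 0) \<sigma>1"
        using S_large W_large by (simp add: edge_init_def edged_def listed_def)
      from ok_wp[OF this] show "ok W S edge_init \<sigma>1 4 (edged 0)" by (simp add: edge_init_def numeral_eq_Suc)
      fix \<sigma>2 assume 2: "edged 0 \<sigma>2"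
      show "ok W S edges \<sigma>2 (2 * n * (15 + 2) + 2) (\<lambda>\<sigma>'. env \<sigma>' \<and> listed \<sigma>' \<and> (\<forall>a<n. idx \<sigma>' ''om'' a = om a))"
      proof (rule ok_mono[OF ok_edges[OF 2]])
        fix \<sigma>' assume e: "edged (2 * n) \<sigma>'"
        have "edge_ok \<sigma>' e" if "e < 3 * n" for e
        proof (cases "e < 2 * n")
          case False
          then obtain a where a: "e = 2 * n + a" using le_Suc_ex not_less by blast
          then have "a < n" "pos (2 * a) < 2 * n" using that nth_pos(1)[of "2 * a"] by auto
          then show ?thesis using e a by (simp add: edged_def)
        qed (use e in \<open>simp add: edged_def\<close>)
        then show "env \<sigma>' \<and> listed \<sigma>' \<and> (\<forall>a<n. idx \<sigma>' ''om'' a = om a)"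
          using e by (auto simp: env_def edge_ok_def edged_def listed_def)
      qed simp
    qed
  qed
  then show ?thesis by (rule ok_mono) auto
qed

end

section \<open>Choosing the parameters of the search\<close>

text \<open>Rationals cannot be converted to indices, so the neighbours of \<open>ds / d\<close> are
  found by comparing it with integer mediants.\<close>

definition mediant_step :: com where
  "mediant_step = If (RLess (RMul (R ''ds'') (ROfIdx (IAdd (V ''qa'') (V ''qb'')))) (RMul (R ''d'') (ROfIdx (IAdd (V ''pa'') (V ''pb'')))))
     (Seq (iset ''pb'' (IAdd (V ''pa'') (V ''pb''))) (iset ''qb'' (IAdd (V ''qa'') (V ''qb''))))
     (Seq (iset ''pa'' (IAdd (V ''pa'') (V ''pb''))) (iset ''qa'' (IAdd (V ''qa'') (V ''qb''))))"

text \<open>The descent starts from \<open>0 / 1\<close> and \<open>1 / 0\<close>. The sum of the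
  four entries grows in every step, so \<open>24 * n ^ 3 + 1\<close> steps suffice, and single
  mediant steps are affordable within cubic time.\<close>

definition neighbours :: com where
  "neighbours = Seq (Seq (iset ''pa'' (IConst 0)) (Seq (iset ''qa'' (IConst 1)) (Seq (iset ''pb'' (IConst 1)) (iset ''qb'' (IConst 0)))))
     (While (ILess (IAdd (IAdd (V ''pa'') (V ''qa'')) (IAdd (V ''pb'') (V ''qb'')))
          (IAdd (IMul (IConst 24) (IMul (V ''n'') (IMul (V ''n'') (V ''n'')))) (IConst 1)))
       mediant_step)"

definition log_step :: com where
  "log_step = Seq (iset ''pw'' (IMul (IConst 2) (V ''pw''))) (iset ''lg'' (IAdd (V ''lg'') (IConst 1)))"

definition logarithm :: com where
  "logarithm = Seq (Seq (iset ''pw'' (IConst 1)) (iset ''lg'' (IConst 0))) (While (ILess (V ''pw'') (V ''n'')) log_step)"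

text \<open>The surrogates \<open>dd\<close> of \<open>d\<close> and \<open>dq\<close> of
  \<open>ds\<close> are denominator and numerator of the mediant.\<close>

definition ranges :: com where
  "ranges =
     Seq (rset ''dd'' (ROfIdx (IAdd (V ''qa'') (V ''qb''))))
    (Seq (rset ''dq'' (ROfIdx (IAdd (V ''pa'') (V ''pb''))))
    (Seq (rset ''lx'' (RAdd (RMul (RMul (RConst 4) (RMul (ROfIdx (V ''n'')) (ROfIdx (V ''n'')))) (RAdd (R ''dd'') (R ''dq''))) (RConst 1)))
    (Seq (rset ''cm'' (RAdd (RMul (ROfIdx (V ''n'')) (RAdd (R ''dd'') (R ''dq''))) (RMul (ROfIdx (V ''n'')) (R ''lx''))))
     (iset ''J'' (IAdd (IMul (IConst 9) (V ''lg'')) (IConst 14))))))"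

definition setup_params :: com where "setup_params = Seq neighbours (Seq logarithm ranges)"

lemma mods_params: "imods setup_params = {''pa'', ''qa'', ''pb'', ''qb'', ''pw'', ''lg'', ''J''}" "rmods setup_params = {''dd'', ''dq'', ''lx'', ''cm''}"
  unfolding setup_params_def neighbours_def mediant_step_def logarithm_def log_step_def ranges_def by auto

text \<open>A step is taken only while the sum is at most \<open>24 * n ^ 3\<close> and at most
  doubles it, which gives the last bound; 2 is the initial sum.\<close>

definition bracketing :: "nat \<Rightarrow> rat \<Rightarrow> rat \<Rightarrow> nat \<Rightarrow> nat \<Rightarrow> nat \<Rightarrow> nat \<Rightarrow> bool" where
  "bracketing n d ds pa qa pb qb \<longleftrightarrow> pb * qa = pa * qb + 1 \<and> of_nat pa * d \<le> of_nat qa * ds \<and> of_nat qb * ds \<le> of_nat pb * d \<and>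
     pa + qa + pb + qb \<le> 48 * n ^ 3 + 2"

definition mediant_inv :: "nat \<Rightarrow> rat \<Rightarrow> rat \<Rightarrow> nat \<Rightarrow> state \<Rightarrow> bool" where
  "mediant_inv n d ds j \<sigma> \<longleftrightarrow> idx \<sigma> ''n'' 0 = n \<and> rats \<sigma> ''d'' 0 = d \<and> rats \<sigma> ''ds'' 0 = ds \<and>
     bracketing n d ds (idx \<sigma> ''pa'' 0) (idx \<sigma> ''qa'' 0) (idx \<sigma> ''pb'' 0) (idx \<sigma> ''qb'' 0) \<and>
     24 * n ^ 3 + 1 \<le> idx \<sigma> ''pa'' 0 + idx \<sigma> ''qa'' 0 + idx \<sigma> ''pb'' 0 + idx \<sigma> ''qb'' 0 + j"

lemma ok_mediant_step:
  assumes I: "mediant_inv n d ds i \<sigma>" and b: "idx \<sigma> ''pa'' 0 + idx \<sigma> ''qa'' 0 + (idx \<sigma> ''pb'' 0 + idx \<sigma> ''qb'' 0) < 24 * n ^ 3 + 1"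
    and S: "0 < S" and W: "100 * n ^ 3 + 100 \<le> W"
  shows "\<exists>j. i = Suc j \<and> ok W S mediant_step \<sigma> 3 (mediant_inv n d ds j)"
proof -
  define pa qa pb qb where "pa = idx \<sigma> ''pa'' 0" and "qa = idx \<sigma> ''qa'' 0" and "pb = idx \<sigma> ''pb'' 0" and "qb = idx \<sigma> ''qb'' 0"
  note pq = pa_def[symmetric] qa_def[symmetric] pb_def[symmetric] qb_def[symmetric]
  have v: "idx \<sigma> ''n'' 0 = n" "rats \<sigma> ''d'' 0 = d" "rats \<sigma> ''ds'' 0 = ds" and br: "bracketing n d ds pa qa pb qb"
    and j: "24 * n ^ 3 + 1 \<le> pa + qa + pb + qb + i" and b': "pa + qa + (pb + qb) < 24 * n ^ 3 + 1"
    using I b by (simp_all add: mediant_inv_def pq)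
  obtain j where ij: "i = Suc j" using j b' by (cases i) auto
  have det: "pb * qa = pa * qb + 1" using br by (simp add: bracketing_def)
  then have one: "0 < pb" "0 < qa" by (auto intro: gr0I)
  have "wp W S mediant_step (mediant_inv n d ds j) \<sigma>"
  proof (cases "ds * of_nat (qa + qb) < d * of_nat (pa + pb)")
    case True
    have "bracketing n d ds pa qa (pa + pb) (qa + qb)"
      using True br b' det by (simp add: bracketing_def algebra_simps)
    then show ?thesis using True v j one b' ij S W by (simp add: mediant_step_def mediant_inv_def pq)
  next
    case False
    have "bracketing n d ds (pa + pb) (qa + qb) pb qb"
      using False br b' det by (simp add: bracketing_def algebra_simps)
    then show ?thesis using False v j one b' ij S W by (simp add: mediant_step_def mediant_inv_def pq)
  qed
  from ok_wp[OF this] have "ok W S mediant_step \<sigma> 3 (mediant_inv n d ds j)" by (simp add: mediant_step_def numeral_eq_Suc)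
  then show ?thesis using ij by blast
qed

lemma ok_neighbours:
  assumes v: "idx \<sigma> ''n'' 0 = n" "rats \<sigma> ''d'' 0 = d" "rats \<sigma> ''ds'' 0 = ds" and d: "0 < d" "0 \<le> ds"
    and S: "0 < S" and W: "100 * n ^ 3 + 100 \<le> W"
  shows "ok W S neighbours \<sigma> (4 + ((24 * n ^ 3 + 1) * (3 + 1) + 1)) (\<lambda>\<sigma>'. mediant_inv n d ds 0 \<sigma>')"
  unfolding neighbours_def
proof (rule ok_seq)
  let ?p = "Seq (iset ''pa'' (IConst 0)) (Seq (iset ''qa'' (IConst 1)) (Seq (iset ''pb'' (IConst 1)) (iset ''qb'' (IConst 0))))"
  have "wp W S ?p (mediant_inv n d ds (24 * n ^ 3 + 1)) \<sigma>"
    using v d S W by (simp add: mediant_inv_def bracketing_def)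
  from ok_wp[OF this] show "ok W S ?p \<sigma> 4 (mediant_inv n d ds (24 * n ^ 3 + 1))" by (simp add: numeral_eq_Suc)
  fix \<sigma>1 assume 1: "mediant_inv n d ds (24 * n ^ 3 + 1) \<sigma>1"
  let ?b = "ILess (IAdd (IAdd (V ''pa'') (V ''qa'')) (IAdd (V ''pb'') (V ''qb'')))
          (IAdd (IMul (IConst 24) (IMul (V ''n'') (IMul (V ''n'') (V ''n'')))) (IConst 1))"
  have b: "bval \<sigma> ?b \<longleftrightarrow> idx \<sigma> ''pa'' 0 + idx \<sigma> ''qa'' 0 + (idx \<sigma> ''pb'' 0 + idx \<sigma> ''qb'' 0) < 24 * n ^ 3 + 1"
    if "mediant_inv n d ds i \<sigma>" for i \<sigma> using that by (simp add: mediant_inv_def power3_eq_cube mult.assoc)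
  show "ok W S (While ?b mediant_step) \<sigma>1 ((24 * n ^ 3 + 1) * (3 + 1) + 1) (mediant_inv n d ds 0)"
  proof (rule ok_while[where I = "mediant_inv n d ds"])
    show "\<exists>j. i = Suc j \<and> ok W S mediant_step \<sigma> 3 (mediant_inv n d ds j)" if "mediant_inv n d ds i \<sigma>" "bval \<sigma> ?b" for i \<sigma>
      using ok_mediant_step[OF that(1) _ S W] b[OF that(1)] that(2) by blast
    show "mediant_inv n d ds 0 \<sigma>" if "mediant_inv n d ds i \<sigma>" "\<not> bval \<sigma> ?b" for i \<sigma>
      using that unfolding b[OF that(1)] by (simp add: mediant_inv_def)
  qed (use 1 S in simp_all)
qed

definition log_inv :: "nat \<Rightarrow> nat \<Rightarrow> state \<Rightarrow> bool" where
  "log_inv n j \<sigma> \<longleftrightarrow> idx \<sigma> ''n'' 0 = n \<and> idx \<sigma> ''pw'' 0 = 2 ^ idx \<sigma> ''lg'' 0 \<and>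
     (idx \<sigma> ''lg'' 0 = 0 \<or> 2 ^ (idx \<sigma> ''lg'' 0 - 1) < n) \<and> n \<le> idx \<sigma> ''pw'' 0 + j"

lemma ok_logarithm:
  assumes v: "idx \<sigma> ''n'' 0 = n" and S: "0 < S" and W: "3 * n + 10 \<le> W"
  shows "ok W S logarithm \<sigma> (2 + (n * (2 + 1) + 1)) (log_inv n 0)"
  unfolding logarithm_def
proof (rule ok_seq)
  have "wp W S (Seq (iset ''pw'' (IConst 1)) (iset ''lg'' (IConst 0))) (log_inv n n) \<sigma>"
    using v S W by (simp add: log_inv_def)
  from ok_wp[OF this] show "ok W S (Seq (iset ''pw'' (IConst 1)) (iset ''lg'' (IConst 0))) \<sigma> 2 (log_inv n n)" by (simp add: numeral_eq_Suc)
  fix \<sigma>1 assume 1: "log_inv n n \<sigma>1"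
  show "ok W S (While (ILess (V ''pw'') (V ''n'')) log_step) \<sigma>1 (n * (2 + 1) + 1) (log_inv n 0)"
  proof (rule ok_while[where I = "log_inv n"])
    show "\<exists>j. i = Suc j \<and> ok W S log_step \<sigma> 2 (log_inv n j)" if I: "log_inv n i \<sigma>" and b: "bval \<sigma> (ILess (V ''pw'') (V ''n''))" for i \<sigma>
    proof -
      have b': "2 ^ idx \<sigma> ''lg'' 0 < n" using I b by (simp add: log_inv_def)
      then obtain j where ij: "i = Suc j" using I by (cases i) (auto simp: log_inv_def)
      have lg: "idx \<sigma> ''lg'' 0 < 2 ^ idx \<sigma> ''lg'' 0" by (rule less_exp)
      then have "Suc (idx \<sigma> ''lg'' 0) < W" using b' W by linarith
      moreover have "n \<le> 2 * 2 ^ idx \<sigma> ''lg'' 0 + j"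
      proof -
        have "n \<le> Suc (2 ^ idx \<sigma> ''lg'' 0 + j)" using I ij by (simp add: log_inv_def)
        then show ?thesis using lg by linarith
      qed
      ultimately have "wp W S log_step (log_inv n j) \<sigma>"
        using I b' S W ij by (simp add: log_step_def log_inv_def)
      from ok_wp[OF this] have "ok W S log_step \<sigma> 2 (log_inv n j)" by (simp add: log_step_def numeral_eq_Suc)
      then show ?thesis using ij by blast
    qed
  qed (use 1 S in \<open>auto simp: log_inv_def\<close>)
qed

definition prepared :: "nat \<Rightarrow> rat \<Rightarrow> rat \<Rightarrow> state \<Rightarrow> bool" where
  "prepared n d ds \<sigma> \<longleftrightarrow> (\<exists>pa qa pb qb L. bracketing n d ds pa qa pb qb \<and> 24 * n ^ 3 < pa + qa + pb + qb \<and>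
     n \<le> 2 ^ L \<and> (L = 0 \<or> 2 ^ (L - 1) < n) \<and> rats \<sigma> ''dd'' 0 = of_nat (qa + qb) \<and> rats \<sigma> ''dq'' 0 = of_nat (pa + pb) \<and>
     rats \<sigma> ''lx'' 0 = 4 * of_nat (n\<^sup>2 * (qa + qb + (pa + pb))) + 1 \<and>
     rats \<sigma> ''cm'' 0 = of_nat n * of_nat (qa + qb + (pa + pb)) + of_nat n * rats \<sigma> ''lx'' 0 \<and> idx \<sigma> ''J'' 0 = 9 * L + 14)"

lemma log_less: "L = 0 \<or> 2 ^ (L - 1) < n \<Longrightarrow> L \<le> n" for L n :: nat
  using less_exp[of "L - 1"] by linarith

lemma ok_setup_params:
  assumes v: "idx \<sigma> ''n'' 0 = n" "rats \<sigma> ''d'' 0 = d" "rats \<sigma> ''ds'' 0 = ds" and d: "0 < d" "0 \<le> ds" and n: "0 < n"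
    and S: "0 < S" and W: "100 * n ^ 3 + 100 \<le> W"
  shows "ok W S setup_params \<sigma> (96 * n ^ 3 + 3 * n + 20) (prepared n d ds)"
proof -
  have cube: "n \<le> n ^ 3" using power_increasing[of 1 3 n] n by simp
  have "ok W S setup_params \<sigma> ((4 + ((24 * n ^ 3 + 1) * (3 + 1) + 1)) + ((2 + (n * (2 + 1) + 1)) + 5)) (prepared n d ds)"
    unfolding setup_params_def
  proof (rule ok_seq[OF ok_neighbours[OF v d S W]])
    fix \<sigma>1 assume 1: "mediant_inv n d ds 0 \<sigma>1"
    show "ok W S (Seq logarithm ranges) \<sigma>1 ((2 + (n * (2 + 1) + 1)) + 5) (prepared n d ds)"
    proof (rule ok_seq[OF ok_frame[OF ok_logarithm[of \<sigma>1 n]]])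
      fix \<sigma>2 assume *: "log_inv n 0 \<sigma>2 \<and> (\<forall>x. x \<notin> imods logarithm \<longrightarrow> idx \<sigma>2 x = idx \<sigma>1 x) \<and> (\<forall>x. x \<notin> rmods logarithm \<longrightarrow> rats \<sigma>2 x = rats \<sigma>1 x)"
      have m: "mediant_inv n d ds 0 \<sigma>2" using 1 * by (auto simp: mediant_inv_def logarithm_def log_step_def)
      define pa qa pb qb L where "pa = idx \<sigma>2 ''pa'' 0" and "qa = idx \<sigma>2 ''qa'' 0" and "pb = idx \<sigma>2 ''pb'' 0" and "qb = idx \<sigma>2 ''qb'' 0"
        and "L = idx \<sigma>2 ''lg'' 0"
      note pq = pa_def[symmetric] qa_def[symmetric] pb_def[symmetric] qb_def[symmetric] L_def[symmetric]
      have nn: "idx \<sigma>2 ''n'' 0 = n" and br: "bracketing n d ds pa qa pb qb" and big: "24 * n ^ 3 < pa + qa + pb + qb"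
        using m by (simp_all add: mediant_inv_def pq)
      have L: "n \<le> 2 ^ L" "L = 0 \<or> 2 ^ (L - 1) < n" using * by (auto simp: log_inv_def L_def)
      have "L \<le> n" by (rule log_less[OF L(2)])
      then have J: "9 * L + 14 < W" using W cube by simp
      define lx :: rat where "lx = 4 * of_nat (n\<^sup>2 * (qa + qb + (pa + pb))) + 1"
      define \<tau> where "\<tau> = \<sigma>2\<lparr>rats := (rats \<sigma>2)(''dd'' := (rats \<sigma>2 ''dd'')(0 := of_nat (qa + qb)), ''dq'' := (rats \<sigma>2 ''dq'')(0 := of_nat (pa + pb)),
          ''lx'' := (rats \<sigma>2 ''lx'')(0 := lx), ''cm'' := (rats \<sigma>2 ''cm'')(0 := of_nat n * of_nat (qa + qb + (pa + pb)) + of_nat n * lx)),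
        idx := (idx \<sigma>2)(''J'' := (idx \<sigma>2 ''J'')(0 := 9 * L + 14))\<rparr>"
      have P: "prepared n d ds \<tau>"
        unfolding prepared_def using br big L
        by (intro exI[of _ pa] exI[of _ qa] exI[of _ pb] exI[of _ qb] exI[of _ L]) (simp add: \<tau>_def lx_def)
      have lx': "4 * (of_nat n * of_nat n) * (of_nat qa + of_nat qb + (of_nat pa + of_nat pb)) + 1 = lx"
        by (simp add: lx_def power2_eq_square)
      have "wp W S ranges (prepared n d ds) \<sigma>2"
        using P J S by (simp add: ranges_def pq nn lx' \<tau>_def)
      from ok_wp[OF this] show "ok W S ranges \<sigma>2 5 (prepared n d ds)" by (simp add: ranges_def numeral_eq_Suc)
    qed (use 1 S W cube in \<open>auto simp: mediant_inv_def\<close>)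
  qed
  then show ?thesis by (rule ok_mono) auto
qed

text \<open>From \<open>s \<le> 50 * n ^ 3\<close> follow \<open>lx \<le> 201 * n ^ 5\<close> and
  \<open>cm \<le> 251 * n ^ 6\<close>. The exponent has \<open>9 * L\<close> for
  \<open>n ^ 9\<close> and 14 because \<open>64 * 251 \<le> 2 ^ 14\<close>.\<close>

lemma precision:
  fixes n L s :: nat and lx cm :: rat
  assumes n: "0 < n" "n \<le> 2 ^ L" and s: "s \<le> 48 * n ^ 3 + 2"
    and lx: "lx = 4 * of_nat (n\<^sup>2 * s) + 1" and cm: "cm = of_nat n * of_nat s + of_nat n * lx"
  shows "64 * of_nat n ^ 3 * (cm / 2 ^ (9 * L + 14)) \<le> 1" "64 * of_nat n ^ 4 * (lx / 2 ^ (9 * L + 14)) \<le> 1"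
proof -
  define l c where "l = 4 * (n\<^sup>2 * s) + 1" and "c = n * s + n * l"
  have lc: "lx = of_nat l" "cm = of_nat c" by (simp_all add: lx cm l_def c_def algebra_simps)
  have p: "n ^ i \<le> n ^ j" if "i \<le> j" for i j using power_increasing[OF that, of n] n by simp
  have s': "s \<le> 50 * n ^ 3" using s n by (cases "n ^ 3") auto
  have "n\<^sup>2 * s \<le> n\<^sup>2 * (50 * n ^ 3)" using s' by simp
  also have "\<dots> = 50 * n ^ 5" by (simp flip: power_add)
  finally have l: "l \<le> 201 * n ^ 5" using p[of 0 5] by (simp add: l_def)
  have "n * s \<le> n * (50 * n ^ 3)" "n * l \<le> n * (201 * n ^ 5)" using s' l by simp_all
  then have "n * s \<le> 50 * n ^ 4" "n * l \<le> 201 * n ^ 6" by (simp_all add: power_numeral_reduce)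
  then have c: "c \<le> 251 * n ^ 6" using p[of 4 6] by (simp add: c_def)
  have "n ^ 9 \<le> (2 ^ L) ^ 9" using n by (intro power_mono) auto
  then have e: "16384 * n ^ 9 \<le> 2 ^ (9 * L + 14)" by (simp add: power_add power_mult[symmetric] mult.commute)
  have "64 * n ^ 3 * c \<le> 64 * n ^ 3 * (251 * n ^ 6)" "64 * n ^ 4 * l \<le> 64 * n ^ 4 * (201 * n ^ 5)"
    using mult_le_mono2[OF c] mult_le_mono2[OF l] by blast+
  moreover have "n ^ 3 * n ^ 6 = n ^ 9" "n ^ 4 * n ^ 5 = n ^ 9" by (simp_all flip: power_add)
  ultimately have "64 * n ^ 3 * c \<le> 2 ^ (9 * L + 14)" "64 * n ^ 4 * l \<le> 2 ^ (9 * L + 14)" using e by (auto simp: algebra_simps)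
  then have "of_nat (64 * n ^ 3 * c) \<le> (of_nat (2 ^ (9 * L + 14)) :: rat)" "of_nat (64 * n ^ 4 * l) \<le> (of_nat (2 ^ (9 * L + 14)) :: rat)"
    unfolding of_nat_le_iff .
  then show "64 * of_nat n ^ 3 * (cm / 2 ^ (9 * L + 14)) \<le> 1" "64 * of_nat n ^ 4 * (lx / 2 ^ (9 * L + 14)) \<le> 1"
    unfolding lc by simp_all
qed

lemma square_le_power2: "L\<^sup>2 \<le> 2 * 2 ^ L" for L :: nat
proof (induction L rule: less_induct)
  case (less L)
  consider "L < 4" | k where "L = Suc k" "3 \<le> k" 
  proof (cases L)
    case (Suc k)
    then show ?thesis using that by (cases "3 \<le> k") auto
  qed (use that in auto)
  then show ?case
  proof cases
    case 1
    then have "L = 0 \<or> L = 1 \<or> L = 2 \<or> L = 3" by auto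
    then show ?thesis by auto
  next
    case 2
    then have "k\<^sup>2 \<le> 2 * 2 ^ k" using less by simp
    moreover have "3 * k \<le> k * k" using 2 by simp
    then have "(Suc k)\<^sup>2 \<le> 2 * k\<^sup>2" using 2(2) unfolding power2_eq_square mult_Suc mult_Suc_right by linarith
    ultimately show ?thesis using 2 by simp
  qed
qed

text \<open>The number of queries is a squared logarithm; a linear bound on it already turns
  quadratic queries into cubic total time.\<close>

lemma log_square:
  fixes n L :: nat
  assumes "L = 0 \<or> 2 ^ (L - 1) < n" "0 < n"
  shows "(9 * L + 15)\<^sup>2 \<le> 2304 * n"
proof (cases L)
  case (Suc k)
  have "(9 * L + 15)\<^sup>2 \<le> (24 * L)\<^sup>2" using Suc by (intro power_mono) auto
  also have "\<dots> = 576 * L\<^sup>2" by (simp add: power_mult_distrib)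
  also have "\<dots> \<le> 576 * (4 * 2 ^ k)" using square_le_power2[of L] Suc by simp
  finally show ?thesis using assms(1) Suc by simp
qed (use assms in simp)

lemma search_time_le:
  assumes "L = 0 \<or> 2 ^ (L - 1) < n" "0 < n"
  shows "search_time n (9 * L + 14) \<le> 2304 * n * (query_time n + 44)"
proof -
  define j where "j = 9 * L + 15"
  have "search_time n (9 * L + 14) = j\<^sup>2 * (query_time n + 12) + 22 * j + 10"
    by (simp add: search_time_def inner_time_def j_def power2_eq_square algebra_simps)
  moreover have "j \<le> j\<^sup>2" "1 \<le> j\<^sup>2" by (simp_all add: j_def power2_eq_square)
  ultimately have "search_time n (9 * L + 14) \<le> j\<^sup>2 * (query_time n + 44)" unfolding add_mult_distrib2 by linarith
  also have "\<dots> \<le> 2304 * n * (query_time n + 44)" using log_square[OF assms] unfolding j_def by (rule mult_le_mono1)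
  finally show ?thesis .
qed

section \<open>The algorithm\<close>

context bgraph
begin

text \<open>The left-hand side is an integer form in \<open>d\<close>, \<open>ds\<close> with coefficients of absolute value at most
  \<open>12 * n ^ 3\<close>.\<close>

lemma crossing_form_sign:
  fixes k1 k2 k3 l1 l2 l3 a1 a2 a3 b1 b2 b3 :: int and pa qa pb qb :: nat and d ds :: rat
  defines "gN \<equiv> \<lambda>a b. a * int (qa + qb) + b * int (pa + pb)" and "g \<equiv> \<lambda>a b. of_int a * d + of_int b * ds"
  assumes v: "valid k1 l1 a1 b1" "valid k2 l2 a2 b2" "valid k3 l3 a3 b3"
    and br: "bracketing n d ds pa qa pb qb" and big: "24 * n ^ 3 < pa + qa + pb + qb"
    and neg: "(l1 * k2 - l2 * k1) * gN a3 b3 + l3 * (k1 * gN a2 b2 - k2 * gN a1 b1) - k3 * (l1 * gN a2 b2 - l2 * gN a1 b1) \<le> 0"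
  shows "of_int (l1 * k2 - l2 * k1) * g a3 b3 + of_int l3 * (of_int k1 * g a2 b2 - of_int k2 * g a1 b1)
     - of_int k3 * (of_int l1 * g a2 b2 - of_int l2 * g a1 b1) \<le> 0"
proof -
  define N where "N = int n"
  \<comment> \<open>The coefficients of \<open>d\<close> and \<open>ds\<close> are
    \<open>F a1 a2 a3\<close> and \<open>F b1 b2 b3\<close>. Each of the three products in
    \<open>F\<close> contributes at most \<open>4 * N ^ 3\<close>, so together they stay below the
    level reached by the descent.\<close>
  define F where "F = (\<lambda>x1 x2 x3. (l1 * k2 - l2 * k1) * x3 + l3 * (k1 * x2 - k2 * x1) - k3 * (l1 * x2 - l2 * x1))"
  have k: "\<bar>k1\<bar> \<le> 2 * N" "\<bar>k2\<bar> \<le> 2 * N" "\<bar>k3\<bar> \<le> 2 * N" and l: "\<bar>l1\<bar> \<le> N" "\<bar>l2\<bar> \<le> N" "\<bar>l3\<bar> \<le> N"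
    using validD(1,2)[OF v(1)] validD(1,2)[OF v(2)] validD(1,2)[OF v(3)] by (simp_all add: N_def)
  have ab: "\<bar>a1\<bar> \<le> N" "\<bar>a2\<bar> \<le> N" "\<bar>a3\<bar> \<le> N" "\<bar>b1\<bar> \<le> N" "\<bar>b2\<bar> \<le> N" "\<bar>b3\<bar> \<le> N"
    using validD(3-6)[OF v(1)] validD(3-6)[OF v(2)] validD(3-6)[OF v(3)] by (simp_all add: N_def)
  have F: "\<bar>F x1 x2 x3\<bar> \<le> 12 * N ^ 3" if x: "\<bar>x1\<bar> \<le> N" "\<bar>x2\<bar> \<le> N" "\<bar>x3\<bar> \<le> N" for x1 x2 x3
  proof -
    have "\<bar>l1 * k2 - l2 * k1\<bar> \<le> 2 * (N * (2 * N))" by (rule abs_det_le[OF l(1) k(2) l(2) k(1)])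
    from abs_mult_le[OF this x(3)] have "\<bar>(l1 * k2 - l2 * k1) * x3\<bar> \<le> 4 * N ^ 3" by (simp add: power3_eq_cube)
    moreover have "\<bar>k1 * x2 - k2 * x1\<bar> \<le> 2 * (2 * N * N)" by (rule abs_det_le[OF k(1) x(2) k(2) x(1)])
    from abs_mult_le[OF l(3) this] have "\<bar>l3 * (k1 * x2 - k2 * x1)\<bar> \<le> 4 * N ^ 3" by (simp add: power3_eq_cube)
    moreover have "\<bar>l1 * x2 - l2 * x1\<bar> \<le> 2 * (N * N)" by (rule abs_det_le[OF l(1) x(2) l(2) x(1)])
    from abs_mult_le[OF k(3) this] have "\<bar>k3 * (l1 * x2 - l2 * x1)\<bar> \<le> 4 * N ^ 3" by (simp add: power3_eq_cube)
    ultimately show ?thesis unfolding F_def by linarith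
  qed
  have "int (24 * n ^ 3) < int (pa + qa + pb + qb)" using big by (simp only: of_nat_less_iff)
  then have small: "\<bar>F a1 a2 a3\<bar> + \<bar>F b1 b2 b3\<bar> < int pa + int qa + int pb + int qb"
    using F[OF ab(1-3)] F[OF ab(4-6)] by (simp add: N_def)
  have br': "int (pb * qa) = int (pa * qb + 1)" "of_nat pa * d \<le> of_nat qa * ds" "of_nat qb * ds \<le> of_nat pb * d"
    using br by (simp_all only: bracketing_def)
  have "of_int (F a1 a2 a3) * d + of_int (F b1 b2 b3) * ds \<le> 0"
  proof (rule small_form_sign[of "int pb" "int qa" "int pa" "int qb"])
    show "F a1 a2 a3 * (int qa + int qb) + F b1 b2 b3 * (int pa + int pb) \<le> 0"
      using neg by (simp add: F_def gN_def algebra_simps)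
  qed (use br' small in simp_all)
  moreover have "of_int (F a1 a2 a3) * d + of_int (F b1 b2 b3) * ds =
     of_int (l1 * k2 - l2 * k1) * g a3 b3 + of_int l3 * (of_int k1 * g a2 b2 - of_int k2 * g a1 b1)
     - of_int k3 * (of_int l1 * g a2 b2 - of_int l2 * g a1 b1)"
    by (simp add: F_def g_def algebra_simps)
  ultimately show ?thesis by simp
qed

text \<open>A certificate of minimality: combined with feasibility it provides the two tight
  constraints of \<open>least_descriptor\<close>.\<close>

definition optimal :: "rat \<Rightarrow> rat \<Rightarrow> rat \<Rightarrow> rat \<Rightarrow> bool" where
  "optimal d ds l c \<longleftrightarrow> (\<exists>k1 l1 a1 b1 k2 l2 a2 b2. valid k1 l1 a1 b1 \<and> valid k2 l2 a2 b2 \<and> 0 < k1 \<and> k2 \<le> 0 \<and>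
     cval k1 l1 a1 b1 d ds l c = 0 \<and> cval k2 l2 a2 b2 d ds l c = 0)"

end

text \<open>Cramer's rule for the constraints in \<open>B1\<close> and \<open>A2\<close>, now at the
  original \<open>d\<close> and \<open>ds\<close>, which replace the surrogates.\<close>

definition solve :: com where
  "solve =
     Seq (rset ''dd'' (R ''d'')) (Seq (rset ''dq'' (R ''ds''))
    (Seq (rset ''D1'' (RAdd (RMul (RLoad ''B1'' (IConst 2)) (R ''dd'')) (RMul (RLoad ''B1'' (IConst 3)) (R ''dq''))))
    (Seq (rset ''D2'' (RAdd (RMul (RLoad ''A2'' (IConst 2)) (R ''dd'')) (RMul (RLoad ''A2'' (IConst 3)) (R ''dq''))))
    (Seq (rset ''mm'' (RSub (RMul (RLoad ''B1'' (IConst 1)) (RLoad ''A2'' (IConst 0))) (RMul (RLoad ''A2'' (IConst 1)) (RLoad ''B1'' (IConst 0)))))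
    (Seq (rset ''lq'' (RDiv (RSub (RMul (RLoad ''B1'' (IConst 0)) (R ''D2'')) (RMul (RLoad ''A2'' (IConst 0)) (R ''D1''))) (R ''mm'')))
     (rset ''cq'' (RDiv (RSub (RMul (RLoad ''B1'' (IConst 1)) (R ''D2'')) (RMul (RLoad ''A2'' (IConst 1)) (R ''D1''))) (R ''mm''))))))))"

text \<open>Potentials are free up to translation. The first extreme is moved to the point 0, which
  brings all coordinates into one turn.\<close>

definition origin :: com where
  "origin =
     Seq (iset ''y'' (ILoad ''order'' (IConst 0)))
    (Seq (rset ''og'' (RAdd (RLoad ''F'' (adr (V ''n'') (half ''y'')))
       (RMul (ROfIdx (parity ''y'')) (RSub (R ''lq'') (RMul (ROfIdx (ILoad ''om'' (half ''y''))) (R ''cq''))))))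
    (Seq (rset ''c'' (R ''cq'')) (rset ''l'' (R ''lq''))))"

definition write_arc :: com where
  "write_arc =
     Seq (RStore ''s'' (V ''i'') (RSub (RLoad ''F'' (adr (V ''n'') (V ''i''))) (R ''og'')))
     (RStore ''t'' (V ''i'') (RSub (RAdd (RLoad ''F'' (adr (V ''n'') (V ''i'')))
        (RSub (R ''lq'') (RMul (ROfIdx (ILoad ''om'' (V ''i''))) (R ''cq'')))) (R ''og'')))"

definition write_model :: com where "write_model = Seq origin (FOR ''i'' (V ''n'') write_arc)"

definition program :: com where
  "program = Seq setup_graph (Seq setup_params (Seq search (Seq solve (Seq query write_model))))"

definition total_time :: "nat \<Rightarrow> nat" where
  "total_time n = (50 * n + 10) + ((96 * n ^ 3 + 3 * n + 20) + (2304 * n * (query_time n + 44) + (7 + (query_time n + (4 + (n * (2 + 2) + 2))))))"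

context clockwise_machine
begin

definition base :: "rat \<Rightarrow> rat \<Rightarrow> state \<Rightarrow> bool" where
  "base d ds \<sigma> \<longleftrightarrow> env \<sigma> \<and> listed \<sigma> \<and> (\<forall>a<n. idx \<sigma> ''om'' a = om a) \<and> rats \<sigma> ''d'' 0 = d \<and> rats \<sigma> ''ds'' 0 = ds"

lemma base_frame:
  assumes b: "base d ds \<sigma>" and fr: "\<forall>x. x \<notin> X \<longrightarrow> idx \<sigma>' x = idx \<sigma> x" "\<forall>x. x \<notin> Y \<longrightarrow> rats \<sigma>' x = rats \<sigma> x"
    and "{''n'', ''order'', ''om'', ''eu'', ''ev''} \<inter> X = {}" "{''ek'', ''el'', ''eb'', ''d'', ''ds''} \<inter> Y = {}"
  shows "base d ds \<sigma>'"
proof -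
  have "idx \<sigma>' x = idx \<sigma> x" if "x \<in> {''n'', ''order'', ''om'', ''eu'', ''ev''}" for x using fr assms(4) that by blast
  moreover have "rats \<sigma>' x = rats \<sigma> x" if "x \<in> {''ek'', ''el'', ''eb'', ''d'', ''ds''}" for x using fr assms(5) that by blast
  ultimately show ?thesis using b by (simp add: base_def env_def listed_def)
qed

definition written :: "rat \<Rightarrow> rat \<Rightarrow> rat \<Rightarrow> (nat \<Rightarrow> rat) \<Rightarrow> nat \<Rightarrow> state \<Rightarrow> bool" where
  "written l c og x i \<sigma> \<longleftrightarrow> rats \<sigma> ''c'' 0 = c \<and> rats \<sigma> ''l'' 0 = l \<and>
     (\<forall>j<i. rats \<sigma> ''s'' j = x j - og \<and> rats \<sigma> ''t'' j = x j + (l - of_nat (om j) * c) - og)"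

text \<open>The rational counterpart of \<open>place\<close> at the first code of the order.\<close>

definition first_place :: "rat \<Rightarrow> rat \<Rightarrow> (nat \<Rightarrow> rat) \<Rightarrow> rat" where
  "first_place l c x = x (os ! 0 div 2) + of_nat (os ! 0 mod 2) * (l - of_nat (om (os ! 0 div 2)) * c)"

lemma ok_write_model:
  assumes b: "base d ds \<sigma>" and lc: "rats \<sigma> ''lq'' 0 = l" "rats \<sigma> ''cq'' 0 = c"
  defines "x \<equiv> \<lambda>v. rats \<sigma> ''F'' (n * n + v)"
  shows "ok W S write_model \<sigma> (4 + (n * (2 + 2) + 2)) (written l c (first_place l c x) x n)"
proof -
  define og where "og = first_place l c x"
  have y: "os ! 0 < 2 * n" "os ! 0 div 2 < n" using nth_less[of 0] n_pos by auto
  have bb: "idx \<sigma> ''n'' 0 = n" "idx \<sigma> ''order'' 0 = os ! 0" "\<forall>a<n. idx \<sigma> ''om'' a = om a"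
    using b n_pos by (auto simp: base_def listed_def)
  have nS: "n * n + v < S" if "v < n" for v using that S_large by simp
  let ?I = "\<lambda>i \<sigma>'. written l c og x i \<sigma>' \<and> idx \<sigma>' ''n'' 0 = n \<and> (\<forall>a<n. idx \<sigma>' ''om'' a = om a) \<and>
     rats \<sigma>' ''F'' = rats \<sigma> ''F'' \<and> rats \<sigma>' ''lq'' 0 = l \<and> rats \<sigma>' ''cq'' 0 = c \<and> rats \<sigma>' ''og'' 0 = og"
  show ?thesis
    unfolding write_model_def og_def[symmetric]
  proof (rule ok_seq)
    have og: "rats \<sigma> ''F'' (n * n + os ! 0 div 2) + of_nat (os ! 0 mod 2) * (l - of_nat (om (os ! 0 div 2)) * c) = og"
      by (simp add: og_def first_place_def x_def)
    have yW: "os ! 0 < W" "os ! 0 div 2 < S" using y W_large S_large by linarith+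
    have "wp W S origin (?I 0) \<sigma>"
      using y bb lc yW nS[OF y(2)] og unfolding origin_def by (simp add: adr_def written_def)
    from ok_wp[OF this] show "ok W S origin \<sigma> 4 (?I 0)" by (simp add: origin_def numeral_eq_Suc)
    fix \<sigma>1 assume 1: "?I 0 \<sigma>1"
    show "ok W S (FOR ''i'' (V ''n'') write_arc) \<sigma>1 (n * (2 + 2) + 2) (written l c og x n)"
    proof (rule ok_FOR[where I = ?I])
      show "?I 0 \<sigma>1" by (rule 1)
      show "n < W" "0 < S" using W_large by auto
      show "?I i (\<sigma>'\<lparr>idx := (idx \<sigma>')(''i'' := f)\<rparr>)" if "?I i \<sigma>'" for i \<sigma>' f
        using that by (simp add: written_def)
      show "ok W S write_arc \<sigma>' 2 (\<lambda>\<sigma>''. idx \<sigma>'' ''i'' 0 = i \<and> ?I (Suc i) \<sigma>'')"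
        if I: "?I i \<sigma>'" and i: "i < n" "idx \<sigma>' ''i'' 0 = i" for i \<sigma>'
      proof -
        have iS: "i < S" using i S_large by linarith
        have F: "rats \<sigma> ''F'' (n * n + v) = x v" for v by (simp add: x_def)
        have "wp W S write_arc (\<lambda>\<sigma>''. idx \<sigma>'' ''i'' 0 = i \<and> ?I (Suc i) \<sigma>'') \<sigma>'"
          using I i iS nS[OF i(1)] unfolding write_arc_def by (simp add: adr_def written_def F less_Suc_eq)
        from ok_wp[OF this] show ?thesis by (simp add: write_arc_def numeral_eq_Suc)
      qed
    qed auto
  qed
qed

lemma ok_solve:
  assumes b: "base d ds \<sigma>" and t: "tup ''B1'' \<sigma> k1 l1 a1 b1" "tup ''A2'' \<sigma> k2 l2 a2 b2"
  defines "D1 \<equiv> of_int a1 * d + of_int b1 * ds" and "D2 \<equiv> of_int a2 * d + of_int b2 * ds" and "m' \<equiv> l1 * k2 - l2 * k1"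
  shows "ok W S solve \<sigma> 7 (\<lambda>\<sigma>'. base d ds \<sigma>' \<and> par d ds ((of_int k1 * D2 - of_int k2 * D1) / of_int m')
     ((of_int l1 * D2 - of_int l2 * D1) / of_int m') \<sigma>')"
    (is "ok W S _ _ _ ?Q")
proof -
  have dd: "rats \<sigma> ''d'' 0 = d" "rats \<sigma> ''ds'' 0 = ds" using b by (auto simp: base_def)
  have "wp W S solve (\<lambda>\<sigma>'. par d ds ((of_int k1 * D2 - of_int k2 * D1) / of_int m')
     ((of_int l1 * D2 - of_int l2 * D1) / of_int m') \<sigma>') \<sigma>"
    using t dd by (simp add: solve_def tup_def par_def D1_def D2_def m'_def)
  from ok_frame[OF ok_wp[OF this]] show ?thesis
  proof (rule ok_mono)
    fix \<sigma>' assume *: "par d ds ((of_int k1 * D2 - of_int k2 * D1) / of_int m')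
        ((of_int l1 * D2 - of_int l2 * D1) / of_int m') \<sigma>' \<and>
      (\<forall>x. x \<notin> imods solve \<longrightarrow> idx \<sigma>' x = idx \<sigma> x) \<and> (\<forall>x. x \<notin> rmods solve \<longrightarrow> rats \<sigma>' x = rats \<sigma> x)"
    have "base d ds \<sigma>'" by (rule base_frame[OF b conjunct1[OF conjunct2[OF *]] conjunct2[OF conjunct2[OF *]]]) (simp_all add: solve_def)
    then show "?Q \<sigma>'" using * by blast
  qed (simp add: solve_def)
qed

end

locale ref_machine = ref_order + clockwise_machine
begin

theorem ok_program:
  assumes li: "listed \<sigma>" "\<And>a. idx \<sigma> ''ss'' a = 0" and dd: "rats \<sigma> ''d'' 0 = d" "rats \<sigma> ''ds'' 0 = ds" and d: "0 < d" "0 \<le> ds"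
  shows "ok W S program \<sigma> (total_time n) (\<lambda>\<sigma>'. \<exists>l c x. optimal d ds l c \<and> feas d ds l c x \<and> written l c (first_place l c x) x n \<sigma>')"
    (is "ok W S _ _ _ ?Q")
  unfolding program_def total_time_def
proof (rule ok_seq[OF ok_frame[OF ok_setup_graph[OF li]]])
  fix \<sigma>1 assume "(env \<sigma>1 \<and> listed \<sigma>1 \<and> (\<forall>a<n. idx \<sigma>1 ''om'' a = om a)) \<and> (\<forall>x. x \<notin> imods setup_graph \<longrightarrow> idx \<sigma>1 x = idx \<sigma> x) \<and>
     (\<forall>x. x \<notin> rmods setup_graph \<longrightarrow> rats \<sigma>1 x = rats \<sigma> x)"
  then have b1: "base d ds \<sigma>1" using dd by (simp add: base_def mods_setup)
  then have v1: "idx \<sigma>1 ''n'' 0 = n" "rats \<sigma>1 ''d'' 0 = d" "rats \<sigma>1 ''ds'' 0 = ds" by (auto simp: base_def)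
  show "ok W S (Seq setup_params (Seq search (Seq solve (Seq query write_model)))) \<sigma>1
     ((96 * n ^ 3 + 3 * n + 20) + (2304 * n * (query_time n + 44) + (7 + (query_time n + (4 + (n * (2 + 2) + 2)))))) ?Q"
  proof (rule ok_seq[OF ok_frame[OF ok_setup_params[OF v1 d n_pos _ W_cube]]])
    show "0 < S" by simp
    fix \<sigma>2 assume *: "prepared n d ds \<sigma>2 \<and> (\<forall>x. x \<notin> imods setup_params \<longrightarrow> idx \<sigma>2 x = idx \<sigma>1 x) \<and> (\<forall>x. x \<notin> rmods setup_params \<longrightarrow> rats \<sigma>2 x = rats \<sigma>1 x)"
    have b2: "base d ds \<sigma>2" by (rule base_frame[OF b1 conjunct1[OF conjunct2[OF *]] conjunct2[OF conjunct2[OF *]]]) (simp_all add: mods_params)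
    obtain pa qa pb qb L where pr: "bracketing n d ds pa qa pb qb" "24 * n ^ 3 < pa + qa + pb + qb" "n \<le> 2 ^ L" "L = 0 \<or> 2 ^ (L - 1) < n"
      and r: "rats \<sigma>2 ''dd'' 0 = of_nat (qa + qb)" "rats \<sigma>2 ''dq'' 0 = of_nat (pa + pb)"
        "rats \<sigma>2 ''lx'' 0 = 4 * of_nat (n\<^sup>2 * (qa + qb + (pa + pb))) + 1"
        "rats \<sigma>2 ''cm'' 0 = of_nat n * of_nat (qa + qb + (pa + pb)) + of_nat n * rats \<sigma>2 ''lx'' 0" "idx \<sigma>2 ''J'' 0 = 9 * L + 14"
      using * unfolding prepared_def by blast
    define J lx cm where "J = 9 * L + 14" and "lx = rats \<sigma>2 ''lx'' 0" and "cm = rats \<sigma>2 ''cm'' 0"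
    have s: "qa + qb + (pa + pb) \<le> 48 * n ^ 3 + 2" using pr(1) by (simp add: bracketing_def)
    note prec = precision[OF n_pos pr(3) s, of lx cm, folded J_def]
    interpret search_graph n "3 * n" g_src g_dst g_kp g_lm g_bt W S d0 l0 c0 x0 "qa + qb" "pa + pb" J
      "of_nat (qa + qb)" "of_nat (pa + pb)" lx cm "cm / 2 ^ J"
    proof
      show "feas d0 0 l0 c0 x0" "0 < d0" "0 < l0" "0 \<le> c0" using ref_feas d0 l0 c0_pos by auto
      show "valid 1 0 1 0" "valid 0 (- 1) 1 0" by (rule valid_circumference, rule valid_length)
      show "0 < qa + qb" using pr(1) by (auto simp: bracketing_def intro: gr0I)
      show "J < W" using log_less[OF pr(4)] n_le_cube W_cube by (simp add: J_def)
      show "64 * of_nat n ^ 3 * (cm / 2 ^ J) \<le> 1" "64 * of_nat n ^ 4 * (lx / 2 ^ J) \<le> 1" by (rule prec; use r in \<open>simp add: lx_def cm_def\<close>)+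
    qed (use r in \<open>simp_all add: lx_def cm_def\<close>)
    have fix2: "fixed (of_nat (qa + qb)) (of_nat (pa + pb)) cm J \<sigma>2" using b2 r by (simp add: fixed_def base_def cm_def J_def)
    have "ok W S (Seq search (Seq solve (Seq query write_model))) \<sigma>2 (search_time n J + (7 + (query_time n + (4 + (n * (2 + 2) + 2))))) ?Q"
    proof (rule ok_seq[OF ok_frame[OF ok_search[OF fix2]]])
      show "rats \<sigma>2 ''lx'' 0 = lx" by (simp add: lx_def)
      fix \<sigma>3 assume *: "(found \<sigma>3 \<and> fixed (of_nat (qa + qb)) (of_nat (pa + pb)) cm J \<sigma>3) \<and>
        (\<forall>x. x \<notin> imods search \<longrightarrow> idx \<sigma>3 x = idx \<sigma>2 x) \<and> (\<forall>x. x \<notin> rmods search \<longrightarrow> rats \<sigma>3 x = rats \<sigma>2 x)"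
      have b3: "base d ds \<sigma>3" by (rule base_frame[OF b2 conjunct1[OF conjunct2[OF *]] conjunct2[OF conjunct2[OF *]]]) (simp_all add: mods_search)
      obtain k1 l1 a1 b1 k2 l2 a2 b2 where v: "valid k1 l1 a1 b1" "valid k2 l2 a2 b2"
        and t: "tup ''B1'' \<sigma>3 k1 l1 a1 b1" "tup ''A2'' \<sigma>3 k2 l2 a2 b2" and k: "0 < k1" "k2 \<le> 0" and m: "0 < l1 * k2 - l2 * k1"
        and cr: "\<And>k3 l3 a3 b3. valid k3 l3 a3 b3 \<Longrightarrow> (l1 * k2 - l2 * k1) * gap a3 b3 + l3 * (k1 * gap a2 b2 - k2 * gap a1 b1)
           - k3 * (l1 * gap a2 b2 - l2 * gap a1 b1) \<le> 0"
        using * unfolding found_def by blast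
      define D1 D2 mm where "D1 = of_int a1 * d + of_int b1 * ds" and "D2 = of_int a2 * d + of_int b2 * ds" and "mm = l1 * k2 - l2 * k1"
      define l c where "l = (of_int k1 * D2 - of_int k2 * D1) / of_int mm" and "c = (of_int l1 * D2 - of_int l2 * D1) / of_int mm"
      have mm: "0 < (of_int mm :: rat)" using m unfolding mm_def of_int_0_less_iff .
      have lc: "of_int mm * cval k3 l3 a3 b3 d ds l c = of_int mm * (of_int a3 * d + of_int b3 * ds)
         + of_int l3 * (of_int k1 * D2 - of_int k2 * D1) - of_int k3 * (of_int l1 * D2 - of_int l2 * D1)" for k3 l3 a3 b3
        using mm by (simp add: cval_def l_def c_def field_simps)
      have "of_int mm * cval k1 l1 a1 b1 d ds l c = 0" "of_int mm * cval k2 l2 a2 b2 d ds l c = 0"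
        unfolding lc by (simp_all add: mm_def D1_def D2_def algebra_simps)
      then have opt: "optimal d ds l c" unfolding optimal_def using v k mm by (metis less_irrefl mult_eq_0_iff)
      \<comment> \<open>Here the determinant signs established for the surrogates are transferred to
        \<open>d\<close> and \<open>ds\<close>.\<close>
      have sat: "cval k3 l3 a3 b3 d ds l c \<le> 0" if v3: "valid k3 l3 a3 b3" for k3 l3 a3 b3
      proof -
        have "of_int mm * cval k3 l3 a3 b3 d ds l c \<le> 0"
          unfolding lc unfolding mm_def D1_def D2_def
          by (rule crossing_form_sign[OF v v3 pr(1,2)]) (use cr[OF v3] in \<open>simp add: gap_def\<close>)
        then show ?thesis using mm by (simp add: mult_le_0_iff)
      qed
      show "ok W S (Seq solve (Seq query write_model)) \<sigma>3 (7 + (query_time n + (4 + (n * (2 + 2) + 2)))) ?Q"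
      proof (rule ok_seq[OF ok_solve[OF b3 t, folded D1_def D2_def mm_def, folded l_def c_def]])
        fix \<sigma>4 assume 4: "base d ds \<sigma>4 \<and> par d ds l c \<sigma>4"
        then have e4: "env \<sigma>4" by (simp add: base_def)
        show "ok W S (Seq query write_model) \<sigma>4 (query_time n + (4 + (n * (2 + 2) + 2))) ?Q"
        proof (rule ok_seq[OF ok_frame[OF ok_query[OF e4 conjunct2[OF 4]]]])
          fix \<sigma>5 assume *: "query_post d ds l c \<sigma>5 \<and> (\<forall>x. x \<notin> imods query \<longrightarrow> idx \<sigma>5 x = idx \<sigma>4 x) \<and> (\<forall>x. x \<notin> rmods query \<longrightarrow> rats \<sigma>5 x = rats \<sigma>4 x)"
          have b5: "base d ds \<sigma>5" by (rule base_frame[OF conjunct1[OF 4] conjunct1[OF conjunct2[OF *]] conjunct2[OF conjunct2[OF *]]]) (simp_all add: mods_query)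
          have p5: "rats \<sigma>5 ''lq'' 0 = l" "rats \<sigma>5 ''cq'' 0 = c" using conjunct2[OF conjunct2[OF *]] 4 by (simp_all add: mods_query par_def)
          \<comment> \<open>The query cannot answer with a violated constraint, since that one would
            be valid and therefore hold at the crossing.\<close>
          have "feas d ds l c (\<lambda>v. rats \<sigma>5 ''F'' (n * n + v))"
            using * sat unfolding query_post_def by (meson not_le)
          then show "ok W S write_model \<sigma>5 (4 + (n * (2 + 2) + 2)) ?Q"
            using opt by (intro ok_mono[OF ok_write_model[OF b5 p5]]) blast+
        qed
      qed
    qed
    then show "ok W S (Seq search (Seq solve (Seq query write_model))) \<sigma>2
       (2304 * n * (query_time n + 44) + (7 + (query_time n + (4 + (n * (2 + 2) + 2))))) ?Q"
      by (rule ok_mono) (use search_time_le[OF pr(4) n_pos] in \<open>simp add: J_def\<close>)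
  qed
qed

end

lemma (in wgraph) feas_shift:
  fixes d ds l c :: "'a::linordered_field"
  shows "feas d ds l c x \<Longrightarrow> feas d ds l c (\<lambda>v. x v - u)"
  unfolding feas_def by (simp add: add.commute add_diff_eq)

section \<open>Equivalent models\<close>

context clockwise_order
begin

text \<open>Arcs with the same index correspond, as both listings realise the order
  \<open>os\<close>.\<close>

lemma sorted_equivalent:
  assumes As: "distinct As" "set As = arcs M" "length As = n" and Bs: "distinct Bs" "set Bs = arcs N" "length Bs = n"
    and s: "sorted_by (extreme_pos As)" "sorted_by (extreme_pos Bs)"
  shows "equivalent M N"
proof -
  have bij: "bij_betw ((!) As) {..<n} (arcs M)" "bij_betw ((!) Bs) {..<n} (arcs N)"
    using bij_betw_nth[OF As(1)] bij_betw_nth[OF Bs(1)] As Bs by auto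
  define f where "f = (\<lambda>A. Bs ! inv_into {..<n} ((!) As) A)"
  have f: "f (As ! i) = Bs ! i" if "i < n" for i
    using bij_betw_inv_into_left[OF bij(1), of i] that by (simp add: f_def)
  have "bij_betw f (arcs M) (arcs N)"
    using bij_betw_trans[OF bij_betw_inv_into[OF bij(1)] bij(2)] by (simp add: f_def comp_def)
  moreover have "e (f A) < e' (f B) \<longleftrightarrow> e A < e' B"
    if AB: "A \<in> arcs M" "B \<in> arcs M" and ee: "e \<in> {fst, snd}" "e' \<in> {fst, snd}" for A B and e e' :: "arc \<Rightarrow> real"
  proof -
    obtain i j where ij: "A = As ! i" "B = As ! j" "i < n" "j < n" using AB As by (metis in_set_conv_nth)
    have ex: "\<exists>y<2 * n. e (As ! i) = extreme_pos As y \<and> e (Bs ! i) = extreme_pos Bs y" if "e \<in> {fst, snd}" "i < n" for e :: "arc \<Rightarrow> real" and i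
    proof (cases "e = fst")
      case True
      then show ?thesis using \<open>i < n\<close> by (intro exI[of _ "2 * i"]) simp
    next
      case False
      then show ?thesis using that by (intro exI[of _ "Suc (2 * i)"]) auto
    qed
    obtain y where y: "y < 2 * n" "e A = extreme_pos As y" "e (f A) = extreme_pos Bs y" using ex[OF ee(1) ij(3)] f ij by auto
    obtain z where z: "z < 2 * n" "e' B = extreme_pos As z" "e' (f B) = extreme_pos Bs z" using ex[OF ee(2) ij(4)] f ij by auto
    show ?thesis unfolding y(2,3) z(2,3) using sorted_byD[OF s(1) y(1) z(1)] sorted_byD[OF s(2) y(1) z(1)] by simp
  qed
  ultimately show ?thesis unfolding equivalent_def by blast
qed

text \<open>Numbers the arcs of a competing model so that it shares the order \<open>os\<close>, and
  with it the constraint graph.\<close>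

lemma equivalent_listing:
  assumes eq: "equivalent N M" and Bs: "distinct Bs" "set Bs = arcs M" "length Bs = n" and s: "sorted_by (extreme_pos Bs)"
  obtains Cs where "distinct Cs" "set Cs = arcs N" "length Cs = n" "sorted_by (extreme_pos Cs)"
proof -
  obtain f where f: "bij_betw f (arcs N) (arcs M)"
    and ord: "\<And>A B e e'. A \<in> arcs N \<Longrightarrow> B \<in> arcs N \<Longrightarrow> e \<in> {fst, snd} \<Longrightarrow> e' \<in> {fst, snd} \<Longrightarrow> e (f A) < e' (f B) \<longleftrightarrow> e A < e' B"
    using eq unfolding equivalent_def by blast
  define g where "g = inv_into (arcs N) f"
  have g: "bij_betw g (set Bs) (arcs N)" unfolding g_def Bs(2) by (rule bij_betw_inv_into[OF f])
  have gB: "Bs ! i \<in> arcs M" "g (Bs ! i) \<in> arcs N" "f (g (Bs ! i)) = Bs ! i" if "i < n" for i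
  proof -
    show m: "Bs ! i \<in> arcs M" using nth_mem[of i Bs] Bs(2,3) that by simp
    show "g (Bs ! i) \<in> arcs N" using bij_betwE[OF g] m Bs(2) by blast
    show "f (g (Bs ! i)) = Bs ! i" unfolding g_def by (rule bij_betw_inv_into_right[OF f m])
  qed
  show ?thesis
  proof (rule that[of "map g Bs"])
    show "distinct (map g Bs)" using Bs(1) g by (simp add: distinct_map bij_betw_def)
    show "set (map g Bs) = arcs N" using g by (simp add: bij_betw_def)
    show "length (map g Bs) = n" using Bs by simp
    show "sorted_by (extreme_pos (map g Bs))"
    proof (rule sorted_byI)
      fix y z assume yz: "y < 2 * n" "z < 2 * n" "pos y < pos z"
      have d: "y div 2 < n" "z div 2 < n" using yz by auto
      define e e' :: "arc \<Rightarrow> real" where "e = (if even y then fst else snd)" and "e' = (if even z then fst else snd)"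
      have "extreme_pos Bs y < extreme_pos Bs z" using sorted_byD[OF s yz(1,2)] yz(3) by blast
      then have "e (f (g (Bs ! (y div 2)))) < e' (f (g (Bs ! (z div 2))))"
        unfolding gB(3)[OF d(1)] gB(3)[OF d(2)] by (simp add: extreme_pos_def e_def e'_def split: if_splits)
      then have "e (g (Bs ! (y div 2))) < e' (g (Bs ! (z div 2)))"
        using ord[OF gB(2)[OF d(1)] gB(2)[OF d(2)], of e e'] by (simp add: e_def e'_def)
      then show "extreme_pos (map g Bs) y < extreme_pos (map g Bs) z"
        using d Bs(3) by (simp add: extreme_pos_def e_def e'_def split: if_splits)
    qed
  qed
qed

lemma build_listing:
  assumes "sorted_by p"
  defines "Bs \<equiv> map (\<lambda>i. (p (2 * i), p (2 * i + 1))) [0..<n]"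
  shows "distinct Bs" "set Bs = arcs (build c p)" "length Bs = n" "sorted_by (extreme_pos Bs)"
proof -
  have "p (2 * i) = p (2 * j) \<longleftrightarrow> i = j" if "i < n" "j < n" for i j using sorted_by_inj[OF assms(1), of "2 * i" "2 * j"] that by simp
  then show "distinct Bs" by (auto simp: Bs_def distinct_map inj_on_def)
  show "set Bs = arcs (build c p)" "length Bs = n" by (auto simp: Bs_def)
  have e: "extreme_pos Bs y = p y" if "y < 2 * n" for y
  proof -
    have "y div 2 < n" using that by simp
    then show ?thesis by (auto simp: extreme_pos_def Bs_def)
  qed
  show "sorted_by (extreme_pos Bs)" using assms(1) by (simp add: sorted_by_def e)
qed

lemma sorted_model:
  assumes "PCA_model M" "distinct As" "set As = arcs M" "length As = n" "os = extreme_order As"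
  shows "sorted_by (extreme_pos As)"
proof (rule sorted_byI)
  let ?p = "extreme_pos As"
  fix y z assume yz: "y < 2 * n" "z < 2 * n" "pos y < pos z"
  have "sorted (map ?p os)" unfolding assms(5) extreme_order_def by simp
  then have "map ?p os ! pos y \<le> map ?p os ! pos z" by (rule sorted_nth_mono) (use yz nth_pos len in auto)
  then have "?p y \<le> ?p z" using nth_pos[OF yz(1)] nth_pos[OF yz(2)] len by simp
  moreover have "?p y \<noteq> ?p z" using inj_onD[OF extreme_pos_inj[OF assms(1-3)], of y z] yz assms(4) by auto
  ultimately show "?p y < ?p z" by simp
qed

end

lemma extreme_order_clockwise:
  assumes "0 < length As"
  shows "clockwise_order (length As) (extreme_order As)"
  by unfold_locales (use assms in \<open>auto simp: extreme_order_def\<close>)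

section \<open>Correctness\<close>

text \<open>The largest demand comes from the tables with \<open>n + 1\<close> rows of
  \<open>n\<close> entries.\<close>

definition cells :: "nat \<Rightarrow> nat" where "cells n = n * n + 5 * n + 10"
definition word :: "nat \<Rightarrow> nat" where "word n = 100 * n ^ 3 + 100"

theorem program_correct:
  assumes M: "UCA_model M" and As: "distinct As" "set As = arcs M" "n = card (arcs M)" "1 \<le> n" and d: "0 < d" "0 \<le> ds"
  shows "ok (word n) (cells n) program (input_state As d ds) (total_time n) (\<lambda>\<sigma>. equivalent M (output_model n \<sigma>) \<and>
     minimal_u_CA_model (output_descriptor d ds \<sigma>) (output_model n \<sigma>))"
proof -
  have n: "length As = n" using As distinct_card[OF As(1)] by simp
  have PM: "PCA_model M" using M by (simp add: UCA_model_def)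
  obtain l0 where al: "\<And>A. A \<in> arcs M \<Longrightarrow> arc_length M A = l0" using M unfolding UCA_model_def by blast
  define c0 x0 os where "c0 = circumference M" and "x0 = (\<lambda>i. fst (As ! i))" and "os = extreme_order As"
  interpret clockwise_order n os using extreme_order_clockwise[of As] n As(4) by (simp add: os_def)
  have s: "sorted_by (extreme_pos As)" by (rule sorted_model[OF PM As(1,2) n os_def])
  obtain d0 where d0: "0 < d0" "layout d0 0 c0 (place l0 c0 x0)"
    unfolding c0_def x0_def by (rule model_small_layout[OF PM As(1,2) n s al])
  have mp: "extreme_pos As y = place l0 c0 x0 y" if "y < 2 * n" for y
    unfolding c0_def x0_def by (rule model_place[OF PM As(1,2) n s al that])
  have rng: "0 \<le> place l0 c0 x0 y \<and> place l0 c0 x0 y < c0" if "y < 2 * n" for y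
    using extreme_pos_range[OF PM As(2), of y] that n mp[OF that] by (simp add: c0_def)
  have l0p: "0 < l0"
  proof -
    have m: "As ! 0 \<in> arcs M" using nth_mem[of 0 As] As(2) n n_pos by simp
    have "extreme_pos As 0 \<noteq> extreme_pos As 1" using sorted_by_inj[OF s, of 0 1] n_pos by simp
    then have "fst (As ! 0) \<noteq> snd (As ! 0)" by (simp add: extreme_pos_def)
    moreover have "0 \<le> extreme_pos As 1" "extreme_pos As 0 < c0"
      using extreme_pos_range[OF PM As(2), of 0] extreme_pos_range[OF PM As(2), of 1] n n_pos by (simp_all add: c0_def)
    then have "0 \<le> snd (As ! 0)" "fst (As ! 0) < c0" by (simp_all add: extreme_pos_def)
    ultimately show ?thesis using al[OF m] by (auto simp: arc_length_def cw_dist_def c0_def split: if_splits)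
  qed
  interpret ref_machine n os d0 l0 c0 x0 "word n" "cells n"
    by unfold_locales (use d0 l0p rng in \<open>auto simp: word_def cells_def\<close>)
  have li: "listed (input_state As d ds)" 
    unfolding listed_def input_state_def by (simp add: n) (simp add: os_def)
  have "ok (word n) (cells n) program (input_state As d ds) (total_time n)
     (\<lambda>\<sigma>'. \<exists>l c x. optimal d ds l c \<and> feas d ds l c x \<and> written l c (first_place l c x) x n \<sigma>')"
    by (rule ok_program[OF li _ _ _ d]) (simp_all add: input_state_def)
  then show ?thesis
  proof (rule ok_mono)
    fix \<sigma> assume "\<exists>l c x. optimal d ds l c \<and> feas d ds l c x \<and> written l c (first_place l c x) x n \<sigma>"
    then obtain l c x where o: "optimal d ds l c" and f: "feas d ds l c x" and w: "written l c (first_place l c x) x n \<sigma>" by blast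
    define D Ds L C :: real where "D = of_rat d" and "Ds = of_rat ds" and "L = of_rat l" and "C = of_rat c"
    define og X where "og = first_place l c x" and "X = (\<lambda>v. of_rat (x v) - of_rat og :: real)"
    have Dp: "0 < D" "0 \<le> Ds" using d by (simp_all add: D_def Ds_def)
    have fX: "feas D Ds L C X"
      unfolding X_def D_def Ds_def L_def C_def by (rule feas_shift[OF feas_of_rat[OF f]])
    define p where "p = place L C X"
    have lay: "layout D Ds C p" using fX feas_iff_layout[OF Dp(1)] by (simp add: p_def)
    have p0: "p (os ! 0) = 0"
      by (simp add: p_def place_def X_def og_def first_place_def L_def C_def of_rat_add of_rat_mult of_rat_diff)
    have len: "p (2 * i + 1) = p (2 * i) + L - of_nat (om i) * C" for i by (simp add: p_def)
    have ins: "\<not> (inside (2 * i) j \<and> inside (2 * i + 1) j)" if "i < n" "j < n" "i \<noteq> j" for i j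
      by (rule model_inside[OF PM As(1,2) n s al that])
    have u: "u_CA_model (C, L, D, Ds) (build C p)" and sp: "sorted_by p"
      using build_model[OF Dp lay p0 len ins] by blast+
    have out: "output_model n \<sigma> = build C p"
    proof -
      have "of_rat (rats \<sigma> ''s'' i) = p (2 * i)" "of_rat (rats \<sigma> ''t'' i) = p (2 * i + 1)" if "i < n" for i
        using w that by (simp_all add: written_def p_def X_def og_def L_def C_def of_rat_add of_rat_mult of_rat_diff)
      then have "{(of_rat (rats \<sigma> ''s'' i), of_rat (rats \<sigma> ''t'' i)) | i. i < n} = arcs (build C p)" by (force simp del: of_rat_diff)
      then show ?thesis using w by (simp add: output_model_def build_def written_def C_def)
    qed
    have desc: "output_descriptor d ds \<sigma> = (C, L, D, Ds)"
      using w by (simp add: output_descriptor_def written_def C_def L_def D_def Ds_def)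
    note Bs = build_listing[OF sp]
    have "equivalent M (build C p)" by (rule sorted_equivalent[OF As(1,2) n Bs(1-3) s Bs(4)])
    \<comment> \<open>A competitor may have irrational coordinates. Its beginnings form a real
      potential of the same graph, to which the rational certificate applies after embedding into
      the reals.\<close>
    moreover have "L \<le> l' \<and> C \<le> c'" if N: "u_CA_model (c', l', D, Ds) N" "equivalent N (build C p)" for c' l' N
    proof -
      obtain Cs where Cs: "distinct Cs" "set Cs = arcs N" "length Cs = n" "sorted_by (extreme_pos Cs)"
        by (rule equivalent_listing[OF N(2) Bs])
      have f': "feas D Ds l' c' (\<lambda>i. fst (Cs ! i))" using model_layout[OF N(1) Cs] feas_iff_layout[OF Dp(1)] by simp
      obtain k1 l1 a1 b1 k2 l2 a2 b2 where v: "valid k1 l1 a1 b1" "valid k2 l2 a2 b2" "0 < k1" "k2 \<le> 0"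
        and t: "cval k1 l1 a1 b1 d ds l c = 0" "cval k2 l2 a2 b2 d ds l c = 0" using o unfolding optimal_def by blast
      have t': "cval k1 l1 a1 b1 D Ds L C = 0" "cval k2 l2 a2 b2 D Ds L C = 0"
        using t by (simp_all add: D_def Ds_def L_def C_def flip: cval_of_rat)
      show ?thesis by (rule least_descriptor[OF v t' less_imp_le[OF Dp(1)] Dp(2) fX f'])
    qed
    ultimately show "equivalent M (output_model n \<sigma>) \<and> minimal_u_CA_model (output_descriptor d ds \<sigma>) (output_model n \<sigma>)"
      unfolding out desc minimal_u_CA_model.simps using u by blast
  qed simp
qed

lemma bigo_power:
  fixes f :: "nat \<Rightarrow> nat"
  assumes "\<And>n. 1 \<le> n \<Longrightarrow> f n \<le> K * n ^ j"
  shows "(\<lambda>n. real (f n)) \<in> O(\<lambda>n. real n ^ j)"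
proof (rule bigoI[of _ "real K"])
  have "real (f n) \<le> real K * real n ^ j" if "1 \<le> n" for n
    using assms[OF that] by (simp flip: of_nat_power of_nat_mult)
  then show "\<forall>\<^sub>F n in sequentially. norm (real (f n)) \<le> real K * norm (real n ^ j)"
    unfolding eventually_sequentially by (intro exI[of _ 1]) simp
qed

lemma total_time_le: assumes "1 \<le> n" shows "total_time n \<le> 400000 * n ^ 3"
proof -
  have "n ^ 0 \<le> n ^ 3" "n ^ 1 \<le> n ^ 3" "n ^ 2 \<le> n ^ 3" by (rule power_increasing; use assms in simp)+
  then have p: "1 \<le> n ^ 3" "n \<le> n ^ 3" "n * n \<le> n ^ 3" by (simp_all add: power2_eq_square)
  have "n * query_time n = 21 * n ^ 3 + 40 * (n * n) + 50 * n" by (simp add: query_time_def power3_eq_cube algebra_simps)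
  moreover have "query_time n = 21 * (n * n) + 40 * n + 50" by (simp add: query_time_def)
  moreover have "total_time n = 96 * n ^ 3 + 2304 * (n * query_time n) + 2304 * (n * 44) + query_time n + 57 * n + 43"
    by (simp add: total_time_def algebra_simps)
  ultimately show ?thesis using p by linarith
qed

theorem theorem14:
  shows "\<exists>(p :: com) (T :: nat \<Rightarrow> nat) (S :: nat \<Rightarrow> nat) (W :: nat \<Rightarrow> nat) (k :: nat).
    (\<lambda>n. real (T n)) \<in> O(\<lambda>n. real n ^ 3) \<and>
    (\<lambda>n. real (S n)) \<in> O(\<lambda>n. real n ^ 2) \<and>
    (\<lambda>n. real (W n)) \<in> O(\<lambda>n. real n ^ k) \<and>
    (\<forall>(M :: model) (As :: arc list) (n :: nat) (d :: rat) (ds :: rat).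
      UCA_model M \<and> distinct As \<and> set As = arcs M \<and> n = card (arcs M) \<and> 1 \<le> n \<and>
      0 < d \<and> 0 \<le> ds \<longrightarrow>
      (\<exists>t \<sigma>. exec (W n) (S n) p (input_state As d ds) t \<sigma> \<and> t \<le> T n \<and>
        equivalent M (output_model n \<sigma>) \<and>
        minimal_u_CA_model (output_descriptor d ds \<sigma>) (output_model n \<sigma>)))"
proof (rule exI[of _ program], rule exI[of _ total_time], rule exI[of _ cells], rule exI[of _ word], rule exI[of _ 3],
    intro conjI allI impI)
  show "(\<lambda>n. real (total_time n)) \<in> O(\<lambda>n. real n ^ 3)" by (rule bigo_power) (rule total_time_le)
  show "(\<lambda>n. real (cells n)) \<in> O(\<lambda>n. real n ^ 2)"
  proof (rule bigo_power)
    fix n :: nat assume "1 \<le> n"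
    then have "n \<le> n * n" "1 \<le> n * n" by auto
    then show "cells n \<le> 16 * n ^ 2" unfolding cells_def power2_eq_square by linarith
  qed
  show "(\<lambda>n. real (word n)) \<in> O(\<lambda>n. real n ^ 3)"
    by (rule bigo_power[of _ 200]) (simp add: word_def)
  fix M As n and d ds :: rat
  assume "UCA_model M \<and> distinct As \<and> set As = arcs M \<and> n = card (arcs M) \<and> 1 \<le> n \<and> (0 :: rat) < d \<and> (0 :: rat) \<le> ds"
  then have "ok (word n) (cells n) program (input_state As d ds) (total_time n) (\<lambda>\<sigma>. equivalent M (output_model n \<sigma>) \<and>
     minimal_u_CA_model (output_descriptor d ds \<sigma>) (output_model n \<sigma>))"
    by (intro program_correct) auto
  then show "\<exists>t \<sigma>. exec (word n) (cells n) program (input_state As d ds) t \<sigma> \<and> t \<le> total_time n \<and>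
        equivalent M (output_model n \<sigma>) \<and> minimal_u_CA_model (output_descriptor d ds \<sigma>) (output_model n \<sigma>)"
    unfolding ok_def by blast
qed

end
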